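(* Let $X_0,X_1,\dots,X_n$ be vector fields on a bounded domain $\Omega\subset\mathbb{R}^p$, with $X_1,\dots,X_n$ having $C^{r-1,\alpha}(\Omega)$ coefficients and $X_0$ having $C^{r-2,\alpha}(\Omega)$ coefficients ($r\ge2$ integer, $\alpha\in(0,1]$), satisfying Hörmander's condition of step $r$ in $\Omega$ and free up to weight $r$ in $\Omega$. Let $d$ be the distance induced by the vector fields and $\rho(x,y)=\|\Theta_y(x)\|$ (defined in the context). Then for every $\overline x\in\Omega$ there exist a neighborhood $W$ of $\overline x$ and constants $C_1,C_2>0$ such that for any $x,y\in W$, $$C_1 d(x,y)\le\rho(x,y)\le C_2 d(x,y).$$
   Context: Weights and commutators: $X_0$ has weight $p_0=2$, $X_i$ has weight $p_i=1$ for $i\ge1$. For $I=(i_1,\dots,i_k)$, $i_j\in\{0,\dots,n\}$, $|I|=\sum_j p_{i_j}$ and $X_{[I]}=[X_{i_1},[X_{i_2},\dots[X_{i_{k-1}},X_{i_k}]\dots]]$, $X_{[(i)]}=X_i$. Hörmander's condition of step $r$ in $\Omega$: $\{(X_{[I]})_x\}_{|I|\le r}$ spans $\mathbb{R}^p$ for every $x\in\Omega$. In noncommuting indeterminates $\xi_0,\dots,\xi_n$ write $\xi_{[I]}=[\xi_{i_1},[\dots,\xi_{i_k}]\dots]=\sum_JA_{IJ}\xi_J$. The fields are free up to weight $r$ in $\Omega$ if at each $x\in\Omega$: $\sum_{|I|\le r}a_I(X_{[I]})_x=0$ (real constants $a_I$) implies $\sum_{|I|\le r} a_IA_{IJ}=0$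 for all $J$. A set $B$ of $p$ multiindices of weight $\le r$ is fixed so that $\{(X_{[I]})_x\}_{I\in B}$ is a basis of $\mathbb{R}^p$ at every $x\in\Omega$. Distance $d$: for $\delta>0$ let $C(\delta)$ be the class of absolutely continuous $\varphi:[0,1]\to\Omega$ with $\varphi'(t)=\sum_{|I|\le r}a_I(t)(X_{[I]})_{\varphi(t)}$ for a.e. $t$, with $|a_I(t)|\le\delta^{|I|}$. Then $d(x,y)=\inf\{\delta>0:\exists\varphi\in C(\delta),\ \varphi(0)=x,\ \varphi(1)=y\}$. Smooth approximating fields: if $X_i=\sum_j b_{ij}(x)\partial_{x_j}$, then for $y\in\Omega$, $S_i^{y}=\sum_j p_{ij}(x)\partial_{x_j}$, where $p_{ij}$ is the Taylor polynomial of $b_{ij}$ centered at $y$ of order $r-p_i$. These are smooth on $\mathbb{R}^p$ and $(S^y_{[I]})_y=(X_{[I]})_y$ for $|I|\le r$. The map $\Theta$: $\exp(Z)(y)$ is the time-1 value of the solution of $\phi'=Z_\phi$, $\phi(0)=y$. For fixed $y$, $u=(u_I)_{I\in B}\mapsto\exp(\sum_{I\in B}u_IS^y_{[I]})(y)$ is a smooth diffeomorphism from a neighborhood of $0\in\mathbb{R}^p$ onto a neighborhood of $y$, and $u=\Theta_y(x)$ denotes its inverse. Finally $\|u\|=\sum_{J\in B}|u_J|^{1/|J|}$ and $\rho(x,y)=\|\Theta_y(x)\|$. *)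

theory Defs
  imports "HOL-Analysis.Analysis"
begin

section \<open>Partial derivatives, Hoelder classes, Taylor polynomials\<close>

definition partial :: "'p::finite \<Rightarrow> (real^'p \<Rightarrow> real) \<Rightarrow> real^'p \<Rightarrow> real" where
  "partial j f x = frechet_derivative f (at x) (axis j 1)"

primrec partials :: "'p::finite list \<Rightarrow> (real^'p \<Rightarrow> real) \<Rightarrow> real^'p \<Rightarrow> real" where
  "partials [] f = f"
| "partials (j # js) f = partial j (partials js f)"

text \<open>The set \<open>S\<close> is meant to be open in the next three definitions.\<close>

definition Ck_on :: "nat \<Rightarrow> (real^'p) set \<Rightarrow> (real^'p::finite \<Rightarrow> real) \<Rightarrow> bool" where
  "Ck_on k S f \<longleftrightarrow>
     (\<forall>js. length js < k \<longrightarrow> partials js f differentiable_on S) \<and>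
     (\<forall>js. length js \<le> k \<longrightarrow> continuous_on S (partials js f))"

definition Ck_Hoelder_on :: "nat \<Rightarrow> real \<Rightarrow> (real^'p) set \<Rightarrow> (real^'p::finite \<Rightarrow> real) \<Rightarrow> bool" where
  "Ck_Hoelder_on k \<alpha> S f \<longleftrightarrow> Ck_on k S f \<and>
     (\<forall>js. length js = k \<longrightarrow>
        (\<exists>M. \<forall>x\<in>S. \<forall>y\<in>S. \<bar>partials js f x - partials js f y\<bar> \<le> M * dist x y powr \<alpha>))"

definition smooth_map_on :: "(real^'p) set \<Rightarrow> (real^'p::finite \<Rightarrow> real^'q::finite) \<Rightarrow> bool" where
  "smooth_map_on S F \<longleftrightarrow> (\<forall>j k. Ck_on k S (\<lambda>x. F x $ j))"

definition smooth_diffeo_on :: "(real^'p) set \<Rightarrow> (real^'p::finite \<Rightarrow> real^'p) \<Rightarrow> bool" where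
  "smooth_diffeo_on U F \<longleftrightarrow> open U \<and> inj_on F U \<and> open (F ` U) \<and>
     smooth_map_on U F \<and> smooth_map_on (F ` U) (inv_into U F)"

text \<open>
  The sum runs over ordered tuples of directions: a multi-exponent \<open>b\<close> with \<open>|b| = k\<close>
  arises from \<open>k!/b!\<close> tuples, so for \<open>f\<close> of class \<open>C^m\<close> this is the sum of
  \<open>\<partial>^b f(y) (x - y)^b / b!\<close> over \<open>|b| \<le> m\<close>.
\<close>

definition taylor_poly :: "nat \<Rightarrow> (real^'p::finite \<Rightarrow> real) \<Rightarrow> real^'p \<Rightarrow> real^'p \<Rightarrow> real" where
  "taylor_poly m f y x =
     (\<Sum>k\<le>m. (\<Sum>js\<in>{js. length js = k}.
        partials js f y * prod_list (map (\<lambda>j. (x - y) $ j) js)) / fact k)"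


section \<open>Multiindices, weights and commutators\<close>

type_synonym 'p vfield = "real^'p \<Rightarrow> real^'p"

definition wt :: "nat \<Rightarrow> nat" where
  "wt i = (if i = 0 then 2 else 1)"

definition weight :: "nat list \<Rightarrow> nat" where
  "weight I = sum_list (map wt I)"

definition multiindices :: "nat \<Rightarrow> nat \<Rightarrow> nat list set" where
  "multiindices n r = {I. I \<noteq> [] \<and> set I \<subseteq> {..n} \<and> weight I \<le> r}"

lemma length_le_weight: "length I \<le> weight I"
  by (induction I) (auto simp: weight_def wt_def)

lemma finite_multiindices: "finite (multiindices n r)"
proof (rule finite_subset)
  show "multiindices n r \<subseteq> {I. set I \<subseteq> {..n} \<and> length I \<le> r}"
    by (auto simp: multiindices_def intro: le_trans[OF length_le_weight])
  show "finite {I. set I \<subseteq> {..n} \<and> length I \<le> r}"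
    by (rule finite_lists_length_le) simp
qed

definition lie_bracket :: "'p::finite vfield \<Rightarrow> 'p vfield \<Rightarrow> 'p vfield" where
  "lie_bracket X Y x = frechet_derivative Y (at x) (X x) - frechet_derivative X (at x) (Y x)"

text \<open>The value at the empty list is a dummy; multiindices are nonempty.\<close>

fun commutator :: "(nat \<Rightarrow> 'p::finite vfield) \<Rightarrow> nat list \<Rightarrow> 'p vfield" where
  "commutator X [] = (\<lambda>x. 0)"
| "commutator X [i] = X i"
| "commutator X (i # j # I) = lie_bracket (X i) (commutator X (j # I))"

text \<open>
  Noncommutative polynomials in the indeterminates \<open>\<xi>\<^sub>0, \<xi>\<^sub>1, \<dots>\<close> are represented by their
  coefficient functions on words; \<open>free_commutator I J\<close> is the number \<open>A\<^bsub>IJ\<^esub>\<close>.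
\<close>

type_synonym nc_poly = "nat list \<Rightarrow> real"

definition nc_var :: "nat \<Rightarrow> nc_poly" where
  "nc_var i J = (if J = [i] then 1 else 0)"

definition nc_mult :: "nc_poly \<Rightarrow> nc_poly \<Rightarrow> nc_poly" where
  "nc_mult f g J = (\<Sum>k\<le>length J. f (take k J) * g (drop k J))"

definition nc_bracket :: "nc_poly \<Rightarrow> nc_poly \<Rightarrow> nc_poly" where
  "nc_bracket f g J = nc_mult f g J - nc_mult g f J"

fun free_commutator :: "nat list \<Rightarrow> nc_poly" where
  "free_commutator [] = (\<lambda>J. 0)"
| "free_commutator [i] = nc_var i"
| "free_commutator (i # j # I) = nc_bracket (nc_var i) (free_commutator (j # I))"

definition hoermander_condition ::
    "nat \<Rightarrow> nat \<Rightarrow> (real^'p) set \<Rightarrow> (nat \<Rightarrow> 'p::finite vfield) \<Rightarrow> bool" where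
  "hoermander_condition n r \<Omega> X \<longleftrightarrow>
     (\<forall>x\<in>\<Omega>. span ((\<lambda>I. commutator X I x) ` multiindices n r) = UNIV)"

definition free_up_to_weight ::
    "nat \<Rightarrow> nat \<Rightarrow> (real^'p) set \<Rightarrow> (nat \<Rightarrow> 'p::finite vfield) \<Rightarrow> bool" where
  "free_up_to_weight n r \<Omega> X \<longleftrightarrow>
     (\<forall>x\<in>\<Omega>. \<forall>a :: nat list \<Rightarrow> real.
        (\<Sum>I\<in>multiindices n r. a I *\<^sub>R commutator X I x) = 0 \<longrightarrow>
        (\<forall>J. (\<Sum>I\<in>multiindices n r. a I * free_commutator I J) = 0))"

text \<open>
  The set of \<open>p\<close> multiindices giving a basis is labelled by the coordinates of \<open>\<real>^p\<close>,
  i.e. it is the range of an injective \<open>B\<close>; then \<open>u $ j\<close> plays the role of \<open>u\<^bsub>B j\<^esub>\<close>.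
\<close>

definition basis_multiindices ::
    "nat \<Rightarrow> nat \<Rightarrow> (real^'p) set \<Rightarrow> (nat \<Rightarrow> 'p::finite vfield) \<Rightarrow> ('p \<Rightarrow> nat list) \<Rightarrow> bool" where
  "basis_multiindices n r \<Omega> X B \<longleftrightarrow> inj B \<and> range B \<subseteq> multiindices n r \<and>
     (\<forall>x\<in>\<Omega>. inj (\<lambda>j. commutator X (B j) x) \<and>
        independent (range (\<lambda>j. commutator X (B j) x)) \<and>
        span (range (\<lambda>j. commutator X (B j) x)) = UNIV)"


section \<open>The distance induced by the vector fields\<close>

definition abs_continuous_on :: "real set \<Rightarrow> (real \<Rightarrow> 'a::real_normed_vector) \<Rightarrow> bool" where
  "abs_continuous_on S f \<longleftrightarrow>
     (\<forall>\<epsilon>>0. \<exists>\<eta>>0. \<forall>D T. D division_of T \<and> T \<subseteq> S \<and> (\<Sum>K\<in>D. measure lborel K) < \<eta> \<longrightarrow>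
        (\<Sum>K\<in>D. norm (f (Sup K) - f (Inf K))) < \<epsilon>)"

definition curve_class ::
    "nat \<Rightarrow> nat \<Rightarrow> (real^'p) set \<Rightarrow> (nat \<Rightarrow> 'p::finite vfield) \<Rightarrow> real \<Rightarrow> (real \<Rightarrow> real^'p) set" where
  "curve_class n r \<Omega> X \<delta> = {\<phi>. \<phi> ` {0..1} \<subseteq> \<Omega> \<and> abs_continuous_on {0..1} \<phi> \<and>
     (\<exists>a :: nat list \<Rightarrow> real \<Rightarrow> real.
        (\<forall>I\<in>multiindices n r. \<forall>t\<in>{0..1}. \<bar>a I t\<bar> \<le> \<delta> ^ weight I) \<and>
        (AE t in lebesgue_on {0..1}.
           (\<phi> has_vector_derivative (\<Sum>I\<in>multiindices n r. a I t *\<^sub>R commutator X I (\<phi> t)))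
             (at t within {0..1})))}"

text \<open>
  In a connected \<open>\<Omega>\<close> the spanning condition makes the set below nonempty for all
  \<open>x, y \<in> \<Omega>\<close>, so the real-valued infimum is the intended one.
\<close>

definition cc_dist ::
    "nat \<Rightarrow> nat \<Rightarrow> (real^'p) set \<Rightarrow> (nat \<Rightarrow> 'p::finite vfield) \<Rightarrow> real^'p \<Rightarrow> real^'p \<Rightarrow> real" where
  "cc_dist n r \<Omega> X x y =
     Inf {\<delta>. \<delta> > 0 \<and> (\<exists>\<phi>\<in>curve_class n r \<Omega> X \<delta>. \<phi> 0 = x \<and> \<phi> 1 = y)}"


section \<open>Approximating fields, exponential map and quasidistance\<close>

definition approx_field :: "nat \<Rightarrow> (nat \<Rightarrow> 'p::finite vfield) \<Rightarrow> real^'p \<Rightarrow> nat \<Rightarrow> 'p vfield" where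
  "approx_field r X y i x = (\<chi> j. taylor_poly (r - wt i) (\<lambda>z. X i z $ j) y x)"

definition integral_curve :: "'p::finite vfield \<Rightarrow> real^'p \<Rightarrow> (real \<Rightarrow> real^'p) \<Rightarrow> bool" where
  "integral_curve Z y \<phi> \<longleftrightarrow> \<phi> 0 = y \<and>
     (\<forall>t\<in>{0..1}. (\<phi> has_vector_derivative Z (\<phi> t)) (at t within {0..1}))"

text \<open>Meaningful when \<open>Z\<close> is locally Lipschitz and some integral curve from \<open>y\<close> reaches time 1.\<close>

definition vf_exp :: "'p::finite vfield \<Rightarrow> real^'p \<Rightarrow> real^'p" where
  "vf_exp Z y = (THE z. \<exists>\<phi>. integral_curve Z y \<phi> \<and> \<phi> 1 = z)"

definition coord_field ::
    "nat \<Rightarrow> (nat \<Rightarrow> 'p::finite vfield) \<Rightarrow> ('p \<Rightarrow> nat list) \<Rightarrow> real^'p \<Rightarrow> real^'p \<Rightarrow> 'p vfield" where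
  "coord_field r X B y u x = (\<Sum>j\<in>UNIV. (u $ j) *\<^sub>R commutator (approx_field r X y) (B j) x)"

definition exp_map ::
    "nat \<Rightarrow> (nat \<Rightarrow> 'p::finite vfield) \<Rightarrow> ('p \<Rightarrow> nat list) \<Rightarrow> real^'p \<Rightarrow> real^'p \<Rightarrow> real^'p" where
  "exp_map r X B y u = vf_exp (coord_field r X B y u) y"

text \<open>
  The neighbourhood of \<open>0\<close> on which the exponential map is inverted is taken to be the
  largest ball on which it is defined and is a smooth diffeomorphism onto an open set. The
  balls occurring in the union are nested, so the map is injective on the union.
\<close>

definition exp_nbhd ::
    "nat \<Rightarrow> (nat \<Rightarrow> 'p::finite vfield) \<Rightarrow> ('p \<Rightarrow> nat list) \<Rightarrow> real^'p \<Rightarrow> (real^'p) set" where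
  "exp_nbhd r X B y = \<Union>{ball 0 \<epsilon> |\<epsilon>. \<epsilon> > 0 \<and>
     (\<forall>u\<in>ball 0 \<epsilon>. \<exists>\<phi>. integral_curve (coord_field r X B y u) y \<phi>) \<and>
     smooth_diffeo_on (ball 0 \<epsilon>) (exp_map r X B y)}"

definition Theta_dom ::
    "nat \<Rightarrow> (nat \<Rightarrow> 'p::finite vfield) \<Rightarrow> ('p \<Rightarrow> nat list) \<Rightarrow> real^'p \<Rightarrow> (real^'p) set" where
  "Theta_dom r X B y = exp_map r X B y ` exp_nbhd r X B y"

definition Theta ::
    "nat \<Rightarrow> (nat \<Rightarrow> 'p::finite vfield) \<Rightarrow> ('p \<Rightarrow> nat list) \<Rightarrow> real^'p \<Rightarrow> real^'p \<Rightarrow> real^'p" where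
  "Theta r X B y = inv_into (exp_nbhd r X B y) (exp_map r X B y)"

definition hom_norm :: "('p::finite \<Rightarrow> nat list) \<Rightarrow> real^'p \<Rightarrow> real" where
  "hom_norm B u = (\<Sum>j\<in>UNIV. \<bar>u $ j\<bar> powr (1 / real (weight (B j))))"

definition rho ::
    "nat \<Rightarrow> (nat \<Rightarrow> 'p::finite vfield) \<Rightarrow> ('p \<Rightarrow> nat list) \<Rightarrow> real^'p \<Rightarrow> real^'p \<Rightarrow> real" where
  "rho r X B x y = hom_norm B (Theta r X B y x)"

end

theory Submission
  imports Defs
begin

text \<open>Since the approximating fields are polynomial, the exponential map in the coordinates \<open>u\<close> is the sum
  of its Lie series, whose coefficients are bounded uniformly in the center \<open>y\<close>. This gives charts of
  uniform size, and it avoids the dependence of solutions of differential equations on parameters.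

  Freeness makes the linear relations between commutators those of the free Lie algebra. Hence the commutator
  of two basis fields of weights \<open>w\<^sub>m\<close> and \<open>w\<^sub>l\<close> is, near \<open>y\<close>, a combination with bounded coefficients
  of basis fields of weight at most \<open>w\<^sub>m + w\<^sub>l\<close> only.
  The differential of the exponential map, written in the frame of basis fields, solves a linear differential
  equation along the ray \<open>t u\<close>. By the weight restriction its inverse maps vectors with \<open>b\<close>-th entry \<open>O(\<sigma>^w\<^sub>b)\<close>
  to vectors of the same kind, as long as \<open>\<sigma>\<close> is at least a large multiple of \<open>\<parallel>u\<parallel>\<close>.
  Therefore a curve whose coefficients in the basis fields are at most \<open>\<delta>^|I|\<close> moves \<open>\<parallel>u\<parallel>\<close> by
  \<open>O(\<delta>)\<close>, and the segment from \<open>0\<close> to \<open>u\<close> is the chart image of a curve of this kind.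

  The commutators of order \<open>I\<close> of the original and of the approximating fields differ by
  \<open>O(|x - y|^(r - |I|))\<close>, so exchanging them costs only a constant factor in \<open>\<delta>\<close>.\<close>

text \<open>Differentiating a polynomial costs only a factor of its degree. The degree grows
  linearly with the number of fields applied, so k fields cost k! times a geometric factor, and the
  1/k! of the Lie series absorbs the factorial. This is why the radius of convergence depends on
  degree and coefficient bounds alone.

  The delicate half is the bound of rho by the distance. The inverse differential respects the
  weights only at a scale \<sigma> that already dominates the unknown size of u along the whole
  curve, so the estimate refers to what it is meant to bound. It is closed by self-consistency: let
  s be the supremum of the homogeneous norm along the curve and \<sigma> a fixed multiple of s.
  Integration yields entries of size q \<sigma>^w with q proportional to \<delta> / \<sigma>, hence
  s is at most a constant times q^(1/r) s. Cancelling s bounds q from below, that is, \<sigma> by a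
  multiple of \<delta>.

  Curves with large \<delta> may leave every neighbourhood under control; for them the bound follows
  from rho being bounded near the given point.\<close>

section \<open>Partial derivatives and the classes C^k\<close>

lemma partial_eqI:
  assumes "(f has_derivative f') (at x)"
  shows "partial j f x = f' (axis j 1)"
  using frechet_derivative_at[OF assms] by (simp add: partial_def)

lemma has_derivative_eq_partials:
  fixes f' :: "real^'p::finite \<Rightarrow> real"
  assumes "(f has_derivative f') (at x)"
  shows "f' = (\<lambda>h. \<Sum>j\<in>UNIV. h$j * partial j f x)"
proof
  fix h :: "real^'p"
  have "linear f'" using assms has_derivative_linear by blast
  then have "f' (\<Sum>j\<in>UNIV. h$j *\<^sub>R axis j 1) = (\<Sum>j\<in>UNIV. h$j * f' (axis j 1))"
    by (simp add: linear_sum linear_scale)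
  moreover have "(\<Sum>j\<in>UNIV. h$j *\<^sub>R axis j 1) = h"
    using basis_expansion[of h] by (simp add: scalar_mult_eq_scaleR)
  ultimately show "f' h = (\<Sum>j\<in>UNIV. h$j * partial j f x)"
    by (simp add: partial_eqI[OF assms])
qed

lemma has_derivative_partials:
  fixes f :: "real^'p::finite \<Rightarrow> real"
  assumes "f differentiable (at x)"
  shows "(f has_derivative (\<lambda>h. \<Sum>j\<in>UNIV. h$j * partial j f x)) (at x)"
proof -
  obtain f' where "(f has_derivative f') (at x)" using assms differentiable_def by blast
  then show ?thesis using has_derivative_eq_partials[of f f' x] by simp
qed

lemma has_derivative_vec_nth_iff:
  fixes F :: "'a::real_normed_vector \<Rightarrow> real^'q::finite"
  shows "(F has_derivative F') (at x within S) \<longleftrightarrow>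
    (\<forall>i. ((\<lambda>x. F x $ i) has_derivative (\<lambda>h. F' h $ i)) (at x within S))"
  by (subst has_derivative_componentwise_within) (auto simp: Basis_vec_def inner_axis)

lemma has_derivative_vec_partials:
  fixes F :: "real^'p::finite \<Rightarrow> real^'q::finite"
  assumes "\<And>i. (\<lambda>x. F x $ i) differentiable (at x)"
  shows "(F has_derivative (\<lambda>h. \<chi> i. \<Sum>j\<in>UNIV. h$j * partial j (\<lambda>x. F x $ i) x)) (at x)"
  by (subst has_derivative_vec_nth_iff) (simp add: has_derivative_partials[OF assms])

lemma partial_cong:
  assumes "open S" "x \<in> S" "\<And>z. z \<in> S \<Longrightarrow> f z = g z"
  shows "partial j f x = partial j g x"
proof -
  have "(f has_derivative f') (at x) \<longleftrightarrow> (g has_derivative f') (at x)" for f'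
    using has_derivative_transform_within_open[OF _ assms(1,2), of f f' UNIV g]
      has_derivative_transform_within_open[OF _ assms(1,2), of g f' UNIV f] assms(3) by metis
  then show ?thesis by (simp add: partial_def frechet_derivative_def)
qed

lemma partials_append: "partials (js @ ks) f = partials js (partials ks f)"
  by (induction js) auto

lemma partials_cong:
  assumes "open S" "\<And>z. z \<in> S \<Longrightarrow> f z = g z" "x \<in> S"
  shows "partials js f x = partials js g x"
  using assms(3)
proof (induction js arbitrary: x)
  case (Cons j js)
  then show ?case unfolding partials.simps by (intro partial_cong[OF assms(1)])
qed (use assms in auto)

lemma differentiable_on_cong:
  assumes "\<And>z. z \<in> S \<Longrightarrow> f z = g z"
  shows "f differentiable_on S \<longleftrightarrow> g differentiable_on S"
  using assms unfolding differentiable_on_def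
  by (metis differentiable_transform_within[where d=1] zero_less_one)

lemma Ck_on_cong:
  assumes "open S" "\<And>z. z \<in> S \<Longrightarrow> f z = g z"
  shows "Ck_on k S f \<longleftrightarrow> Ck_on k S g"
proof -
  have e: "z \<in> S \<Longrightarrow> partials js f z = partials js g z" for js z
    using partials_cong[OF assms] .
  show ?thesis unfolding Ck_on_def
    using differentiable_on_cong[of S "partials js f" "partials js g" for js]
      continuous_on_cong[of S S "partials js f" "partials js g" for js] e by meson
qed

lemma Ck_on_eq: "open S \<Longrightarrow> Ck_on k S g \<Longrightarrow> (\<And>z. z \<in> S \<Longrightarrow> f z = g z) \<Longrightarrow> Ck_on k S f"
  using Ck_on_cong by blast

lemma Ck_on_0: "Ck_on 0 S f \<longleftrightarrow> continuous_on S f"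
  by (simp add: Ck_on_def)

text \<open>\<open>partials\<close> applies the last letter of the word first, so splitting that
  letter off leaves derivatives of \<open>partial j f\<close>. This is the recursion behind the
  inductions on the order below.\<close>

lemma Ck_on_Suc:
  "Ck_on (Suc k) S f \<longleftrightarrow> f differentiable_on S \<and> (\<forall>j. Ck_on k S (partial j f))"
proof
  assume "Ck_on (Suc k) S f"
  then have *: "length js < Suc k \<Longrightarrow> partials js f differentiable_on S"
    "length js \<le> Suc k \<Longrightarrow> continuous_on S (partials js f)" for js
    by (auto simp: Ck_on_def)
  show "f differentiable_on S \<and> (\<forall>j. Ck_on k S (partial j f))"
    unfolding Ck_on_def using *[of "[]"] *[of "js @ [j]" for js j] by (simp add: partials_append)
next
  assume a: "f differentiable_on S \<and> (\<forall>j. Ck_on k S (partial j f))"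
  have "partials js f differentiable_on S" if "length js < Suc k" for js
    using that a by (cases js rule: rev_cases) (auto simp: Ck_on_def partials_append)
  moreover have "continuous_on S (partials js f)" if "length js \<le> Suc k" for js
    using that a by (cases js rule: rev_cases)
      (auto simp: Ck_on_def partials_append intro: differentiable_imp_continuous_on)
  ultimately show "Ck_on (Suc k) S f" by (simp add: Ck_on_def)
qed

lemma Ck_on_mono: "Ck_on k S f \<Longrightarrow> k' \<le> k \<Longrightarrow> Ck_on k' S f"
  by (auto simp: Ck_on_def)

lemma Ck_on_subset: "Ck_on k S f \<Longrightarrow> T \<subseteq> S \<Longrightarrow> Ck_on k T f"
  unfolding Ck_on_def by (meson continuous_on_subset differentiable_on_subset)

lemma Ck_on_imp_continuous: "Ck_on k S f \<Longrightarrow> continuous_on S f"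
  unfolding Ck_on_def by (metis le0 length_0_conv list.size(3) partials.simps(1))

lemma Ck_on_differentiable:
  assumes "Ck_on k S f" "0 < k" "open S" "x \<in> S"
  shows "f differentiable (at x)"
proof -
  have "partials [] f differentiable_on S"
    using assms(1,2) unfolding Ck_on_def by (metis list.size(3))
  then show ?thesis using assms(3,4) by (simp add: differentiable_on_eq_differentiable_at)
qed

lemma Ck_on_partial: "Ck_on (Suc k) S f \<Longrightarrow> Ck_on k S (partial j f)"
  by (simp add: Ck_on_Suc)

lemma partial_const [simp]: "partial j (\<lambda>x. c) = (\<lambda>x. 0)"
  using partial_eqI[OF has_derivative_const] by fastforce

lemma Ck_on_const: "Ck_on k S (\<lambda>x. c)"
  by (induction k arbitrary: c) (simp_all add: Ck_on_0 Ck_on_Suc)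

lemma partial_add:
  assumes "f differentiable (at x)" "g differentiable (at x)"
  shows "partial j (\<lambda>x. f x + g x) x = partial j f x + partial j g x"
  using partial_eqI[OF has_derivative_add] assms[unfolded frechet_derivative_works]
  by (simp add: partial_def)

lemma partial_diff:
  assumes "f differentiable (at x)" "g differentiable (at x)"
  shows "partial j (\<lambda>x. f x - g x) x = partial j f x - partial j g x"
  using partial_eqI[OF has_derivative_diff] assms[unfolded frechet_derivative_works]
  by (simp add: partial_def)

lemma partial_mult:
  assumes "f differentiable (at x)" "g differentiable (at x)"
  shows "partial j (\<lambda>x. f x * g x) x = f x * partial j g x + partial j f x * g x"
  using partial_eqI[OF has_derivative_mult] assms[unfolded frechet_derivative_works]
  by (simp add: partial_def)

lemma partial_cmult:
  assumes "f differentiable (at x)"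
  shows "partial j (\<lambda>x. c * f x) x = c * partial j f x"
  using partial_mult[OF differentiable_const assms, of j c] by simp

lemma partial_sum:
  assumes "finite A" "\<And>a. a \<in> A \<Longrightarrow> f a differentiable (at x)"
  shows "partial j (\<lambda>x. \<Sum>a\<in>A. f a x) x = (\<Sum>a\<in>A. partial j (f a) x)"
  using assms
proof (induction A)
  case (insert a A)
  then have "partial j (\<lambda>x. f a x + (\<Sum>a\<in>A. f a x)) x = partial j (f a) x + partial j (\<lambda>x. \<Sum>a\<in>A. f a x) x"
    by (intro partial_add) auto
  then show ?case using insert.IH insert.hyps insert.prems by simp
qed simp

lemma partial_coord [simp]: "partial j (\<lambda>x. x $ i) x = (if j = i then 1 else 0)" for x :: "real^'p::finite"
proof -
  have "((\<lambda>x::real^'p. x $ i) has_derivative (\<lambda>h. h $ i)) (at x)"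
    by (intro bounded_linear.has_derivative[OF bounded_linear_vec_nth] has_derivative_ident)
  from partial_eqI[OF this, of j] show ?thesis by (auto simp: axis_def)
qed

lemma coord_differentiable [simp]: "(\<lambda>x::real^'p::finite. x $ i) differentiable (at x within S)"
  by (metis bounded_linear_imp_differentiable bounded_linear_vec_nth)

lemma Ck_on_add:
  assumes "open S" "Ck_on k S f" "Ck_on k S g"
  shows "Ck_on k S (\<lambda>x. f x + g x)"
  using assms(2,3)
proof (induction k arbitrary: f g)
  case 0
  then show ?case unfolding Ck_on_0 by (rule continuous_on_add)
next
  case (Suc k)
  have e: "partial j (\<lambda>x. f x + g x) z = partial j f z + partial j g z" if "z \<in> S" for j z
    by (intro partial_add Ck_on_differentiable[OF Suc.prems(1) _ assms(1) that]
        Ck_on_differentiable[OF Suc.prems(2) _ assms(1) that]) simp_all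
  have "Ck_on k S (\<lambda>x. partial j f x + partial j g x)" for j
    by (rule Suc.IH[OF Ck_on_partial[OF Suc.prems(1)] Ck_on_partial[OF Suc.prems(2)]])
  then have "Ck_on k S (partial j (\<lambda>x. f x + g x))" for j
    by (rule Ck_on_eq[OF assms(1) _ e])
  moreover have "(\<lambda>x. f x + g x) differentiable_on S"
    using Suc.prems unfolding Ck_on_Suc differentiable_on_def by (blast intro: differentiable_add)
  ultimately show ?case unfolding Ck_on_Suc by blast
qed

lemma Ck_on_mult:
  assumes "open S" "Ck_on k S f" "Ck_on k S g"
  shows "Ck_on k S (\<lambda>x. f x * g x)"
  using assms(2,3)
proof (induction k arbitrary: f g)
  case 0
  then show ?case unfolding Ck_on_0 by (rule continuous_on_mult)
next
  case (Suc k)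
  have k: "Ck_on k S f" "Ck_on k S g"
    using Ck_on_mono[OF Suc.prems(1)] Ck_on_mono[OF Suc.prems(2)] by auto
  have e: "partial j (\<lambda>x. f x * g x) z = f z * partial j g z + partial j f z * g z" if "z \<in> S" for j z
    by (intro partial_mult Ck_on_differentiable[OF Suc.prems(1) _ assms(1) that]
        Ck_on_differentiable[OF Suc.prems(2) _ assms(1) that]) simp_all
  have "Ck_on k S (\<lambda>x. f x * partial j g x + partial j f x * g x)" for j
    by (rule Ck_on_add[OF assms(1) Suc.IH[OF k(1) Ck_on_partial[OF Suc.prems(2)]]
          Suc.IH[OF Ck_on_partial[OF Suc.prems(1)] k(2)]])
  then have "Ck_on k S (partial j (\<lambda>x. f x * g x))" for j
    by (rule Ck_on_eq[OF assms(1) _ e])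
  moreover have "(\<lambda>x. f x * g x) differentiable_on S"
    using Suc.prems unfolding Ck_on_Suc differentiable_on_def by (blast intro: differentiable_mult)
  ultimately show ?case unfolding Ck_on_Suc by blast
qed

lemma Ck_on_cmult: "open S \<Longrightarrow> Ck_on k S f \<Longrightarrow> Ck_on k S (\<lambda>x. c * f x)"
  by (rule Ck_on_mult[OF _ Ck_on_const])

lemma Ck_on_sum:
  assumes "open S" "finite A" "\<And>a. a \<in> A \<Longrightarrow> Ck_on k S (f a)"
  shows "Ck_on k S (\<lambda>x. \<Sum>a\<in>A. f a x)"
  using assms(2,3)
proof (induction A)
  case empty
  show ?case unfolding sum.empty by (rule Ck_on_const)
next
  case (insert a A)
  have "Ck_on k S (\<lambda>x. f a x + (\<Sum>a\<in>A. f a x))"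
    by (rule Ck_on_add[OF assms(1) insert.prems[OF insertI1] insert.IH[OF insert.prems[OF insertI2]]])
  then show ?case unfolding sum.insert[OF insert.hyps] .
qed

lemma Ck_on_prod:
  assumes "open S" "finite A" "\<And>a. a \<in> A \<Longrightarrow> Ck_on k S (f a)"
  shows "Ck_on k S (\<lambda>x. \<Prod>a\<in>A. f a x)"
  using assms(2,3)
proof (induction A)
  case empty
  show ?case unfolding prod.empty by (rule Ck_on_const)
next
  case (insert a A)
  have "Ck_on k S (\<lambda>x. f a x * (\<Prod>a\<in>A. f a x))"
    by (rule Ck_on_mult[OF assms(1) insert.prems[OF insertI1] insert.IH[OF insert.prems[OF insertI2]]])
  then show ?case unfolding prod.insert[OF insert.hyps] .
qed

lemma Ck_on_diff:
  assumes "open S" "Ck_on k S f" "Ck_on k S g"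
  shows "Ck_on k S (\<lambda>x. f x - g x)"
proof -
  have "Ck_on k S (\<lambda>x. f x + (-1) * g x)"
    by (rule Ck_on_add[OF assms(1,2) Ck_on_cmult[OF assms(1,3)]])
  then show ?thesis by simp
qed

lemma Ck_on_coord: "Ck_on k S (\<lambda>x. x $ i)"
proof (cases k)
  case 0
  show ?thesis unfolding 0 Ck_on_0 by (rule continuous_on_component[OF continuous_on_id])
next
  case (Suc m)
  have "partial j (\<lambda>x::real^'a. x $ i) = (\<lambda>x. if j = i then 1 else 0)" for j by (rule ext) simp
  then have "Ck_on m S (partial j (\<lambda>x::real^'a. x $ i))" for j by (simp only: Ck_on_const)
  moreover have "(\<lambda>x::real^'a. x $ i) differentiable_on S"
    unfolding differentiable_on_def by (blast intro: coord_differentiable)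
  ultimately show ?thesis unfolding Suc Ck_on_Suc by blast
qed

lemma sum_axis_mult [simp]: "(\<Sum>i\<in>UNIV. axis j (1::real) $ i * g i) = g j"
proof -
  have "(\<Sum>i\<in>UNIV. axis j (1::real) $ i * g i) = (\<Sum>i\<in>UNIV. if i = j then g i else 0)"
    by (rule sum.cong) (auto simp: axis_def)
  then show ?thesis by simp
qed

lemma partial_inverse:
  fixes f :: "real^'p::finite \<Rightarrow> real"
  assumes "f differentiable (at x)" "f x \<noteq> 0"
  shows "partial j (\<lambda>x. inverse (f x)) x = - (inverse (f x) * partial j f x * inverse (f x))"
  using partial_eqI[OF Deriv.has_derivative_inverse[OF assms(2) has_derivative_partials[OF assms(1)]], of j]
  by simp

text \<open>The derivative of 1/f is a product of 1/f, a derivative of f and 1/f again, so the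
  regularity of 1/f at order k feeds order k + 1.\<close>

lemma Ck_on_inverse:
  assumes "open S" "Ck_on k S f" "\<And>x. x \<in> S \<Longrightarrow> f x \<noteq> 0"
  shows "Ck_on k S (\<lambda>x. inverse (f x))"
  using assms(2)
proof (induction k)
  case (Suc k)
  then have "Ck_on k S (\<lambda>x. inverse (f x))" using Ck_on_mono[OF Suc.prems] by auto
  then have "Ck_on k S (\<lambda>x. - 1 * (inverse (f x) * partial j f x * inverse (f x)))" for j
    using Suc.prems by (intro Ck_on_cmult Ck_on_mult assms(1)) (auto simp: Ck_on_Suc)
  moreover have e: "partial j (\<lambda>x. inverse (f x)) z = - 1 * (inverse (f z) * partial j f z * inverse (f z))"
    if "z \<in> S" for j z
    using partial_inverse[OF Ck_on_differentiable[OF Suc.prems _ assms(1) that] assms(3)[OF that]] by simp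
  ultimately have "Ck_on k S (partial j (\<lambda>x. inverse (f x)))" for j
    by (intro Ck_on_eq[OF assms(1) _ e])
  moreover have "(\<lambda>x. inverse (f x)) differentiable_on S"
    using Suc.prems assms(3) unfolding Ck_on_Suc differentiable_on_def
    by (auto intro!: differentiable_inverse)
  ultimately show ?case by (simp add: Ck_on_Suc)
qed (use assms in \<open>auto simp: Ck_on_0 intro!: continuous_intros\<close>)

section \<open>The chain rule\<close>

lemma has_derivative_compose_partials:
  fixes G :: "real^'p::finite \<Rightarrow> real^'q::finite" and h :: "real^'q \<Rightarrow> real"
  assumes "\<And>i. (\<lambda>x. G x $ i) differentiable (at x)" "h differentiable (at (G x))"
  shows "((\<lambda>x. h (G x)) has_derivative
    (\<lambda>v. \<Sum>i\<in>UNIV. (\<Sum>j\<in>UNIV. v$j * partial j (\<lambda>x. G x $ i) x) * partial i h (G x))) (at x)"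
  using has_derivative_compose[OF has_derivative_vec_partials[OF assms(1)] has_derivative_partials[OF assms(2)]]
  by simp

lemma partial_compose:
  fixes G :: "real^'p::finite \<Rightarrow> real^'q::finite" and h :: "real^'q \<Rightarrow> real"
  assumes "\<And>i. (\<lambda>x. G x $ i) differentiable (at x)" "h differentiable (at (G x))"
  shows "partial j (\<lambda>x. h (G x)) x = (\<Sum>i\<in>UNIV. partial j (\<lambda>x. G x $ i) x * partial i h (G x))"
  by (subst partial_eqI[OF has_derivative_compose_partials[OF assms]])
    simp_all

text \<open>By the chain rule a derivative of the composition contains \<open>partial i h\<close> in
  place of \<open>h\<close>, which is why the induction lets \<open>h\<close> vary while
  \<open>G\<close> stays fixed.\<close>

lemma Ck_on_compose:
  fixes G :: "real^'p::finite \<Rightarrow> real^'q::finite" and h :: "real^'q \<Rightarrow> real"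
  assumes "open S" "open T" "G ` S \<subseteq> T" "\<And>i. Ck_on k S (\<lambda>x. G x $ i)" "Ck_on k T h"
  shows "Ck_on k S (\<lambda>x. h (G x))"
  using assms(4,5)
proof (induction k arbitrary: h)
  case 0
  have "continuous_on S (\<lambda>x. \<chi> i. G x $ i)"
    using 0 by (intro continuous_on_vec_lambda) (simp add: Ck_on_0)
  then have "continuous_on S G" by simp
  then show ?case using 0 assms(3) by (auto simp: Ck_on_0 intro: continuous_on_compose2)
next
  case (Suc k)
  have d: "(\<lambda>x. G x $ i) differentiable (at x)" if "x \<in> S" for i x
    using Ck_on_differentiable[OF Suc.prems(1) _ assms(1) that] by simp
  have dh: "h differentiable (at (G x))" if "x \<in> S" for x
    using Ck_on_differentiable[OF Suc.prems(2) _ assms(2)] that assms(3) by blast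
  have k: "Ck_on k S (\<lambda>x. G x $ i)" for i using Ck_on_mono[OF Suc.prems(1)] by simp
  have "Ck_on k S (\<lambda>x. \<Sum>i\<in>UNIV. partial j (\<lambda>x. G x $ i) x * partial i h (G x))" for j
    by (rule Ck_on_sum[OF assms(1) finite],
        rule Ck_on_mult[OF assms(1) Ck_on_partial[OF Suc.prems(1)] Suc.IH[OF k Ck_on_partial[OF Suc.prems(2)]]])
  then have "Ck_on k S (partial j (\<lambda>x. h (G x)))" for j
    by (intro Ck_on_eq[OF assms(1) _ partial_compose[OF d dh]])
  moreover have "(\<lambda>x. h (G x)) differentiable (at x)" if "x \<in> S" for x
    using has_derivative_compose_partials[OF d[OF that] dh[OF that]] differentiable_def by blast
  ultimately show ?case
    by (simp add: Ck_on_Suc differentiable_on_eq_differentiable_at[OF assms(1)])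
qed

subsection \<open>Symmetry of second partial derivatives\<close>

lemma has_field_derivative_line:
  fixes f :: "real^'p::finite \<Rightarrow> real"
  assumes "f differentiable (at (z + t *\<^sub>R axis j 1))"
  shows "((\<lambda>t. f (z + t *\<^sub>R axis j 1)) has_real_derivative partial j f (z + t *\<^sub>R axis j 1)) (at t)"
proof -
  have "((\<lambda>t. z + t *\<^sub>R axis j 1) has_derivative (\<lambda>h. h *\<^sub>R axis j 1)) (at t)"
    by (auto intro!: derivative_eq_intros)
  from has_derivative_compose[OF this has_derivative_partials[OF assms]]
  show ?thesis unfolding has_field_derivative_def
    by (simp add: mult.assoc sum_distrib_left[symmetric] mult.commute[of _ "partial j f (z + t *\<^sub>R axis j 1)"])
qed

text \<open>Two applications of the mean value theorem, in direction i to the increment over the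
  step in direction j, then in direction j. The second difference is symmetric in i and j while the
  mixed derivative is not visibly so; comparing the two orders proves Schwarz's theorem.\<close>

lemma mixed_difference_mean_value:
  fixes f :: "real^'p::finite \<Rightarrow> real"
  assumes "open S" "Ck_on 2 S f" "h > 0"
    and "\<And>s t. s \<in> {0..h} \<Longrightarrow> t \<in> {0..h} \<Longrightarrow> x + s *\<^sub>R axis i 1 + t *\<^sub>R axis j 1 \<in> S"
  shows "\<exists>s t. s \<in> {0..h} \<and> t \<in> {0..h} \<and>
    f (x + h *\<^sub>R axis i 1 + h *\<^sub>R axis j 1) - f (x + h *\<^sub>R axis i 1) - f (x + h *\<^sub>R axis j 1) + f x
     = h * h * partial j (partial i f) (x + s *\<^sub>R axis i 1 + t *\<^sub>R axis j 1)"
proof -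
  let ?e = "\<lambda>k. axis k (1::real)"
  have C1: "Ck_on 1 S (partial i f)" using assms(2) by (metis Ck_on_Suc one_add_one plus_1_eq_Suc)
  have df: "f differentiable (at z)" if "z \<in> S" for z
    using Ck_on_differentiable[OF assms(2)] that assms(1) by auto
  have dpf: "partial i f differentiable (at z)" if "z \<in> S" for z
    using Ck_on_differentiable[OF C1] that assms(1) by auto
  have i: "x + h *\<^sub>R ?e j + s *\<^sub>R ?e i \<in> S" "x + s *\<^sub>R ?e i \<in> S" if "s \<in> {0..h}" for s
    using assms(4)[of s h] assms(4)[of s 0] that assms(3) by (auto simp: algebra_simps)
  let ?g = "\<lambda>s. f (x + h *\<^sub>R ?e j + s *\<^sub>R ?e i) - f (x + s *\<^sub>R ?e i)"
  have "\<exists>s>0. s < h \<and> ?g h - ?g 0 = (h - 0) * (partial i f (x + h *\<^sub>R ?e j + s *\<^sub>R ?e i) - partial i f (x + s *\<^sub>R ?e i))"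
    using assms(3) i by (intro MVT2 DERIV_diff has_field_derivative_line df) auto
  then obtain s where s: "s > 0" "s < h"
    "?g h - ?g 0 = h * (partial i f (x + h *\<^sub>R ?e j + s *\<^sub>R ?e i) - partial i f (x + s *\<^sub>R ?e i))" by auto
  let ?k = "\<lambda>t. partial i f (x + s *\<^sub>R ?e i + t *\<^sub>R ?e j)"
  have "\<exists>t>0. t < h \<and> ?k h - ?k 0 = (h - 0) * partial j (partial i f) (x + s *\<^sub>R ?e i + t *\<^sub>R ?e j)"
    using assms(3,4) s by (intro MVT2 has_field_derivative_line dpf) auto
  then obtain t where t: "t > 0" "t < h" "?k h - ?k 0 = h * partial j (partial i f) (x + s *\<^sub>R ?e i + t *\<^sub>R ?e j)"
    by auto
  have "?k h - ?k 0 = partial i f (x + h *\<^sub>R ?e j + s *\<^sub>R ?e i) - partial i f (x + s *\<^sub>R ?e i)"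
    by (simp add: algebra_simps)
  then have "?g h - ?g 0 = h * h * partial j (partial i f) (x + s *\<^sub>R ?e i + t *\<^sub>R ?e j)"
    using s(3) t(3) by simp
  then show ?thesis using s t by (intro exI[of _ s] exI[of _ t]) (auto simp: algebra_simps)
qed

lemma partial_commute:
  fixes f :: "real^'p::finite \<Rightarrow> real"
  assumes "open S" "Ck_on 2 S f" "x \<in> S"
  shows "partial i (partial j f) x = partial j (partial i f) x"
proof (rule ccontr)
  let ?a = "partial i (partial j f)" and ?b = "partial j (partial i f)"
  assume ne: "?a x \<noteq> ?b x"
  define \<epsilon> where "\<epsilon> = dist (?a x) (?b x) / 2"
  have e: "\<epsilon> > 0" using ne by (simp add: \<epsilon>_def)
  have c: "continuous_on S ?a" "continuous_on S ?b"
    using assms(2) by (auto simp: numeral_2_eq_2 Ck_on_Suc Ck_on_0)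
  obtain d0 where d0: "d0 > 0" "ball x d0 \<subseteq> S" using assms(1,3) open_contains_ball by blast
  obtain d1 where d1: "d1 > 0" "\<And>z. z \<in> S \<Longrightarrow> dist z x < d1 \<Longrightarrow> dist (?a z) (?a x) < \<epsilon>"
    using c(1)[unfolded continuous_on_iff] assms(3) e by metis
  obtain d2 where d2: "d2 > 0" "\<And>z. z \<in> S \<Longrightarrow> dist z x < d2 \<Longrightarrow> dist (?b z) (?b x) < \<epsilon>"
    using c(2)[unfolded continuous_on_iff] assms(3) e by metis
  \<comment> \<open>A third leaves room for two steps of length h: every sample point is within 2h
    of x and so in all three neighbourhoods.\<close>
  define h where "h = min d0 (min d1 d2) / 3"
  have h: "h > 0" "2 * h < d0" "2 * h < d1" "2 * h < d2" using d0 d1 d2 by (auto simp: h_def)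
  have near: "dist (x + s *\<^sub>R axis k 1 + t *\<^sub>R axis l 1) x \<le> 2 * h"
    if "s \<in> {0..h}" "t \<in> {0..h}" for s t k l
  proof -
    have "norm (s *\<^sub>R axis k (1::real) + t *\<^sub>R axis l 1) \<le> \<bar>s\<bar> + \<bar>t\<bar>"
      using norm_triangle_ineq[of "s *\<^sub>R axis k (1::real)" "t *\<^sub>R axis l 1"] by simp
    then show ?thesis using that by (simp add: dist_norm algebra_simps)
  qed
  have inS: "x + s *\<^sub>R axis k 1 + t *\<^sub>R axis l 1 \<in> S" if "s \<in> {0..h}" "t \<in> {0..h}" for s t k l
    using near[OF that, of k l] h d0 by (auto simp: subset_eq dist_commute)
  obtain s t where 1: "s \<in> {0..h}" "t \<in> {0..h}"
    "f (x + h *\<^sub>R axis i 1 + h *\<^sub>R axis j 1) - f (x + h *\<^sub>R axis i 1) - f (x + h *\<^sub>R axis j 1) + f x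
     = h * h * ?b (x + s *\<^sub>R axis i 1 + t *\<^sub>R axis j 1)"
    using mixed_difference_mean_value[OF assms(1,2) h(1) inS] by blast
  obtain s' t' where 2: "s' \<in> {0..h}" "t' \<in> {0..h}"
    "f (x + h *\<^sub>R axis j 1 + h *\<^sub>R axis i 1) - f (x + h *\<^sub>R axis j 1) - f (x + h *\<^sub>R axis i 1) + f x
     = h * h * ?a (x + s' *\<^sub>R axis j 1 + t' *\<^sub>R axis i 1)"
    using mixed_difference_mean_value[OF assms(1,2) h(1) inS] by blast
  \<comment> \<open>The same second difference, evaluated in the two orders.\<close>
  have "h * h * ?a (x + s' *\<^sub>R axis j 1 + t' *\<^sub>R axis i 1) = h * h * ?b (x + s *\<^sub>R axis i 1 + t *\<^sub>R axis j 1)"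
  proof -
    have sw: "x + h *\<^sub>R axis j 1 + h *\<^sub>R axis i 1 = x + h *\<^sub>R axis i 1 + h *\<^sub>R axis j 1"
      by (simp add: algebra_simps)
    then show ?thesis using 1(3) 2(3)[unfolded sw] by linarith
  qed
  then have eq: "?a (x + s' *\<^sub>R axis j 1 + t' *\<^sub>R axis i 1) = ?b (x + s *\<^sub>R axis i 1 + t *\<^sub>R axis j 1)"
    using h by simp
  have "dist (?a (x + s' *\<^sub>R axis j 1 + t' *\<^sub>R axis i 1)) (?a x) < \<epsilon>"
    using near[OF 2(1,2), of j i] h by (intro d1 inS 2) auto
  moreover have "dist (?b (x + s *\<^sub>R axis i 1 + t *\<^sub>R axis j 1)) (?b x) < \<epsilon>"
    using near[OF 1(1,2), of i j] h by (intro d2 inS 1) auto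
  ultimately show False unfolding \<epsilon>_def eq
    using dist_triangle3[of "?a x" "?b x" "?b (x + s *\<^sub>R axis i 1 + t *\<^sub>R axis j 1)"] by (simp add: dist_commute)
qed

text \<open>A mean value inequality with the sum of coordinate bounds in place of an operator norm.
  With equal bounds it costs a factor CARD('p), one source of the powers of CARD('p) in the later
  constants.\<close>

lemma abs_diff_le_partials:
  fixes f :: "real^'p::finite \<Rightarrow> real"
  assumes "convex S" "\<And>z. z \<in> S \<Longrightarrow> f differentiable (at z)"
    and "\<And>j z. z \<in> S \<Longrightarrow> \<bar>partial j f z\<bar> \<le> B j" and "x \<in> S" "y \<in> S"
  shows "\<bar>f x - f y\<bar> \<le> (\<Sum>j\<in>UNIV. B j) * norm (x - y)"
proof -
  have "norm (f x - f y) \<le> (\<Sum>j\<in>UNIV. B j) * norm (x - y)"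
  proof (rule differentiable_bound[OF assms(1) _ _ assms(4,5)])
    fix z assume z: "z \<in> S"
    show "(f has_derivative (\<lambda>h. \<Sum>j\<in>UNIV. h$j * partial j f z)) (at z within S)"
      by (rule has_derivative_at_withinI[OF has_derivative_partials[OF assms(2)[OF z]]])
    show "onorm (\<lambda>h. \<Sum>j\<in>UNIV. h$j * partial j f z) \<le> (\<Sum>j\<in>UNIV. B j)"
    proof (rule onorm_le)
      fix h :: "real^'p"
      have "norm (\<Sum>j\<in>UNIV. h$j * partial j f z) \<le> (\<Sum>j\<in>UNIV. B j * norm h)"
        using assms(3)[OF z] component_le_norm_cart[of h]
        by (intro sum_norm_le) (auto simp: abs_mult mult.commute[of "B _"] intro!: mult_mono)
      then show "norm (\<Sum>j\<in>UNIV. h$j * partial j f z) \<le> (\<Sum>j\<in>UNIV. B j) * norm h"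
        by (simp add: sum_distrib_right)
    qed
  qed
  then show ?thesis by simp
qed

lemma Ck_on_partials:
  assumes "Ck_on (k + length js) S f"
  shows "Ck_on k S (partials js f)"
  using assms unfolding Ck_on_def partials_append[symmetric] by auto

subsection \<open>Homogeneous polynomials as sums over words\<close>

definition mon :: "real^'p::finite \<Rightarrow> 'p list \<Rightarrow> real" where
  "mon u w = prod_list (map (\<lambda>j. u $ j) w)"

text \<open>Words replace multi-exponents because the coefficients of a Lie series are products of
  noncommuting operators; in this form they can be used without symmetrisation.\<close>

definition wsum :: "('p::finite list \<Rightarrow> real) \<Rightarrow> nat \<Rightarrow> real^'p \<Rightarrow> real" where
  "wsum c k u = (\<Sum>w\<in>{w. length w = k}. c w * mon u w)"

text \<open>The coefficients of the partial derivative: \<open>j\<close> is inserted at all positions of the word.\<close>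

fun dcoeff :: "'p \<Rightarrow> ('p list \<Rightarrow> real) \<Rightarrow> 'p list \<Rightarrow> real" where
  "dcoeff j c [] = c [j]"
| "dcoeff j c (a # w) = c (j # a # w) + dcoeff j (\<lambda>v. c (a # v)) w"

lemma mon_Nil [simp]: "mon u [] = 1" and mon_Cons [simp]: "mon u (a # w) = u $ a * mon u w"
  by (simp_all add: mon_def)

lemma finite_words [simp]: "finite {w :: 'p::finite list. length w = k}"
  using finite_lists_length_eq[of "UNIV :: 'p set" k] by simp

lemma sum_words_Suc:
  fixes g :: "'p::finite list \<Rightarrow> 'b::comm_monoid_add"
  shows "(\<Sum>w\<in>{w. length w = Suc k}. g w) = (\<Sum>a\<in>UNIV. \<Sum>w\<in>{w. length w = k}. g (a # w))"
proof -
  have e: "{w :: 'p list. length w = Suc k} = (\<lambda>(a, w). a # w) ` (UNIV \<times> {w. length w = k})"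
    by (auto simp: length_Suc_conv)
  have "inj_on (\<lambda>(a, w :: 'p list). a # w) (UNIV \<times> {w. length w = k})" by (auto simp: inj_on_def)
  then show ?thesis unfolding e sum.reindex[OF \<open>inj_on _ _\<close>]
    by (simp add: sum.cartesian_product case_prod_beta)
qed

lemma wsum_0 [simp]: "wsum c 0 u = c []"
  by (simp add: wsum_def)

lemma wsum_Suc: "wsum c (Suc k) u = (\<Sum>a\<in>UNIV. u $ a * wsum (\<lambda>w. c (a # w)) k u)"
  by (simp add: wsum_def sum_words_Suc sum_distrib_left mult_ac)

lemma wsum_zero: "wsum c k 0 = (if k = 0 then c [] else 0)"
  by (cases k) (simp_all add: wsum_Suc)

lemma wsum_add: "wsum (\<lambda>w. c w + d w) k u = wsum c k u + wsum d k u"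
  by (simp add: wsum_def distrib_right sum.distrib)

lemma Ck_on_wsum: "Ck_on m UNIV (wsum c k)"
proof (induction k arbitrary: c)
  case 0
  have "wsum c 0 = (\<lambda>u. c [])" by (rule ext) simp
  then show ?case by (simp only: Ck_on_const)
next
  case (Suc k)
  have "Ck_on m UNIV (\<lambda>u. \<Sum>a\<in>UNIV. u $ a * wsum (\<lambda>w. c (a # w)) k u)"
    by (rule Ck_on_sum[OF open_UNIV finite], rule Ck_on_mult[OF open_UNIV Ck_on_coord Suc.IH])
  then show ?case by (rule Ck_on_eq[OF open_UNIV]) (rule wsum_Suc)
qed

lemma wsum_differentiable: "wsum c k differentiable (at u)"
  by (rule Ck_on_differentiable[OF Ck_on_wsum[of 1]]) simp_all

text \<open>Peeling off the first letter leaves a sum of u_a times shorter forms. The product rule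
  then hits either that letter or a later one, and these are the two summands in the recursion of
  \<open>dcoeff\<close>.\<close>

lemma partial_wsum: "partial j (wsum c (Suc k)) u = wsum (dcoeff j c) k u"
proof (induction k arbitrary: c)
  case 0
  have e: "wsum c (Suc 0) = (\<lambda>u. \<Sum>a\<in>UNIV. c [a] * u $ a)" by (rule ext) (simp add: wsum_Suc mult.commute)
  have "partial j (wsum c (Suc 0)) u = (\<Sum>a\<in>UNIV. c [a] * (if j = a then 1 else 0))"
    unfolding e by (subst partial_sum) (auto simp: partial_cmult intro!: derivative_intros)
  also have "\<dots> = (\<Sum>a\<in>UNIV. if j = a then c [a] else 0)" by (rule sum.cong) auto
  finally show ?case by simp
next
  case (Suc k)
  let ?c = "\<lambda>a w. c (a # w)"
  have e: "wsum c (Suc (Suc k)) = (\<lambda>u. \<Sum>a\<in>UNIV. u $ a * wsum (?c a) (Suc k) u)"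
    by (rule ext) (simp only: wsum_Suc[of c])
  have "partial j (wsum c (Suc (Suc k))) u =
      (\<Sum>a\<in>UNIV. partial j (\<lambda>u. u $ a * wsum (?c a) (Suc k) u) u)"
    unfolding e by (rule partial_sum) (auto intro!: differentiable_mult wsum_differentiable)
  also have "\<dots> = (\<Sum>a\<in>UNIV. u $ a * wsum (dcoeff j (?c a)) k u + (if j = a then 1 else 0) * wsum (?c a) (Suc k) u)"
    by (subst partial_mult) (auto intro!: wsum_differentiable simp: Suc.IH)
  also have "\<dots> = (\<Sum>a\<in>UNIV. u $ a * wsum (dcoeff j (?c a)) k u) + (\<Sum>a\<in>UNIV. if j = a then wsum (?c a) (Suc k) u else 0)"
    unfolding sum.distrib by (intro arg_cong2[where f = "(+)"] refl sum.cong) auto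
  also have "\<dots> = (\<Sum>a\<in>UNIV. u $ a * wsum (dcoeff j (?c a)) k u) + wsum (?c j) (Suc k) u" by simp
  also have "\<dots> = wsum (dcoeff j c) (Suc k) u"
    unfolding wsum_Suc[of "dcoeff j c"] wsum_Suc[of "?c j"] by (simp add: wsum_add distrib_left sum.distrib add.commute)
  finally show ?case .
qed

text \<open>All insertions of j into a word of length k give the same coefficient, and their number
  k + 1 is the factor that turns 1/(k + 1)! into 1/k! in a differentiated Taylor polynomial.\<close>

lemma dcoeff_symmetric:
  assumes "\<And>v w'. w = v @ w' \<Longrightarrow> c (v @ j # w') = c (w @ [j])"
  shows "dcoeff j c w = real (Suc (length w)) * c (w @ [j])"
  using assms
proof (induction w arbitrary: c)
  case (Cons a w)
  have "dcoeff j (\<lambda>v. c (a # v)) w = real (Suc (length w)) * c (a # (w @ [j]))"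
    by (rule Cons.IH) (use Cons.prems[of "a # _"] in simp)
  moreover have "c (j # a # w) = c (a # w @ [j])" using Cons.prems[of "[]"] by simp
  ultimately show ?case by (simp add: algebra_simps)
qed simp

text \<open>The derivative in direction j is carried outwards one letter at a time; each exchange is
  Schwarz's theorem for an iterated derivative that is still of class C^2.\<close>

lemma partials_rotate:
  fixes f :: "real^'p::finite \<Rightarrow> real"
  assumes "open S" "Ck_on (Suc (length w)) S f" "x \<in> S"
  shows "partials (w @ [j]) f x = partial j (partials w f) x"
  using assms(2,3)
proof (induction w arbitrary: x)
  case (Cons a w)
  have C: "Ck_on 2 S (partials w f)" by (rule Ck_on_partials) (use Cons.prems in simp)
  have "Ck_on (Suc (length w)) S f" by (rule Ck_on_mono[OF Cons.prems(1)]) simp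
  then have "partial a (partials (w @ [j]) f) x = partial a (partial j (partials w f)) x"
    by (intro partial_cong[OF assms(1) Cons.prems(2)] Cons.IH)
  then show ?case using partial_commute[OF assms(1) C Cons.prems(2)] by simp
qed simp

lemma partials_insert:
  assumes "open S" "Ck_on (Suc (length (v @ w))) S f" "x \<in> S"
  shows "partials (v @ j # w) f x = partials (v @ w @ [j]) f x"
  unfolding partials_append[of v]
proof (rule partials_cong[OF assms(1) _ assms(3)])
  fix z assume z: "z \<in> S"
  have "Ck_on (Suc (length w)) S f" by (rule Ck_on_mono[OF assms(2)]) simp
  from partials_rotate[OF assms(1) this z] show "partials (j # w) f z = partials (w @ [j]) f z" by simp
qed

subsection \<open>Taylor polynomials\<close>

lemma taylor_poly_wsum: "taylor_poly m f y x = (\<Sum>k\<le>m. wsum (\<lambda>w. partials w f y) k (x - y) / fact k)"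
  by (simp add: taylor_poly_def wsum_def mon_def)

lemma Ck_on_shift:
  fixes h :: "real^'p::finite \<Rightarrow> real"
  assumes "Ck_on k UNIV h"
  shows "Ck_on k UNIV (\<lambda>x. h (x - y))"
proof (rule Ck_on_compose[OF open_UNIV open_UNIV _ _ assms])
  show "Ck_on k UNIV (\<lambda>x. (x - y) $ i)" for i
    unfolding vector_minus_component by (rule Ck_on_diff[OF open_UNIV Ck_on_coord Ck_on_const])
qed simp

lemma partial_coord_diff: "partial j (\<lambda>x::real^'p::finite. (x - y) $ i) x = (if j = i then 1 else 0)"
proof -
  have "partial j (\<lambda>x::real^'p. x $ i - y $ i) x = partial j (\<lambda>x. x $ i) x - partial j (\<lambda>x. y $ i) x"
    by (rule partial_diff) auto
  then show ?thesis by simp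
qed

lemma partial_shift:
  fixes h :: "real^'p::finite \<Rightarrow> real"
  assumes "h differentiable (at (x - y))"
  shows "partial j (\<lambda>x. h (x - y)) x = partial j h (x - y)"
proof -
  have "partial j (\<lambda>x. h (x - y)) x = (\<Sum>i\<in>UNIV. partial j (\<lambda>x. (x - y) $ i) x * partial i h (x - y))"
    by (rule partial_compose) (use assms in \<open>auto intro: differentiable_diff\<close>)
  also have "\<dots> = (\<Sum>i\<in>UNIV. if j = i then partial i h (x - y) else 0)"
    by (rule sum.cong) (auto simp: partial_coord_diff simp del: vector_minus_component)
  finally show ?thesis by simp
qed

lemma Ck_on_taylor_poly: "Ck_on k UNIV (taylor_poly m f y)"
proof -
  have "Ck_on k UNIV (\<lambda>x. \<Sum>l\<le>m. inverse (fact l) * wsum (\<lambda>w. partials w f y) l (x - y))"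
    by (rule Ck_on_sum[OF open_UNIV finite_atMost], rule Ck_on_cmult[OF open_UNIV Ck_on_shift[OF Ck_on_wsum]])
  then show ?thesis
    by (rule Ck_on_eq[OF open_UNIV]) (simp add: taylor_poly_wsum divide_inverse mult.commute)
qed

lemma taylor_poly_center: "taylor_poly m f y y = f y"
proof -
  have "taylor_poly m f y y = (\<Sum>k\<le>m. if k = 0 then f y else 0)"
    unfolding taylor_poly_wsum by (rule sum.cong) (auto simp: wsum_zero)
  then show ?thesis by simp
qed

text \<open>Differentiating a word sum inserts j at all positions. By the symmetry of iterated
  derivatives each insertion amounts to differentiating f once more, before everything else.\<close>

lemma partial_taylor_poly:
  fixes f :: "real^'p::finite \<Rightarrow> real"
  assumes "open S" "Ck_on (Suc m) S f" "y \<in> S"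
  shows "partial j (taylor_poly (Suc m) f y) x = taylor_poly m (partial j f) y x"
proof -
  let ?c = "\<lambda>w. partials w f y"
  have d: "(\<lambda>x. wsum ?c k (x - y)) differentiable (at x)" for k
    by (rule Ck_on_differentiable[OF Ck_on_shift[OF Ck_on_wsum[of 1]]]) auto
  have e: "taylor_poly (Suc m) f y = (\<lambda>x. \<Sum>k\<le>Suc m. inverse (fact k) * wsum ?c k (x - y))"
    by (rule ext) (simp add: taylor_poly_wsum divide_inverse mult.commute)
  have s: "wsum (dcoeff j ?c) k u = real (Suc k) * wsum (\<lambda>w. partials w (partial j f) y) k u" if "k \<le> m" for k u
  proof -
    have "dcoeff j ?c w = real (Suc k) * partials w (partial j f) y" if w: "length w = k" for w
    proof -
      have "dcoeff j ?c w = real (Suc (length w)) * ?c (w @ [j])"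
      proof (rule dcoeff_symmetric)
        fix v w' assume vw: "w = v @ w'"
        have "Ck_on (Suc (length (v @ w'))) S f"
          by (rule Ck_on_mono[OF assms(2)]) (use vw w \<open>k \<le> m\<close> in simp)
        from partials_insert[OF assms(1) this assms(3)] show "?c (v @ j # w') = ?c (w @ [j])" using vw by simp
      qed
      then show ?thesis using w by (simp add: partials_append)
    qed
    then show ?thesis unfolding wsum_def sum_distrib_left
      by (intro sum.cong) (auto simp: mult_ac)
  qed
  have "partial j (taylor_poly (Suc m) f y) x = (\<Sum>k\<le>Suc m. partial j (\<lambda>x. inverse (fact k) * wsum ?c k (x - y)) x)"
    unfolding e by (rule partial_sum) (auto intro!: differentiable_mult d)
  also have "\<dots> = (\<Sum>k\<le>Suc m. inverse (fact k) * partial j (wsum ?c k) (x - y))"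
    by (simp only: partial_cmult[OF d] partial_shift[OF wsum_differentiable])
  \<comment> \<open>The term of degree 0 is constant and disappears, which shifts the summation
    index by one.\<close>
  also have "\<dots> = (\<Sum>k\<le>m. inverse (fact (Suc k)) * partial j (wsum ?c (Suc k)) (x - y))"
  proof -
    have "wsum ?c 0 = (\<lambda>u. ?c [])" by (rule ext) simp
    then show ?thesis unfolding sum.atMost_Suc_shift by simp
  qed
  also have "\<dots> = (\<Sum>k\<le>m. wsum (\<lambda>w. partials w (partial j f) y) k (x - y) / fact k)"
    by (rule sum.cong) (auto simp: partial_wsum s divide_inverse simp del: of_nat_Suc)
  finally show ?thesis by (simp add: taylor_poly_wsum)
qed

subsection \<open>Agreement of a function with a family of approximations\<close>

context
  fixes S K :: "(real^'p::finite) set"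
  assumes S: "open S" and K: "compact K" "convex K" "K \<subseteq> S"
begin

text \<open>The clause on the diagonal matters at m = 0, where the estimate asserts boundedness
  only: for commutators of full weight r it is the sole link between f and g at the centre.\<close>

definition agree0 :: "nat \<Rightarrow> (real^'p \<Rightarrow> real) \<Rightarrow> (real^'p \<Rightarrow> real^'p \<Rightarrow> real) \<Rightarrow> bool" where
  "agree0 m f g \<longleftrightarrow> Ck_on m S f \<and> (\<forall>y\<in>K. Ck_on m S (g y)) \<and> (\<forall>y\<in>K. f y = g y y) \<and>
    (\<exists>C. \<forall>y\<in>K. \<forall>x\<in>K. \<bar>f x - g y x\<bar> \<le> C * dist x y ^ m)"

text \<open>Derivatives are included, each with one order less, so that products preserve the order
  and a Lie bracket costs exactly one. At every level the constant is uniform in the centre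
  y.\<close>

primrec agree :: "nat \<Rightarrow> (real^'p \<Rightarrow> real) \<Rightarrow> (real^'p \<Rightarrow> real^'p \<Rightarrow> real) \<Rightarrow> bool" where
  "agree 0 f g = agree0 0 f g"
| "agree (Suc m) f g = (agree0 (Suc m) f g \<and> (\<forall>j. agree m (partial j f) (\<lambda>y. partial j (g y))))"

lemma agree_imp_agree0: "agree m f g \<Longrightarrow> agree0 m f g"
  by (cases m) auto

lemma agree0_cong:
  assumes "\<And>x. x \<in> S \<Longrightarrow> f x = f' x" "\<And>y x. y \<in> K \<Longrightarrow> x \<in> S \<Longrightarrow> g y x = g' y x" "agree0 m f g"
  shows "agree0 m f' g'"
  unfolding agree0_def
proof (intro conjI ballI)
  show "Ck_on m S f'" by (rule Ck_on_eq[OF S, of m f]) (use assms(3) in \<open>simp_all add: agree0_def assms(1)\<close>)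
  show "Ck_on m S (g' y)" if "y \<in> K" for y
    by (rule Ck_on_eq[OF S, of m "g y"]) (use assms(3) that in \<open>simp_all add: agree0_def assms(2)\<close>)
  show "f' y = g' y y" if "y \<in> K" for y
    using assms(3) assms(1)[of y] assms(2)[of y y] that K(3) by (auto simp: agree0_def)
  obtain C where "\<forall>y\<in>K. \<forall>x\<in>K. \<bar>f x - g y x\<bar> \<le> C * dist x y ^ m" using assms(3) agree0_def by blast
  then have "\<forall>y\<in>K. \<forall>x\<in>K. \<bar>f' x - g' y x\<bar> \<le> C * dist x y ^ m"
    using assms(1)[OF subsetD[OF K(3)]] assms(2)[OF _ subsetD[OF K(3)]] by simp
  then show "\<exists>C. \<forall>y\<in>K. \<forall>x\<in>K. \<bar>f' x - g' y x\<bar> \<le> C * dist x y ^ m" by blast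
qed

lemma agree_cong:
  assumes "\<And>x. x \<in> S \<Longrightarrow> f x = f' x" "\<And>y x. y \<in> K \<Longrightarrow> x \<in> S \<Longrightarrow> g y x = g' y x" "agree m f g"
  shows "agree m f' g'"
  using assms
proof (induction m arbitrary: f f' g g')
  case 0
  then show ?case using agree0_cong[of f f' g g' 0] by simp
next
  case (Suc m)
  have "agree m (partial j f') (\<lambda>y. partial j (g' y))" for j
    by (rule Suc.IH[of "partial j f" _ "\<lambda>y. partial j (g y)"])
      (use Suc.prems in \<open>auto intro!: partial_cong[OF S]\<close>)
  then show ?case using agree0_cong[of f f' g g' "Suc m"] Suc.prems by simp
qed

lemma compact_bound:
  assumes "continuous_on S f"
  obtains M :: real where "M \<ge> 0" "\<And>x. x \<in> K \<Longrightarrow> \<bar>f x\<bar> \<le> M"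
proof -
  have "compact (f ` K)" by (rule compact_continuous_image[OF continuous_on_subset[OF assms K(3)] K(1)])
  then obtain M where "\<forall>z\<in>f ` K. norm z \<le> M" using compact_imp_bounded bounded_iff by metis
  then show ?thesis using that[of "max M 0"] by fastforce
qed

lemma dist_bound: obtains D where "D \<ge> 1" "\<And>x y. x \<in> K \<Longrightarrow> y \<in> K \<Longrightarrow> dist x y \<le> D"
proof -
  obtain e where "\<forall>x\<in>K. \<forall>y\<in>K. dist x y \<le> e"
    using compact_imp_bounded[OF K(1)] bounded_two_points by metis
  then show ?thesis using that[of "max e 1"] by fastforce
qed

lemma agree0_E:
  assumes "agree0 m f g"
  obtains C where "C \<ge> 0" "\<And>x y. x \<in> K \<Longrightarrow> y \<in> K \<Longrightarrow> \<bar>f x - g y x\<bar> \<le> C * dist x y ^ m"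
proof -
  obtain C where C: "\<forall>y\<in>K. \<forall>x\<in>K. \<bar>f x - g y x\<bar> \<le> C * dist x y ^ m" using assms agree0_def by blast
  have "\<bar>f x - g y x\<bar> \<le> max C 0 * dist x y ^ m" if "x \<in> K" "y \<in> K" for x y
    by (rule order_trans[OF C[rule_format, OF that(2,1)]]) (simp add: mult_right_mono)
  then show ?thesis using that[of "max C 0"] by simp
qed

lemma agree0_I:
  assumes "Ck_on m S f" "\<And>y. y \<in> K \<Longrightarrow> Ck_on m S (g y)" "\<And>y. y \<in> K \<Longrightarrow> f y = g y y"
    and "\<And>x y. x \<in> K \<Longrightarrow> y \<in> K \<Longrightarrow> \<bar>f x - g y x\<bar> \<le> C * dist x y ^ m"
  shows "agree0 m f g"
  unfolding agree0_def using assms by blast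

lemma agree0_Suc: assumes "agree0 (Suc m) f g" shows "agree0 m f g"
proof -
  obtain D where D: "D \<ge> 1" "\<And>x y. x \<in> K \<Longrightarrow> y \<in> K \<Longrightarrow> dist x y \<le> D" using dist_bound by blast
  obtain C where C: "C \<ge> 0" "\<And>x y. x \<in> K \<Longrightarrow> y \<in> K \<Longrightarrow> \<bar>f x - g y x\<bar> \<le> C * dist x y ^ Suc m"
    using agree0_E[OF assms] by blast
  show ?thesis
  proof (rule agree0_I)
    show "Ck_on m S f" "\<And>y. y \<in> K \<Longrightarrow> Ck_on m S (g y)" "\<And>y. y \<in> K \<Longrightarrow> f y = g y y"
      using assms Ck_on_mono[of "Suc m" S] unfolding agree0_def by auto
    fix x y assume xy: "x \<in> K" "y \<in> K"
    have "\<bar>f x - g y x\<bar> \<le> C * (D * dist x y ^ m)"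
      by (rule order_trans[OF C(2)[OF xy]]) (use D(2)[OF xy] C(1) in \<open>auto intro!: mult_left_mono mult_right_mono\<close>)
    then show "\<bar>f x - g y x\<bar> \<le> (C * D) * dist x y ^ m" by (simp add: mult.assoc)
  qed
qed

lemma agree_Suc: "agree (Suc m) f g \<Longrightarrow> agree m f g"
proof (induction m arbitrary: f g)
  case 0
  then show ?case using agree0_Suc[of 0 f g] by simp
next
  case (Suc m)
  have "agree m (partial j f) (\<lambda>y. partial j (g y))" for j by (rule Suc.IH) (use Suc.prems in simp)
  moreover have "agree0 (Suc m) f g" by (rule agree0_Suc) (use Suc.prems in simp)
  ultimately show ?case by simp
qed

lemma agree_mono: "agree m f g \<Longrightarrow> m' \<le> m \<Longrightarrow> agree m' f g"
proof (induction m)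
  case (Suc m)
  show ?case
  proof (cases "m' = Suc m")
    case True
    then show ?thesis using Suc.prems(1) by simp
  next
    case False
    show ?thesis by (rule Suc.IH[OF agree_Suc[OF Suc.prems(1)]]) (use False Suc.prems(2) in simp)
  qed
qed simp

lemma agree_differentiable:
  assumes "agree (Suc m) f g" "x \<in> S"
  shows "f differentiable (at x)" "y \<in> K \<Longrightarrow> g y differentiable (at x)"
  using assms by (auto simp: agree0_def intro: Ck_on_differentiable[OF _ zero_less_Suc S])

lemma agree0_add:
  assumes "agree0 m f g" "agree0 m f' g'"
  shows "agree0 m (\<lambda>x. f x + f' x) (\<lambda>y x. g y x + g' y x)"
proof -
  obtain C where C: "C \<ge> 0" "\<And>x y. x \<in> K \<Longrightarrow> y \<in> K \<Longrightarrow> \<bar>f x - g y x\<bar> \<le> C * dist x y ^ m"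
    using agree0_E[OF assms(1)] by blast
  obtain C' where C': "C' \<ge> 0" "\<And>x y. x \<in> K \<Longrightarrow> y \<in> K \<Longrightarrow> \<bar>f' x - g' y x\<bar> \<le> C' * dist x y ^ m"
    using agree0_E[OF assms(2)] by blast
  show ?thesis
  proof (rule agree0_I)
    show "Ck_on m S (\<lambda>x. f x + f' x)" by (rule Ck_on_add[OF S]) (use assms in \<open>simp_all add: agree0_def\<close>)
    show "Ck_on m S (\<lambda>x. g y x + g' y x)" if "y \<in> K" for y
      by (rule Ck_on_add[OF S]) (use assms that in \<open>simp_all add: agree0_def\<close>)
    show "f y + f' y = g y y + g' y y" if "y \<in> K" for y using assms that by (simp add: agree0_def)
    fix x y assume xy: "x \<in> K" "y \<in> K"
    show "\<bar>f x + f' x - (g y x + g' y x)\<bar> \<le> (C + C') * dist x y ^ m"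
      unfolding distrib_right using C(2)[OF xy] C'(2)[OF xy] by linarith
  qed
qed

lemma agree0_mult:
  assumes "agree0 m f g" "agree0 m f' g'"
  shows "agree0 m (\<lambda>x. f x * f' x) (\<lambda>y x. g y x * g' y x)"
proof -
  obtain C where C: "C \<ge> 0" "\<And>x y. x \<in> K \<Longrightarrow> y \<in> K \<Longrightarrow> \<bar>f x - g y x\<bar> \<le> C * dist x y ^ m"
    using agree0_E[OF assms(1)] by blast
  obtain C' where C': "C' \<ge> 0" "\<And>x y. x \<in> K \<Longrightarrow> y \<in> K \<Longrightarrow> \<bar>f' x - g' y x\<bar> \<le> C' * dist x y ^ m"
    using agree0_E[OF assms(2)] by blast
  obtain D where D: "D \<ge> 1" "\<And>x y. x \<in> K \<Longrightarrow> y \<in> K \<Longrightarrow> dist x y \<le> D" using dist_bound by blast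
  have co: "continuous_on S f" "continuous_on S f'" using assms by (auto simp: agree0_def Ck_on_imp_continuous)
  obtain M where M: "M \<ge> 0" "\<And>x. x \<in> K \<Longrightarrow> \<bar>f x\<bar> \<le> M" using compact_bound[OF co(1)] by blast
  obtain M' where M': "M' \<ge> 0" "\<And>x. x \<in> K \<Longrightarrow> \<bar>f' x\<bar> \<le> M'" using compact_bound[OF co(2)] by blast
  show ?thesis
  proof (rule agree0_I)
    show "Ck_on m S (\<lambda>x. f x * f' x)" by (rule Ck_on_mult[OF S]) (use assms in \<open>simp_all add: agree0_def\<close>)
    show "Ck_on m S (\<lambda>x. g y x * g' y x)" if "y \<in> K" for y
      by (rule Ck_on_mult[OF S]) (use assms that in \<open>simp_all add: agree0_def\<close>)
    show "f y * f' y = g y y * g' y y" if "y \<in> K" for y using assms that by (simp add: agree0_def)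
    fix x y assume xy: "x \<in> K" "y \<in> K"
    let ?d = "dist x y ^ m"
    have dm: "?d \<le> D ^ m" using D(2)[OF xy] by (simp add: power_mono)
    have "C' * ?d \<le> C' * D ^ m" by (rule mult_left_mono[OF dm C'(1)])
    then have g': "\<bar>g' y x\<bar> \<le> M' + C' * D ^ m" using C'(2)[OF xy] M'(2)[OF xy(1)] by linarith
    have "f x * f' x - g y x * g' y x = f x * (f' x - g' y x) + (f x - g y x) * g' y x" by (simp add: algebra_simps)
    then have "\<bar>f x * f' x - g y x * g' y x\<bar> \<le> \<bar>f x\<bar> * \<bar>f' x - g' y x\<bar> + \<bar>f x - g y x\<bar> * \<bar>g' y x\<bar>"
      unfolding abs_mult[symmetric] by linarith
    also have "\<dots> \<le> M * (C' * ?d) + (C * ?d) * (M' + C' * D ^ m)"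
      using g' C(1) M(1) by (intro add_mono mult_mono C(2)[OF xy] C'(2)[OF xy] M(2)[OF xy(1)]) auto
    finally show "\<bar>f x * f' x - g y x * g' y x\<bar> \<le> (M * C' + C * (M' + C' * D ^ m)) * ?d"
      by (simp add: algebra_simps)
  qed
qed

lemma agree_add:
  assumes "agree m f g" "agree m f' g'"
  shows "agree m (\<lambda>x. f x + f' x) (\<lambda>y x. g y x + g' y x)"
  using assms
proof (induction m arbitrary: f g f' g')
  case 0
  then show ?case using agree0_add[of 0 f g f' g'] by simp
next
  case (Suc m)
  have "agree m (partial j (\<lambda>x. f x + f' x)) (\<lambda>y. partial j (\<lambda>x. g y x + g' y x))" for j
  proof (rule agree_cong)
    show "agree m (\<lambda>x. partial j f x + partial j f' x) (\<lambda>y x. partial j (g y) x + partial j (g' y) x)"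
      by (rule Suc.IH) (use Suc.prems in auto)
    fix x assume x: "x \<in> S"
    show "partial j f x + partial j f' x = partial j (\<lambda>x. f x + f' x) x"
      by (rule partial_add[symmetric]) (rule agree_differentiable[OF Suc.prems(1) x] agree_differentiable[OF Suc.prems(2) x])+
    fix y assume y: "y \<in> K"
    show "partial j (g y) x + partial j (g' y) x = partial j (\<lambda>x. g y x + g' y x) x"
      by (rule partial_add[symmetric]) (rule agree_differentiable(2)[OF Suc.prems(1) x y] agree_differentiable(2)[OF Suc.prems(2) x y])+
  qed
  then show ?case using agree0_add[of "Suc m" f g f' g'] Suc.prems by simp
qed

lemma agree_mult:
  assumes "agree m f g" "agree m f' g'"
  shows "agree m (\<lambda>x. f x * f' x) (\<lambda>y x. g y x * g' y x)"
  using assms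
proof (induction m arbitrary: f g f' g')
  case 0
  then show ?case using agree0_mult[of 0 f g f' g'] by simp
next
  case (Suc m)
  have "agree m (partial j (\<lambda>x. f x * f' x)) (\<lambda>y. partial j (\<lambda>x. g y x * g' y x))" for j
  proof (rule agree_cong)
    show "agree m (\<lambda>x. f x * partial j f' x + partial j f x * f' x)
        (\<lambda>y x. g y x * partial j (g' y) x + partial j (g y) x * g' y x)"
      by (rule agree_add; rule Suc.IH) (use Suc.prems agree_Suc in auto)
    fix x assume x: "x \<in> S"
    show "f x * partial j f' x + partial j f x * f' x = partial j (\<lambda>x. f x * f' x) x"
      by (rule partial_mult[symmetric]) (rule agree_differentiable[OF Suc.prems(1) x] agree_differentiable[OF Suc.prems(2) x])+
    fix y assume y: "y \<in> K"
    show "g y x * partial j (g' y) x + partial j (g y) x * g' y x = partial j (\<lambda>x. g y x * g' y x) x"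
      by (rule partial_mult[symmetric]) (rule agree_differentiable(2)[OF Suc.prems(1) x y] agree_differentiable(2)[OF Suc.prems(2) x y])+
  qed
  then show ?case using agree0_mult[of "Suc m" f g f' g'] Suc.prems by simp
qed

lemma agree_const: "agree m (\<lambda>x. c) (\<lambda>y x. c)"
proof -
  have "agree0 m (\<lambda>x. c) (\<lambda>y x. c)" for m c by (rule agree0_I[where C = 0]) (auto simp: Ck_on_const)
  then show ?thesis by (induction m arbitrary: c) auto
qed

lemma agree_diff:
  assumes "agree m f g" "agree m f' g'"
  shows "agree m (\<lambda>x. f x - f' x) (\<lambda>y x. g y x - g' y x)"
  using agree_add[OF assms(1) agree_mult[OF agree_const[of m "-1"] assms(2)]] by simp

lemma agree_sum:
  assumes "finite A" "\<And>a. a \<in> A \<Longrightarrow> agree m (f a) (g a)"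
  shows "agree m (\<lambda>x. \<Sum>a\<in>A. f a x) (\<lambda>y x. \<Sum>a\<in>A. g a y x)"
  using assms
proof (induction A)
  case empty
  show ?case unfolding sum.empty by (rule agree_const)
next
  case (insert a A)
  have "agree m (\<lambda>x. f a x + (\<Sum>a\<in>A. f a x)) (\<lambda>y x. g a y x + (\<Sum>a\<in>A. g a y x))"
    by (rule agree_add[OF insert.prems[OF insertI1] insert.IH[OF insert.prems[OF insertI2]]])
  then show ?case unfolding sum.insert[OF insert.hyps] .
qed

text \<open>The gradient of a Taylor remainder is the Taylor remainder of the gradient, so the
  induction hypothesis bounds it by the power m of the distance; the mean value inequality adds one
  factor \<open>dist x y\<close>. Order 0 is boundedness on the compact set K.\<close>

lemma agree_taylor_poly:
  assumes "Ck_on m S f"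
  shows "agree m f (taylor_poly m f)"
  using assms
proof (induction m arbitrary: f)
  case 0
  obtain M where M: "\<And>x. x \<in> K \<Longrightarrow> \<bar>f x\<bar> \<le> M"
    using compact_bound[OF Ck_on_imp_continuous[OF 0]] by blast
  have "agree0 0 f (taylor_poly 0 f)"
  proof (rule agree0_I[OF 0])
    show "Ck_on 0 S (taylor_poly 0 f y)" for y by (rule Ck_on_subset[OF Ck_on_taylor_poly]) simp
    show "f y = taylor_poly 0 f y y" for y by (simp add: taylor_poly_center)
    fix x y assume "x \<in> K" "y \<in> K"
    then show "\<bar>f x - taylor_poly 0 f y x\<bar> \<le> (2 * M) * dist x y ^ 0"
      using M[of x] M[of y] by (simp add: taylor_poly_wsum)
  qed
  then show ?case by simp
next
  case (Suc m)
  have KS: "y \<in> S" if "y \<in> K" for y using that K(3) by blast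
  have eq: "partial j (taylor_poly (Suc m) f y) x = taylor_poly m (partial j f) y x" if "y \<in> K" for j y x
    by (rule partial_taylor_poly[OF S Suc.prems KS[OF that]])
  have ag: "agree m (partial j f) (taylor_poly m (partial j f))" for j
    by (rule Suc.IH[OF Ck_on_partial[OF Suc.prems]])
  have ag': "agree m (partial j f) (\<lambda>y. partial j (taylor_poly (Suc m) f y))" for j
    by (rule agree_cong[OF _ _ ag[of j]]) (auto simp: eq)
  have "\<exists>C. C \<ge> 0 \<and> (\<forall>x\<in>K. \<forall>y\<in>K. \<bar>partial j f x - taylor_poly m (partial j f) y x\<bar> \<le> C * dist x y ^ m)" for j
    using agree0_E[OF agree_imp_agree0[OF ag[of j]]] by metis
  then obtain C where C: "\<And>j. C j \<ge> 0"
    "\<And>j x y. x \<in> K \<Longrightarrow> y \<in> K \<Longrightarrow> \<bar>partial j f x - taylor_poly m (partial j f) y x\<bar> \<le> C j * dist x y ^ m"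
    by metis
  have dT: "taylor_poly (Suc m) f y differentiable (at z)" for y z
    by (rule Ck_on_differentiable[OF Ck_on_taylor_poly[of 1]]) auto
  have df: "f differentiable (at z)" if "z \<in> K" for z
    by (rule Ck_on_differentiable[OF Suc.prems _ S KS[OF that]]) simp
  have "agree0 (Suc m) f (taylor_poly (Suc m) f)"
  proof (rule agree0_I[OF Suc.prems])
    show "Ck_on (Suc m) S (taylor_poly (Suc m) f y)" for y by (rule Ck_on_subset[OF Ck_on_taylor_poly]) simp
    show "f y = taylor_poly (Suc m) f y y" for y by (simp add: taylor_poly_center)
    fix x y assume xy: "x \<in> K" "y \<in> K"
    let ?R = "\<lambda>z. f z - taylor_poly (Suc m) f y z"
    have sub: "closed_segment y x \<subseteq> K" by (rule closed_segment_subset[OF xy(2,1) K(2)])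
    \<comment> \<open>The convex set is the segment and not all of K: only there is
      \<open>dist z y\<close> at most \<open>dist x y\<close>.\<close>
    have "\<bar>?R x - ?R y\<bar> \<le> (\<Sum>j\<in>UNIV. C j * dist x y ^ m) * norm (x - y)"
    proof (rule abs_diff_le_partials[of "closed_segment y x"])
      fix j z assume z: "z \<in> closed_segment y x"
      then have zK: "z \<in> K" using sub by blast
      have "partial j ?R z = partial j f z - taylor_poly m (partial j f) y z"
        using partial_diff[OF df[OF zK] dT] eq[OF xy(2)] by simp
      moreover have "dist z y \<le> dist x y" using segment_bound(1)[OF z] by (simp add: dist_norm)
      then have "C j * dist z y ^ m \<le> C j * dist x y ^ m" by (intro mult_left_mono power_mono C) auto
      ultimately show "\<bar>partial j ?R z\<bar> \<le> C j * dist x y ^ m" using C(2)[OF zK xy(2), of j] by linarith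
    qed (use sub in \<open>auto intro!: differentiable_diff df dT\<close>)
    then show "\<bar>f x - taylor_poly (Suc m) f y x\<bar> \<le> (\<Sum>j\<in>UNIV. C j) * dist x y ^ Suc m"
      by (simp add: taylor_poly_center sum_distrib_right[symmetric] dist_norm mult_ac)
  qed
  then show ?case using ag' by simp
qed

end

subsection \<open>Commutators\<close>

lemma lie_bracket_nth:
  fixes V W :: "'p::finite vfield"
  assumes "\<And>i. (\<lambda>x. V x $ i) differentiable (at x)" "\<And>i. (\<lambda>x. W x $ i) differentiable (at x)"
  shows "lie_bracket V W x $ i =
    (\<Sum>j\<in>UNIV. V x $ j * partial j (\<lambda>x. W x $ i) x) - (\<Sum>j\<in>UNIV. W x $ j * partial j (\<lambda>x. V x $ i) x)"
proof -
  have "frechet_derivative V (at x) = (\<lambda>h. \<chi> i. \<Sum>j\<in>UNIV. h$j * partial j (\<lambda>x. V x $ i) x)"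
    "frechet_derivative W (at x) = (\<lambda>h. \<chi> i. \<Sum>j\<in>UNIV. h$j * partial j (\<lambda>x. W x $ i) x)"
    by (rule frechet_derivative_at[symmetric, OF has_derivative_vec_partials], fact)+
  then show ?thesis by (simp add: lie_bracket_def)
qed

lemma wt_pos: "wt i \<ge> 1"
  by (simp add: wt_def)

lemma weight_simps [simp]: "weight [] = 0" "weight (i # I) = wt i + weight I"
  by (simp_all add: weight_def)

lemma weight_append [simp]: "weight (I @ J) = weight I + weight J"
  by (induction I) auto

lemma weight_pos: "I \<noteq> [] \<Longrightarrow> weight I \<ge> 1"
  using wt_pos by (cases I) (auto intro: trans_le_add1)

text \<open>Every letter has weight at least 1. Lowering r by the weight of the whole bracket
  therefore pays for the one derivative it takes: both factors agree to one order more than is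
  claimed for the bracket.\<close>

lemma agree_commutator:
  fixes X :: "nat \<Rightarrow> 'p::finite vfield" and Y :: "real^'p \<Rightarrow> nat \<Rightarrow> 'p vfield"
  assumes S: "open S" and K: "compact K" "convex K" "K \<subseteq> S"
    and ag: "\<And>i c. i \<le> n \<Longrightarrow> wt i \<le> r \<Longrightarrow> agree S K (r - wt i) (\<lambda>x. X i x $ c) (\<lambda>y x. Y y i x $ c)"
    and "I \<in> multiindices n r"
  shows "agree S K (r - weight I) (\<lambda>x. commutator X I x $ c) (\<lambda>y x. commutator (Y y) I x $ c)"
  using assms(6)
proof (induction I arbitrary: c rule: induct_list012)
  case (3 i j I)
  let ?J = "j # I" and ?m = "r - weight (i # j # I)"
  let ?V = "X i" and ?W = "commutator X ?J" and ?V' = "\<lambda>y. Y y i" and ?W' = "\<lambda>y. commutator (Y y) ?J"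
  have wle: "wt i + weight ?J \<le> r" and i: "i \<le> n" and J: "?J \<in> multiindices n r"
    using "3.prems" by (auto simp: multiindices_def)
  have w1: "wt i \<ge> 1" "weight ?J \<ge> 1" by (rule wt_pos) (rule weight_pos, simp)
  have V: "agree S K (Suc ?m) (\<lambda>x. ?V x $ c) (\<lambda>y x. ?V' y x $ c)" for c
    using w1 wle by (intro agree_mono[OF S K ag[OF i]]) auto
  have W: "agree S K (Suc ?m) (\<lambda>x. ?W x $ c) (\<lambda>y x. ?W' y x $ c)" for c
    using w1 wle by (intro agree_mono[OF S K "3.IH"(2)[OF J]]) auto
  have pV: "agree S K ?m (partial l (\<lambda>x. ?V x $ c)) (\<lambda>y. partial l (\<lambda>x. ?V' y x $ c))"
    and pW: "agree S K ?m (partial l (\<lambda>x. ?W x $ c)) (\<lambda>y. partial l (\<lambda>x. ?W' y x $ c))" for l c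
    using V[of c] W[of c] by (simp_all add: agree.simps[OF S K])
  have sV: "agree S K ?m (\<lambda>x. \<Sum>l\<in>UNIV. ?V x $ l * partial l (\<lambda>x. ?W x $ c) x)
      (\<lambda>y x. \<Sum>l\<in>UNIV. ?V' y x $ l * partial l (\<lambda>x. ?W' y x $ c) x)"
    by (rule agree_sum[OF S K finite], rule agree_mult[OF S K agree_Suc[OF S K V] pW])
  have sW: "agree S K ?m (\<lambda>x. \<Sum>l\<in>UNIV. ?W x $ l * partial l (\<lambda>x. ?V x $ c) x)
      (\<lambda>y x. \<Sum>l\<in>UNIV. ?W' y x $ l * partial l (\<lambda>x. ?V' y x $ c) x)"
    by (rule agree_sum[OF S K finite], rule agree_mult[OF S K agree_Suc[OF S K W] pV])
  show ?case
    unfolding commutator.simps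
  proof (rule agree_cong[OF S K _ _ agree_diff[OF S K sV sW]])
    show "(\<Sum>l\<in>UNIV. ?V x $ l * partial l (\<lambda>x. ?W x $ c) x) - (\<Sum>l\<in>UNIV. ?W x $ l * partial l (\<lambda>x. ?V x $ c) x)
        = lie_bracket ?V ?W x $ c" if "x \<in> S" for x
      by (rule lie_bracket_nth[symmetric])
        (rule agree_differentiable(1)[OF S K V that] agree_differentiable(1)[OF S K W that])+
    show "(\<Sum>l\<in>UNIV. ?V' y x $ l * partial l (\<lambda>x. ?W' y x $ c) x) - (\<Sum>l\<in>UNIV. ?W' y x $ l * partial l (\<lambda>x. ?V' y x $ c) x)
        = lie_bracket (?V' y) (?W' y) x $ c" if "x \<in> S" "y \<in> K" for x y
      by (rule lie_bracket_nth[symmetric])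
        (rule agree_differentiable(2)[OF S K V that] agree_differentiable(2)[OF S K W that])+
  qed
qed (use ag in \<open>auto simp: multiindices_def\<close>)

subsection \<open>Smooth vector fields as differential operators\<close>

definition smooth :: "(real^'p::finite \<Rightarrow> real) \<Rightarrow> bool" where
  "smooth f \<longleftrightarrow> (\<forall>k. Ck_on k UNIV f)"

definition smooth_vf :: "'p::finite vfield \<Rightarrow> bool" where
  "smooth_vf V \<longleftrightarrow> (\<forall>i. smooth (\<lambda>x. V x $ i))"

definition vop :: "'p::finite vfield \<Rightarrow> (real^'p \<Rightarrow> real) \<Rightarrow> real^'p \<Rightarrow> real" where
  "vop V f x = (\<Sum>j\<in>UNIV. V x $ j * partial j f x)"

lemma smooth_differentiable: "smooth f \<Longrightarrow> f differentiable (at x)"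
  using Ck_on_differentiable[of 1 UNIV f x] by (simp add: smooth_def)

lemma smooth_partial: "smooth f \<Longrightarrow> smooth (partial j f)"
  unfolding smooth_def using Ck_on_partial by blast

lemma smooth_const: "smooth (\<lambda>x. c)"
  by (simp add: smooth_def Ck_on_const)

lemma smooth_coord: "smooth (\<lambda>x. x $ i)"
  by (simp add: smooth_def Ck_on_coord)

lemma smooth_add: "smooth f \<Longrightarrow> smooth g \<Longrightarrow> smooth (\<lambda>x. f x + g x)"
  by (simp add: smooth_def Ck_on_add)

lemma smooth_diff: "smooth f \<Longrightarrow> smooth g \<Longrightarrow> smooth (\<lambda>x. f x - g x)"
  by (simp add: smooth_def Ck_on_diff)

lemma smooth_mult: "smooth f \<Longrightarrow> smooth g \<Longrightarrow> smooth (\<lambda>x. f x * g x)"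
  by (simp add: smooth_def Ck_on_mult)

lemma smooth_cmult: "smooth f \<Longrightarrow> smooth (\<lambda>x. c * f x)"
  by (simp add: smooth_def Ck_on_cmult)

lemma smooth_sum: "finite A \<Longrightarrow> (\<And>a. a \<in> A \<Longrightarrow> smooth (f a)) \<Longrightarrow> smooth (\<lambda>x. \<Sum>a\<in>A. f a x)"
  by (simp add: smooth_def Ck_on_sum)

lemma smooth_partial_commute: "smooth f \<Longrightarrow> partial i (partial j f) x = partial j (partial i f) x"
  by (rule partial_commute[OF open_UNIV]) (simp_all add: smooth_def)

lemma smooth_vop:
  assumes "smooth_vf V" "smooth f"
  shows "smooth (vop V f)"
  unfolding vop_def[abs_def]
  by (rule smooth_sum[OF finite], rule smooth_mult[OF _ smooth_partial[OF assms(2)]])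
    (use assms(1) in \<open>simp add: smooth_vf_def\<close>)

lemma vop_coord: "vop V (\<lambda>x. x $ i) x = V x $ i"
proof -
  have "vop V (\<lambda>x. x $ i) x = (\<Sum>j\<in>UNIV. if j = i then V x $ j else 0)"
    unfolding vop_def by (rule sum.cong) auto
  then show ?thesis by simp
qed

lemma vop_diff: "smooth f \<Longrightarrow> smooth g \<Longrightarrow> vop V (\<lambda>x. f x - g x) x = vop V f x - vop V g x"
  by (simp add: vop_def partial_diff smooth_differentiable right_diff_distrib sum_subtractf)

lemma vop_sum:
  assumes "finite A" "\<And>a. a \<in> A \<Longrightarrow> smooth (f a)"
  shows "vop V (\<lambda>x. \<Sum>a\<in>A. c a * f a x) x = (\<Sum>a\<in>A. c a * vop V (f a) x)"
proof -
  have "partial j (\<lambda>x. \<Sum>a\<in>A. c a * f a x) x = (\<Sum>a\<in>A. c a * partial j (f a) x)" for j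
  proof -
    have "partial j (\<lambda>x. \<Sum>a\<in>A. c a * f a x) x = (\<Sum>a\<in>A. partial j (\<lambda>x. c a * f a x) x)"
      by (rule partial_sum) (simp_all add: assms smooth_differentiable smooth_cmult)
    then show ?thesis using assms(2) by (simp add: partial_cmult smooth_differentiable)
  qed
  then have "vop V (\<lambda>x. \<Sum>a\<in>A. c a * f a x) x = (\<Sum>j\<in>UNIV. \<Sum>a\<in>A. c a * (V x $ j * partial j (f a) x))"
    by (simp add: vop_def sum_distrib_left mult.left_commute)
  also have "\<dots> = (\<Sum>a\<in>A. \<Sum>j\<in>UNIV. c a * (V x $ j * partial j (f a) x))" by (rule sum.swap)
  finally show ?thesis by (simp add: vop_def sum_distrib_left)
qed

lemma lie_bracket_vop:
  assumes "smooth_vf V" "smooth_vf W"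
  shows "lie_bracket V W x $ i = vop V (\<lambda>x. W x $ i) x - vop W (\<lambda>x. V x $ i) x"
  unfolding vop_def by (rule lie_bracket_nth) (use assms in \<open>auto simp: smooth_vf_def intro: smooth_differentiable\<close>)

lemma smooth_lie_bracket:
  assumes "smooth_vf V" "smooth_vf W"
  shows "smooth_vf (lie_bracket V W)"
  unfolding smooth_vf_def lie_bracket_vop[OF assms]
  using assms by (auto simp: smooth_vf_def intro!: smooth_diff smooth_vop)

text \<open>Isolates the second order part of the composed operator. By Schwarz's theorem this part
  does not change when the two fields are exchanged, so it drops out of the commutator and a first
  order operator is left.\<close>

lemma vop_vop:
  assumes "smooth_vf W" "smooth f"
  shows "vop V (vop W f) x = vop (\<lambda>x. \<chi> i. vop V (\<lambda>x. W x $ i) x) f x +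
    (\<Sum>i\<in>UNIV. \<Sum>j\<in>UNIV. V x $ j * (W x $ i * partial j (partial i f) x))"
proof -
  have W: "smooth (\<lambda>x. W x $ i)" for i using assms(1) by (simp add: smooth_vf_def)
  have p: "partial j (vop W f) x = (\<Sum>i\<in>UNIV. W x $ i * partial j (partial i f) x + partial j (\<lambda>x. W x $ i) x * partial i f x)" for j
  proof -
    have "partial j (vop W f) x = (\<Sum>i\<in>UNIV. partial j (\<lambda>x. W x $ i * partial i f x) x)"
      unfolding vop_def[abs_def] by (rule partial_sum) (simp_all add: W assms smooth_differentiable smooth_mult smooth_partial)
    then show ?thesis by (simp add: partial_mult W assms smooth_differentiable smooth_partial)
  qed
  have "vop V (vop W f) x = (\<Sum>j\<in>UNIV. \<Sum>i\<in>UNIV. V x $ j * (W x $ i * partial j (partial i f) x))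
     + (\<Sum>j\<in>UNIV. \<Sum>i\<in>UNIV. V x $ j * partial j (\<lambda>x. W x $ i) x * partial i f x)"
    unfolding vop_def[of V] p by (simp add: sum_distrib_left distrib_left sum.distrib mult.assoc)
  also have "(\<Sum>j\<in>UNIV. \<Sum>i\<in>UNIV. V x $ j * partial j (\<lambda>x. W x $ i) x * partial i f x)
     = vop (\<lambda>x. \<chi> i. vop V (\<lambda>x. W x $ i) x) f x"
    by (subst sum.swap) (simp add: vop_def sum_distrib_right)
  also have "(\<Sum>j\<in>UNIV. \<Sum>i\<in>UNIV. V x $ j * (W x $ i * partial j (partial i f) x))
     = (\<Sum>i\<in>UNIV. \<Sum>j\<in>UNIV. V x $ j * (W x $ i * partial j (partial i f) x))" by (rule sum.swap)
  finally show ?thesis by simp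
qed

lemma vop_lie_bracket:
  assumes "smooth_vf V" "smooth_vf W" "smooth f"
  shows "vop (lie_bracket V W) f x = vop V (vop W f) x - vop W (vop V f) x"
proof -
  have "(\<Sum>i\<in>UNIV. \<Sum>j\<in>UNIV. V x $ j * (W x $ i * partial j (partial i f) x))
     = (\<Sum>j\<in>UNIV. \<Sum>i\<in>UNIV. W x $ i * (V x $ j * partial i (partial j f) x))"
    by (subst sum.swap) (simp add: mult.left_commute smooth_partial_commute[OF assms(3)])
  moreover have "vop (lie_bracket V W) f x =
      vop (\<lambda>x. \<chi> i. vop V (\<lambda>x. W x $ i) x) f x - vop (\<lambda>x. \<chi> i. vop W (\<lambda>x. V x $ i) x) f x"
    by (simp add: vop_def[of "lie_bracket V W"] vop_def[of "\<lambda>x. \<chi> i. _ i x"]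
        lie_bracket_vop[OF assms(1,2)] left_diff_distrib sum_subtractf)
  ultimately show ?thesis
    unfolding vop_vop[OF assms(2,3)] vop_vop[OF assms(1,3)] by linarith
qed

text \<open>Componentwise both sides expand into two operators \<open>vop\<close> applied to a
  component of the third field, and these terms match.\<close>

lemma lie_bracket_jacobi:
  assumes "smooth_vf U" "smooth_vf V" "smooth_vf W"
  shows "lie_bracket (lie_bracket U V) W x =
    lie_bracket U (lie_bracket V W) x - lie_bracket V (lie_bracket U W) x"
proof (rule vec_eq_iff[THEN iffD2, rule_format])
  fix i
  have s: "smooth (\<lambda>x. U x $ i)" "smooth (\<lambda>x. V x $ i)" "smooth (\<lambda>x. W x $ i)"
    using assms by (auto simp: smooth_vf_def)
  show "lie_bracket (lie_bracket U V) W x $ i =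
    (lie_bracket U (lie_bracket V W) x - lie_bracket V (lie_bracket U W) x) $ i"
    by (simp add: lie_bracket_vop smooth_lie_bracket assms vop_lie_bracket s vop_diff smooth_vop)
qed

lemma lie_bracket_sum:
  assumes "finite A" "smooth_vf V" "\<And>a. a \<in> A \<Longrightarrow> smooth_vf (W a)"
  shows "lie_bracket V (\<lambda>x. \<Sum>a\<in>A. c a *\<^sub>R W a x) x = (\<Sum>a\<in>A. c a *\<^sub>R lie_bracket V (W a) x)"
proof (rule vec_eq_iff[THEN iffD2, rule_format])
  fix i
  have s: "\<And>a i. a \<in> A \<Longrightarrow> smooth (\<lambda>x. W a x $ i)" using assms(3) by (simp add: smooth_vf_def)
  then have W: "smooth_vf (\<lambda>x. \<Sum>a\<in>A. c a *\<^sub>R W a x)"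
    unfolding smooth_vf_def by (simp add: assms(1) smooth_sum smooth_cmult)
  have "vop (\<lambda>x. \<Sum>a\<in>A. c a *\<^sub>R W a x) f x = (\<Sum>a\<in>A. c a * vop (W a) f x)" for f
  proof -
    have "vop (\<lambda>x. \<Sum>a\<in>A. c a *\<^sub>R W a x) f x = (\<Sum>j\<in>UNIV. \<Sum>a\<in>A. c a * (W a x $ j * partial j f x))"
      by (simp add: vop_def sum_distrib_right mult.assoc)
    also have "\<dots> = (\<Sum>a\<in>A. \<Sum>j\<in>UNIV. c a * (W a x $ j * partial j f x))" by (rule sum.swap)
    finally show ?thesis by (simp add: vop_def sum_distrib_left)
  qed
  moreover have "vop V (\<lambda>x. (\<Sum>a\<in>A. c a *\<^sub>R W a x) $ i) x = (\<Sum>a\<in>A. c a * vop V (\<lambda>x. W a x $ i) x)"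
    using vop_sum[OF assms(1) s] by simp
  ultimately have "lie_bracket V (\<lambda>x. \<Sum>a\<in>A. c a *\<^sub>R W a x) x $ i =
      (\<Sum>a\<in>A. c a * (vop V (\<lambda>x. W a x $ i) x - vop (W a) (\<lambda>x. V x $ i) x))"
    unfolding lie_bracket_vop[OF assms(2) W] by (simp add: right_diff_distrib sum_subtractf)
  also have "\<dots> = (\<Sum>a\<in>A. c a *\<^sub>R lie_bracket V (W a) x) $ i"
    by (simp add: lie_bracket_vop[OF assms(2,3)])
  finally show "lie_bracket V (\<lambda>x. \<Sum>a\<in>A. c a *\<^sub>R W a x) x $ i = (\<Sum>a\<in>A. c a *\<^sub>R lie_bracket V (W a) x) $ i" .
qed

lemma smooth_commutator:
  assumes "\<forall>i. smooth_vf (S i)"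
  shows "smooth_vf (commutator S I)"
proof (induction I rule: induct_list012)
  case 1
  show ?case by (simp add: smooth_vf_def smooth_const)
next
  case (3 i j I)
  then show ?case by (simp add: smooth_lie_bracket assms)
qed (simp add: assms)

subsection \<open>The universal property of the free Lie algebra\<close>

text \<open>The image of a word when the field S_i is substituted for the indeterminate \<xi>_i. The
  type of letters is left open: words over the numbers 0 to n serve the free Lie algebra, words over
  the basis labels serve the Lie series.\<close>

primrec wop :: "('i \<Rightarrow> 'p::finite vfield) \<Rightarrow> 'i list \<Rightarrow> (real^'p \<Rightarrow> real) \<Rightarrow> real^'p \<Rightarrow> real" where
  "wop S [] f = f"
| "wop S (k # K) f = vop (S k) (wop S K f)"

lemma wop_snoc: "wop S (K @ [k]) f = wop S K (vop (S k) f)"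
  by (induction K) auto

lemma smooth_wop: "\<forall>i. smooth_vf (S i) \<Longrightarrow> smooth f \<Longrightarrow> smooth (wop S K f)"
  by (induction K) (auto intro: smooth_vop)

lemma nc_mult_var_left: "nc_mult (nc_var i) g (a # K) = (if a = i then g K else 0)"
proof -
  have "nc_mult (nc_var i) g (a # K) = (\<Sum>k\<le>Suc (length K). if k = 1 then (if a = i then g K else 0) else 0)"
    unfolding nc_mult_def
  proof (rule sum.cong)
    fix k assume "k \<in> {..Suc (length K)}"
    show "nc_var i (take k (a # K)) * g (drop k (a # K)) = (if k = 1 then (if a = i then g K else 0) else 0)"
    proof (cases k)
      case (Suc l)
      then show ?thesis using \<open>k \<in> _\<close> by (cases K; cases l) (auto simp: nc_var_def)
    qed (simp add: nc_var_def)
  qed simp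
  then show ?thesis by (simp del: sum.atMost_Suc)
qed

lemma nc_mult_var_right: "nc_mult g (nc_var i) (K @ [a]) = (if a = i then g K else 0)"
proof -
  have "nc_mult g (nc_var i) (K @ [a]) = (\<Sum>k\<le>Suc (length K). if k = length K then (if a = i then g K else 0) else 0)"
    unfolding nc_mult_def
  proof (rule sum.cong)
    fix k assume k: "k \<in> {..Suc (length K)}"
    show "g (take k (K @ [a])) * nc_var i (drop k (K @ [a])) = (if k = length K then (if a = i then g K else 0) else 0)"
    proof (cases "k < length K")
      case True
      then have "length (drop k (K @ [a])) \<noteq> 1" by simp
      then have "drop k (K @ [a]) \<noteq> [i]" by (metis length_Cons list.size(3) One_nat_def)
      then show ?thesis using True by (simp add: nc_var_def)
    next
      case False
      then have "k = length K \<or> k = Suc (length K)" using k by auto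
      then show ?thesis by (auto simp: nc_var_def)
    qed
  qed simp
  then show ?thesis by (simp del: sum.atMost_Suc)
qed

lemma free_commutator_Nil [simp]: "free_commutator I [] = 0"
  by (induction I rule: induct_list012) (auto simp: nc_var_def nc_bracket_def nc_mult_def)

lemma free_commutator_Cons:
  assumes "I \<noteq> []" "M \<noteq> []"
  shows "free_commutator (i # I) M = (if hd M = i then free_commutator I (tl M) else 0)
     - (if last M = i then free_commutator I (butlast M) else 0)"
proof -
  obtain j J where I: "I = j # J" using assms(1) by (cases I) auto
  have "nc_mult (nc_var i) g M = (if hd M = i then g (tl M) else 0)" for g
    using nc_mult_var_left[of i g "hd M" "tl M"] assms(2) by simp
  moreover have "nc_mult g (nc_var i) M = (if last M = i then g (butlast M) else 0)" for g
    using nc_mult_var_right[of g i "butlast M" "last M"] assms(2) by simp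
  ultimately show ?thesis unfolding I by (simp add: nc_bracket_def)
qed

text \<open>Brackets of indeterminates are homogeneous in length and in weight. Homogeneity in
  weight later splits a formal relation into its weight components.\<close>

lemma free_commutator_nonzero:
  assumes "free_commutator I M \<noteq> 0"
  shows "length M = length I \<and> weight M = weight I"
  using assms
proof (induction I arbitrary: M rule: induct_list012)
  case (2 i)
  then show ?case by (auto simp: nc_var_def split: if_splits)
next
  case (3 i j I)
  have M: "M \<noteq> []" using "3.prems" by (metis free_commutator_Nil)
  consider "hd M = i" "free_commutator (j # I) (tl M) \<noteq> 0" | "last M = i" "free_commutator (j # I) (butlast M) \<noteq> 0"
    using "3.prems" unfolding free_commutator_Cons[OF list.distinct(2) M]
    by (cases "free_commutator (j # I) (tl M) = 0") (auto split: if_splits)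
  then show ?case
  proof cases
    case 1
    have "length (hd M # tl M) = length (i # j # I) \<and> weight (hd M # tl M) = weight (i # j # I)"
      using "3.IH"(2)[OF 1(2)] 1(1) by simp
    then show ?thesis using M by simp
  next
    case 2
    have "length (butlast M @ [last M]) = length (i # j # I) \<and> weight (butlast M @ [last M]) = weight (i # j # I)"
      using "3.IH"(2)[OF 2(2)] 2(1) by (simp del: append_butlast_last_id)
    then show ?thesis using M by simp
  qed
qed simp

definition words :: "nat \<Rightarrow> nat \<Rightarrow> nat list set" where
  "words n l = {K. set K \<subseteq> {..n} \<and> length K = l}"

lemma finite_nat_words: "finite (words n l)"
  unfolding words_def by (rule finite_lists_length_eq) simp

lemma sum_words_hd:
  fixes a :: "nat list \<Rightarrow> real"
  assumes "i \<le> n"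
  shows "(\<Sum>M\<in>words n (Suc l). (if hd M = i then a (tl M) else 0) * g M) = (\<Sum>K\<in>words n l. a K * g (i # K))"
proof -
  have "(\<Sum>M\<in>words n (Suc l). (if hd M = i then a (tl M) else 0) * g M)
      = (\<Sum>M\<in>(#) i ` words n l. (if hd M = i then a (tl M) else 0) * g M)"
  proof (rule sum.mono_neutral_right[OF finite_nat_words])
    show "(#) i ` words n l \<subseteq> words n (Suc l)" using assms by (auto simp: words_def)
    have "M \<in> (#) i ` words n l" if "M \<in> words n (Suc l)" "hd M = i" for M
      using that by (cases M) (auto simp: words_def)
    then show "\<forall>M\<in>words n (Suc l) - (#) i ` words n l. (if hd M = i then a (tl M) else 0) * g M = 0" by auto
  qed
  also have "\<dots> = (\<Sum>K\<in>words n l. a K * g (i # K))" by (subst sum.reindex) auto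
  finally show ?thesis .
qed

lemma sum_words_last:
  fixes a :: "nat list \<Rightarrow> real"
  assumes "i \<le> n"
  shows "(\<Sum>M\<in>words n (Suc l). (if last M = i then a (butlast M) else 0) * g M) = (\<Sum>K\<in>words n l. a K * g (K @ [i]))"
proof -
  let ?s = "\<lambda>K. K @ [i]"
  have "(\<Sum>M\<in>words n (Suc l). (if last M = i then a (butlast M) else 0) * g M)
      = (\<Sum>M\<in>?s ` words n l. (if last M = i then a (butlast M) else 0) * g M)"
  proof (rule sum.mono_neutral_right[OF finite_nat_words])
    show "?s ` words n l \<subseteq> words n (Suc l)" using assms by (auto simp: words_def)
    have "M \<in> ?s ` words n l" if "M \<in> words n (Suc l)" "last M = i" for M
      using that by (cases M rule: rev_cases) (auto simp: words_def)
    then show "\<forall>M\<in>words n (Suc l) - ?s ` words n l. (if last M = i then a (butlast M) else 0) * g M = 0" by auto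
  qed
  also have "\<dots> = (\<Sum>K\<in>words n l. a K * g (K @ [i]))" by (subst sum.reindex) (auto simp: inj_on_def)
  finally show ?thesis .
qed

text \<open>Substituting differential operators for indeterminates is an algebra homomorphism, so it
  maps the formal bracket to the bracket of fields. In the induction, prepending i and appending i
  to a word are the two halves of the bracket with S_i.\<close>

lemma vop_commutator:
  fixes S :: "nat \<Rightarrow> 'p::finite vfield"
  assumes S: "\<forall>i. smooth_vf (S i)" and "smooth f" "I \<noteq> []" "set I \<subseteq> {..n}"
  shows "vop (commutator S I) f x = (\<Sum>K\<in>words n (length I). free_commutator I K * wop S K f x)"
  using assms(2,3,4)
proof (induction I arbitrary: f x rule: induct_list012)
  case (2 i)
  have "(\<Sum>K\<in>words n (length [i]). free_commutator [i] K * wop S K f x)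
     = (\<Sum>K\<in>words n (length [i]). if K = [i] then vop (S i) f x else 0)"
    by (rule sum.cong) (auto simp: nc_var_def)
  also have "\<dots> = vop (S i) f x"
    using 2 by (subst sum.delta[OF finite_nat_words]) (auto simp: words_def)
  finally show ?case by simp
next
  case (3 i j I)
  let ?J = "j # I"
  let ?A = "free_commutator ?J" and ?w = "words n (length ?J)"
  have i: "i \<le> n" and J: "?J \<noteq> []" "set ?J \<subseteq> {..n}" using "3.prems" by auto
  have IH: "vop (commutator S ?J) g = (\<lambda>x. \<Sum>K\<in>?w. ?A K * wop S K g x)" if "smooth g" for g
    by (rule ext) (rule "3.IH"(2)[OF that J])
  have "vop (commutator S (i # ?J)) f x = vop (S i) (vop (commutator S ?J) f) x - vop (commutator S ?J) (vop (S i) f) x"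
    using vop_lie_bracket[OF spec[OF S] smooth_commutator[OF S] "3.prems"(1)] by simp
  also have "\<dots> = (\<Sum>K\<in>?w. ?A K * wop S (i # K) f x) - (\<Sum>K\<in>?w. ?A K * wop S (K @ [i]) f x)"
    unfolding IH[OF "3.prems"(1)] IH[OF smooth_vop[OF spec[OF S] "3.prems"(1)]] wop_snoc
    by (simp add: vop_sum[OF finite_nat_words smooth_wop[OF S "3.prems"(1)]])
  also have "\<dots> = (\<Sum>M\<in>words n (Suc (length ?J)). ((if hd M = i then ?A (tl M) else 0) - (if last M = i then ?A (butlast M) else 0)) * wop S M f x)"
    
    unfolding left_diff_distrib sum_subtractf
      sum_words_hd[OF i, where l = "length ?J" and a = ?A and g = "\<lambda>M. wop S M f x"]
      sum_words_last[OF i, where l = "length ?J" and a = ?A and g = "\<lambda>M. wop S M f x"] ..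
  also have "\<dots> = (\<Sum>M\<in>words n (length (i # ?J)). free_commutator (i # ?J) M * wop S M f x)"
  proof (rule sum.cong)
    fix M assume "M \<in> words n (length (i # ?J))"
    then have "M \<noteq> []" by (auto simp: words_def)
    from free_commutator_Cons[OF J(1) this, of i]
    show "((if hd M = i then ?A (tl M) else 0) - (if last M = i then ?A (butlast M) else 0)) * wop S M f x
      = free_commutator (i # ?J) M * wop S M f x" by metis
  qed simp
  finally show ?case .
qed simp

text \<open>The sum over all lengths up to r makes the index set independent of I, so that sums over
  I can be moved inside.\<close>

lemma commutator_nth:
  fixes S :: "nat \<Rightarrow> 'p::finite vfield"
  assumes S: "\<forall>i. smooth_vf (S i)" and "I \<in> multiindices n r"
  shows "commutator S I x $ c = (\<Sum>l\<le>r. \<Sum>K\<in>words n l. free_commutator I K * wop S K (\<lambda>x. x $ c) x)"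
proof -
  let ?g = "\<lambda>l. \<Sum>K\<in>words n l. free_commutator I K * wop S K (\<lambda>x. x $ c) x"
  have I: "I \<noteq> []" "set I \<subseteq> {..n}" "length I \<le> r"
    using assms(2) length_le_weight[of I] by (auto simp: multiindices_def)
  have "?g l = 0" if "l \<noteq> length I" for l
    using that free_commutator_nonzero[of I] by (intro sum.neutral) (auto simp: words_def)
  then have "(\<Sum>l\<le>r. ?g l) = (\<Sum>l\<le>r. if l = length I then ?g l else 0)" by (intro sum.cong) auto
  also have "\<dots> = ?g (length I)" using I(3) by simp
  finally show ?thesis
    using vop_commutator[OF S smooth_coord[of c] I(1,2), where x = x] by (simp add: vop_coord)
qed

text \<open>The expansion into words is linear in the coefficients of the formal commutators, so a
  formal relation carries over. It will be applied to the approximating fields, whose smoothness is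
  guaranteed, unlike that of the X_i.\<close>

lemma commutator_relation:
  fixes S :: "nat \<Rightarrow> 'p::finite vfield"
  assumes S: "\<forall>i. smooth_vf (S i)" and rel: "\<And>J. (\<Sum>I\<in>multiindices n r. a I * free_commutator I J) = 0"
  shows "(\<Sum>I\<in>multiindices n r. a I *\<^sub>R commutator S I x) = 0"
proof (rule vec_eq_iff[THEN iffD2, rule_format])
  fix c
  let ?M = "multiindices n r" and ?g = "\<lambda>K. wop S K (\<lambda>x. x $ c) x"
  have "(\<Sum>I\<in>?M. a I *\<^sub>R commutator S I x) $ c = (\<Sum>I\<in>?M. \<Sum>l\<le>r. \<Sum>K\<in>words n l. a I * free_commutator I K * ?g K)"
    by (simp add: commutator_nth[OF S] sum_distrib_left mult.assoc)
  also have "\<dots> = (\<Sum>l\<le>r. \<Sum>I\<in>?M. \<Sum>K\<in>words n l. a I * free_commutator I K * ?g K)" by (rule sum.swap)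
  also have "\<dots> = (\<Sum>l\<le>r. \<Sum>K\<in>words n l. \<Sum>I\<in>?M. a I * free_commutator I K * ?g K)"
    by (rule sum.cong[OF refl], rule sum.swap)
  also have "\<dots> = 0" by (simp add: sum_distrib_right[symmetric] rel)
  finally show "(\<Sum>I\<in>?M. a I *\<^sub>R commutator S I x) $ c = 0 $ c" by simp
qed

subsection \<open>Structure constants\<close>

lemma span_range_explicit:
  fixes e :: "'p::finite \<Rightarrow> 'b::real_vector"
  assumes "inj e" "v \<in> span (range e)"
  obtains a where "v = (\<Sum>k\<in>UNIV. a k *\<^sub>R e k)"
proof -
  obtain u where u: "v = (\<Sum>w\<in>range e. u w *\<^sub>R w)" using assms(2) by (auto simp: span_finite)
  have "v = (\<Sum>k\<in>UNIV. u (e k) *\<^sub>R e k)" unfolding u by (subst sum.reindex[OF assms(1)]) simp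
  then show ?thesis by (rule that)
qed

text \<open>The coefficients are read off at the single point x0. Freeness turns that pointwise
  relation into a formal one, which then holds for all smooth families at all points. Hence the
  coefficients are constants, the same for every centre y.\<close>

lemma commutator_basis_expansion:
  fixes X :: "nat \<Rightarrow> 'p::finite vfield"
  assumes free: "free_up_to_weight n r \<Omega> X" and basis: "basis_multiindices n r \<Omega> X B"
    and x0: "x0 \<in> \<Omega>" and I: "I \<in> multiindices n r"
  obtains a where "\<And>k. a k \<noteq> 0 \<Longrightarrow> weight (B k) = weight I"
    and "\<And>S x. (\<forall>i. smooth_vf (S i)) \<Longrightarrow> commutator S I x = (\<Sum>k\<in>UNIV. a k *\<^sub>R commutator S (B k) (x :: real^'p))"
proof -
  let ?M = "multiindices n r"
  have B: "inj B" "range B \<subseteq> ?M" "inj (\<lambda>j. commutator X (B j) x0)"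
    "span (range (\<lambda>j. commutator X (B j) x0)) = UNIV"
    using basis x0 by (auto simp: basis_multiindices_def)
  obtain a where a: "commutator X I x0 = (\<Sum>k\<in>UNIV. a k *\<^sub>R commutator X (B k) x0)"
    by (rule span_range_explicit[OF B(3), of "commutator X I x0"]) (use B(4) in simp_all)
  \<comment> \<open>Encodes \<open>I\<close> minus a combination of the \<open>B k\<close> as one
    coefficient family on all multiindices, the form in which freeness is stated.\<close>
  define coef where "coef a J = (if J = I then 1 else 0) - (\<Sum>k\<in>UNIV. if J = B k then a k else 0)" for a :: "'p \<Rightarrow> real" and J
  have expand: "(\<Sum>J\<in>?M. coef a J *\<^sub>R v J) = v I - (\<Sum>k\<in>UNIV. a k *\<^sub>R v (B k))"
    for v :: "nat list \<Rightarrow> 'v::real_vector" and a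
  proof -
    have "(\<Sum>J\<in>?M. coef a J *\<^sub>R v J) = (\<Sum>J\<in>?M. if J = I then v J else 0) - (\<Sum>J\<in>?M. \<Sum>k\<in>UNIV. if J = B k then a k *\<^sub>R v J else 0)"
      unfolding coef_def scaleR_diff_left sum_subtractf scaleR_sum_left
      by (intro arg_cong2[where f = "(-)"] sum.cong refl) auto
    also have "(\<Sum>J\<in>?M. if J = I then v J else 0) = v I" using I by (simp add: finite_multiindices)
    also have "(\<Sum>J\<in>?M. \<Sum>k\<in>UNIV. if J = B k then a k *\<^sub>R v J else 0) = (\<Sum>k\<in>UNIV. \<Sum>J\<in>?M. if J = B k then a k *\<^sub>R v J else 0)"
      by (rule sum.swap)
    also have "\<dots> = (\<Sum>k\<in>UNIV. a k *\<^sub>R v (B k))"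
      by (rule sum.cong[OF refl], subst sum.delta[OF finite_multiindices]) (use B(2) in auto)
    finally show ?thesis .
  qed
  have "(\<Sum>J\<in>?M. coef a J *\<^sub>R commutator X J x0) = 0" unfolding expand using a by simp
  then have "(\<Sum>J\<in>?M. coef a J * free_commutator J K) = 0" for K
    using free x0 unfolding free_up_to_weight_def by blast
  then have rel: "free_commutator I K = (\<Sum>k\<in>UNIV. a k * free_commutator (B k) K)" for K
    using expand[of a "\<lambda>J. free_commutator J K"] by simp
  \<comment> \<open>Discarding coefficients of other weights preserves the formal relation, because
    a word occurs only in commutators of its own weight.\<close>
  define b where "b k = (if weight (B k) = weight I then a k else 0)" for k
  have rel': "free_commutator I K = (\<Sum>k\<in>UNIV. b k * free_commutator (B k) K)" for K
  proof (cases "weight K = weight I")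
    case True
    have "a k * free_commutator (B k) K = b k * free_commutator (B k) K" for k
      using free_commutator_nonzero[of "B k" K] True by (cases "free_commutator (B k) K = 0") (auto simp: b_def)
    then show ?thesis unfolding rel[of K] by (intro sum.cong refl)
  next
    case False
    have z: "b k * free_commutator (B k) K = 0" for k
      using free_commutator_nonzero[of "B k" K] False by (cases "free_commutator (B k) K = 0") (auto simp: b_def)
    have "free_commutator I K = 0" using free_commutator_nonzero[of I K] False by auto
    then show ?thesis unfolding z by simp
  qed
  show ?thesis
  proof (rule that[of b])
    show "weight (B k) = weight I" if "b k \<noteq> 0" for k using that by (simp add: b_def split: if_splits)
    show "commutator S I x = (\<Sum>k\<in>UNIV. b k *\<^sub>R commutator S (B k) x)" if S: "\<forall>i. smooth_vf (S i)" for S x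
    proof -
      have "(\<Sum>J\<in>?M. coef b J * free_commutator J K) = 0" for K
        using expand[of b "\<lambda>J. free_commutator J K"] rel'[of K] by simp
      from commutator_relation[OF S this, of x] show ?thesis unfolding expand by simp
    qed
  qed
qed

text \<open>The coefficients are chosen before the fields and the point. Membership is thus a
  universal identity and can be substituted inside further brackets.\<close>

definition comm_span :: "nat \<Rightarrow> nat \<Rightarrow> ((nat \<Rightarrow> 'p::finite vfield) \<Rightarrow> 'p vfield) \<Rightarrow> bool" where
  "comm_span n w V \<longleftrightarrow> (\<exists>b. \<forall>S x. (\<forall>i. smooth_vf (S i)) \<longrightarrow>
     V S x = (\<Sum>M\<in>{M \<in> multiindices n w. weight M = w}. b M *\<^sub>R commutator S M x))"

lemma comm_span_commutator:
  assumes "I \<noteq> []" "set I \<subseteq> {..n}"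
  shows "comm_span n (weight I) (\<lambda>S :: nat \<Rightarrow> 'p::finite vfield. commutator S I)"
  unfolding comm_span_def
proof (intro exI allI impI)
  fix S :: "nat \<Rightarrow> 'p vfield" and x :: "real^'p"
  let ?A = "{M \<in> multiindices n (weight I). weight M = weight I}"
  have "(\<Sum>M\<in>?A. (if M = I then 1 else 0) *\<^sub>R commutator S M x) = (\<Sum>M\<in>?A. if M = I then commutator S M x else 0)"
    by (rule sum.cong) auto
  moreover have "I \<in> ?A" "finite ?A"
    using assms finite_subset[OF _ finite_multiindices[of n "weight I"], of ?A] by (auto simp: multiindices_def)
  ultimately show "commutator S I x = (\<Sum>M\<in>?A. (if M = I then 1 else 0) *\<^sub>R commutator S M x)"
    by (simp only: sum.delta if_True)
qed

lemma comm_span_sum: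
  assumes "finite A" "\<And>a. a \<in> A \<Longrightarrow> comm_span n w (V a)"
  shows "comm_span n w (\<lambda>S x. \<Sum>a\<in>A. c a *\<^sub>R V a S x)"
proof -
  have "\<forall>a. \<exists>b. a \<in> A \<longrightarrow> (\<forall>S x. (\<forall>i. smooth_vf (S i)) \<longrightarrow>
     V a S x = (\<Sum>M\<in>{M \<in> multiindices n w. weight M = w}. b M *\<^sub>R commutator S M x))"
    using assms(2) unfolding comm_span_def by blast
  from choice[OF this] obtain b where b: "\<And>a S x. a \<in> A \<Longrightarrow> (\<forall>i. smooth_vf (S i)) \<Longrightarrow>
     V a S x = (\<Sum>M\<in>{M \<in> multiindices n w. weight M = w}. b a M *\<^sub>R commutator S M x)"
    by blast
  have "(\<Sum>a\<in>A. c a *\<^sub>R V a S x) = (\<Sum>M\<in>{M \<in> multiindices n w. weight M = w}. (\<Sum>a\<in>A. c a * b a M) *\<^sub>R commutator S M x)"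
    if S: "\<forall>i. smooth_vf (S i)" for S x
  proof -
    have "(\<Sum>a\<in>A. c a *\<^sub>R V a S x) = (\<Sum>a\<in>A. \<Sum>M\<in>{M \<in> multiindices n w. weight M = w}. (c a * b a M) *\<^sub>R commutator S M x)"
      by (rule sum.cong) (simp_all add: b[OF _ S] scaleR_sum_right)
    also have "\<dots> = (\<Sum>M\<in>{M \<in> multiindices n w. weight M = w}. \<Sum>a\<in>A. (c a * b a M) *\<^sub>R commutator S M x)"
      by (rule sum.swap)
    finally show ?thesis by (simp add: scaleR_sum_left)
  qed
  then show ?thesis unfolding comm_span_def
    by (intro exI[of _ "\<lambda>M. \<Sum>a\<in>A. c a * b a M"] allI impI)
qed

lemma comm_span_diff:
  assumes "comm_span n w V" "comm_span n w W"
  shows "comm_span n w (\<lambda>S x. V S x - W S x)"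
proof -
  let ?A = "{M \<in> multiindices n w. weight M = w}"
  obtain b where b: "\<And>S x. (\<forall>i. smooth_vf (S i)) \<Longrightarrow> V S x = (\<Sum>M\<in>?A. b M *\<^sub>R commutator S M x)"
    using assms(1) unfolding comm_span_def by blast
  obtain b' where b': "\<And>S x. (\<forall>i. smooth_vf (S i)) \<Longrightarrow> W S x = (\<Sum>M\<in>?A. b' M *\<^sub>R commutator S M x)"
    using assms(2) unfolding comm_span_def by blast
  show ?thesis
    unfolding comm_span_def
  proof (intro exI allI impI)
    fix S :: "nat \<Rightarrow> 'a vfield" and x :: "real^'a"
    assume S: "\<forall>i. smooth_vf (S i)"
    show "V S x - W S x = (\<Sum>M\<in>?A. (b M - b' M) *\<^sub>R commutator S M x)"
      unfolding b[OF S] b'[OF S] by (simp add: scaleR_diff_left sum_subtractf)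
  qed
qed

lemma comm_span_cong:
  assumes "comm_span n w V" "\<And>S x. \<forall>i. smooth_vf (S i) \<Longrightarrow> W S x = V S x"
  shows "comm_span n w W"
proof -
  obtain b where "\<forall>S x. (\<forall>i. smooth_vf (S i)) \<longrightarrow>
     V S x = (\<Sum>M\<in>{M \<in> multiindices n w. weight M = w}. b M *\<^sub>R commutator S M x)"
    using assms(1) unfolding comm_span_def by blast
  then show ?thesis unfolding comm_span_def using assms(2) by (intro exI[of _ b]) simp
qed

text \<open>Induction on the left word by the Jacobi identity [[i,I],J] = [i,[I,J]] - [I,[i,J]]. The
  left word shrinks while the right one may grow, so J has to be arbitrary.\<close>

lemma comm_span_lie_bracket:
  assumes "I \<noteq> []" "set I \<subseteq> {..n}" "J \<noteq> []" "set J \<subseteq> {..n}"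
  shows "comm_span n (weight I + weight J) (\<lambda>S :: nat \<Rightarrow> 'p::finite vfield. lie_bracket (commutator S I) (commutator S J))"
  using assms
proof (induction I arbitrary: J rule: induct_list012)
  case (2 i)
  then have "comm_span n (weight (i # J)) (\<lambda>S :: nat \<Rightarrow> 'p vfield. commutator S (i # J))" by (intro comm_span_commutator) auto
  then show ?case using 2 by (cases J) auto
next
  case (3 i j I)
  let ?I = "j # I" and ?w = "weight (i # j # I) + weight J"
  have i: "i \<le> n" and I: "?I \<noteq> []" "set ?I \<subseteq> {..n}" using 3 by auto
  have iC: "lie_bracket (S i) (commutator S M) = commutator S (i # M)" if "M \<noteq> []" for S :: "nat \<Rightarrow> 'p vfield" and M
    using that by (cases M) auto
  have "comm_span n (weight ?I + weight J) (\<lambda>S :: nat \<Rightarrow> 'p vfield. lie_bracket (commutator S ?I) (commutator S J))"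
    using "3.IH"(2)[OF I "3.prems"(3,4)] .
  then obtain b where b: "\<And>S x. (\<forall>i. smooth_vf (S i)) \<Longrightarrow> lie_bracket (commutator S ?I) (commutator S J) (x :: real^'p) =
    (\<Sum>M\<in>{M \<in> multiindices n (weight ?I + weight J). weight M = weight ?I + weight J}. b M *\<^sub>R commutator S M x)"
    unfolding comm_span_def by blast
  let ?A = "{M \<in> multiindices n (weight ?I + weight J). weight M = weight ?I + weight J}"
  have fin: "finite ?A" using finite_multiindices by (rule rev_finite_subset) auto
  have 1: "comm_span n ?w (\<lambda>(S :: nat \<Rightarrow> 'p vfield) x. \<Sum>M\<in>?A. b M *\<^sub>R commutator S (i # M) x)"
  proof (rule comm_span_sum[OF fin])
    fix M assume M: "M \<in> ?A"
    then have w: "weight (i # M) = ?w" by simp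
    have "comm_span n (weight (i # M)) (\<lambda>S :: nat \<Rightarrow> 'p vfield. commutator S (i # M))"
      by (rule comm_span_commutator) (use M i in \<open>auto simp: multiindices_def\<close>)
    then show "comm_span n ?w (\<lambda>S :: nat \<Rightarrow> 'p vfield. commutator S (i # M))"
      unfolding w .
  qed
  have "comm_span n (weight ?I + weight (i # J)) (\<lambda>S :: nat \<Rightarrow> 'p vfield. lie_bracket (commutator S ?I) (commutator S (i # J)))"
    by (rule "3.IH"(2)[OF I]) (use "3.prems" in auto)
  then have 2: "comm_span n ?w (\<lambda>S :: nat \<Rightarrow> 'p vfield. lie_bracket (commutator S ?I) (commutator S (i # J)))"
    by (simp add: ac_simps)
  show ?case
  proof (rule comm_span_cong[OF comm_span_diff[OF 1 2]])
    fix S :: "nat \<Rightarrow> 'p vfield" and x :: "real^'p"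
    assume S: "\<forall>i. smooth_vf (S i)"
    have "lie_bracket (commutator S ?I) (commutator S J) = (\<lambda>x. \<Sum>M\<in>?A. b M *\<^sub>R commutator S M x)"
      by (rule ext) (use b S in blast)
    then have "lie_bracket (S i) (lie_bracket (commutator S ?I) (commutator S J)) x
        = (\<Sum>M\<in>?A. b M *\<^sub>R lie_bracket (S i) (commutator S M) x)"
      by (simp only: lie_bracket_sum[OF fin spec[OF S] smooth_commutator[OF S]])
    also have "\<dots> = (\<Sum>M\<in>?A. b M *\<^sub>R commutator S (i # M) x)"
      by (rule sum.cong) (auto simp: iC multiindices_def)
    finally show "lie_bracket (commutator S (i # j # I)) (commutator S J) x =
        (\<Sum>M\<in>?A. b M *\<^sub>R commutator S (i # M) x) - lie_bracket (commutator S ?I) (commutator S (i # J)) x"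
      using lie_bracket_jacobi[OF spec[OF S, of i] smooth_commutator[OF S, of ?I] smooth_commutator[OF S, of J], of x]
      by (simp add: iC[OF "3.prems"(3)])
  qed
qed simp

text \<open>A bracket of commutators is a combination of commutators of the summed weight; the bound
  r on that weight keeps them within the range of freeness, where they can be rewritten in the
  basis.\<close>

lemma structure_constants:
  fixes X :: "nat \<Rightarrow> 'p::finite vfield"
  assumes free: "free_up_to_weight n r \<Omega> X" and basis: "basis_multiindices n r \<Omega> X B"
    and x0: "x0 \<in> \<Omega>" and ml: "weight (B m) + weight (B l) \<le> r"
  obtains c where "\<And>k. c k \<noteq> 0 \<Longrightarrow> weight (B k) = weight (B m) + weight (B l)"
    and "\<And>S x. (\<forall>i. smooth_vf (S i)) \<Longrightarrow>
      lie_bracket (commutator S (B m)) (commutator S (B l)) (x :: real^'p) = (\<Sum>k\<in>UNIV. c k *\<^sub>R commutator S (B k) x)"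
proof -
  let ?w = "weight (B m) + weight (B l)"
  let ?A = "{M \<in> multiindices n ?w. weight M = ?w}"
  have "range B \<subseteq> multiindices n r" using basis by (simp add: basis_multiindices_def)
  then have "B m \<noteq> []" "set (B m) \<subseteq> {..n}" "B l \<noteq> []" "set (B l) \<subseteq> {..n}"
    by (auto simp: multiindices_def)
  from comm_span_lie_bracket[OF this] obtain b where b: "\<And>S x. (\<forall>i. smooth_vf (S i)) \<Longrightarrow>
     lie_bracket (commutator S (B m)) (commutator S (B l)) (x :: real^'p) = (\<Sum>M\<in>?A. b M *\<^sub>R commutator S M x)"
    unfolding comm_span_def by blast
  have "\<exists>a. (\<forall>k. a k \<noteq> 0 \<longrightarrow> weight (B k) = weight M) \<and>
    (\<forall>S x. (\<forall>i. smooth_vf (S i)) \<longrightarrow> commutator S M (x :: real^'p) = (\<Sum>k\<in>UNIV. a k *\<^sub>R commutator S (B k) x))"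
    if "M \<in> ?A" for M
  proof -
    have "M \<in> multiindices n r" using that ml by (auto simp: multiindices_def)
    then obtain a where "\<And>k. a k \<noteq> 0 \<Longrightarrow> weight (B k) = weight M"
      "\<And>S x. (\<forall>i. smooth_vf (S i)) \<Longrightarrow> commutator S M x = (\<Sum>k\<in>UNIV. a k *\<^sub>R commutator S (B k) (x :: real^'p))"
      using commutator_basis_expansion[OF free basis x0] by blast
    then show ?thesis by (intro exI[of _ a] conjI allI impI) auto
  qed
  then have "\<forall>M. \<exists>a. M \<in> ?A \<longrightarrow> (\<forall>k. a k \<noteq> 0 \<longrightarrow> weight (B k) = weight M) \<and>
    (\<forall>S x. (\<forall>i. smooth_vf (S i)) \<longrightarrow> commutator S M (x :: real^'p) = (\<Sum>k\<in>UNIV. a k *\<^sub>R commutator S (B k) x))"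
    by blast
  from choice[OF this] obtain a where a: "\<And>M k. M \<in> ?A \<Longrightarrow> a M k \<noteq> 0 \<Longrightarrow> weight (B k) = weight M"
    "\<And>M S x. M \<in> ?A \<Longrightarrow> (\<forall>i. smooth_vf (S i)) \<Longrightarrow> commutator S M (x :: real^'p) = (\<Sum>k\<in>UNIV. a M k *\<^sub>R commutator S (B k) x)"
    by blast
  define c where "c k = (\<Sum>M\<in>?A. b M * a M k)" for k
  show ?thesis
  proof (rule that[of c])
    fix k assume "c k \<noteq> 0"
    then obtain M where "M \<in> ?A" "b M * a M k \<noteq> 0" unfolding c_def by (meson sum.neutral)
    then show "weight (B k) = ?w" using a(1)[of M k] by auto
  next
    fix S :: "nat \<Rightarrow> 'p vfield" and x :: "real^'p"
    assume S: "\<forall>i. smooth_vf (S i)"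
    have "(\<Sum>M\<in>?A. b M *\<^sub>R commutator S M x) = (\<Sum>M\<in>?A. \<Sum>k\<in>UNIV. (b M * a M k) *\<^sub>R commutator S (B k) x)"
      by (rule sum.cong) (simp_all add: a(2)[OF _ S] scaleR_sum_right)
    also have "\<dots> = (\<Sum>k\<in>UNIV. \<Sum>M\<in>?A. (b M * a M k) *\<^sub>R commutator S (B k) x)" by (rule sum.swap)
    finally show "lie_bracket (commutator S (B m)) (commutator S (B l)) x = (\<Sum>k\<in>UNIV. c k *\<^sub>R commutator S (B k) x)"
      using b[OF S] by (simp add: c_def scaleR_sum_left)
  qed
qed

subsection \<open>Polynomials with bounded degree and coefficients\<close>

text \<open>Degree at most \<open>d\<close> and coefficients in powers of \<open>x - y\<close> whose absolute values sum to at most \<open>N\<close>.\<close>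

inductive poly_bd :: "real^'p::finite \<Rightarrow> nat \<Rightarrow> real \<Rightarrow> (real^'p \<Rightarrow> real) \<Rightarrow> bool" for y where
  const: "\<bar>c\<bar> \<le> N \<Longrightarrow> poly_bd y d N (\<lambda>x. c)"
| var: "poly_bd y d N f \<Longrightarrow> N \<le> N' \<Longrightarrow> poly_bd y (Suc d) N' (\<lambda>x. (x - y) $ i * f x)"
| add: "poly_bd y d N f \<Longrightarrow> poly_bd y d M g \<Longrightarrow> N + M \<le> P \<Longrightarrow> poly_bd y d P (\<lambda>x. f x + g x)"

lemma poly_bd_eq: "poly_bd y d N g \<Longrightarrow> (\<And>x. f x = g x) \<Longrightarrow> poly_bd y d N f"
  by (subgoal_tac "f = g") auto

lemma poly_bd_nonneg: "poly_bd y d N f \<Longrightarrow> 0 \<le> N"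
  by (induction rule: poly_bd.induct) auto

lemma poly_bd_mono: "poly_bd y d N f \<Longrightarrow> d \<le> d' \<Longrightarrow> N \<le> N' \<Longrightarrow> poly_bd y d' N' f"
proof (induction arbitrary: d' N' rule: poly_bd.induct)
  case (const c N d)
  then show ?case by (intro poly_bd.const) auto
next
  case (var d N f N1 i)
  obtain e where e: "d' = Suc e" "d \<le> e" using var.prems(1) by (cases d') auto
  show ?case unfolding e(1) by (rule poly_bd.var[OF var.IH[OF e(2) order_refl]]) (use var in simp)
next
  case (add d N f M g P)
  show ?case
    by (rule poly_bd.add[OF add.IH(1)[OF add.prems(1) order_refl] add.IH(2)[OF add.prems(1) order_refl]])
      (use add in simp)
qed

lemma smooth_coord_diff: "smooth (\<lambda>x. (x - y) $ i)"
  unfolding vector_minus_component by (rule smooth_diff[OF smooth_coord smooth_const])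

lemma poly_bd_smooth: "poly_bd y d N f \<Longrightarrow> smooth f"
proof (induction rule: poly_bd.induct)
  case (var d N f N' i)
  show ?case by (rule smooth_mult[OF smooth_coord_diff var.IH])
qed (auto intro: smooth_const smooth_add)

lemma poly_bd_cmult: "poly_bd y d N f \<Longrightarrow> poly_bd y d (\<bar>c\<bar> * N) (\<lambda>x. c * f x)"
proof (induction rule: poly_bd.induct)
  case (const c' N d)
  then show ?case by (intro poly_bd.const) (simp add: abs_mult mult_left_mono)
next
  case (var d N f N' i)
  have "poly_bd y (Suc d) (\<bar>c\<bar> * N') (\<lambda>x. (x - y) $ i * (c * f x))"
    by (rule poly_bd.var[OF var.IH]) (use var in \<open>simp add: mult_left_mono\<close>)
  then show ?case by (rule poly_bd_eq) (simp add: mult.left_commute)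
next
  case (add d N f M g P)
  have "poly_bd y d (\<bar>c\<bar> * P) (\<lambda>x. c * f x + c * g x)"
  proof (rule poly_bd.add[OF add.IH])
    show "\<bar>c\<bar> * N + \<bar>c\<bar> * M \<le> \<bar>c\<bar> * P"
      unfolding distrib_left[symmetric] using add.hyps by (simp add: mult_left_mono)
  qed
  then show ?case by (rule poly_bd_eq) (simp add: distrib_left)
qed

lemma poly_bd_mult:
  assumes "poly_bd y d N f" "poly_bd y e M g"
  shows "poly_bd y (d + e) (N * M) (\<lambda>x. f x * g x)"
  using assms(1)
proof (induction rule: poly_bd.induct)
  case (const c N d)
  show ?case
    by (rule poly_bd_mono[OF poly_bd_cmult[OF assms(2)]])
      (use const poly_bd_nonneg[OF assms(2)] in \<open>simp_all add: mult_right_mono\<close>)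
next
  case (var d N f N' i)
  have "poly_bd y (Suc (d + e)) (N' * M) (\<lambda>x. (x - y) $ i * (f x * g x))"
    by (rule poly_bd.var[OF var.IH]) (use var poly_bd_nonneg[OF assms(2)] in \<open>simp add: mult_right_mono\<close>)
  then have "poly_bd y (Suc (d + e)) (N' * M) (\<lambda>x. (x - y) $ i * f x * g x)"
    by (rule poly_bd_eq) (simp add: mult.assoc)
  then show ?case by simp
next
  case (add d N f M' g' P)
  have "poly_bd y (d + e) (P * M) (\<lambda>x. f x * g x + g' x * g x)"
  proof (rule poly_bd.add[OF add.IH])
    show "N * M + M' * M \<le> P * M"
      unfolding distrib_right[symmetric] using add.hyps poly_bd_nonneg[OF assms(2)] by (simp add: mult_right_mono)
  qed
  then show ?case by (rule poly_bd_eq) (simp add: distrib_right)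
qed

lemma poly_bd_sum:
  assumes "finite A" "\<And>a. a \<in> A \<Longrightarrow> poly_bd y d N (f a)"
  shows "poly_bd y d (real (card A) * N) (\<lambda>x. \<Sum>a\<in>A. f a x)"
  using assms
proof (induction A)
  case empty
  show ?case by (simp add: poly_bd.const)
next
  case (insert a A)
  have "poly_bd y d (real (card (insert a A)) * N) (\<lambda>x. f a x + (\<Sum>a\<in>A. f a x))"
    by (rule poly_bd.add[OF insert.prems[OF insertI1] insert.IH[OF insert.prems[OF insertI2]]])
      (use insert.hyps in \<open>simp_all add: distrib_right\<close>)
  then show ?case unfolding sum.insert[OF insert.hyps] .
qed

text \<open>Each monomial of degree at most d gains at most the factor d. This linear cost is the
  origin of the factorial in \<open>poly_bd_wop\<close>.\<close>

lemma poly_bd_partial: "poly_bd y d N f \<Longrightarrow> poly_bd y d (real d * N) (partial j f)"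
proof (induction rule: poly_bd.induct)
  case (const c N d)
  then show ?case unfolding partial_const by (intro poly_bd.const) auto
next
  case (var d N f N' i)
  have N: "0 \<le> N" by (rule poly_bd_nonneg[OF var.hyps(1)])
  have 1: "poly_bd y (Suc d) (real d * N) (\<lambda>x. (x - y) $ i * partial j f x)"
    by (rule poly_bd.var[OF var.IH order_refl])
  have 2: "poly_bd y (Suc d) N (\<lambda>x. (if j = i then 1 else 0) * f x)"
    by (rule poly_bd_mono[OF poly_bd_cmult[OF var.hyps(1)]]) (use N in auto)
  have "poly_bd y (Suc d) (real (Suc d) * N') (\<lambda>x. (x - y) $ i * partial j f x + (if j = i then 1 else 0) * f x)"
  proof (rule poly_bd.add[OF 1 2])
    have "real (Suc d) * N \<le> real (Suc d) * N'" using var.hyps by (intro mult_left_mono) auto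
    then show "real d * N + N \<le> real (Suc d) * N'" by (simp add: algebra_simps)
  qed
  then show ?case
  proof (rule poly_bd_eq)
    fix x
    show "partial j (\<lambda>x. (x - y) $ i * f x) x = (x - y) $ i * partial j f x + (if j = i then 1 else 0) * f x"
      unfolding partial_coord_diff[of j y i x, symmetric]
      by (rule partial_mult[OF smooth_differentiable[OF smooth_coord_diff] smooth_differentiable[OF poly_bd_smooth[OF var.hyps(1)]]])
  qed
next
  case (add d N f M g P)
  have "poly_bd y d (real d * P) (\<lambda>x. partial j f x + partial j g x)"
  proof (rule poly_bd.add[OF add.IH])
    show "real d * N + real d * M \<le> real d * P"
      unfolding distrib_left[symmetric] using add.hyps by (simp add: mult_left_mono)
  qed
  then show ?case
    by (rule poly_bd_eq)
      (rule partial_add[OF smooth_differentiable[OF poly_bd_smooth[OF add.hyps(1)]] smooth_differentiable[OF poly_bd_smooth[OF add.hyps(2)]]])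
qed

lemma poly_bd_abs_le:
  assumes "poly_bd y d N f" "\<And>i. \<bar>(x - y) $ i\<bar> \<le> 1"
  shows "\<bar>f x\<bar> \<le> N"
  using assms(1)
proof (induction rule: poly_bd.induct)
  case (var d N f N' i)
  have "\<bar>(x - y) $ i\<bar> * \<bar>f x\<bar> \<le> 1 * N" using assms(2)[of i] var.IH by (intro mult_mono) auto
  then show ?case using var.hyps by (simp add: abs_mult)
qed auto

lemma poly_bd_vop:
  fixes V :: "'p::finite vfield"
  assumes "\<And>j. poly_bd y e A (\<lambda>x. V x $ j)" "poly_bd y d N f"
  shows "poly_bd y (e + d) (real CARD('p) * (A * (real d * N))) (vop V f)"
  unfolding vop_def[abs_def] by (rule poly_bd_sum[OF finite], rule poly_bd_mult[OF assms(1) poly_bd_partial[OF assms(2)]])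

text \<open>At degree (k + 1) D the next field costs the factor CARD('p) A (k + 1) D and raises the
  degree by D. The factors k + 1 multiply to the factorial, the rest to the geometric part.\<close>

lemma poly_bd_wop:
  fixes P :: "'i \<Rightarrow> 'p::finite vfield"
  assumes P: "\<And>a j. poly_bd y D A (\<lambda>x. P a x $ j)" and f: "poly_bd y D N f"
  shows "poly_bd y (Suc (length w) * D) (N * (real CARD('p) * A * real D) ^ length w * fact (length w)) (wop P w f)"
proof (induction w)
  case Nil
  then show ?case using f by simp
next
  case (Cons a w)
  show ?case unfolding wop.simps
    by (rule poly_bd_mono[OF poly_bd_vop[OF P Cons.IH]]) (simp_all add: algebra_simps)
qed

subsection \<open>Power series indexed by words\<close>

text \<open>The natural norm for words: the absolute monomials of degree k sum exactly to its k-th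
  power, so a series over words is dominated by a scalar power series in
  \<open>norm1 u\<close>.\<close>

definition norm1 :: "real^'p::finite \<Rightarrow> real" where
  "norm1 u = (\<Sum>j\<in>UNIV. \<bar>u $ j\<bar>)"

lemma norm1_nonneg: "0 \<le> norm1 u"
  by (simp add: norm1_def sum_nonneg)

lemma norm1_scale: "norm1 (t *\<^sub>R u) = \<bar>t\<bar> * norm1 u"
  by (simp add: norm1_def abs_mult sum_distrib_left)

lemma norm1_triangle: "norm1 (u + v) \<le> norm1 u + norm1 v"
  unfolding norm1_def sum.distrib[symmetric] by (rule sum_mono) (simp add: abs_triangle_ineq)

lemma norm1_le: "norm1 (u :: real^'p::finite) \<le> real CARD('p) * norm u"
  unfolding norm1_def by (rule order_trans[OF sum_bounded_above]) (auto intro: component_le_norm_cart)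

lemma norm_le_norm1: "norm u \<le> norm1 u"
  unfolding norm1_def by (rule norm_le_l1_cart)

lemma continuous_on_norm1: "continuous_on S norm1"
  unfolding norm1_def[abs_def] by (intro continuous_intros)

lemma open_norm1: "open {u. norm1 u < R}"
  by (rule open_Collect_less[OF continuous_on_norm1 continuous_on_const])

lemma convex_norm1: "convex {u. norm1 u < R}"
proof (rule convexI)
  fix x y :: "real^'a" and s t :: real
  assume a: "x \<in> {u. norm1 u < R}" "y \<in> {u. norm1 u < R}" "0 \<le> s" "0 \<le> t" "s + t = 1"
  have "norm1 (s *\<^sub>R x + t *\<^sub>R y) \<le> s * norm1 x + t * norm1 y"
    using norm1_triangle[of "s *\<^sub>R x" "t *\<^sub>R y"] a by (simp add: norm1_scale)
  also have "\<dots> < R" by (rule convex_bound_lt) (use a in auto)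
  finally show "s *\<^sub>R x + t *\<^sub>R y \<in> {u. norm1 u < R}" by simp
qed

lemma sum_abs_mon: "(\<Sum>w\<in>{w. length w = k}. \<bar>mon u w\<bar>) = norm1 u ^ k"
proof (induction k)
  case (Suc k)
  have "(\<Sum>w\<in>{w. length w = Suc k}. \<bar>mon u w\<bar>) = (\<Sum>a\<in>UNIV. \<bar>u $ a\<bar> * (\<Sum>w\<in>{w. length w = k}. \<bar>mon u w\<bar>))"
    by (simp add: sum_words_Suc abs_mult sum_distrib_left)
  then show ?case unfolding Suc by (simp add: norm1_def sum_distrib_right)
qed simp

lemma wsum_abs_le:
  assumes "\<And>w. \<bar>c w\<bar> \<le> a (length w)"
  shows "\<bar>wsum c k u\<bar> \<le> a k * norm1 u ^ k"
proof -
  have "\<bar>wsum c k u\<bar> \<le> (\<Sum>w\<in>{w. length w = k}. a k * \<bar>mon u w\<bar>)"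
    unfolding wsum_def using assms by (intro sum_abs[THEN order_trans] sum_mono) (auto simp: abs_mult mult_right_mono)
  then show ?thesis by (simp add: sum_distrib_left[symmetric] sum_abs_mon)
qed

lemma wsum_scale: "wsum c k (t *\<^sub>R u) = t ^ k * wsum c k u"
proof -
  have "mon (t *\<^sub>R u) w = t ^ length w * mon u w" for w
    by (induction w) (auto simp: mult_ac)
  then show ?thesis by (simp add: wsum_def sum_distrib_left mult_ac)
qed

definition wseries :: "('p::finite list \<Rightarrow> real) \<Rightarrow> real^'p \<Rightarrow> real" where
  "wseries c u = (\<Sum>k. wsum c k u)"

text \<open>A scalar power series that converges for arguments below R and dominates the
  coefficients by word length. Convergence, differentiation and bounds of word series are all
  reduced to it.\<close>

definition majorant :: "real \<Rightarrow> (nat \<Rightarrow> real) \<Rightarrow> ('p::finite list \<Rightarrow> real) \<Rightarrow> bool" where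
  "majorant R a c \<longleftrightarrow> (\<forall>w. \<bar>c w\<bar> \<le> a (length w)) \<and> (\<forall>x. \<bar>x\<bar> < R \<longrightarrow> summable (\<lambda>k. a k * x ^ k))"

text \<open>A word of length k admits k + 1 insertions, and k + 1 times the coefficient of index k +
  1 is the coefficient of the differentiated majorant.\<close>

lemma dcoeff_abs_le:
  assumes "\<And>w. \<bar>c w\<bar> \<le> a (length w)"
  shows "\<bar>dcoeff j c w\<bar> \<le> diffs a (length w)"
  using assms
proof (induction w arbitrary: c a)
  case Nil
  then show ?case using Nil[of "[j]"] by (simp add: diffs_def)
next
  case (Cons b w)
  have "\<bar>dcoeff j (\<lambda>v. c (b # v)) w\<bar> \<le> diffs (\<lambda>k. a (Suc k)) (length w)"
    by (rule Cons.IH) (metis Cons.prems length_Cons)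
  moreover have "\<bar>c (j # b # w)\<bar> \<le> a (Suc (Suc (length w)))" by (metis Cons.prems length_Cons)
  ultimately show ?case by (simp add: diffs_def algebra_simps)
qed

lemma majorant_dcoeff:
  assumes "majorant R a c"
  shows "majorant R (diffs a) (dcoeff j c)"
  using assms unfolding majorant_def
  by (intro conjI allI impI dcoeff_abs_le termdiff_converges[where K = R]) auto

lemma majorant_nonneg: "majorant R a c \<Longrightarrow> 0 \<le> a k"
proof -
  assume "majorant R a c"
  then have "\<bar>c (replicate k undefined)\<bar> \<le> a (length (replicate k (undefined :: 'a)))" unfolding majorant_def by blast
  then show ?thesis by (simp add: order_trans[OF abs_ge_zero])
qed

lemma summable_wsum:
  assumes "majorant R a c" "norm1 u < R"
  shows "summable (\<lambda>k. norm (wsum c k u))" "summable (\<lambda>k. wsum c k u)"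
proof -
  have "summable (\<lambda>k. a k * norm1 u ^ k)" using assms norm1_nonneg[of u] by (simp add: majorant_def)
  moreover have "norm (wsum c k u) \<le> a k * norm1 u ^ k" for k
    using wsum_abs_le[of c a k u] assms(1) by (simp add: majorant_def)
  ultimately show "summable (\<lambda>k. norm (wsum c k u))" "summable (\<lambda>k. wsum c k u)"
    using summable_comparison_test'[of "\<lambda>k. a k * norm1 u ^ k" 0 "\<lambda>k. wsum c k u"]
      summable_comparison_test'[of "\<lambda>k. a k * norm1 u ^ k" 0 "\<lambda>k. norm (wsum c k u)"] by auto
qed

lemma wseries_abs_le:
  assumes "majorant R a c" "norm1 u \<le> x" "x < R"
  shows "\<bar>wseries c u\<bar> \<le> (\<Sum>k. a k * x ^ k)"
proof -
  have x: "0 \<le> x" using assms(2) norm1_nonneg[of u] by linarith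
  have uR: "norm1 u < R" using assms(2,3) by linarith
  have le: "norm (wsum c k u) \<le> a k * x ^ k" for k
  proof -
    have "\<bar>wsum c k u\<bar> \<le> a k * norm1 u ^ k"
      by (rule wsum_abs_le) (use assms(1) in \<open>simp add: majorant_def\<close>)
    also have "\<dots> \<le> a k * x ^ k"
      by (rule mult_left_mono[OF power_mono[OF assms(2) norm1_nonneg] majorant_nonneg[OF assms(1)]])
    finally show ?thesis by simp
  qed
  have "summable (\<lambda>k. a k * x ^ k)" using assms x by (simp add: majorant_def)
  from suminf_le[OF le summable_wsum(1)[OF assms(1) uR] this] summable_norm[OF summable_wsum(1)[OF assms(1) uR]]
  show ?thesis unfolding wseries_def by simp
qed

lemma wseries_zero: "wseries c 0 = c []"
proof -
  have "(\<lambda>k. wsum c k 0) = (\<lambda>k. if k = 0 then c [] else 0)" by (rule ext) (simp add: wsum_zero)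
  then show ?thesis unfolding wseries_def using suminf_finite[of "{0}" "\<lambda>k. if k = 0 then c [] else 0"] by simp
qed

text \<open>Termwise differentiation: on a slightly smaller ball of \<open>norm1\<close> the
  differentiated terms are dominated by the differentiated majorant, so the Weierstrass test gives
  uniform convergence.\<close>

lemma has_derivative_wseries:
  fixes u :: "real^'p::finite"
  assumes maj: "majorant R a c" and u: "norm1 u < R"
  shows "(wseries c has_derivative (\<lambda>h. \<Sum>j\<in>UNIV. h $ j * wseries (dcoeff j c) u)) (at u)"
proof -
  obtain \<rho> where \<rho>: "norm1 u < \<rho>" "\<rho> < R" using u dense by blast
  have \<rho>0: "0 \<le> \<rho>" using \<rho>(1) norm1_nonneg[of u] by linarith
  let ?S = "{v :: real^'p. norm1 v < \<rho>}"
  let ?p = "\<lambda>j k. partial j (wsum c k)"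
  \<comment> \<open>Differentiation lowers the degree, so the bound for term k is the derivative
    coefficient with index k - 1; the constant term contributes 0.\<close>
  define M where "M k = (case k of 0 \<Rightarrow> 0 | Suc l \<Rightarrow> diffs a l * \<rho> ^ l)" for k
  have mD: "majorant R (diffs a) (dcoeff j c)" for j by (rule majorant_dcoeff[OF maj])
  have "summable (\<lambda>l. diffs a l * \<rho> ^ l)" using mD \<rho> \<rho>0 by (simp add: majorant_def)
  then have sM: "summable M" by (subst summable_Suc_iff[symmetric]) (simp add: M_def)
  have w0: "wsum c 0 = (\<lambda>u. c [])" by (rule ext) simp
  have pM: "norm (?p j k x) \<le> M k" if "x \<in> ?S" for j k x
  proof (cases k)
    case (Suc l)
    have "\<bar>wsum (dcoeff j c) l x\<bar> \<le> diffs a l * norm1 x ^ l"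
      by (rule wsum_abs_le) (use mD in \<open>simp add: majorant_def\<close>)
    also have "\<dots> \<le> diffs a l * \<rho> ^ l"
      using that norm1_nonneg[of x] majorant_nonneg[OF mD] by (intro mult_left_mono power_mono) auto
    finally show ?thesis by (simp add: Suc partial_wsum M_def)
  qed (simp add: M_def w0)
  have lim: "(\<Sum>k. ?p j k x) = wseries (dcoeff j c) x" if "x \<in> ?S" for j x
  proof -
    have "summable (\<lambda>k. ?p j k x)" by (rule summable_comparison_test'[OF sM, of 0]) (rule pM[OF that])
    from suminf_split_head[OF this] show ?thesis by (simp add: w0 partial_wsum wseries_def)
  qed
  have ul: "uniform_limit ?S (\<lambda>n x. \<Sum>i<n. ?p j i x) (\<lambda>x. \<Sum>k. ?p j k x) sequentially" for j
    by (rule Weierstrass_m_test[OF pM sM])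
  have "\<exists>g. \<forall>x\<in>?S. (\<lambda>n. wsum c n x) sums g x \<and>
      (g has_derivative (\<lambda>h. \<Sum>j\<in>UNIV. h $ j * wseries (dcoeff j c) x)) (at x within ?S)"
  proof (rule has_derivative_series[where f' = "\<lambda>n x h. \<Sum>j\<in>UNIV. h $ j * ?p j n x" and x = u and l = "wseries c u"])
    show "convex ?S" by (rule convex_norm1)
    show "(wsum c n has_derivative (\<lambda>h. \<Sum>j\<in>UNIV. h $ j * ?p j n x)) (at x within ?S)" for n x
      by (rule has_derivative_at_withinI[OF has_derivative_partials[OF wsum_differentiable]])
    show "u \<in> ?S" using \<rho> by simp
    show "(\<lambda>n. wsum c n u) sums wseries c u"
      unfolding wseries_def by (rule summable_sums[OF summable_wsum(2)[OF maj u]])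
    fix e :: real assume e: "e > 0"
    define e' where "e' = e / real CARD('p)"
    have e': "e' > 0" using e by (simp add: e'_def)
    have "\<forall>\<^sub>F n in sequentially. \<forall>j. \<forall>x\<in>?S. dist (\<Sum>i<n. ?p j i x) (\<Sum>k. ?p j k x) < e'"
      by (rule eventually_all_finite) (use ul e' in \<open>simp add: uniform_limit_iff\<close>)
    then show "\<forall>\<^sub>F n in sequentially. \<forall>x\<in>?S. \<forall>h. norm ((\<Sum>i<n. \<Sum>j\<in>UNIV. h $ j * ?p j i x) -
        (\<Sum>j\<in>UNIV. h $ j * wseries (dcoeff j c) x)) \<le> e * norm h"
    proof (rule eventually_mono, intro ballI allI)
      fix n x and h :: "real^'p"
      assume n: "\<forall>j. \<forall>x\<in>?S. dist (\<Sum>i<n. ?p j i x) (\<Sum>k. ?p j k x) < e'" and x: "x \<in> ?S"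
      have "(\<Sum>i<n. \<Sum>j\<in>UNIV. h $ j * ?p j i x) = (\<Sum>j\<in>UNIV. h $ j * (\<Sum>i<n. ?p j i x))"
        by (subst sum.swap) (simp add: sum_distrib_left)
      then have "norm ((\<Sum>i<n. \<Sum>j\<in>UNIV. h $ j * ?p j i x) - (\<Sum>j\<in>UNIV. h $ j * wseries (dcoeff j c) x))
         = norm (\<Sum>j\<in>UNIV. h $ j * ((\<Sum>i<n. ?p j i x) - (\<Sum>k. ?p j k x)))"
        using lim[OF x] by (simp add: right_diff_distrib sum_subtractf)
      also have "\<dots> \<le> (\<Sum>j\<in>(UNIV :: 'p set). norm h * e')"
      proof (rule sum_norm_le)
        fix j
        have "\<bar>(\<Sum>i<n. ?p j i x) - (\<Sum>k. ?p j k x)\<bar> \<le> e'" using n x by (auto simp: dist_norm intro: less_imp_le)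
        then show "norm (h $ j * ((\<Sum>i<n. ?p j i x) - (\<Sum>k. ?p j k x))) \<le> norm h * e'"
          unfolding real_norm_def abs_mult by (intro mult_mono component_le_norm_cart) auto
      qed
      also have "\<dots> = e * norm h" by (simp add: e'_def)
      finally show "norm ((\<Sum>i<n. \<Sum>j\<in>UNIV. h $ j * ?p j i x) - (\<Sum>j\<in>UNIV. h $ j * wseries (dcoeff j c) x)) \<le> e * norm h" .
    qed
  qed
  then obtain g where g: "\<And>x. x \<in> ?S \<Longrightarrow> (\<lambda>n. wsum c n x) sums g x"
    "\<And>x. x \<in> ?S \<Longrightarrow> (g has_derivative (\<lambda>h. \<Sum>j\<in>UNIV. h $ j * wseries (dcoeff j c) x)) (at x within ?S)" by blast
  have eq: "g x = wseries c x" if "x \<in> ?S" for x using sums_unique[OF g(1)[OF that]] by (simp add: wseries_def)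
  have uS: "u \<in> ?S" using \<rho> by simp
  have "(g has_derivative (\<lambda>h. \<Sum>j\<in>UNIV. h $ j * wseries (dcoeff j c) u)) (at u)"
    using g(2)[OF uS] unfolding at_within_open[OF uS open_norm1] .
  then show ?thesis by (rule has_derivative_transform_within_open[OF _ open_norm1 uS eq])
qed

lemma partial_wseries:
  assumes "majorant R a c" "norm1 u < R"
  shows "partial j (wseries c) u = wseries (dcoeff j c) u"
  using partial_eqI[OF has_derivative_wseries[OF assms], of j] by simp

lemma Ck_on_wseries:
  assumes "majorant R a c"
  shows "Ck_on k {u. norm1 u < R} (wseries c)"
  using assms
proof (induction k arbitrary: a c)
  case 0
  show ?case unfolding Ck_on_0
    by (rule continuous_at_imp_continuous_on) (use has_derivative_continuous[OF has_derivative_wseries[OF 0]] in blast)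
next
  case (Suc k)
  have "Ck_on k {u. norm1 u < R} (partial j (wseries c))" for j
    by (rule Ck_on_eq[OF open_norm1 Suc.IH[OF majorant_dcoeff[OF Suc.prems]]])
      (use partial_wseries[OF Suc.prems] in simp)
  moreover have "wseries c differentiable_on {u. norm1 u < R}"
    unfolding differentiable_on_eq_differentiable_at[OF open_norm1]
    using has_derivative_wseries[OF Suc.prems] by (auto simp: differentiable_def)
  ultimately show ?case unfolding Ck_on_Suc by blast
qed

subsection \<open>The Lie series of a linear combination of polynomial fields\<close>

definition lin_field :: "('p::finite \<Rightarrow> 'p vfield) \<Rightarrow> real^'p \<Rightarrow> 'p vfield" where
  "lin_field P u x = (\<Sum>a\<in>UNIV. (u $ a) *\<^sub>R P a x)"

text \<open>The coefficient of the word w in the sum of (Z^k f)(y) / k!, where Z is the combination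
  of the fields P_a with coefficients u_a. Formally this sum is the value of f at exp(Z)(y).\<close>

definition lcoeff :: "('p::finite \<Rightarrow> 'p vfield) \<Rightarrow> (real^'p \<Rightarrow> real) \<Rightarrow> real^'p \<Rightarrow> 'p list \<Rightarrow> real" where
  "lcoeff P f y w = wop P w f y / fact (length w)"

text \<open>The coordinates enter as differences from y, which makes their polynomial bound 1
  wherever y lies.\<close>

definition lie_exp :: "('p::finite \<Rightarrow> 'p vfield) \<Rightarrow> real^'p \<Rightarrow> real^'p \<Rightarrow> real^'p" where
  "lie_exp P y u = (\<chi> i. y $ i + wseries (lcoeff P (\<lambda>x. (x - y) $ i) y) u)"

lemma vop_lin_field: "vop (lin_field P u) f x = (\<Sum>a\<in>UNIV. u $ a * vop (P a) f x)"
proof -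
  have "vop (lin_field P u) f x = (\<Sum>j\<in>UNIV. \<Sum>a\<in>UNIV. u $ a * (P a x $ j * partial j f x))"
    by (simp add: vop_def lin_field_def sum_distrib_right mult.assoc)
  also have "\<dots> = (\<Sum>a\<in>UNIV. \<Sum>j\<in>UNIV. u $ a * (P a x $ j * partial j f x))" by (rule sum.swap)
  finally show ?thesis by (simp add: vop_def sum_distrib_left)
qed

lemma vop_add: "smooth f \<Longrightarrow> smooth g \<Longrightarrow> vop V (\<lambda>x. f x + g x) x = vop V f x + vop V g x"
  by (simp add: vop_def partial_add smooth_differentiable distrib_left sum.distrib)

lemma vop_mult: "smooth f \<Longrightarrow> smooth g \<Longrightarrow> vop V (\<lambda>x. f x * g x) x = f x * vop V g x + vop V f x * g x"
  by (simp add: vop_def partial_mult smooth_differentiable distrib_left sum.distrib sum_distrib_left sum_distrib_right mult_ac)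

lemma smooth_vf_lin_field:
  assumes "\<forall>a. smooth_vf (P a)"
  shows "smooth_vf (lin_field P u)"
  using assms unfolding smooth_vf_def lin_field_def
  by (simp add: smooth_sum smooth_cmult)

lemma funpow_vop_eq_wsum:
  assumes "\<forall>a. smooth_vf (P a)" "smooth f"
  shows "(vop (lin_field P u) ^^ k) f x = wsum (\<lambda>w. wop P w f x) k u"
proof (induction k arbitrary: x)
  case (Suc k)
  have e: "(vop (lin_field P u) ^^ k) f = (\<lambda>x. \<Sum>w\<in>{w. length w = k}. mon u w * wop P w f x)"
    by (rule ext) (simp add: Suc wsum_def mult.commute)
  have "(vop (lin_field P u) ^^ Suc k) f x = (\<Sum>a\<in>UNIV. u $ a * vop (P a) ((vop (lin_field P u) ^^ k) f) x)"
    by (simp add: vop_lin_field)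
  also have "\<dots> = (\<Sum>a\<in>UNIV. u $ a * wsum (\<lambda>w. wop P (a # w) f x) k u)"
    unfolding e by (simp add: vop_sum smooth_wop assms wsum_def mult.commute)
  finally show ?case by (simp add: wsum_Suc)
qed simp

lemma wsum_lcoeff:
  assumes "\<forall>a. smooth_vf (P a)" "smooth f"
  shows "wsum (lcoeff P f y) k u = (vop (lin_field P u) ^^ k) f y / fact k"
  unfolding funpow_vop_eq_wsum[OF assms] by (simp add: wsum_def lcoeff_def sum_divide_distrib)

lemma wsum_lcoeff_Suc:
  assumes "\<forall>a. smooth_vf (P a)" "smooth f"
  shows "real (Suc k) * wsum (lcoeff P f y) (Suc k) u = wsum (lcoeff P (vop (lin_field P u) f) y) k u"
proof -
  have "smooth (vop (lin_field P u) f)" by (rule smooth_vop[OF smooth_vf_lin_field[OF assms(1)] assms(2)])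
  then show ?thesis
    by (simp add: wsum_lcoeff assms funpow_Suc_right fact_Suc del: funpow.simps of_nat_Suc)
qed

text \<open>The Leibniz rule for Z^k / k!: the factorials absorb the binomial coefficients and leave
  a Cauchy product. The induction multiplies by k + 1 and splits this factor into i for f and k + 1
  - i for g.\<close>

lemma wsum_lcoeff_mult:
  assumes "\<forall>a. smooth_vf (P a)" "smooth f" "smooth g"
  shows "wsum (lcoeff P (\<lambda>x. f x * g x) y) k u =
    (\<Sum>i\<le>k. wsum (lcoeff P f y) i u * wsum (lcoeff P g y) (k - i) u)"
  using assms(2,3)
proof (induction k arbitrary: f g)
  case 0
  then show ?case by (simp add: lcoeff_def)
next
  case (Suc k)
  let ?Z = "vop (lin_field P u)" and ?b = "\<lambda>f k. wsum (lcoeff P f y) k u"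
  have sZ: "smooth (?Z h)" if "smooth h" for h
    by (rule smooth_vop[OF smooth_vf_lin_field[OF assms(1)] that])
  note S = Suc.prems
  have add: "?b (\<lambda>x. h x + h' x) k = ?b h k + ?b h' k" if "smooth h" "smooth h'" for h h'
  proof -
    have "wop P w (\<lambda>x. h x + h' x) = (\<lambda>x. wop P w h x + wop P w h' x)" for w
      by (induction w) (auto simp: vop_add[OF smooth_wop[OF assms(1) that(1)] smooth_wop[OF assms(1) that(2)]])
    then show ?thesis by (simp add: wsum_def lcoeff_def add_divide_distrib distrib_right sum.distrib)
  qed
  have "?Z (\<lambda>x. f x * g x) = (\<lambda>x. f x * ?Z g x + ?Z f x * g x)" by (rule ext) (rule vop_mult[OF S])
  then have "real (Suc k) * ?b (\<lambda>x. f x * g x) (Suc k) = ?b (\<lambda>x. f x * ?Z g x + ?Z f x * g x) k"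
    using wsum_lcoeff_Suc[OF assms(1) smooth_mult[OF S]] by simp
  also have "\<dots> = (\<Sum>i\<le>k. ?b f i * ?b (?Z g) (k - i)) + (\<Sum>i\<le>k. ?b (?Z f) i * ?b g (k - i))"
    by (simp add: add smooth_mult sZ S Suc.IH)
  also have "(\<Sum>i\<le>k. ?b f i * ?b (?Z g) (k - i)) = (\<Sum>i\<le>k. real (Suc k - i) * (?b f i * ?b g (Suc k - i)))"
  proof (rule sum.cong)
    fix i assume "i \<in> {..k}"
    then have "Suc k - i = Suc (k - i)" by auto
    then show "?b f i * ?b (?Z g) (k - i) = real (Suc k - i) * (?b f i * ?b g (Suc k - i))"
      by (simp only: wsum_lcoeff_Suc[OF assms(1) S(2), symmetric] mult.left_commute)
  qed simp
  also have "\<dots> = (\<Sum>i\<le>Suc k. real (Suc k - i) * (?b f i * ?b g (Suc k - i)))" by simp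
  also have "(\<Sum>i\<le>k. ?b (?Z f) i * ?b g (k - i)) = (\<Sum>i\<le>k. real (Suc i) * (?b f (Suc i) * ?b g (Suc k - Suc i)))"
    by (rule sum.cong) (simp_all only: wsum_lcoeff_Suc[OF assms(1) S(1), symmetric] mult.assoc diff_Suc_Suc)
  \<comment> \<open>The term i = k + 1 added to the first sum and the term i = 0 added here carry
    the factor 0; both sums now have the same range.\<close>
  also have "\<dots> = (\<Sum>i\<le>Suc k. real i * (?b f i * ?b g (Suc k - i)))"
    unfolding sum.atMost_Suc_shift by simp
  also have "(\<Sum>i\<le>Suc k. real (Suc k - i) * (?b f i * ?b g (Suc k - i))) + (\<Sum>i\<le>Suc k. real i * (?b f i * ?b g (Suc k - i)))
     = (\<Sum>i\<le>Suc k. real (Suc k) * (?b f i * ?b g (Suc k - i)))"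
    unfolding sum.distrib[symmetric] distrib_right[symmetric] by (rule sum.cong) (auto simp: of_nat_diff)
  also have "\<dots> = real (Suc k) * (\<Sum>i\<le>Suc k. ?b f i * ?b g (Suc k - i))" by (simp only: sum_distrib_left)
  finally show ?case by (simp only: mult_cancel_left) auto
qed

text \<open>The geometric ratio of \<open>poly_bd_wop\<close>. Its reciprocal serves as radius of
  convergence of the Lie series, and it involves the fields and their centre only through D and
  A.\<close>

definition word_growth :: "nat \<Rightarrow> nat \<Rightarrow> real \<Rightarrow> real" where
  "word_growth p D A = real p * A * real D"

context
  fixes P :: "'p::finite \<Rightarrow> 'p vfield" and y :: "real^'p" and D :: nat and A :: real
  assumes P: "\<And>a j. poly_bd y D A (\<lambda>x. P a x $ j)" and D: "1 \<le> D" and A: "0 < A"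
begin

lemma growth_pos: "0 < word_growth CARD('p) D A"
  using A D by (simp add: word_growth_def)

lemma smooth_P: "\<forall>a. smooth_vf (P a)"
  using poly_bd_smooth[OF P] by (simp add: smooth_vf_def)

lemma majorant_lcoeff:
  assumes "poly_bd y D N f"
  shows "majorant (1 / word_growth CARD('p) D A) (\<lambda>k. N * word_growth CARD('p) D A ^ k) (lcoeff P f y)"
  unfolding majorant_def
proof (intro conjI allI impI)
  fix w
  have "\<bar>wop P w f y\<bar> \<le> N * word_growth CARD('p) D A ^ length w * fact (length w)"
    unfolding word_growth_def by (rule poly_bd_abs_le[OF poly_bd_wop[OF P assms]]) simp
  then show "\<bar>lcoeff P f y w\<bar> \<le> N * word_growth CARD('p) D A ^ length w"
    by (simp add: lcoeff_def abs_divide divide_le_eq)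
next
  fix x :: real assume "\<bar>x\<bar> < 1 / word_growth CARD('p) D A"
  then have "norm (word_growth CARD('p) D A * x) < 1" using growth_pos by (simp add: abs_mult field_simps)
  then have "summable (\<lambda>k. N * (word_growth CARD('p) D A * x) ^ k)" by (intro summable_mult summable_geometric)
  then show "summable (\<lambda>k. N * word_growth CARD('p) D A ^ k * x ^ k)" by (simp add: power_mult_distrib mult.assoc)
qed

lemma poly_bd_coord: "poly_bd y D 1 (\<lambda>x. (x - y) $ i)"
proof -
  obtain e where e: "D = Suc e" using D by (cases D) auto
  have "poly_bd y D 1 (\<lambda>x. (x - y) $ i * 1)"
    unfolding e by (rule poly_bd.var[OF poly_bd.const]) auto
  then show ?thesis by simp
qed

lemma wseries_lcoeff_const: "wseries (lcoeff P (\<lambda>x. c) y) u = c"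
proof -
  have w: "wop P w (\<lambda>x. c) = (\<lambda>x. if w = [] then c else 0)" for w
    by (induction w) (auto simp: vop_def)
  have "wsum (lcoeff P (\<lambda>x. c) y) k u = (if k = 0 then c else 0)" for k
    by (cases k) (auto simp: wsum_def lcoeff_def w intro!: sum.neutral)
  then show ?thesis unfolding wseries_def using suminf_finite[of "{0}" "\<lambda>k. if k = 0 then c else 0"] by simp
qed

lemma wseries_lcoeff_add:
  assumes "poly_bd y D N f" "poly_bd y D M g" "norm1 u < 1 / word_growth CARD('p) D A"
  shows "wseries (lcoeff P (\<lambda>x. f x + g x) y) u = wseries (lcoeff P f y) u + wseries (lcoeff P g y) u"
proof -
  have "wop P w (\<lambda>x. f x + g x) = (\<lambda>x. wop P w f x + wop P w g x)" for w
    by (induction w)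
      (auto simp: vop_add[OF smooth_wop[OF smooth_P poly_bd_smooth[OF assms(1)]] smooth_wop[OF smooth_P poly_bd_smooth[OF assms(2)]]])
  then have "wsum (lcoeff P (\<lambda>x. f x + g x) y) k u = wsum (lcoeff P f y) k u + wsum (lcoeff P g y) k u" for k
    by (simp add: wsum_def lcoeff_def add_divide_distrib distrib_right sum.distrib)
  then show ?thesis unfolding wseries_def
    using suminf_add[OF summable_wsum(2)[OF majorant_lcoeff[OF assms(1)] assms(3)] summable_wsum(2)[OF majorant_lcoeff[OF assms(2)] assms(3)]]
    by simp
qed

lemma wseries_lcoeff_mult:
  assumes "poly_bd y D N f" "poly_bd y D M g" "norm1 u < 1 / word_growth CARD('p) D A"
  shows "wseries (lcoeff P (\<lambda>x. f x * g x) y) u = wseries (lcoeff P f y) u * wseries (lcoeff P g y) u"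
  unfolding wseries_def wsum_lcoeff_mult[OF smooth_P poly_bd_smooth[OF assms(1)] poly_bd_smooth[OF assms(2)]]
  using Cauchy_product[OF summable_wsum(1)[OF majorant_lcoeff[OF assms(1)] assms(3)] summable_wsum(1)[OF majorant_lcoeff[OF assms(2)] assms(3)]]
  by simp

text \<open>The Lie series is multiplicative, so it evaluates polynomials at the Lie exponential.\<close>

lemma wseries_lcoeff_eval:
  assumes "poly_bd y d N f" "d \<le> D" "norm1 u < 1 / word_growth CARD('p) D A"
  shows "wseries (lcoeff P f y) u = f (lie_exp P y u)"
  using assms(1,2)
proof (induction rule: poly_bd.induct)
  case (const c N d)
  show ?case by (rule wseries_lcoeff_const)
next
  case (var d N f N' i)
  have "poly_bd y D N f" by (rule poly_bd_mono[OF var.hyps(1)]) (use var.prems in auto)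
  from wseries_lcoeff_mult[OF poly_bd_coord this assms(3)] show ?case
    using var by (simp add: lie_exp_def)
next
  case (add d N f M g Q)
  have "poly_bd y D N f" "poly_bd y D M g"
    by (rule poly_bd_mono[OF add.hyps(1)] poly_bd_mono[OF add.hyps(2)]; use add.prems in simp)+
  from wseries_lcoeff_add[OF this assms(3)] show ?case using add by simp
qed

lemma poly_bd_lin_field: "poly_bd y D (real CARD('p) * (norm u * A)) (\<lambda>x. lin_field P u x $ i)"
proof -
  have "poly_bd y D (real CARD('p) * (norm u * A)) (\<lambda>x. \<Sum>a\<in>UNIV. u $ a * P a x $ i)"
    by (rule poly_bd_sum[OF finite], rule poly_bd_mono[OF poly_bd_cmult[OF P] order_refl])
      (use A in \<open>simp add: mult_right_mono component_le_norm_cart\<close>)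
  then show ?thesis by (rule poly_bd_eq) (simp add: lin_field_def)
qed

lemma lie_exp_zero: "lie_exp P y 0 = y"
  by (simp add: lie_exp_def wseries_zero lcoeff_def vec_eq_iff)

text \<open>Along a ray the Lie series is a power series in t. Its derivative is the Lie series of Z
  applied to a coordinate, again a polynomial of degree at most D, so
  \<open>wseries_lcoeff_eval\<close> evaluates it at the exponential itself.\<close>

lemma has_vector_derivative_lie_exp:
  assumes t: "norm1 (t *\<^sub>R u) < 1 / word_growth CARD('p) D A"
  shows "((\<lambda>t. lie_exp P y (t *\<^sub>R u)) has_vector_derivative lin_field P u (lie_exp P y (t *\<^sub>R u))) (at t)"
proof -
  let ?R = "1 / word_growth CARD('p) D A"
  have "((\<lambda>t. lie_exp P y (t *\<^sub>R u) $ i) has_real_derivative lin_field P u (lie_exp P y (t *\<^sub>R u)) $ i) (at t)" for i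
  proof -
    let ?X = "\<lambda>x :: real^'p. (x - y) $ i"
    let ?c = "lcoeff P ?X y"
    have R: "?R > 0" using growth_pos by simp
    \<comment> \<open>\<open>K\<close> bounds the range of t on which the power series is known to
      converge; for u = 0 any bound above |t| will do.\<close>
    obtain K where K: "\<bar>t\<bar> < K" "\<And>z. \<bar>z\<bar> < K \<Longrightarrow> \<bar>z\<bar> * norm1 u < ?R"
    proof (cases "norm1 u = 0")
      case True
      then show ?thesis using that[of "\<bar>t\<bar> + 1"] R by simp
    next
      case False
      then have n: "norm1 u > 0" using norm1_nonneg[of u] by simp
      show ?thesis by (rule that[of "?R / norm1 u"]) (use n t in \<open>simp_all only: norm1_scale pos_less_divide_eq\<close>)
    qed
    have m: "majorant ?R (\<lambda>k. 1 * word_growth CARD('p) D A ^ k) ?c" by (rule majorant_lcoeff[OF poly_bd_coord])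
    have e: "lie_exp P y (t *\<^sub>R u) $ i = y $ i + (\<Sum>k. wsum ?c k u * t ^ k)" for t
      by (simp add: lie_exp_def wseries_def wsum_scale mult.commute)
    have "((\<lambda>t. \<Sum>k. wsum ?c k u * t ^ k) has_real_derivative (\<Sum>k. diffs (\<lambda>k. wsum ?c k u) k * t ^ k)) (at t)"
    proof (rule termdiffs_strong'[of K])
      fix z :: real assume "norm z < K"
      then have "norm1 (z *\<^sub>R u) < ?R" using K(2)[of z] by (simp add: norm1_scale)
      from summable_wsum(2)[OF m this] show "summable (\<lambda>k. wsum ?c k u * z ^ k)"
        by (simp add: wsum_scale mult.commute)
    qed (use K in simp)
    moreover have "(\<Sum>k. diffs (\<lambda>k. wsum ?c k u) k * t ^ k) = lin_field P u (lie_exp P y (t *\<^sub>R u)) $ i"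
    proof -
      have Z: "vop (lin_field P u) ?X = (\<lambda>x. lin_field P u x $ i)"
      proof
        fix x
        have "vop (lin_field P u) ?X x = (\<Sum>j\<in>UNIV. if j = i then lin_field P u x $ j else 0)"
          unfolding vop_def by (rule sum.cong) (auto simp: partial_coord_diff simp del: vector_minus_component)
        then show "vop (lin_field P u) ?X x = lin_field P u x $ i" by simp
      qed
      have "diffs (\<lambda>k. wsum ?c k u) k * t ^ k = wsum (lcoeff P (\<lambda>x. lin_field P u x $ i) y) k (t *\<^sub>R u)" for k
        using wsum_lcoeff_Suc[OF smooth_P smooth_coord_diff, of k y i y u]
        by (simp add: diffs_def Z wsum_scale del: vector_minus_component)
      then have "(\<Sum>k. diffs (\<lambda>k. wsum ?c k u) k * t ^ k) = wseries (lcoeff P (\<lambda>x. lin_field P u x $ i) y) (t *\<^sub>R u)"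
        by (simp add: wseries_def)
      then show ?thesis using wseries_lcoeff_eval[OF poly_bd_lin_field order_refl t] by simp
    qed
    ultimately show ?thesis unfolding e by (auto intro!: derivative_eq_intros)
  qed
  then show ?thesis
    unfolding has_vector_derivative_def has_derivative_vec_nth_iff has_field_derivative_def
    by (simp add: mult.commute[of _ "lin_field P u _ $ _"])
qed

lemma Ck_on_lie_exp: "Ck_on k {u. norm1 u < 1 / word_growth CARD('p) D A} (\<lambda>u. lie_exp P y u $ i)"
proof -
  have "Ck_on k {u. norm1 u < 1 / word_growth CARD('p) D A} (\<lambda>u. y $ i + wseries (lcoeff P (\<lambda>x. (x - y) $ i) y) u)"
    by (rule Ck_on_add[OF open_norm1 Ck_on_const Ck_on_wseries[OF majorant_lcoeff[OF poly_bd_coord]]])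
  then show ?thesis by (simp add: lie_exp_def)
qed

lemma partial_lie_exp:
  assumes "norm1 u < 1 / word_growth CARD('p) D A"
  shows "partial j (\<lambda>u. lie_exp P y u $ i) u = wseries (dcoeff j (lcoeff P (\<lambda>x. (x - y) $ i) y)) u"
proof -
  let ?c = "lcoeff P (\<lambda>x. (x - y) $ i) y"
  have m: "majorant (1 / word_growth CARD('p) D A) (\<lambda>k. 1 * word_growth CARD('p) D A ^ k) ?c" by (rule majorant_lcoeff[OF poly_bd_coord])
  have d: "wseries ?c differentiable (at u)" using has_derivative_wseries[OF m assms] differentiable_def by blast
  have e: "(\<lambda>u. lie_exp P y u $ i) = (\<lambda>u. y $ i + wseries ?c u)" by (simp add: lie_exp_def fun_eq_iff)
  show ?thesis unfolding e
    using partial_add[OF differentiable_const d, of j "y $ i"] partial_wseries[OF m assms, of j] by simp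
qed

lemma partial_lie_exp_zero: "partial j (\<lambda>u. lie_exp P y u $ i) 0 = P j y $ i"
proof -
  have "norm1 (0 :: real^'p) < 1 / word_growth CARD('p) D A" using growth_pos by (simp add: norm1_def)
  then have "partial j (\<lambda>u. lie_exp P y u $ i) 0 = lcoeff P (\<lambda>x. (x - y) $ i) y [j]"
    by (simp add: partial_lie_exp wseries_zero del: vector_minus_component)
  also have "\<dots> = (\<Sum>l\<in>UNIV. if l = i then P j y $ l else 0)"
    unfolding lcoeff_def by (simp add: vop_def partial_coord_diff if_distrib[of "\<lambda>a. _ * a"] del: vector_minus_component cong: if_cong)
  finally show ?thesis by simp
qed

text \<open>At half the radius of convergence the twice differentiated majorant is finite, and it
  sees the fields only through the growth constant. This uniformity in y is what gives charts of a
  common size.\<close>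

lemma partial_partial_lie_exp_le:
  assumes "norm1 u \<le> 1 / (2 * word_growth CARD('p) D A)"
  shows "\<bar>partial l (partial j (\<lambda>u. lie_exp P y u $ i)) u\<bar> \<le> (\<Sum>k. diffs (diffs (\<lambda>k. word_growth CARD('p) D A ^ k)) k * (1 / (2 * word_growth CARD('p) D A)) ^ k)"
proof -
  let ?c = "lcoeff P (\<lambda>x. (x - y) $ i) y"
  have m: "majorant (1 / word_growth CARD('p) D A) (\<lambda>k. word_growth CARD('p) D A ^ k) ?c" using majorant_lcoeff[OF poly_bd_coord[of i]] by simp
  have lt: "1 / (2 * word_growth CARD('p) D A) < 1 / word_growth CARD('p) D A" using growth_pos by (simp add: field_simps)
  then have u: "u \<in> {u. norm1 u < 1 / word_growth CARD('p) D A}" using assms by simp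
  have "partial l (partial j (\<lambda>u. lie_exp P y u $ i)) u = partial l (wseries (dcoeff j ?c)) u"
    by (rule partial_cong[OF open_norm1 u]) (simp add: partial_lie_exp del: vector_minus_component)
  also have "\<dots> = wseries (dcoeff l (dcoeff j ?c)) u"
    by (rule partial_wseries[OF majorant_dcoeff[OF m]]) (use u in simp)
  finally show ?thesis using wseries_abs_le[OF majorant_dcoeff[OF majorant_dcoeff[OF m]] assms lt] by simp
qed

end

subsection \<open>Uniqueness of integral curves\<close>

lemma smooth_vf_lipschitz:
  fixes Z :: "'p::finite vfield"
  assumes "smooth_vf Z"
  obtains L where "L \<ge> 0" "\<And>x x'. x \<in> cball c \<rho> \<Longrightarrow> x' \<in> cball c \<rho> \<Longrightarrow> norm (Z x - Z x') \<le> L * norm (x - x')"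
proof -
  have s: "smooth (\<lambda>x. Z x $ i)" for i using assms by (simp add: smooth_vf_def)
  have "\<exists>M. \<forall>x\<in>cball c \<rho>. \<bar>partial j (\<lambda>x. Z x $ i) x\<bar> \<le> M" for i j
  proof -
    have "Ck_on 0 UNIV (partial j (\<lambda>x. Z x $ i))" using smooth_partial[OF s] unfolding smooth_def by blast
    then have "continuous_on UNIV (partial j (\<lambda>x. Z x $ i))" by (rule Ck_on_imp_continuous)
    then have "compact (partial j (\<lambda>x. Z x $ i) ` cball c \<rho>)"
      by (rule compact_continuous_image[OF continuous_on_subset[OF _ subset_UNIV] compact_cball])
    then show ?thesis using compact_imp_bounded by (fastforce simp: bounded_iff)
  qed
  then have "\<forall>i j. \<exists>M. \<forall>x\<in>cball c \<rho>. \<bar>partial j (\<lambda>x. Z x $ i) x\<bar> \<le> M" by blast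
  then obtain M where M: "\<And>i j x. x \<in> cball c \<rho> \<Longrightarrow> \<bar>partial j (\<lambda>x. Z x $ i) x\<bar> \<le> M i j"
    unfolding choice_iff by blast
  define L where "L = (\<Sum>i\<in>UNIV. \<bar>\<Sum>j\<in>UNIV. M i j\<bar>)"
  have "norm (Z x - Z x') \<le> L * norm (x - x')" if "x \<in> cball c \<rho>" "x' \<in> cball c \<rho>" for x x'
  proof -
    have "\<bar>Z x $ i - Z x' $ i\<bar> \<le> \<bar>\<Sum>j\<in>UNIV. M i j\<bar> * norm (x - x')" for i
    proof -
      have "\<bar>Z x $ i - Z x' $ i\<bar> \<le> (\<Sum>j\<in>UNIV. M i j) * norm (x - x')"
        by (rule abs_diff_le_partials[OF convex_cball smooth_differentiable[OF s] M that])
      also have "\<dots> \<le> \<bar>\<Sum>j\<in>UNIV. M i j\<bar> * norm (x - x')" by (rule mult_right_mono) auto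
      finally show ?thesis .
    qed
    then have "norm1 (Z x - Z x') \<le> L * norm (x - x')"
      unfolding norm1_def L_def sum_distrib_right by (intro sum_mono) simp
    then show ?thesis using norm_le_norm1 order_trans by blast
  qed
  moreover have "L \<ge> 0" by (simp add: L_def sum_nonneg)
  ultimately show ?thesis using that by blast
qed

text \<open>Gronwall for the squared distance h: on a ball containing both curves the field is
  Lipschitz, so h times exp(-2Lt) does not increase, and it starts at 0. This gives meaning to the
  definite description in \<open>vf_exp\<close>.\<close>

lemma integral_curve_unique:
  fixes Z :: "'p::finite vfield"
  assumes Z: "smooth_vf Z" and "integral_curve Z y \<phi>" "integral_curve Z y \<psi>"
  shows "\<phi> 1 = \<psi> 1"
proof -
  have d: "t \<in> {0..1} \<Longrightarrow> (\<phi> has_vector_derivative Z (\<phi> t)) (at t within {0..1})"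
    "t \<in> {0..1} \<Longrightarrow> (\<psi> has_vector_derivative Z (\<psi> t)) (at t within {0..1})" for t
    using assms by (auto simp: integral_curve_def)
  have c: "continuous_on {0..1} \<phi>" "continuous_on {0..1} \<psi>"
    unfolding continuous_on_eq_continuous_within
    by (auto intro: has_vector_derivative_continuous[OF d(1)] has_vector_derivative_continuous[OF d(2)])
  have "bounded (\<phi> ` {0..1} \<union> \<psi> ` {0..1})"
    unfolding bounded_Un by (intro conjI compact_imp_bounded compact_continuous_image c) auto
  then obtain \<rho> where \<rho>: "\<phi> ` {0..1} \<union> \<psi> ` {0..1} \<subseteq> cball 0 \<rho>" by (auto simp: bounded_iff subset_eq)
  obtain L where L: "L \<ge> 0" "\<And>x x'. x \<in> cball 0 \<rho> \<Longrightarrow> x' \<in> cball 0 \<rho> \<Longrightarrow> norm (Z x - Z x') \<le> L * norm (x - x')"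
    using smooth_vf_lipschitz[OF Z] by blast
  define h where "h t = (\<phi> t - \<psi> t) \<bullet> (\<phi> t - \<psi> t)" for t
  define g where "g t = h t * exp (- (2 * L * t))" for t
  have "g 1 \<le> g 0"
  proof (rule DERIV_nonpos_imp_decreasing_open[of 0 1 g])
    show "continuous_on {0..1} g" unfolding g_def h_def by (intro continuous_intros c)
    fix t :: real assume t: "0 < t" "t < 1"
    let ?w = "\<phi> t - \<psi> t" and ?dw = "Z (\<phi> t) - Z (\<psi> t)"
    have at: "at t within {0..1} = at t" by (rule at_within_Icc_at) (use t in auto)
    have t': "t \<in> {0..1}" using t by auto
    have "((\<lambda>t. \<phi> t - \<psi> t) has_vector_derivative ?dw) (at t)"
      using has_vector_derivative_diff[OF d(1)[OF t'] d(2)[OF t']] unfolding at .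
    from bounded_bilinear.has_vector_derivative[OF bounded_bilinear_inner this this]
    have "(h has_real_derivative ?w \<bullet> ?dw + ?dw \<bullet> ?w) (at t)"
      unfolding h_def has_real_derivative_iff_has_vector_derivative .
    moreover have "((\<lambda>t. exp (- (2 * L * t))) has_real_derivative exp (- (2 * L * t)) * (- (2 * L))) (at t)"
      by (auto intro!: derivative_eq_intros)
    ultimately have "(g has_real_derivative (?w \<bullet> ?dw + ?dw \<bullet> ?w) * exp (- (2 * L * t)) + exp (- (2 * L * t)) * (- (2 * L)) * h t) (at t)"
      unfolding g_def by (rule DERIV_mult)
    moreover have "?w \<bullet> ?dw \<le> L * h t"
    proof -
      have "\<phi> t \<in> cball 0 \<rho>" "\<psi> t \<in> cball 0 \<rho>" using \<rho> imageI[OF t', of \<phi>] imageI[OF t', of \<psi>] by blast+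
      from L(2)[OF this] have "norm ?w * norm ?dw \<le> norm ?w * (L * norm ?w)" by (rule mult_left_mono) simp
      moreover have "norm ?w * norm ?w = h t" by (simp add: h_def dot_square_norm power2_eq_square)
      ultimately show ?thesis using norm_cauchy_schwarz[of ?w ?dw] by (simp add: mult.left_commute)
    qed
    then have "exp (- (2 * L * t)) * (2 * (?w \<bullet> ?dw) - 2 * L * h t) \<le> 0"
      by (intro mult_nonneg_nonpos) auto
    then have "(?w \<bullet> ?dw + ?dw \<bullet> ?w) * exp (- (2 * L * t)) + exp (- (2 * L * t)) * (- (2 * L)) * h t \<le> 0"
      by (simp add: algebra_simps inner_commute)
    ultimately show "\<exists>y. (g has_real_derivative y) (at t) \<and> y \<le> 0" by blast
  qed simp
  moreover have "g 0 = 0" using assms by (simp add: g_def h_def integral_curve_def)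
  moreover have "0 \<le> h 1" by (simp add: h_def)
  ultimately have "h 1 = 0" by (simp add: g_def mult_le_0_iff)
  then show ?thesis by (simp add: h_def)
qed

lemma vf_exp_eq:
  assumes "smooth_vf Z" "integral_curve Z y \<phi>"
  shows "vf_exp Z y = \<phi> 1"
  unfolding vf_exp_def
proof (rule the_equality)
  show "\<exists>\<phi>'. integral_curve Z y \<phi>' \<and> \<phi>' 1 = \<phi> 1" using assms(2) by blast
  show "z = \<phi> 1" if "\<exists>\<phi>. integral_curve Z y \<phi> \<and> \<phi> 1 = z" for z
    using that integral_curve_unique[OF assms(1) _ assms(2)] by blast
qed

subsection \<open>Inverse functions\<close>

lemma Ck_on_det:
  fixes M :: "real^'p::finite \<Rightarrow> real^'n::finite^'n"
  assumes U: "open U" and M: "\<And>a b. Ck_on k U (\<lambda>u. M u $ a $ b)"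
  shows "Ck_on k U (\<lambda>u. det (M u))"
  unfolding det_def
  by (rule Ck_on_sum[OF U finite_permutations[OF finite]], rule Ck_on_cmult[OF U], rule Ck_on_prod[OF U finite M])

definition jac :: "(real^'p::finite \<Rightarrow> real^'p) \<Rightarrow> real^'p \<Rightarrow> real^'p^'p" where
  "jac F u = (\<chi> i j. partial j (\<lambda>u. F u $ i) u)"

lemma jac_mult_nth: "(jac F u *v v) $ i = (\<Sum>j\<in>UNIV. v $ j * partial j (\<lambda>u. F u $ i) u)"
  by (simp add: jac_def matrix_vector_mult_def mult.commute)

lemma has_derivative_jac:
  assumes "\<And>i. (\<lambda>u. F u $ i) differentiable (at u)"
  shows "(F has_derivative (\<lambda>v. jac F u *v v)) (at u)"
proof -
  have "(\<lambda>v. jac F u *v v) = (\<lambda>h. \<chi> i. \<Sum>j\<in>UNIV. h$j * partial j (\<lambda>x. F x $ i) u)"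
    by (simp add: fun_eq_iff vec_eq_iff jac_mult_nth)
  then show ?thesis using has_derivative_vec_partials[OF assms] by simp
qed

text \<open>Bootstrapping: Cramer's rule writes the partial derivatives of the inverse as the smooth
  functions \<open>q i j\<close> evaluated at the inverse itself, so C^k for the inverse implies
  C^(k+1). The start, continuity, comes from invariance of domain.\<close>

lemma smooth_diffeo_onI:
  fixes F :: "real^'p::finite \<Rightarrow> real^'p"
  assumes U: "open U" and inj: "inj_on F U" and sm: "\<And>k i. Ck_on k U (\<lambda>u. F u $ i)"
    and nz: "\<And>u v. u \<in> U \<Longrightarrow> jac F u *v v = 0 \<Longrightarrow> v = 0"
  shows "smooth_diffeo_on U F"
proof -
  let ?V = "F ` U" and ?g = "inv_into U F"
  have dF: "(\<lambda>u. F u $ i) differentiable (at u)" if "u \<in> U" for i u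
    by (rule Ck_on_differentiable[OF sm[of 1] _ U that]) simp
  have "continuous_on U (\<lambda>u. \<chi> i. F u $ i)"
    by (intro continuous_on_vec_lambda Ck_on_imp_continuous[OF sm])
  then have cF: "continuous_on U F" by simp
  have V: "open ?V" by (rule invariance_of_domain[OF cF U inj])
  obtain g' where g': "homeomorphism U ?V F g'" using invariance_of_domain_homeomorphism[OF U cF _ inj] by auto
  have g'g: "g' x = ?g x" if "x \<in> ?V" for x
    using that g' inj by (auto simp: homeomorphism_def)
  have cg: "continuous_on ?V ?g"
    using g' g'g by (auto simp: homeomorphism_def intro: continuous_on_eq)
  have gU: "?g x \<in> U" "F (?g x) = x" if "x \<in> ?V" for x
    using that by (auto intro: inv_into_into f_inv_into_f)
  define q where "q i j u = det (\<chi> a b. if b = i then axis j 1 $ a else jac F u $ a $ b) * inverse (det (jac F u))" for i j u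
  have det: "det (jac F u) \<noteq> 0" if "u \<in> U" for u
    using nz[OF that] matrix_left_invertible_ker[of "jac F u"] invertible_left_inverse[of "jac F u"] invertible_det_nz[of "jac F u"] by blast
  have jac: "Ck_on k U (\<lambda>u. jac F u $ a $ b)" for k a b
    using Ck_on_partial[OF sm[of "Suc k" a], of b] by (simp add: jac_def)
  have q: "Ck_on k U (q i j)" for k i j
  proof -
    have "Ck_on k U (\<lambda>u. det (\<chi> a b. if b = i then axis j 1 $ a else jac F u $ a $ b) * inverse (det (jac F u)))"
    proof (rule Ck_on_mult[OF U Ck_on_det[OF U] Ck_on_inverse[OF U Ck_on_det[OF U jac] det]])
      show "Ck_on k U (\<lambda>u. (\<chi> a b. if b = i then axis j 1 $ a else jac F u $ a $ b) $ a $ b)" for a b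
        by (cases "b = i") (simp_all add: Ck_on_const jac)
    qed
    then show ?thesis by (simp add: q_def[abs_def])
  qed
  have dg: "\<exists>B. jac F (?g x) ** B = mat 1 \<and> (?g has_derivative (\<lambda>h. B *v h)) (at x)" if x: "x \<in> ?V" for x
  proof -
    let ?J = "jac F (?g x)"
    obtain B where B: "?J ** B = mat 1" "B ** ?J = mat 1"
      using det[OF gU(1)[OF x]] invertible_det_nz[of ?J] unfolding invertible_def by blast
    have "(?g has_derivative (\<lambda>h. B *v h)) (at x)"
    proof (rule has_derivative_inverse_basic[OF has_derivative_jac _ _ _ V x])
      show "matrix_vector_mult B \<circ> matrix_vector_mult ?J = id" by (simp add: fun_eq_iff matrix_vector_mul_assoc B)
      show "bounded_linear (matrix_vector_mult B)" by (rule matrix_vector_mul_bounded_linear)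
      show "continuous (at x) ?g" using cg V x continuous_on_eq_continuous_at by blast
    qed (use gU dF x in auto)
    then show ?thesis using B(1) by blast
  qed
  have pg: "partial j (\<lambda>x. ?g x $ i) x = q i j (?g x)"
    and dgi: "(\<lambda>x. ?g x $ i) differentiable (at x)" if x: "x \<in> ?V" for i j x
  proof -
    let ?J = "jac F (?g x)"
    obtain B where B: "?J ** B = mat 1" "(?g has_derivative (\<lambda>h. B *v h)) (at x)" using dg[OF x] by blast
    have d: "((\<lambda>x. ?g x $ i) has_derivative (\<lambda>h. (B *v h) $ i)) (at x)"
      using B(2) unfolding has_derivative_vec_nth_iff by blast
    then show "(\<lambda>x. ?g x $ i) differentiable (at x)" using differentiable_def by blast
    have "?J *v (B *v axis j 1) = axis j 1" by (simp add: matrix_vector_mul_assoc B)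
    from cramer[OF det[OF gU(1)[OF x]], THEN iffD1, OF this]
    show "partial j (\<lambda>x. ?g x $ i) x = q i j (?g x)"
      unfolding partial_eqI[OF d] q_def by (simp add: divide_inverse)
  qed
  have "Ck_on k ?V (\<lambda>x. ?g x $ i)" for k i
  proof (induction k arbitrary: i)
    case 0
    show ?case unfolding Ck_on_0 by (intro continuous_intros cg)
  next
    case (Suc k)
    have "Ck_on k ?V (\<lambda>x. q i j (?g x))" for j
      by (rule Ck_on_compose[OF V U _ Suc.IH q]) (use gU in auto)
    then have "Ck_on k ?V (partial j (\<lambda>x. ?g x $ i))" for j by (rule Ck_on_eq[OF V _ pg])
    moreover have "(\<lambda>x. ?g x $ i) differentiable_on ?V"
      unfolding differentiable_on_eq_differentiable_at[OF V] using dgi by blast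
    ultimately show ?case unfolding Ck_on_Suc by blast
  qed
  then show ?thesis using U inj V sm by (simp add: smooth_diffeo_on_def smooth_map_on_def)
qed

section \<open>A quantitative inverse function theorem\<close>

context
  fixes F :: "real^'p::finite \<Rightarrow> real^'p" and S :: "(real^'p) set" and \<epsilon> C \<kappa> :: real
  assumes S: "open S" "cball 0 \<epsilon> \<subseteq> S" and \<epsilon>: "0 < \<epsilon>" and F: "\<And>i. Ck_on 2 S (\<lambda>u. F u $ i)"
    and C: "\<And>i j l u. u \<in> cball 0 \<epsilon> \<Longrightarrow> \<bar>partial l (partial j (\<lambda>u. F u $ i)) u\<bar> \<le> C"
    and \<kappa>: "0 < \<kappa>" "\<And>v. \<kappa> * norm v \<le> norm (jac F 0 *v v)"
    and small: "real CARD('p) ^ 3 * C * \<epsilon> \<le> \<kappa> / 2"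
begin

lemma cball_in_S: "u \<in> cball 0 \<epsilon> \<Longrightarrow> u \<in> S"
  using S by blast

lemma F_differentiable: "u \<in> cball 0 \<epsilon> \<Longrightarrow> (\<lambda>u. F u $ i) differentiable (at u)"
  by (rule Ck_on_differentiable[OF F _ S(1) cball_in_S]) simp_all

lemma partial_F_diff:
  assumes "u \<in> cball 0 \<epsilon>"
  shows "\<bar>partial j (\<lambda>u. F u $ i) u - partial j (\<lambda>u. F u $ i) 0\<bar> \<le> real CARD('p) * C * \<epsilon>"
proof -
  have C0: "0 \<le> C" by (rule order_trans[OF abs_ge_zero C[of 0]]) (use \<epsilon> in simp)
  have F1: "Ck_on 1 S (partial j (\<lambda>u. F u $ i))" using F[of i] by (simp add: numeral_2_eq_2 Ck_on_Suc)
  have "\<bar>partial j (\<lambda>u. F u $ i) u - partial j (\<lambda>u. F u $ i) 0\<bar> \<le> (\<Sum>l\<in>(UNIV :: 'p set). C) * norm (u - 0)"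
  proof (rule abs_diff_le_partials[OF convex_cball _ C assms])
    show "partial j (\<lambda>u. F u $ i) differentiable (at z)" if "z \<in> cball 0 \<epsilon>" for z
      by (rule Ck_on_differentiable[OF F1 _ S(1) cball_in_S[OF that]]) simp
  qed (use \<epsilon> in simp_all)
  also have "\<dots> \<le> (\<Sum>l\<in>(UNIV :: 'p set). C) * \<epsilon>"
    using assms C0 by (intro mult_left_mono) auto
  finally show ?thesis by simp
qed

text \<open>Entries of the Jacobian move by at most CARD('p) C \<epsilon> over the ball; summing
  over columns and then over rows gives the cube in the smallness condition, and half of \<kappa>
  survives.\<close>

lemma jac_lower_bound:
  assumes "u \<in> cball 0 \<epsilon>"
  shows "\<kappa> / 2 * norm v \<le> norm (jac F u *v v)"
proof -
  let ?n = "real CARD('p)"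
  have "\<bar>(jac F u *v v - jac F 0 *v v) $ i\<bar> \<le> ?n * (?n * C * \<epsilon>) * norm v" for i
  proof -
    have "(jac F u *v v - jac F 0 *v v) $ i = (\<Sum>j\<in>UNIV. v $ j * (partial j (\<lambda>u. F u $ i) u - partial j (\<lambda>u. F u $ i) 0))"
      by (simp add: jac_mult_nth right_diff_distrib sum_subtractf)
    also have "norm \<dots> \<le> (\<Sum>j\<in>(UNIV :: 'p set). norm v * (?n * C * \<epsilon>))"
      by (rule sum_norm_le) (auto simp: abs_mult intro!: mult_mono component_le_norm_cart partial_F_diff[OF assms])
    finally show ?thesis by (simp add: mult_ac)
  qed
  then have "norm1 (jac F u *v v - jac F 0 *v v) \<le> (\<Sum>i\<in>(UNIV :: 'p set). ?n * (?n * C * \<epsilon>) * norm v)"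
    unfolding norm1_def by (rule sum_mono)
  also have "\<dots> = ?n ^ 3 * C * \<epsilon> * norm v" by (simp add: power3_eq_cube)
  also have "\<dots> \<le> \<kappa> / 2 * norm v" by (rule mult_right_mono[OF small]) simp
  finally have "norm (jac F u *v v - jac F 0 *v v) \<le> \<kappa> / 2 * norm v" using norm_le_norm1 order_trans by blast
  moreover have "norm (jac F 0 *v v) \<le> norm (jac F u *v v) + norm (jac F u *v v - jac F 0 *v v)"
    by (metis norm_minus_commute norm_triangle_sub)
  ultimately show ?thesis using \<kappa>(2)[of v] by (simp add: field_simps)
qed

text \<open>F minus its linearisation at 0 has Lipschitz constant at most \<kappa> / 2, whereas the
  linearisation stretches by at least \<kappa>.\<close>

lemma expanding:
  assumes "u \<in> cball 0 \<epsilon>" "u' \<in> cball 0 \<epsilon>"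
  shows "\<kappa> / 2 * norm (u - u') \<le> norm (F u - F u')"
proof -
  let ?n = "real CARD('p)" and ?d = "norm (u - u')"
  have "\<bar>(F u - F u' - jac F 0 *v (u - u')) $ i\<bar> \<le> ?n * (?n * C * \<epsilon>) * ?d" for i
  proof -
    let ?T = "\<lambda>u. \<Sum>j\<in>UNIV. partial j (\<lambda>u. F u $ i) 0 * u $ j"
    have dT: "?T differentiable (at z)" for z by (intro differentiable_sum differentiable_mult) auto
    have pT: "partial l ?T z = partial l (\<lambda>u. F u $ i) 0" for l z
    proof -
      have "partial l ?T z = (\<Sum>j\<in>UNIV. partial j (\<lambda>u. F u $ i) 0 * (if l = j then 1 else 0))"
        by (subst partial_sum) (auto simp: partial_cmult intro!: differentiable_mult)
      also have "\<dots> = (\<Sum>j\<in>UNIV. if l = j then partial j (\<lambda>u. F u $ i) 0 else 0)" by (rule sum.cong) auto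
      finally show ?thesis by simp
    qed
    have "\<bar>(F u $ i - ?T u) - (F u' $ i - ?T u')\<bar> \<le> (\<Sum>j\<in>(UNIV :: 'p set). ?n * C * \<epsilon>) * ?d"
    proof (rule abs_diff_le_partials[OF convex_cball _ _ assms])
      fix z assume z: "z \<in> cball (0 :: real^'p) \<epsilon>"
      show "(\<lambda>u. F u $ i - ?T u) differentiable (at z)" by (intro differentiable_diff F_differentiable[OF z] dT)
      show "\<bar>partial j (\<lambda>u. F u $ i - ?T u) z\<bar> \<le> ?n * C * \<epsilon>" for j
        unfolding partial_diff[OF F_differentiable[OF z] dT] pT by (rule partial_F_diff[OF z])
    qed
    moreover have "(F u - F u' - jac F 0 *v (u - u')) $ i = (F u $ i - ?T u) - (F u' $ i - ?T u')"
      by (simp add: jac_mult_nth left_diff_distrib sum_subtractf mult.commute)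
    ultimately show ?thesis by (simp add: mult_ac)
  qed
  then have "norm1 (F u - F u' - jac F 0 *v (u - u')) \<le> (\<Sum>i\<in>(UNIV :: 'p set). ?n * (?n * C * \<epsilon>) * ?d)"
    unfolding norm1_def by (rule sum_mono)
  also have "\<dots> = ?n ^ 3 * C * \<epsilon> * ?d" by (simp add: power3_eq_cube)
  also have "\<dots> \<le> \<kappa> / 2 * ?d" by (rule mult_right_mono[OF small]) simp
  finally have "norm (F u - F u' - jac F 0 *v (u - u')) \<le> \<kappa> / 2 * ?d" using norm_le_norm1 order_trans by blast
  moreover have "norm (jac F 0 *v (u - u')) \<le> norm (F u - F u') + norm (F u - F u' - jac F 0 *v (u - u'))"
    by (metis norm_minus_commute norm_triangle_sub)
  ultimately show ?thesis using \<kappa>(2)[of "u - u'"] by (simp add: field_simps)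
qed

lemma inj_on_F: "inj_on F (cball 0 \<epsilon>)"
proof (rule inj_onI)
  fix u u' assume "u \<in> cball 0 \<epsilon>" "u' \<in> cball 0 \<epsilon>" "F u = F u'"
  with expanding[of u u'] \<kappa>(1) show "u = u'" by (simp add: mult_le_0_iff)
qed

lemma continuous_on_F: "continuous_on (cball 0 \<epsilon>) F"
proof -
  have "continuous_on S (\<lambda>u. \<chi> i. F u $ i)" by (intro continuous_on_vec_lambda Ck_on_imp_continuous[OF F])
  then show ?thesis using continuous_on_subset[OF _ S(2)] by simp
qed

text \<open>By \<open>expanding\<close> the sphere of radius \<epsilon> is mapped outside the target
  ball. Within that ball the image of the open ball is therefore open and also closed, and
  connectedness finishes.\<close>

lemma ball_subset_image: "ball (F 0) (\<kappa> / 2 * \<epsilon>) \<subseteq> F ` ball 0 \<epsilon>"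
proof -
  let ?A = "ball (F 0) (\<kappa> / 2 * \<epsilon>)" and ?U = "F ` ball 0 \<epsilon>" and ?V = "- (F ` cball 0 \<epsilon>)"
  have oU: "open ?U"
    by (rule invariance_of_domain[OF continuous_on_subset[OF continuous_on_F ball_subset_cball] open_ball
          inj_on_subset[OF inj_on_F ball_subset_cball]])
  have oV: "open ?V"
    by (rule open_Compl[OF compact_imp_closed[OF compact_continuous_image[OF continuous_on_F compact_cball]]])
  have "?A \<subseteq> ?U \<union> ?V"
  proof
    fix z assume z: "z \<in> ?A"
    show "z \<in> ?U \<union> ?V"
    proof (rule ccontr)
      assume n: "z \<notin> ?U \<union> ?V"
      then obtain u where u: "u \<in> cball 0 \<epsilon>" "z = F u" by auto
      with n have "norm u = \<epsilon>" by (cases "norm u < \<epsilon>") auto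
      then have "\<kappa> / 2 * \<epsilon> \<le> dist (F 0) z" using expanding[OF u(1), of 0] \<epsilon> u(2) by (simp add: dist_norm norm_minus_commute)
      then show False using z by simp
    qed
  qed
  moreover have "?U \<inter> ?V \<inter> ?A = {}" by auto
  ultimately have "?U \<inter> ?A = {} \<or> ?V \<inter> ?A = {}" by (intro connectedD[OF connected_ball oU oV])
  moreover have "F 0 \<in> ?U \<inter> ?A" using \<epsilon> \<kappa>(1) by simp
  ultimately have "?V \<inter> ?A = {}" by blast
  then show ?thesis using \<open>?A \<subseteq> ?U \<union> ?V\<close> by blast
qed

end

subsection \<open>A weighted estimate for linear differential equations\<close>

text \<open>The forcing v is recovered from the endpoint of the solution. After division by the
  weights let S be the maximum of |c| and m that of |v|. Since c stays within S/4 of t v, both S <=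
  m + S/4 and m <= Q + S/4 hold, whence m <= 2 Q.\<close>

lemma weighted_linear_ode:
  fixes c :: "real \<Rightarrow> 'p::finite \<Rightarrow> real"
  assumes der: "\<And>k t. t \<in> {0..1} \<Longrightarrow> ((\<lambda>t. c t k) has_real_derivative v k - (\<Sum>l\<in>UNIV. M t k l * c t l)) (at t)"
    and c0: "\<And>k. c 0 k = 0" and \<omega>: "\<And>k. 0 < \<omega> k"
    and M: "\<And>t k l. t \<in> {0..1} \<Longrightarrow> \<bar>M t k l\<bar> * \<omega> l \<le> \<omega> k / (4 * real CARD('p))"
    and c1: "\<And>k. \<bar>c 1 k\<bar> \<le> Q * \<omega> k"
  shows "\<bar>v k\<bar> \<le> 2 * Q * \<omega> k"
proof -
  let ?f = "\<lambda>k t. \<bar>c t k\<bar> / \<omega> k" and ?m = "\<lambda>k. \<bar>v k\<bar> / \<omega> k"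
  have "continuous_on {0..1} (\<lambda>t. c t k)" for k
    by (rule continuous_at_imp_continuous_on) (use der DERIV_isCont in blast)
  then have "continuous_on {0..1} (?f k)" for k
    using \<omega>[of k] by (intro continuous_intros) auto
  then have "\<exists>t\<in>{0..1}. \<forall>s\<in>{0..1}. ?f k s \<le> ?f k t" for k
    by (intro continuous_attains_sup) auto
  then have "\<forall>k. \<exists>t. t \<in> {0..1} \<and> (\<forall>s\<in>{0..1}. ?f k s \<le> ?f k t)" by blast
  from choice[OF this] obtain \<tau> where \<tau>0: "\<forall>k. \<tau> k \<in> {0..1} \<and> (\<forall>s\<in>{0..1}. ?f k s \<le> ?f k (\<tau> k))" ..
  have \<tau>: "\<tau> k \<in> {0..1}" "s \<in> {0..1} \<Longrightarrow> ?f k s \<le> ?f k (\<tau> k)" for k s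
    using \<tau>0[THEN spec, of k] by simp_all
  define S where "S = Max (range (\<lambda>k. ?f k (\<tau> k)))"
  have S: "?f k s \<le> S" if "s \<in> {0..1}" for k s
  proof -
    have "?f k (\<tau> k) \<le> S" unfolding S_def by (rule Max_ge) auto
    then show ?thesis using \<tau>(2)[OF that, of k] by linarith
  qed
  define m where "m = Max (range ?m)"
  have m: "?m k \<le> m" for k unfolding m_def by (rule Max_ge) auto
  have c_le: "\<bar>c s k\<bar> \<le> S * \<omega> k" if "s \<in> {0..1}" for k s
    using S[OF that, of k] \<omega>[of k] by (simp add: divide_le_eq)
  have close: "\<bar>c s k - s * v k\<bar> \<le> S / 4 * \<omega> k" if s: "s \<in> {0..1}" for k s
  proof -
    have "norm ((c s k - s * v k) - (c 0 k - 0 * v k)) \<le> S / 4 * \<omega> k * norm (s - 0)"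
    proof (rule field_differentiable_bound[of "{0..1}" "\<lambda>t. c t k - t * v k" "\<lambda>t. - (\<Sum>l\<in>UNIV. M t k l * c t l)"])
      fix t :: real assume t: "t \<in> {0..1}"
      show "((\<lambda>t. c t k - t * v k) has_field_derivative - (\<Sum>l\<in>UNIV. M t k l * c t l)) (at t within {0..1})"
        by (rule DERIV_subset[OF _ subset_UNIV]) (auto intro!: derivative_eq_intros der t)
      have "norm (\<Sum>l\<in>UNIV. M t k l * c t l) \<le> (\<Sum>l\<in>(UNIV :: 'p set). \<omega> k / (4 * real CARD('p)) * S)"
      proof (rule sum_norm_le)
        fix l
        have S0: "0 \<le> S" by (rule order_trans[OF _ S[OF t, of l]]) (use \<omega>[of l] in simp)
        have "\<bar>M t k l\<bar> * \<bar>c t l\<bar> \<le> \<bar>M t k l\<bar> * (S * \<omega> l)" by (rule mult_left_mono[OF c_le[OF t]]) simp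
        also have "\<dots> = (\<bar>M t k l\<bar> * \<omega> l) * S" by simp
        also have "\<dots> \<le> \<omega> k / (4 * real CARD('p)) * S" by (rule mult_right_mono[OF M[OF t] S0])
        finally show "norm (M t k l * c t l) \<le> \<omega> k / (4 * real CARD('p)) * S" by (simp add: abs_mult)
      qed
      then show "norm (- (\<Sum>l\<in>UNIV. M t k l * c t l)) \<le> S / 4 * \<omega> k" by (simp add: mult.commute)
    qed (use s in auto)
    then have *: "\<bar>c s k - s * v k\<bar> \<le> S / 4 * \<omega> k * s" using s c0 by simp
    have "0 \<le> S / 4 * \<omega> k" using order_trans[OF abs_ge_zero c_le[OF s, of k]] by simp
    then have "S / 4 * \<omega> k * s \<le> S / 4 * \<omega> k * 1" using s by (intro mult_left_mono) auto
    then show ?thesis using * by simp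
  qed
  have "S \<le> m + S / 4"
  proof -
    have "S \<in> range (\<lambda>k. ?f k (\<tau> k))" unfolding S_def by (rule Max_in) auto
    then obtain k where k: "S = ?f k (\<tau> k)" by blast
    have "\<bar>\<tau> k * v k\<bar> \<le> \<bar>v k\<bar>" using \<tau>(1)[of k] by (simp add: abs_mult mult_left_le_one_le)
    then have "\<bar>c (\<tau> k) k\<bar> \<le> \<bar>v k\<bar> + S / 4 * \<omega> k" using close[OF \<tau>(1), of k k] by linarith
    then have "?f k (\<tau> k) \<le> ?m k + S / 4" using \<omega>[of k] by (simp add: field_simps)
    then show ?thesis using m[of k] k by linarith
  qed
  moreover have "m \<le> Q + S / 4"
  proof -
    have "m \<in> range ?m" unfolding m_def by (rule Max_in) auto
    then obtain k where k: "m = ?m k" by blast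
    have "\<bar>c 1 k - 1 * v k\<bar> \<le> S / 4 * \<omega> k" by (rule close) simp
    then have "\<bar>v k\<bar> \<le> Q * \<omega> k + S / 4 * \<omega> k" using c1[of k] by linarith
    then show ?thesis unfolding k using \<omega>[of k] by (simp add: divide_le_eq distrib_right)
  qed
  moreover have "0 \<le> m" by (rule order_trans[OF _ m[of k]]) (use \<omega>[of k] in simp)
  ultimately have "m \<le> 2 * Q" by linarith
  then have "?m k \<le> 2 * Q" using m[of k] by linarith
  then show ?thesis using \<omega>[of k] by (simp add: divide_le_eq)
qed

subsection \<open>The differential of the exponential map in a frame\<close>

lemma lin_field_nth: "lin_field P u x $ i = (\<Sum>a\<in>UNIV. u $ a * P a x $ i)"
  by (simp add: lin_field_def)

lemma has_real_derivative_line: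
  fixes f :: "real^'p::finite \<Rightarrow> real"
  assumes "f differentiable (at (t *\<^sub>R u))"
  shows "((\<lambda>t. f (t *\<^sub>R u)) has_real_derivative (\<Sum>k\<in>UNIV. u $ k * partial k f (t *\<^sub>R u))) (at t)"
proof -
  have "((\<lambda>t. t *\<^sub>R u) has_derivative (\<lambda>h. h *\<^sub>R u)) (at t)" by (auto intro!: derivative_eq_intros)
  from has_derivative_compose[OF this has_derivative_partials[OF assms]]
  show ?thesis unfolding has_field_derivative_def
    by (simp add: mult.assoc sum_distrib_left[symmetric] mult_commute_abs)
qed

lemma prod_differentiable:
  fixes f :: "'a \<Rightarrow> real \<Rightarrow> real"
  assumes "finite A" "\<And>a. a \<in> A \<Longrightarrow> f a differentiable (at t)"
  shows "(\<lambda>t. \<Prod>a\<in>A. f a t) differentiable (at t)"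
  using assms
proof (induction A)
  case (insert a A)
  have "(\<lambda>t. f a t * (\<Prod>a\<in>A. f a t)) differentiable (at t)"
    by (rule differentiable_mult[OF insert.prems[OF insertI1] insert.IH[OF insert.prems[OF insertI2]]])
  then show ?case unfolding prod.insert[OF insert.hyps] .
qed simp

lemma det_differentiable:
  fixes M :: "real \<Rightarrow> real^'n::finite^'n"
  assumes "\<And>a b. (\<lambda>t. M t $ a $ b) differentiable (at t)"
  shows "(\<lambda>t. det (M t)) differentiable (at t)"
  unfolding det_def
  by (rule differentiable_sum[OF finite_permutations[OF finite]], rule ballI,
      rule differentiable_mult[OF differentiable_const prod_differentiable[OF finite assms]])

text \<open>Index bookkeeping for a fixed component i: with \<open>p a m\<close> the m-th component
  of P_a and \<open>d m a\<close> the m-th partial derivative of its i-th component, the difference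
  on the right is the i-th component of the bracket of P_a and P_l.\<close>

lemma bracket_cancel:
  fixes c u :: "'p::finite \<Rightarrow> real" and p :: "'p \<Rightarrow> 'p \<Rightarrow> real" and d :: "'p \<Rightarrow> 'p \<Rightarrow> real"
  shows "(\<Sum>a\<in>UNIV. u a * (\<Sum>m\<in>UNIV. d m a * (\<Sum>l\<in>UNIV. c l * p l m))) - (\<Sum>l\<in>UNIV. c l * (\<Sum>m\<in>UNIV. d m l * (\<Sum>a\<in>UNIV. u a * p a m)))
    = - (\<Sum>a\<in>UNIV. \<Sum>l\<in>UNIV. u a * c l * ((\<Sum>m\<in>UNIV. p a m * d m l) - (\<Sum>m\<in>UNIV. p l m * d m a)))"
proof -
  have "(\<Sum>a\<in>UNIV. u a * (\<Sum>m\<in>UNIV. d m a * (\<Sum>l\<in>UNIV. c l * p l m))) = (\<Sum>a\<in>UNIV. \<Sum>l\<in>UNIV. u a * c l * (\<Sum>m\<in>UNIV. p l m * d m a))"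
  proof (rule sum.cong[OF refl])
    fix a
    have "u a * (\<Sum>m\<in>UNIV. d m a * (\<Sum>l\<in>UNIV. c l * p l m)) = (\<Sum>m\<in>UNIV. \<Sum>l\<in>UNIV. u a * c l * (p l m * d m a))"
      by (simp add: sum_distrib_left mult_ac)
    also have "\<dots> = (\<Sum>l\<in>UNIV. \<Sum>m\<in>UNIV. u a * c l * (p l m * d m a))" by (rule sum.swap)
    finally show "u a * (\<Sum>m\<in>UNIV. d m a * (\<Sum>l\<in>UNIV. c l * p l m)) = (\<Sum>l\<in>UNIV. u a * c l * (\<Sum>m\<in>UNIV. p l m * d m a))"
      by (simp add: sum_distrib_left)
  qed
  moreover have "(\<Sum>l\<in>UNIV. c l * (\<Sum>m\<in>UNIV. d m l * (\<Sum>a\<in>UNIV. u a * p a m))) = (\<Sum>a\<in>UNIV. \<Sum>l\<in>UNIV. u a * c l * (\<Sum>m\<in>UNIV. p a m * d m l))"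
  proof -
    have "(\<Sum>l\<in>UNIV. c l * (\<Sum>m\<in>UNIV. d m l * (\<Sum>a\<in>UNIV. u a * p a m))) = (\<Sum>l\<in>UNIV. \<Sum>a\<in>UNIV. \<Sum>m\<in>UNIV. u a * c l * (p a m * d m l))"
    proof (rule sum.cong[OF refl])
      fix l
      have "c l * (\<Sum>m\<in>UNIV. d m l * (\<Sum>a\<in>UNIV. u a * p a m)) = (\<Sum>m\<in>UNIV. \<Sum>a\<in>UNIV. u a * c l * (p a m * d m l))"
        by (simp add: sum_distrib_left mult_ac)
      also have "\<dots> = (\<Sum>a\<in>UNIV. \<Sum>m\<in>UNIV. u a * c l * (p a m * d m l))" by (rule sum.swap)
      finally show "c l * (\<Sum>m\<in>UNIV. d m l * (\<Sum>a\<in>UNIV. u a * p a m)) = (\<Sum>a\<in>UNIV. \<Sum>m\<in>UNIV. u a * c l * (p a m * d m l))" .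
    qed
    also have "\<dots> = (\<Sum>a\<in>UNIV. \<Sum>l\<in>UNIV. \<Sum>m\<in>UNIV. u a * c l * (p a m * d m l))" by (rule sum.swap)
    finally show ?thesis by (simp add: sum_distrib_left)
  qed
  ultimately show ?thesis by (simp add: right_diff_distrib sum_subtractf)
qed

section \<open>The linearised exponential along a ray\<close>

context
  fixes P :: "'p::finite \<Rightarrow> 'p vfield" and y :: "real^'p" and D :: nat and A :: real
  assumes P: "\<And>a j. poly_bd y D A (\<lambda>x. P a x $ j)" and D: "1 \<le> D" and A: "0 < A"
begin

abbreviation "EE \<equiv> lie_exp P y"
abbreviation "expdom \<equiv> {u :: real^'p. norm1 u < 1 / word_growth CARD('p) D A}"

lemma EE_Ck: "Ck_on k expdom (\<lambda>u. EE u $ i)"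
  by (rule Ck_on_lie_exp[OF P D A])

lemma EE_differentiable: "u \<in> expdom \<Longrightarrow> (\<lambda>u. EE u $ i) differentiable (at u)"
  by (rule Ck_on_differentiable[OF EE_Ck[of 1] _ open_norm1]) auto

lemma partial_EE_differentiable: "u \<in> expdom \<Longrightarrow> partial j (\<lambda>u. EE u $ i) differentiable (at u)"
  by (rule Ck_on_differentiable[OF Ck_on_partial[OF EE_Ck[of "Suc 1"]] _ open_norm1]) auto

lemma P_differentiable: "(\<lambda>x. P a x $ i) differentiable (at x)"
  by (rule smooth_differentiable[OF poly_bd_smooth[OF P]])

lemma P_EE_differentiable:
  assumes "u \<in> expdom"
  shows "(\<lambda>u. P a (EE u) $ i) differentiable (at u)"
  using has_derivative_compose_partials[OF EE_differentiable[OF assms] P_differentiable] differentiable_def by blast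

lemma DERIV_EE_line:
  assumes "t *\<^sub>R u \<in> expdom"
  shows "((\<lambda>t. EE (t *\<^sub>R u) $ i) has_real_derivative lin_field P u (EE (t *\<^sub>R u)) $ i) (at t)"
proof -
  have "((\<lambda>t. EE (t *\<^sub>R u)) has_vector_derivative lin_field P u (EE (t *\<^sub>R u))) (at t)"
    by (rule has_vector_derivative_lie_exp[where A = A and D = D]) (use P D A assms in auto)
  then show ?thesis
    unfolding has_vector_derivative_def has_derivative_vec_nth_iff has_field_derivative_def
    by (simp add: mult_commute_abs)
qed

text \<open>The radial derivative of the exponential computed twice, by the chain rule and by the
  differential equation. Differentiating this identity in u takes the place of a theorem on
  dependence on parameters.\<close>

lemma euler_identity:
  assumes "u \<in> expdom"
  shows "(\<Sum>k\<in>UNIV. u $ k * partial k (\<lambda>u. EE u $ i) u) = (\<Sum>a\<in>UNIV. u $ a * P a (EE u) $ i)"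
  using DERIV_unique[OF has_real_derivative_line[of "\<lambda>u. EE u $ i" 1 u] DERIV_EE_line[of 1 u i]]
    EE_differentiable[OF assms] assms by (simp add: lin_field_nth)

lemma euler_identity_derivative:
  assumes u: "u \<in> expdom"
  shows "partial j (\<lambda>u. EE u $ i) u + (\<Sum>k\<in>UNIV. u $ k * partial j (partial k (\<lambda>u. EE u $ i)) u)
    = P j (EE u) $ i + (\<Sum>a\<in>UNIV. u $ a * (\<Sum>l\<in>UNIV. partial j (\<lambda>u. EE u $ l) u * partial l (\<lambda>x. P a x $ i) (EE u)))"
proof -
  have "partial j (\<lambda>u. \<Sum>k\<in>UNIV. u $ k * partial k (\<lambda>u. EE u $ i) u) u
      = (\<Sum>k\<in>UNIV. partial j (\<lambda>u. u $ k * partial k (\<lambda>u. EE u $ i) u) u)"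
    by (rule partial_sum) (auto intro!: differentiable_mult partial_EE_differentiable[OF u])
  also have "\<dots> = (\<Sum>k\<in>UNIV. u $ k * partial j (partial k (\<lambda>u. EE u $ i)) u + (if j = k then partial k (\<lambda>u. EE u $ i) u else 0))"
    by (rule sum.cong) (auto simp: partial_mult[OF coord_differentiable partial_EE_differentiable[OF u]])
  finally have 1: "partial j (\<lambda>u. \<Sum>k\<in>UNIV. u $ k * partial k (\<lambda>u. EE u $ i) u) u
      = (\<Sum>k\<in>UNIV. u $ k * partial j (partial k (\<lambda>u. EE u $ i)) u) + partial j (\<lambda>u. EE u $ i) u"
    by (simp add: sum.distrib)
  have "partial j (\<lambda>u. \<Sum>a\<in>UNIV. u $ a * P a (EE u) $ i) u = (\<Sum>a\<in>UNIV. partial j (\<lambda>u. u $ a * P a (EE u) $ i) u)"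
    by (rule partial_sum) (auto intro!: differentiable_mult P_EE_differentiable[OF u])
  also have "\<dots> = (\<Sum>a\<in>UNIV. u $ a * partial j (\<lambda>u. P a (EE u) $ i) u + (if j = a then P a (EE u) $ i else 0))"
    by (rule sum.cong) (auto simp: partial_mult[OF coord_differentiable P_EE_differentiable[OF u]])
  finally have 2: "partial j (\<lambda>u. \<Sum>a\<in>UNIV. u $ a * P a (EE u) $ i) u
      = (\<Sum>a\<in>UNIV. u $ a * (\<Sum>l\<in>UNIV. partial j (\<lambda>u. EE u $ l) u * partial l (\<lambda>x. P a x $ i) (EE u))) + P j (EE u) $ i"
    by (simp add: sum.distrib partial_compose[OF EE_differentiable[OF u] P_differentiable])
  have "partial j (\<lambda>u. \<Sum>k\<in>UNIV. u $ k * partial k (\<lambda>u. EE u $ i) u) u = partial j (\<lambda>u. \<Sum>a\<in>UNIV. u $ a * P a (EE u) $ i) u"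
    by (rule partial_cong[OF open_norm1 u euler_identity])
  then show ?thesis using 1 2 by simp
qed

text \<open>The variation field of the ray: the derivative of \<open>EE (t u)\<close> with respect
  to u in direction v. It vanishes at t = 0 and equals \<open>jac EE u *v v\<close> at t =
  1.\<close>

definition variation :: "real^'p \<Rightarrow> real^'p \<Rightarrow> real \<Rightarrow> 'p \<Rightarrow> real" where
  "variation u v t i = (\<Sum>j\<in>UNIV. v $ j * (t * partial j (\<lambda>u. EE u $ i) (t *\<^sub>R u)))"

text \<open>This is the linearised equation. Symmetry of second derivatives identifies the radial
  derivative of \<open>partial j\<close> with the sum in the differentiated Euler identity.\<close>

lemma DERIV_variation:
  assumes u: "t *\<^sub>R u \<in> expdom"
  shows "((\<lambda>t. variation u v t i) has_real_derivative (\<Sum>j\<in>UNIV. v $ j * P j (EE (t *\<^sub>R u)) $ i) +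
     (\<Sum>a\<in>UNIV. u $ a * (\<Sum>l\<in>UNIV. partial l (\<lambda>x. P a x $ i) (EE (t *\<^sub>R u)) * variation u v t l))) (at t)"
proof -
  let ?e = "\<lambda>j i. partial j (\<lambda>u. EE u $ i) (t *\<^sub>R u)" and ?d = "\<lambda>l a. partial l (\<lambda>x. P a x $ i) (EE (t *\<^sub>R u))"
  have C2: "Ck_on 2 expdom (\<lambda>u. EE u $ i)" by (rule EE_Ck)
  have "((\<lambda>t. variation u v t i) has_real_derivative (\<Sum>j\<in>UNIV. v $ j * (1 * ?e j i +
      t * (\<Sum>k\<in>UNIV. u $ k * partial k (partial j (\<lambda>u. EE u $ i)) (t *\<^sub>R u))))) (at t)"
    unfolding variation_def
    by (auto intro!: derivative_eq_intros has_real_derivative_line partial_EE_differentiable[OF u] sum.cong)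
  moreover have "1 * ?e j i + t * (\<Sum>k\<in>UNIV. u $ k * partial k (partial j (\<lambda>u. EE u $ i)) (t *\<^sub>R u))
     = P j (EE (t *\<^sub>R u)) $ i + (\<Sum>a\<in>UNIV. u $ a * (\<Sum>l\<in>UNIV. t * ?e j l * ?d l a))" for j
  proof -
    have "t * (\<Sum>k\<in>UNIV. u $ k * partial k (partial j (\<lambda>u. EE u $ i)) (t *\<^sub>R u))
       = (\<Sum>k\<in>UNIV. (t *\<^sub>R u) $ k * partial j (partial k (\<lambda>u. EE u $ i)) (t *\<^sub>R u))"
      unfolding sum_distrib_left
      by (rule sum.cong[OF refl]) (simp add: partial_commute[OF open_norm1 C2 u, of _ j] mult.assoc)
    moreover have "(\<Sum>a\<in>UNIV. (t *\<^sub>R u) $ a * (\<Sum>l\<in>UNIV. ?e j l * ?d l a)) = (\<Sum>a\<in>UNIV. u $ a * (\<Sum>l\<in>UNIV. t * ?e j l * ?d l a))"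
      by (rule sum.cong[OF refl]) (simp add: sum_distrib_left mult_ac)
    ultimately show ?thesis using euler_identity_derivative[OF u, of j i] by simp
  qed
  ultimately have "((\<lambda>t. variation u v t i) has_real_derivative (\<Sum>j\<in>UNIV. v $ j * (P j (EE (t *\<^sub>R u)) $ i +
      (\<Sum>a\<in>UNIV. u $ a * (\<Sum>l\<in>UNIV. t * ?e j l * ?d l a))))) (at t)" by simp
  moreover have "(\<Sum>j\<in>UNIV. v $ j * (\<Sum>a\<in>UNIV. u $ a * (\<Sum>l\<in>UNIV. t * ?e j l * ?d l a)))
     = (\<Sum>a\<in>UNIV. u $ a * (\<Sum>l\<in>UNIV. ?d l a * variation u v t l))"
  proof -
    have "(\<Sum>j\<in>UNIV. v $ j * (\<Sum>a\<in>UNIV. u $ a * (\<Sum>l\<in>UNIV. t * ?e j l * ?d l a)))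
       = (\<Sum>j\<in>UNIV. \<Sum>a\<in>UNIV. \<Sum>l\<in>UNIV. u $ a * (?d l a * (v $ j * (t * ?e j l))))"
      by (simp add: sum_distrib_left mult_ac)
    also have "\<dots> = (\<Sum>a\<in>UNIV. \<Sum>j\<in>UNIV. \<Sum>l\<in>UNIV. u $ a * (?d l a * (v $ j * (t * ?e j l))))" by (rule sum.swap)
    also have "\<dots> = (\<Sum>a\<in>UNIV. \<Sum>l\<in>UNIV. \<Sum>j\<in>UNIV. u $ a * (?d l a * (v $ j * (t * ?e j l))))"
      by (rule sum.cong[OF refl], rule sum.swap)
    finally show ?thesis by (simp add: variation_def sum_distrib_left)
  qed
  ultimately show ?thesis by (simp add: distrib_left sum.distrib)
qed

section \<open>The variation in the moving frame\<close>

context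
  fixes \<epsilon> \<rho> \<kappa> H :: real and \<Lambda> :: "'p \<Rightarrow> 'p \<Rightarrow> real^'p \<Rightarrow> real^'p" and w :: "'p \<Rightarrow> nat"
  assumes ball: "ball 0 \<epsilon> \<subseteq> expdom" "\<And>u. u \<in> ball 0 \<epsilon> \<Longrightarrow> EE u \<in> ball y \<rho>"
    and frame: "0 < \<kappa>" "\<And>x c. x \<in> ball y \<rho> \<Longrightarrow> \<kappa> * norm c \<le> norm (lin_field P c x)"
    and \<Lambda>: "\<And>a l x. x \<in> ball y \<rho> \<Longrightarrow> lie_bracket (P a) (P l) x = lin_field P (\<Lambda> a l x) x"
    and \<Lambda>_le: "\<And>a l x k. x \<in> ball y \<rho> \<Longrightarrow> \<bar>\<Lambda> a l x $ k\<bar> \<le> H"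
    and \<Lambda>_zero: "\<And>a l x k. x \<in> ball y \<rho> \<Longrightarrow> \<Lambda> a l x $ k \<noteq> 0 \<Longrightarrow> w k \<le> w a + w l"
    and w_pos: "\<And>a. 1 \<le> w a"
begin

definition frame_mat :: "real^'p \<Rightarrow> real^'p^'p" where "frame_mat x = (\<chi> i l. P l x $ i)"

lemma frame_mat_mult: "frame_mat x *v c = lin_field P c x"
  by (simp add: frame_mat_def matrix_vector_mult_def lin_field_def vec_eq_iff mult.commute)

lemma lin_field_zero: "x \<in> ball y \<rho> \<Longrightarrow> lin_field P c x = 0 \<Longrightarrow> c = 0"
  using frame(2)[of x c] frame(1) by (simp add: mult_le_0_iff)

lemma det_frame: "x \<in> ball y \<rho> \<Longrightarrow> det (frame_mat x) \<noteq> 0"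
  using lin_field_zero[of x] matrix_left_invertible_ker[of "frame_mat x"] invertible_left_inverse[of "frame_mat x"]
    invertible_det_nz[of "frame_mat x"] unfolding frame_mat_mult by blast

text \<open>Cramer's rule makes the coordinates visibly differentiable in \<open>t\<close>.\<close>

definition vcoord :: "real^'p \<Rightarrow> real^'p \<Rightarrow> real \<Rightarrow> 'p \<Rightarrow> real" where
  "vcoord u v t l = det (\<chi> i m. if m = l then variation u v t i else P m (EE (t *\<^sub>R u)) $ i) * inverse (det (frame_mat (EE (t *\<^sub>R u))))"

lemma variation_eq_vcoord:
  assumes "t *\<^sub>R u \<in> ball 0 \<epsilon>"
  shows "variation u v t i = (\<Sum>l\<in>UNIV. vcoord u v t l * P l (EE (t *\<^sub>R u)) $ i)"
proof -
  let ?x = "EE (t *\<^sub>R u)"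
  have "frame_mat ?x *v (\<chi> l. vcoord u v t l) = (\<chi> i. variation u v t i)"
    by (rule cramer[OF det_frame[OF ball(2)[OF assms]], THEN iffD2])
      (simp add: vec_eq_iff vcoord_def divide_inverse frame_mat_def cong: if_cong)
  then have "(frame_mat ?x *v (\<chi> l. vcoord u v t l)) $ i = variation u v t i" by simp
  then show ?thesis by (simp add: frame_mat_mult lin_field_nth)
qed

lemma vcoord_zero: "vcoord u v 0 l = 0"
proof -
  have "det (\<chi> i m. if m = l then variation u v 0 i else P m (EE (0 *\<^sub>R u)) $ i) = 0"
    by (rule det_zero_column(1)[of l]) (simp add: column_def variation_def vec_eq_iff)
  then show ?thesis by (simp add: vcoord_def)
qed

text \<open>Differentiating the frame expansion of the variation brings in derivatives of the frame
  along the flow. Together with the linearised equation they combine into brackets of the P_a with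
  the P_l, whose frame coordinates are \<Lambda>. The outcome is c' = v - M c with M linear in
  u.\<close>

lemma DERIV_vcoord:
  assumes tu: "t *\<^sub>R u \<in> ball 0 \<epsilon>"
  shows "((\<lambda>t. vcoord u v t k) has_real_derivative
    v $ k - (\<Sum>l\<in>UNIV. (\<Sum>a\<in>UNIV. u $ a * \<Lambda> a l (EE (t *\<^sub>R u)) $ k) * vcoord u v t l)) (at t)"
proof -
  let ?x = "EE (t *\<^sub>R u)"
  have dm: "t *\<^sub>R u \<in> expdom" by (rule subsetD[OF ball(1) tu])
  have x: "?x \<in> ball y \<rho>" by (rule ball(2)[OF tu])
  have dP: "((\<lambda>t. P l (EE (t *\<^sub>R u)) $ i) has_real_derivative
      (\<Sum>m\<in>UNIV. partial m (\<lambda>x. P l x $ i) ?x * (\<Sum>a\<in>UNIV. u $ a * P a ?x $ m))) (at t)" for l i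
  proof -
    have "(\<Sum>k\<in>UNIV. u $ k * partial k (\<lambda>u. P l (EE u) $ i) (t *\<^sub>R u))
      = (\<Sum>k\<in>UNIV. \<Sum>m\<in>UNIV. partial m (\<lambda>x. P l x $ i) ?x * (u $ k * partial k (\<lambda>u. EE u $ m) (t *\<^sub>R u)))"
      by (simp add: partial_compose[OF EE_differentiable[OF dm] P_differentiable] sum_distrib_left mult_ac)
    also have "\<dots> = (\<Sum>m\<in>UNIV. \<Sum>k\<in>UNIV. partial m (\<lambda>x. P l x $ i) ?x * (u $ k * partial k (\<lambda>u. EE u $ m) (t *\<^sub>R u)))"
      by (rule sum.swap)
    also have "\<dots> = (\<Sum>m\<in>UNIV. partial m (\<lambda>x. P l x $ i) ?x * lin_field P u ?x $ m)"
    proof -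
      have "(\<Sum>k\<in>UNIV. u $ k * partial k (\<lambda>u. EE u $ m) (t *\<^sub>R u)) = lin_field P u ?x $ m" for m
        by (rule DERIV_unique[OF has_real_derivative_line[OF EE_differentiable[OF dm]] DERIV_EE_line[OF dm]])
      then show ?thesis by (simp only: sum_distrib_left[symmetric])
    qed
    finally show ?thesis using has_real_derivative_line[OF P_EE_differentiable[OF dm], of l i] by (simp add: lin_field_nth)
  qed
  have "(\<lambda>t. vcoord u v t l) differentiable (at t)" for l
    unfolding vcoord_def
  proof (intro differentiable_mult differentiable_inverse det_differentiable det_frame[OF x])
    have dPt: "(\<lambda>t. P b (EE (t *\<^sub>R u)) $ a) differentiable (at t)" for a b
      using dP real_differentiable_def by blast
    have "(\<lambda>t. variation u v t a) differentiable (at t)" for a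
      using DERIV_variation[OF dm] real_differentiable_def by blast
    then show "(\<lambda>t. (\<chi> i m. if m = l then variation u v t i else P m (EE (t *\<^sub>R u)) $ i) $ a $ b) differentiable (at t)" for a b
      by (cases "b = l") (simp_all add: dPt)
    show "(\<lambda>t. frame_mat (EE (t *\<^sub>R u)) $ a $ b) differentiable (at t)" for a b
      by (simp add: frame_mat_def dPt)
  qed
  then obtain dc where dc: "\<And>l. ((\<lambda>t. vcoord u v t l) has_real_derivative dc l) (at t)"
    unfolding real_differentiable_def by metis
  let ?c = "vcoord u v t"
  let ?B = "\<lambda>a l. lie_bracket (P a) (P l) ?x"
  have eq: "(\<Sum>l\<in>UNIV. dc l * P l ?x $ i) = (\<Sum>j\<in>UNIV. v $ j * P j ?x $ i) - (\<Sum>a\<in>UNIV. \<Sum>l\<in>UNIV. u $ a * ?c l * ?B a l $ i)" for i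
  proof -
    let ?d = "\<lambda>m l. partial m (\<lambda>x. P l x $ i) ?x" and ?p = "\<lambda>l m. P l ?x $ m"
    have "((\<lambda>t. \<Sum>l\<in>UNIV. vcoord u v t l * P l (EE (t *\<^sub>R u)) $ i) has_real_derivative
       (\<Sum>l\<in>UNIV. ?c l * (\<Sum>m\<in>UNIV. ?d m l * (\<Sum>a\<in>UNIV. u $ a * ?p a m)) + dc l * ?p l i)) (at t)"
      by (intro DERIV_sum DERIV_mult' dc dP)
    moreover have "((\<lambda>t. \<Sum>l\<in>UNIV. vcoord u v t l * P l (EE (t *\<^sub>R u)) $ i) has_real_derivative
       (\<Sum>j\<in>UNIV. v $ j * ?p j i) + (\<Sum>a\<in>UNIV. u $ a * (\<Sum>m\<in>UNIV. ?d m a * variation u v t m))) (at t)"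
    proof (rule has_field_derivative_transform_within_open[OF DERIV_variation[OF dm, of v i], of "{s. s *\<^sub>R u \<in> ball 0 \<epsilon>}"])
      show "open {s. s *\<^sub>R u \<in> ball 0 \<epsilon>}"
        by (simp add: open_Collect_less continuous_intros)
    qed (use tu variation_eq_vcoord in auto)
    ultimately have "(\<Sum>l\<in>UNIV. ?c l * (\<Sum>m\<in>UNIV. ?d m l * (\<Sum>a\<in>UNIV. u $ a * ?p a m)) + dc l * ?p l i)
      = (\<Sum>j\<in>UNIV. v $ j * ?p j i) + (\<Sum>a\<in>UNIV. u $ a * (\<Sum>m\<in>UNIV. ?d m a * variation u v t m))"
      by (rule DERIV_unique)
    then have "(\<Sum>l\<in>UNIV. dc l * ?p l i) = (\<Sum>j\<in>UNIV. v $ j * ?p j i) +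
       ((\<Sum>a\<in>UNIV. u $ a * (\<Sum>m\<in>UNIV. ?d m a * (\<Sum>l\<in>UNIV. ?c l * ?p l m))) - (\<Sum>l\<in>UNIV. ?c l * (\<Sum>m\<in>UNIV. ?d m l * (\<Sum>a\<in>UNIV. u $ a * ?p a m))))"
      by (simp add: sum.distrib variation_eq_vcoord[OF tu])
    moreover have "?B a l $ i = (\<Sum>m\<in>UNIV. ?p a m * ?d m l) - (\<Sum>m\<in>UNIV. ?p l m * ?d m a)" for a l
      by (rule lie_bracket_nth) (rule P_differentiable)+
    ultimately show ?thesis using bracket_cancel[of "\<lambda>a. u $ a" ?d ?c ?p] by simp
  qed
  \<comment> \<open>The defect in the claimed equation. Its combination of frame fields vanishes, so
    it is 0 by nondegeneracy of the frame.\<close>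
  define e where "e = (\<chi> k. dc k - v $ k + (\<Sum>a\<in>UNIV. \<Sum>l\<in>UNIV. u $ a * ?c l * \<Lambda> a l ?x $ k))"
  have "lin_field P e ?x = 0"
  proof (rule vec_eq_iff[THEN iffD2, rule_format])
    fix i
    have "(\<Sum>k\<in>UNIV. (\<Sum>a\<in>UNIV. \<Sum>l\<in>UNIV. u $ a * ?c l * \<Lambda> a l ?x $ k) * P k ?x $ i)
       = (\<Sum>k\<in>UNIV. \<Sum>a\<in>UNIV. \<Sum>l\<in>UNIV. u $ a * ?c l * (\<Lambda> a l ?x $ k * P k ?x $ i))"
      by (simp add: sum_distrib_right mult.assoc)
    also have "\<dots> = (\<Sum>a\<in>UNIV. \<Sum>k\<in>UNIV. \<Sum>l\<in>UNIV. u $ a * ?c l * (\<Lambda> a l ?x $ k * P k ?x $ i))" by (rule sum.swap)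
    also have "\<dots> = (\<Sum>a\<in>UNIV. \<Sum>l\<in>UNIV. \<Sum>k\<in>UNIV. u $ a * ?c l * (\<Lambda> a l ?x $ k * P k ?x $ i))"
      by (rule sum.cong[OF refl], rule sum.swap)
    also have "\<dots> = (\<Sum>a\<in>UNIV. \<Sum>l\<in>UNIV. u $ a * ?c l * ?B a l $ i)"
      by (simp add: \<Lambda>[OF x] lin_field_nth sum_distrib_left)
    finally show "lin_field P e ?x $ i = 0 $ i"
      using eq[of i] by (simp add: lin_field_nth e_def distrib_right left_diff_distrib sum.distrib sum_subtractf)
  qed
  from lin_field_zero[OF x this] have "e $ k = 0" by simp
  then have "dc k = v $ k - (\<Sum>a\<in>UNIV. \<Sum>l\<in>UNIV. u $ a * ?c l * \<Lambda> a l ?x $ k)" by (simp add: e_def)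
  also have "(\<Sum>a\<in>UNIV. \<Sum>l\<in>UNIV. u $ a * ?c l * \<Lambda> a l ?x $ k) = (\<Sum>l\<in>UNIV. (\<Sum>a\<in>UNIV. u $ a * \<Lambda> a l ?x $ k) * ?c l)"
    by (subst sum.swap) (simp add: sum_distrib_left sum_distrib_right mult_ac)
  finally show ?thesis using dc[of k] by simp
qed

text \<open>In row k and column l the coordinate u_a occurs only if w_k <= w_a + w_l, so it
  contributes at most H \<sigma>^(w_k) / K after scaling; one factor 1/K is left because w_a >= 1.
  The square of CARD('p) in the demand on K covers the sum over a and the CARD('p) in
  \<open>weighted_linear_ode\<close>.\<close>

lemma weighted_differential_bound:
  assumes u: "u \<in> ball 0 \<epsilon>" "\<And>a. \<bar>u $ a\<bar> \<le> (\<sigma> / K) ^ w a"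
    and \<sigma>: "0 < \<sigma>" "\<sigma> \<le> 1" and K: "1 \<le> K" "4 * real CARD('p) ^ 2 * H \<le> K"
    and v: "jac EE u *v v = lin_field P b (EE u)" and b: "\<And>l. \<bar>b $ l\<bar> \<le> Q * \<sigma> ^ w l"
  shows "\<bar>v $ k\<bar> \<le> 2 * Q * \<sigma> ^ w k"
proof (rule weighted_linear_ode[where c = "vcoord u v" and v = "\<lambda>k. v $ k"
      and M = "\<lambda>t k l. \<Sum>a\<in>UNIV. u $ a * \<Lambda> a l (EE (t *\<^sub>R u)) $ k" and \<omega> = "\<lambda>k. \<sigma> ^ w k" and Q = Q])
  have tu: "t *\<^sub>R u \<in> ball 0 \<epsilon>" if "t \<in> {0..1}" for t
  proof -
    have "\<bar>t\<bar> * norm u \<le> 1 * norm u" using that by (intro mult_right_mono) auto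
    then show ?thesis using u(1) by simp
  qed
  show "((\<lambda>t. vcoord u v t k) has_real_derivative v $ k -
      (\<Sum>l\<in>UNIV. (\<Sum>a\<in>UNIV. u $ a * \<Lambda> a l (EE (t *\<^sub>R u)) $ k) * vcoord u v t l)) (at t)" if "t \<in> {0..1}" for k t
    by (rule DERIV_vcoord[OF tu[OF that]])
  show "vcoord u v 0 k = 0" for k by (rule vcoord_zero)
  show "0 < \<sigma> ^ w k" for k using \<sigma> by simp
  show "\<bar>\<Sum>a\<in>UNIV. u $ a * \<Lambda> a l (EE (t *\<^sub>R u)) $ k\<bar> * \<sigma> ^ w l \<le> \<sigma> ^ w k / (4 * real CARD('p))"
    if t: "t \<in> {0..1}" for t k l
  proof -
    let ?x = "EE (t *\<^sub>R u)"
    have x: "?x \<in> ball y \<rho>" by (rule ball(2)[OF tu[OF t]])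
    have H0: "0 \<le> H" by (rule order_trans[OF abs_ge_zero \<Lambda>_le[OF x]])
    have "\<bar>u $ a * \<Lambda> a l ?x $ k\<bar> * \<sigma> ^ w l \<le> H / K * \<sigma> ^ w k" for a
    proof (cases "\<Lambda> a l ?x $ k = 0")
      case True
      then show ?thesis using H0 K(1) \<sigma> by simp
    next
      case False
      have wk: "w k \<le> w a + w l" by (rule \<Lambda>_zero[OF x False])
      have "(1 / K) ^ w a \<le> (1 / K) ^ 1" using K(1) w_pos[of a] by (intro power_decreasing) auto
      then have "\<sigma> ^ w a * (1 / K) ^ w a \<le> \<sigma> ^ w a * (1 / K)"
        using \<sigma> by (intro mult_left_mono) auto
      moreover have "(\<sigma> / K) ^ w a = \<sigma> ^ w a * (1 / K) ^ w a" by (simp add: power_divide)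
      ultimately have "(\<sigma> / K) ^ w a \<le> \<sigma> ^ w a * (1 / K)" by simp
      then have ua: "\<bar>u $ a\<bar> \<le> \<sigma> ^ w a * (1 / K)" using u(2)[of a] by linarith
      have "\<bar>u $ a * \<Lambda> a l ?x $ k\<bar> * \<sigma> ^ w l \<le> \<sigma> ^ w a * (1 / K) * H * \<sigma> ^ w l"
        unfolding abs_mult using \<sigma> K(1) by (intro mult_right_mono mult_mono ua \<Lambda>_le[OF x]) auto
      also have "\<dots> = H / K * \<sigma> ^ (w a + w l)" by (simp add: power_add)
      also have "\<dots> \<le> H / K * \<sigma> ^ w k"
        using \<sigma> K(1) H0 by (intro mult_left_mono power_decreasing[OF wk]) auto
      finally show ?thesis .
    qed
    then have "(\<Sum>a\<in>UNIV. \<bar>u $ a * \<Lambda> a l ?x $ k\<bar> * \<sigma> ^ w l) \<le> (\<Sum>a\<in>(UNIV :: 'p set). H / K * \<sigma> ^ w k)"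
      by (rule sum_mono)
    moreover have "\<bar>\<Sum>a\<in>UNIV. u $ a * \<Lambda> a l ?x $ k\<bar> * \<sigma> ^ w l \<le> (\<Sum>a\<in>UNIV. \<bar>u $ a * \<Lambda> a l ?x $ k\<bar> * \<sigma> ^ w l)"
      unfolding sum_distrib_right[symmetric] using \<sigma> by (intro mult_right_mono sum_abs) auto
    ultimately have "\<bar>\<Sum>a\<in>UNIV. u $ a * \<Lambda> a l ?x $ k\<bar> * \<sigma> ^ w l \<le> real CARD('p) * (H / K) * \<sigma> ^ w k"
      by (simp add: mult.assoc)
    also have "\<dots> \<le> 1 / (4 * real CARD('p)) * \<sigma> ^ w k"
    proof (rule mult_right_mono)
      have "4 * real CARD('p) * (real CARD('p) * H) \<le> K" using K(2) by (simp add: power2_eq_square mult_ac)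
      then show "real CARD('p) * (H / K) \<le> 1 / (4 * real CARD('p))"
        using K(1) by (simp add: field_simps)
    qed (use \<sigma> in simp)
    finally show ?thesis by simp
  qed
  show "\<bar>vcoord u v 1 k\<bar> \<le> Q * \<sigma> ^ w k" for k
  proof -
    have x: "EE u \<in> ball y \<rho>" by (rule ball(2)[OF u(1)])
    have "lin_field P ((\<chi> l. vcoord u v 1 l) - b) (EE u) = 0"
    proof (rule vec_eq_iff[THEN iffD2, rule_format])
      fix i
      have "(jac EE u *v v) $ i = (\<Sum>l\<in>UNIV. vcoord u v 1 l * P l (EE u) $ i)"
        using variation_eq_vcoord[of 1 u v i] u(1) by (simp add: variation_def jac_mult_nth)
      then show "lin_field P ((\<chi> l. vcoord u v 1 l) - b) (EE u) $ i = 0 $ i"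
        unfolding v by (simp add: lin_field_nth left_diff_distrib sum_subtractf)
    qed
    from lin_field_zero[OF x this] have "vcoord u v 1 k = b $ k" by (simp add: vec_eq_iff)
    then show ?thesis using b[of k] by simp
  qed
qed

end

end

subsection \<open>Absolutely continuous curves\<close>

lemma abs_continuous_onD:
  assumes "abs_continuous_on S f" "0 < e"
  shows "\<exists>\<eta>>0. \<forall>D T. D division_of T \<longrightarrow> T \<subseteq> S \<longrightarrow> (\<Sum>K\<in>D. measure lborel K) < \<eta> \<longrightarrow>
      (\<Sum>K\<in>D. norm (f (Sup K) - f (Inf K))) < e"
  using assms unfolding abs_continuous_on_def imp_conjL by (elim allE impE)

text \<open>In a fine tagged division, intervals tagged outside N have increments controlled by the
  derivative at the tag. Those tagged in N lie in an open set of small measure, where absolute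
  continuity makes the total increment small. Integrability of the derivative does not
  enter.\<close>

lemma abs_continuous_increment_bound:
  fixes f :: "real \<Rightarrow> 'a::real_normed_vector"
  assumes ac: "abs_continuous_on {0..1} f" and ab: "0 \<le> a" "a \<le> b" "b \<le> 1"
    and N: "negligible N" and L: "0 \<le> L"
    and d: "\<And>t. t \<in> {a..b} - N \<Longrightarrow> \<exists>f'. (f has_vector_derivative f') (at t within {0..1}) \<and> norm f' \<le> L"
  shows "norm (f b - f a) \<le> L * (b - a)"
proof (rule field_le_epsilon)
  fix e :: real assume e: "0 < e"
  obtain \<eta> where \<eta>: "\<eta> > 0" "\<forall>D T. D division_of T \<longrightarrow> T \<subseteq> {0..1} \<longrightarrow> (\<Sum>K\<in>D. measure lborel K) < \<eta> \<longrightarrow>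
      (\<Sum>K\<in>D. norm (f (Sup K) - f (Inf K))) < e / 2"
    using abs_continuous_onD[OF ac half_gt_zero[OF e]] by blast
  have Nm: "N \<in> sets lebesgue" "emeasure lebesgue N = 0" using N by (auto simp: negligible_iff_null_sets)
  \<comment> \<open>Outer regularity: the null set lies in an open set whose measure is below the
    \<eta> of absolute continuity.\<close>
  obtain U where U: "open U" "N \<subseteq> U" and UN: "U - N \<in> lmeasurable" "emeasure lebesgue (U - N) < ennreal \<eta>"
    using sets_lebesgue_outer_open[OF Nm(1) \<eta>(1)] by blast
  have "emeasure lebesgue U \<le> emeasure lebesgue (U - N) + emeasure lebesgue N"
    using emeasure_subadditive[of "U - N" lebesgue N] Nm(1) UN(1) U(2) by (simp add: Un_absorb2 fmeasurableD)
  then have Ue: "emeasure lebesgue U < ennreal \<eta>" using UN(2) Nm(2) by simp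
  then have Um: "U \<in> lmeasurable"
    using U(1) by (intro fmeasurableI) (auto intro: less_trans[OF _ ennreal_less_top])
  then have U4: "measure lebesgue U < \<eta>"
    using Ue by (simp add: emeasure_eq_measure2 ennreal_less_iff)
  define e' where "e' = e / 2"
  have e': "e' > 0" using e by (simp add: e'_def)
  have "\<exists>r>0. (t \<in> N \<longrightarrow> ball t r \<subseteq> U) \<and>
      (t \<in> {a..b} - N \<longrightarrow> (\<forall>s\<in>{0..1}. \<bar>s - t\<bar> < r \<longrightarrow> norm (f s - f t) \<le> (L + e') * \<bar>s - t\<bar>))" for t
  proof (cases "t \<in> N")
    case True
    then obtain r where "r > 0" "ball t r \<subseteq> U" using U(1,2) open_contains_ball by blast
    then show ?thesis using True by blast
  next
    case False
    show ?thesis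
    proof (cases "t \<in> {a..b}")
      case True
      then obtain f' where f': "(f has_vector_derivative f') (at t within {0..1})" "norm f' \<le> L" using d False by blast
      then obtain r where r: "r > 0" "\<And>s. s \<in> {0..1} \<Longrightarrow> norm (s - t) < r \<Longrightarrow> norm (f s - f t - (s - t) *\<^sub>R f') \<le> e' * norm (s - t)"
        using e' unfolding has_vector_derivative_def has_derivative_within_alt by blast
      have "norm (f s - f t) \<le> (L + e') * \<bar>s - t\<bar>" if "s \<in> {0..1}" "\<bar>s - t\<bar> < r" for s
      proof -
        have "norm (f s - f t) \<le> norm (f s - f t - (s - t) *\<^sub>R f') + norm ((s - t) *\<^sub>R f')"
          using norm_triangle_ineq[of "f s - f t - (s - t) *\<^sub>R f'" "(s - t) *\<^sub>R f'"] by simp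
        also have "\<dots> \<le> e' * \<bar>s - t\<bar> + \<bar>s - t\<bar> * L"
          using r(2)[of s] that f'(2) by (intro add_mono) (auto intro: mult_left_mono)
        finally show ?thesis by (simp add: algebra_simps)
      qed
      then show ?thesis using r(1) False by blast
    next
      case False
      then show ?thesis using \<open>t \<notin> N\<close> zero_less_one by blast
    qed
  qed
  then obtain r where r: "\<And>t. r t > 0" "\<And>t. t \<in> N \<Longrightarrow> ball t (r t) \<subseteq> U"
    "\<And>t s. t \<in> {a..b} - N \<Longrightarrow> s \<in> {0..1} \<Longrightarrow> \<bar>s - t\<bar> < r t \<Longrightarrow> norm (f s - f t) \<le> (L + e') * \<bar>s - t\<bar>" by metis
  have "gauge (\<lambda>t. ball t (r t))" using r(1) by (simp add: gauge_def)
  then obtain p where p: "p tagged_division_of {a..b}" "(\<lambda>t. ball t (r t)) fine p"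
    using fine_division_exists_real by blast
  note pD = tagged_division_ofD[OF p(1)]
  define p' where "p' = {(t, K) \<in> p. t \<in> N}"
  have p'p: "p' \<subseteq> p" by (auto simp: p'_def)
  let ?g = "\<lambda>(t, K). norm (f (Sup K) - f (Inf K))"
  have pp: "p' tagged_partial_division_of {a..b}"
    by (rule tagged_partial_division_subset[OF _ p'p]) (use p(1) tagged_division_of_def in blast)
  have sub01: "K \<subseteq> {0..1}" if "(t, K) \<in> p" for t K using pD(3)[OF that] ab by auto
  have bad: "(\<Sum>x\<in>p'. ?g x) < e / 2"
  proof -
    let ?D = "snd ` p'"
    \<comment> \<open>Passing from tagged pairs to sets requires a function that vanishes on
      degenerate intervals. The empty set gets the value 0 because its \<open>Sup\<close> and
      \<open>Inf\<close> carry no information.\<close>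
    define h where "h K = (if K = {} then 0 else norm (f (Sup K) - f (Inf K)))" for K
    have D: "?D division_of \<Union>?D" by (rule partial_division_of_tagged_division[OF pp])
    have ne: "K \<noteq> {}" if KD: "K \<in> ?D" for K
    proof -
      obtain t where "(t, K) \<in> p'" using KD by auto
      then have "t \<in> K" using pD(2) p'p by blast
      then show ?thesis by blast
    qed
    have ne': "K \<noteq> {}" if "(t, K) \<in> p'" for t K using ne[OF imageI[OF that, of snd]] by simp
    have "(\<Sum>x\<in>p'. ?g x) = (\<Sum>(t, K)\<in>p'. h K)"
      by (rule sum.cong) (auto simp: h_def dest: ne')
    also have "\<dots> = (\<Sum>K\<in>?D. h K)"
    proof (rule sum.over_tagged_division_lemma[OF tagged_partial_division_of_Union_self[OF pp]])
      fix u v :: real assume "box u v = {}"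
      then have "v \<le> u" by (simp add: box_real)
      then show "h (cbox u v) = 0" by (cases "u = v") (auto simp: h_def)
    qed
    also have "\<dots> = (\<Sum>K\<in>?D. norm (f (Sup K) - f (Inf K)))" by (rule sum.cong) (use ne in \<open>auto simp: h_def\<close>)
    also have "\<dots> < e / 2"
    proof (rule \<eta>(2)[rule_format, OF D])
      show "\<Union>?D \<subseteq> {0..1}" using sub01 p'p by fastforce
      have "(\<Sum>K\<in>?D. measure lborel K) = measure lebesgue (\<Union>?D)"
      proof -
        have "measure lborel K = measure lebesgue K" if "K \<in> ?D" for K
          using division_ofD(4)[OF D that] by auto
        then show ?thesis using content_division[OF D] by simp
      qed
      also have "\<dots> \<le> measure lebesgue U"
      proof (rule measure_mono_fmeasurable)
        show "\<Union>?D \<subseteq> U" using p(2) r(2) by (auto simp: p'_def fine_def) blast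
        show "\<Union>?D \<in> sets lebesgue" using lmeasurable_division[OF D] by blast
      qed (use Um in simp)
      finally show "(\<Sum>K\<in>?D. measure lborel K) < \<eta>" using U4 by linarith
    qed
    finally show ?thesis .
  qed
  have good: "?g x \<le> (L + e') * (case x of (t, K) \<Rightarrow> measure lborel K)" if x: "x \<in> p - p'" for x
  proof -
    obtain t K where tK: "x = (t, K)" by (cases x)
    have m: "(t, K) \<in> p" "t \<notin> N" using x tK by (auto simp: p'_def)
    obtain u v where K: "K = {u..v}" using pD(4)[OF m(1)] by (auto simp: cbox_interval)
    have t: "u \<le> t" "t \<le> v" using pD(2)[OF m(1)] K by auto
    have tab: "t \<in> {a..b} - N" using pD(2,3)[OF m(1)] m(2) by auto
    have uv: "u \<in> {0..1}" "v \<in> {0..1}" using sub01[OF m(1)] K t by auto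
    have "K \<subseteq> ball t (r t)" using p(2) m(1) by (auto simp: fine_def)
    moreover have "u \<in> K" "v \<in> K" using K t by auto
    ultimately have "u \<in> ball t (r t)" "v \<in> ball t (r t)" by blast+
    then have "\<bar>u - t\<bar> < r t" "\<bar>v - t\<bar> < r t" by (auto simp: dist_real_def)
    then have "norm (f u - f t) \<le> (L + e') * (t - u)" "norm (f v - f t) \<le> (L + e') * (v - t)"
      using r(3)[OF tab uv(1)] r(3)[OF tab uv(2)] t by auto
    moreover have "norm (f v - f u) \<le> norm (f v - f t) + norm (f u - f t)"
      using norm_triangle_ineq4[of "f v - f t" "f u - f t"] by simp
    ultimately have "norm (f v - f u) \<le> (L + e') * (v - u)" by (simp add: algebra_simps)
    then show ?thesis using t by (simp add: tK K)
  qed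
  have "norm (f b - f a) = norm (\<Sum>(t, K)\<in>p. f (Sup K) - f (Inf K))"
    using additive_tagged_division_1[OF ab(2) p(1), of f] by simp
  also have "\<dots> \<le> (\<Sum>x\<in>p. ?g x)" by (rule sum_norm_le) auto
  also have "\<dots> = (\<Sum>x\<in>p - p'. ?g x) + (\<Sum>x\<in>p'. ?g x)" by (rule sum.subset_diff[OF p'p pD(1)])
  also have "\<dots> \<le> (\<Sum>x\<in>p - p'. (L + e') * (case x of (t, K) \<Rightarrow> measure lborel K)) + e / 2"
    using bad by (intro add_mono sum_mono good) auto
  also have "(\<Sum>x\<in>p - p'. (L + e') * (case x of (t, K) \<Rightarrow> measure lborel K)) \<le> (\<Sum>x\<in>p. (L + e') * (case x of (t, K) \<Rightarrow> measure lborel K))"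
    using L e' by (intro sum_mono2 pD(1)) (auto simp: case_prod_beta)
  also have "\<dots> = (L + e') * (b - a)"
    using additive_content_tagged_division[of p a b] p(1) ab(2) by (simp add: sum_distrib_left[symmetric] case_prod_beta)
  also have "(L + e') * (b - a) + e / 2 \<le> L * (b - a) + e"
  proof -
    have "e' * (b - a) \<le> e' * 1" using ab e' by (intro mult_left_mono) auto
    then show ?thesis by (simp add: distrib_right e'_def)
  qed
  finally show "norm (f b - f a) \<le> L * (b - a) + e" by simp
qed

lemma division_endpoints:
  assumes "D division_of T" "T \<subseteq> {0..1::real}" "K \<in> D"
  shows "Sup K \<in> {0..1}" "Inf K \<in> {0..1}"
proof -
  obtain u v where K: "K = cbox u v" "K \<noteq> {}" "K \<subseteq> T" using division_ofD(2-4)[OF assms(1,3)] by metis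
  then have "u \<le> v" "{u..v} \<subseteq> {0..1}" using subset_trans[OF K(3) assms(2)] K by (auto simp: cbox_interval)
  moreover from this have "u \<in> {0..1}" "v \<in> {0..1}" by (meson atLeastAtMost_iff order_refl subsetD)+
  ultimately show "Sup K \<in> {0..1}" "Inf K \<in> {0..1}" by (auto simp: K cbox_interval)
qed

lemma abs_continuous_on_lipschitz:
  assumes "abs_continuous_on {0..1} f" "0 < M"
    and M: "\<And>s t. s \<in> {0..1} \<Longrightarrow> t \<in> {0..1} \<Longrightarrow> norm (g s - g t) \<le> M * norm (f s - f t)"
  shows "abs_continuous_on {0..1} g"
  unfolding abs_continuous_on_def
proof (intro allI impI)
  fix e :: real assume "0 < e"
  then have "0 < e / M" using assms(2) by simp
  then obtain \<eta> where \<eta>: "\<eta> > 0" "\<forall>D T. D division_of T \<longrightarrow> T \<subseteq> {0..1} \<longrightarrow> (\<Sum>K\<in>D. measure lborel K) < \<eta> \<longrightarrow>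
      (\<Sum>K\<in>D. norm (f (Sup K) - f (Inf K))) < e / M"
    using abs_continuous_onD[OF assms(1) \<open>0 < e / M\<close>] by blast
  show "\<exists>\<eta>>0. \<forall>D T. D division_of T \<and> T \<subseteq> {0..1} \<and> (\<Sum>K\<in>D. measure lborel K) < \<eta> \<longrightarrow>
        (\<Sum>K\<in>D. norm (g (Sup K) - g (Inf K))) < e"
  proof (intro exI[of _ \<eta>] conjI allI impI \<eta>(1), elim conjE)
    fix D T assume DT: "D division_of T" "T \<subseteq> {0..1::real}" "(\<Sum>K\<in>D. measure lborel K) < \<eta>"
    have "(\<Sum>K\<in>D. norm (g (Sup K) - g (Inf K))) \<le> (\<Sum>K\<in>D. M * norm (f (Sup K) - f (Inf K)))"
      by (rule sum_mono) (intro M division_endpoints[OF DT(1,2)])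
    also have "\<dots> = M * (\<Sum>K\<in>D. norm (f (Sup K) - f (Inf K)))" by (simp add: sum_distrib_left)
    also have "\<dots> < e" using \<eta>(2)[rule_format, OF DT] assms(2) by (simp add: pos_less_divide_eq mult.commute)
    finally show "(\<Sum>K\<in>D. norm (g (Sup K) - g (Inf K))) < e" .
  qed
qed

lemma abs_continuous_on_id: "abs_continuous_on {0..1} (\<lambda>t. t)"
  unfolding abs_continuous_on_def
proof (intro allI impI)
  fix e :: real assume e: "0 < e"
  have "(\<Sum>K\<in>D. norm (Sup K - Inf K)) < e"
    if DT: "D division_of T" "T \<subseteq> {0..1::real}" "(\<Sum>K\<in>D. measure lborel K) < e" for D T
  proof -
    have "norm (Sup K - Inf K) = measure lborel K" if KD: "K \<in> D" for K
    proof -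
      obtain u v where K: "K = cbox u v" "K \<noteq> {}" using division_ofD(3,4)[OF DT(1) KD] by metis
      then have "u \<le> v" by (auto simp: cbox_interval)
      then show ?thesis by (simp add: K cbox_interval)
    qed
    then show ?thesis using DT(3) by simp
  qed
  then show "\<exists>\<eta>>0. \<forall>D T. D division_of T \<and> T \<subseteq> {0..1::real} \<and> (\<Sum>K\<in>D. measure lborel K) < \<eta> \<longrightarrow>
        (\<Sum>K\<in>D. norm (Sup K - Inf K)) < e"
    using e by (intro exI[of _ e]) auto
qed

lemma abs_continuous_on_imp_continuous:
  assumes "abs_continuous_on {0..1} f"
  shows "continuous_on {0..1} f"
  unfolding continuous_on_iff
proof (intro ballI allI impI)
  fix t e :: real assume t: "t \<in> {0..1}" and e: "0 < e"
  obtain \<eta> where \<eta>: "\<eta> > 0" "\<forall>D T. D division_of T \<longrightarrow> T \<subseteq> {0..1} \<longrightarrow> (\<Sum>K\<in>D. measure lborel K) < \<eta> \<longrightarrow>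
      (\<Sum>K\<in>D. norm (f (Sup K) - f (Inf K))) < e"
    using abs_continuous_onD[OF assms e] by blast
  have "norm (f v - f u) < e" if "u \<le> v" "u \<in> {0..1}" "v \<in> {0..1}" "v - u < \<eta>" for u v
  proof -
    have "{{u..v}} division_of {u..v}" using that(1) division_of_self[of u v] by (simp add: cbox_interval)
    from \<eta>(2)[rule_format, OF this] show ?thesis using that by simp
  qed
  note uv = this
  have "dist (f s) (f t) < e" if "s \<in> {0..1}" "dist s t < \<eta>" for s
    using uv[of s t] uv[of t s] that t by (cases "s \<le> t") (auto simp: dist_norm dist_real_def norm_minus_commute)
  then show "\<exists>d>0. \<forall>s\<in>{0..1}. dist s t < d \<longrightarrow> dist (f s) (f t) < e" using \<eta>(1) by blast
qed

subsection \<open>The exponential chart\<close>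

text \<open>\<open>dbound1 g\<close> and \<open>dbound2 g\<close> are the first and second
  derivative of 1/(1 - g x) at x = 1/(2 g), half the radius of convergence: the majorants of the
  first and second partial derivatives of the exponential.\<close>

definition dbound1 :: "real \<Rightarrow> real" where
  "dbound1 g = (\<Sum>k. diffs (\<lambda>k. g ^ k) k * (1 / (2 * g)) ^ k)"

definition dbound2 :: "real \<Rightarrow> real" where
  "dbound2 g = (\<Sum>k. diffs (diffs (\<lambda>k. g ^ k)) k * (1 / (2 * g)) ^ k)"

context
  fixes P :: "'p::finite \<Rightarrow> 'p vfield" and y :: "real^'p" and D :: nat and A \<kappa> \<epsilon> g :: real
  assumes P: "\<And>a j. poly_bd y D A (\<lambda>x. P a x $ j)" and D: "1 \<le> D" and A: "0 < A"
    and \<kappa>: "0 < \<kappa>" "\<And>c. \<kappa> * norm c \<le> norm (lin_field P c y)"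
    and g: "g = word_growth CARD('p) D A"
    and \<epsilon>: "0 < \<epsilon>" "real CARD('p) * \<epsilon> \<le> 1 / (2 * g)" "real CARD('p) ^ 3 * dbound2 g * \<epsilon> \<le> \<kappa> / 2"
begin

lemma chart_norm1: "u \<in> cball 0 \<epsilon> \<Longrightarrow> norm1 (u :: real^'p) \<le> 1 / (2 * g)"
proof -
  assume u: "u \<in> cball 0 \<epsilon>"
  have "norm1 u \<le> real CARD('p) * norm u" by (rule norm1_le)
  also have "\<dots> \<le> real CARD('p) * \<epsilon>" using u by (intro mult_left_mono) auto
  finally show ?thesis using \<epsilon>(2) by simp
qed

lemma chart_g_pos: "0 < g"
  using A D by (simp add: g word_growth_def)

lemma chart_dom: "cball 0 \<epsilon> \<subseteq> {u :: real^'p. norm1 u < 1 / g}"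
proof
  fix u :: "real^'p" assume "u \<in> cball 0 \<epsilon>"
  then have "norm1 u \<le> 1 / (2 * g)" by (rule chart_norm1)
  also have "\<dots> < 1 / g" using chart_g_pos by (simp add: field_simps)
  finally show "u \<in> {u. norm1 u < 1 / g}" by simp
qed

lemma chart_Ck: "Ck_on k {u. norm1 u < 1 / g} (\<lambda>u. lie_exp P y u $ i)"
  unfolding g by (rule Ck_on_lie_exp[OF P D A])

lemma chart_jac_zero: "jac (lie_exp P y) 0 *v c = lin_field P c y"
proof -
  have "partial j (\<lambda>u. lie_exp P y u $ i) 0 = P j y $ i" for i j
    by (rule partial_lie_exp_zero[OF P D A])
  then show ?thesis by (simp add: vec_eq_iff jac_mult_nth lin_field_nth)
qed

lemma chart_frame: "\<kappa> * norm c \<le> norm (jac (lie_exp P y) 0 *v c)"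
  unfolding chart_jac_zero by (rule \<kappa>(2))

lemma chart_partial_partial: "u \<in> cball 0 \<epsilon> \<Longrightarrow> \<bar>partial l (partial j (\<lambda>u. lie_exp P y u $ i)) u\<bar> \<le> dbound2 g"
  unfolding dbound2_def g by (rule partial_partial_lie_exp_le[OF P D A chart_norm1[unfolded g]])

lemma chart_partial:
  assumes "u \<in> cball 0 \<epsilon>"
  shows "\<bar>partial j (\<lambda>u. lie_exp P y u $ i) u\<bar> \<le> dbound1 g"
proof -
  have m: "majorant (1 / g) (\<lambda>k. 1 * g ^ k) (lcoeff P (\<lambda>x. (x - y) $ i) y)"
    unfolding g by (rule majorant_lcoeff[OF P D A poly_bd_coord[OF P D A]])
  have u: "norm1 u < 1 / word_growth CARD('p) D A" using chart_dom assms g by auto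
  have "partial j (\<lambda>u. lie_exp P y u $ i) u = wseries (dcoeff j (lcoeff P (\<lambda>x. (x - y) $ i) y)) u"
    by (rule partial_lie_exp[OF P D A u])
  moreover have "1 / (2 * g) < 1 / g" using chart_g_pos by (simp add: field_simps)
  ultimately show ?thesis
    using wseries_abs_le[OF majorant_dcoeff[OF m] chart_norm1[OF assms]] by (simp add: dbound1_def)
qed

lemma chart_lower:
  assumes "u \<in> cball 0 \<epsilon>" "u' \<in> cball 0 \<epsilon>"
  shows "\<kappa> / 2 * norm (u - u') \<le> norm (lie_exp P y u - lie_exp P y u')"
  by (rule expanding[OF open_norm1 chart_dom \<epsilon>(1) chart_Ck chart_partial_partial \<kappa>(1) chart_frame \<epsilon>(3) assms])

lemma chart_jac_lower:
  assumes "u \<in> cball 0 \<epsilon>"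
  shows "\<kappa> / 2 * norm v \<le> norm (jac (lie_exp P y) u *v v)"
  by (rule jac_lower_bound[OF open_norm1 chart_dom \<epsilon>(1) chart_Ck chart_partial_partial \<kappa>(1) chart_frame \<epsilon>(3) assms])

lemma chart_image: "ball y (\<kappa> / 2 * \<epsilon>) \<subseteq> lie_exp P y ` ball 0 \<epsilon>"
proof -
  have "ball (lie_exp P y 0) (\<kappa> / 2 * \<epsilon>) \<subseteq> lie_exp P y ` ball 0 \<epsilon>"
    by (rule ball_subset_image[OF open_norm1 chart_dom \<epsilon>(1) chart_Ck chart_partial_partial \<kappa>(1) chart_frame \<epsilon>(3)])
  then show ?thesis by (simp add: lie_exp_zero[OF P D A])
qed

lemma chart_diffeo: "smooth_diffeo_on (ball 0 \<epsilon>) (lie_exp P y)"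
proof (rule smooth_diffeo_onI[OF open_ball])
  have "inj_on (lie_exp P y) (cball 0 \<epsilon>)"
    by (rule inj_on_F[OF open_norm1 chart_dom \<epsilon>(1) chart_Ck chart_partial_partial \<kappa>(1) chart_frame \<epsilon>(3)])
  then show "inj_on (lie_exp P y) (ball 0 \<epsilon>)" by (rule inj_on_subset) auto
  show "Ck_on k (ball 0 \<epsilon>) (\<lambda>u. lie_exp P y u $ i)" for k i
    by (rule Ck_on_subset[OF chart_Ck order_trans[OF ball_subset_cball chart_dom]])
  show "v = 0" if "u \<in> ball 0 \<epsilon>" "jac (lie_exp P y) u *v v = 0" for u v
    using chart_jac_lower[of u v] that \<kappa>(1) by (simp add: mult_le_0_iff)
qed

lemma chart_upper:
  assumes "u \<in> cball 0 \<epsilon>"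
  shows "norm (lie_exp P y u - y) \<le> real CARD('p) ^ 2 * dbound1 g * norm u"
proof -
  have "\<bar>(lie_exp P y u - y) $ i\<bar> \<le> real CARD('p) * dbound1 g * norm u" for i
  proof -
    have "\<bar>lie_exp P y u $ i - lie_exp P y 0 $ i\<bar> \<le> (\<Sum>j\<in>(UNIV :: 'p set). dbound1 g) * norm (u - 0)"
    proof (rule abs_diff_le_partials[OF convex_cball _ chart_partial assms])
      show "(\<lambda>u. lie_exp P y u $ i) differentiable (at z)" if "z \<in> cball 0 \<epsilon>" for z
        by (rule Ck_on_differentiable[OF chart_Ck[of 1] _ open_norm1]) (use that chart_dom in auto)
    qed (use \<epsilon>(1) in auto)
    then show ?thesis by (simp add: lie_exp_zero[OF P D A])
  qed
  then have "norm1 (lie_exp P y u - y) \<le> (\<Sum>i\<in>(UNIV :: 'p set). real CARD('p) * dbound1 g * norm u)"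
    unfolding norm1_def by (rule sum_mono)
  then show ?thesis using norm_le_norm1[of "lie_exp P y u - y"] by (simp add: power2_eq_square mult_ac)
qed

lemma chart_integral_curve:
  assumes "norm1 (u :: real^'p) < 1 / g"
  shows "integral_curve (lin_field P u) y (\<lambda>t. lie_exp P y (t *\<^sub>R u))"
  unfolding integral_curve_def
proof (intro conjI ballI)
  show "lie_exp P y (0 *\<^sub>R u) = y" by (simp add: lie_exp_zero[OF P D A])
  fix t :: real assume t: "t \<in> {0..1}"
  have "\<bar>t\<bar> * norm1 u \<le> 1 * norm1 u" using t norm1_nonneg[of u] by (intro mult_right_mono) auto
  then have tu: "norm1 (t *\<^sub>R u) < 1 / word_growth CARD('p) D A" using assms by (simp add: norm1_scale g)
  show "((\<lambda>t. lie_exp P y (t *\<^sub>R u)) has_vector_derivative lin_field P u (lie_exp P y (t *\<^sub>R u))) (at t within {0..1})"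
    by (rule has_vector_derivative_at_within, rule has_vector_derivative_lie_exp[where A = A and D = D])
      (use P D A tu in auto)
qed

lemma chart_vf_exp:
  assumes "norm1 (u :: real^'p) < 1 / g"
  shows "vf_exp (lin_field P u) y = lie_exp P y u"
proof -
  have "smooth_vf (lin_field P u)" by (rule smooth_vf_lin_field[OF smooth_P[OF P D A]])
  from vf_exp_eq[OF this chart_integral_curve[OF assms]] show ?thesis by simp
qed

end

lemma smooth_diffeo_on_cong:
  assumes "smooth_diffeo_on U F" "\<And>u. u \<in> U \<Longrightarrow> F u = G u"
  shows "smooth_diffeo_on U G"
proof -
  have img: "G ` U = F ` U" using assms(2) by (auto simp: image_iff)
  have inv: "inv_into U G = inv_into U F"
    unfolding inv_into_def by (intro ext arg_cong[where f = Eps]) (use assms(2) in auto)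
  have U: "open U" using assms(1) by (simp add: smooth_diffeo_on_def)
  have "Ck_on k U (\<lambda>u. G u $ j)" for k j
    by (rule Ck_on_eq[OF U, of k "\<lambda>u. F u $ j"])
      (use assms in \<open>simp_all add: smooth_diffeo_on_def smooth_map_on_def\<close>)
  moreover have "inj_on G U" using assms inj_on_cong[of U F G] by (simp add: smooth_diffeo_on_def)
  ultimately show ?thesis
    using assms(1) unfolding smooth_diffeo_on_def img inv by (simp add: smooth_map_on_def)
qed

lemma coord_field_lin_field:
  "coord_field r X B y u = lin_field (\<lambda>j. commutator (approx_field r X y) (B j)) u"
  by (rule ext) (simp add: coord_field_def lin_field_def)

lemma inj_on_exp_map: "inj_on (exp_map r X B y) (exp_nbhd r X B y)"
proof (rule inj_onI)
  fix u u' assume u: "u \<in> exp_nbhd r X B y" "u' \<in> exp_nbhd r X B y" "exp_map r X B y u = exp_map r X B y u'"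
  obtain e where e: "u \<in> ball 0 e" "smooth_diffeo_on (ball 0 e) (exp_map r X B y)"
    using u(1) unfolding exp_nbhd_def by blast
  obtain e' where e': "u' \<in> ball 0 e'" "smooth_diffeo_on (ball 0 e') (exp_map r X B y)"
    using u(2) unfolding exp_nbhd_def by blast
  have "smooth_diffeo_on (ball 0 (max e e')) (exp_map r X B y)" using e(2) e'(2) by (cases "e \<le> e'") (simp_all add: max_def)
  then have "inj_on (exp_map r X B y) (ball 0 (max e e'))" by (simp add: smooth_diffeo_on_def)
  moreover have "u \<in> ball 0 (max e e')" "u' \<in> ball 0 (max e e')" using e(1) e'(1) by auto
  ultimately show "u = u'" using u(3) by (auto dest: inj_onD)
qed

text \<open>Any ball carrying a smooth diffeomorphism is contained in the neighbourhood used for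
  \<open>Theta\<close>, and injectivity on the union makes the inverse value independent of the ball
  exhibited.\<close>

lemma Theta_exp_map:
  assumes "0 < \<epsilon>" "\<And>u. u \<in> ball 0 \<epsilon> \<Longrightarrow> \<exists>\<phi>. integral_curve (coord_field r X B y u) y \<phi>"
    and "smooth_diffeo_on (ball 0 \<epsilon>) F" "\<And>u. u \<in> ball 0 \<epsilon> \<Longrightarrow> exp_map r X B y u = F u" and u: "u \<in> ball 0 \<epsilon>"
  shows "F u \<in> Theta_dom r X B y" "Theta r X B y (F u) = u"
proof -
  have "smooth_diffeo_on (ball 0 \<epsilon>) (exp_map r X B y)"
    by (rule smooth_diffeo_on_cong[OF assms(3)]) (simp add: assms(4))
  then have n: "u \<in> exp_nbhd r X B y" unfolding exp_nbhd_def using assms(1,2) u by blast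
  then show "F u \<in> Theta_dom r X B y" unfolding Theta_dom_def assms(4)[OF u, symmetric] by (rule imageI)
  show "Theta r X B y (F u) = u"
    unfolding Theta_def assms(4)[OF u, symmetric] by (rule inv_into_f_f[OF inj_on_exp_map n])
qed

subsection \<open>Frames\<close>

lemma lin_field_linear: "linear (\<lambda>c. lin_field P c x)"
proof (rule linearI)
  show "lin_field P (b + c) x = lin_field P b x + lin_field P c x" for b c
    by (simp add: lin_field_def scaleR_add_left sum.distrib)
  show "lin_field P (a *\<^sub>R c) x = a *\<^sub>R lin_field P c x" for a c
    by (simp add: lin_field_def scaleR_sum_right)
qed

lemma frame_coordinates:
  assumes "0 < \<kappa>" "\<And>c. \<kappa> * norm c \<le> norm (lin_field P c x)"
  obtains c where "lin_field P c x = b" "norm c \<le> norm b / \<kappa>"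
proof -
  have "inj (\<lambda>c. lin_field P c x)"
    unfolding linear_injective_0[OF lin_field_linear]
    using assms by (metis mult_le_0_iff norm_le_zero_iff norm_zero not_le)
  then have "surj (\<lambda>c. lin_field P c x)" by (rule linear_injective_imp_surjective[OF lin_field_linear _ refl])
  then obtain c where c: "b = lin_field P c x" by (rule surjE)
  have "norm c \<le> norm b / \<kappa>" using assms(2)[of c] assms(1) by (simp add: c pos_le_divide_eq mult.commute)
  then show ?thesis using that c by blast
qed

lemma sum_le_norm1_bound:
  fixes b :: "real^'p::finite"
  assumes "\<And>i. \<bar>b $ i\<bar> \<le> M"
  shows "norm b \<le> real CARD('p) * M"
proof -
  have "norm1 b \<le> (\<Sum>i\<in>(UNIV :: 'p set). M)" unfolding norm1_def by (rule sum_mono) (rule assms)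
  then show ?thesis using norm_le_norm1[of b] by simp
qed

text \<open>On the unit ball around y the components of the fields have partial derivatives at most
  D A, so over the distance \<rho> the frame loses at most half of its lower bound. The cube again
  counts the sums over directions, fields and components.\<close>

lemma frame_near:
  fixes P :: "'p::finite \<Rightarrow> 'p vfield"
  assumes P: "\<And>a j. poly_bd y D A (\<lambda>x. P a x $ j)" and A: "0 < A"
    and \<kappa>: "\<And>c. \<kappa> * norm c \<le> norm (lin_field P c y)"
    and \<rho>: "\<rho> \<le> 1" "real CARD('p) ^ 3 * real D * A * \<rho> \<le> \<kappa> / 2" and x: "x \<in> ball y \<rho>"
  shows "\<kappa> / 2 * norm c \<le> norm (lin_field P c x)"
proof -
  let ?n = "real CARD('p)"
  have xy: "norm (x - y) \<le> \<rho>" "x \<in> cball y 1" "y \<in> cball y 1" using x \<rho>(1) by (auto simp: dist_norm norm_minus_commute)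
  have Pd: "\<bar>P a x $ i - P a y $ i\<bar> \<le> ?n * (real D * A) * \<rho>" for a i
  proof -
    have "\<bar>P a x $ i - P a y $ i\<bar> \<le> (\<Sum>j\<in>(UNIV :: 'p set). real D * A) * norm (x - y)"
    proof (rule abs_diff_le_partials[OF convex_cball _ _ xy(2,3)])
      show "(\<lambda>x. P a x $ i) differentiable (at z)" for z by (rule smooth_differentiable[OF poly_bd_smooth[OF P]])
      show "\<bar>partial j (\<lambda>x. P a x $ i) z\<bar> \<le> real D * A" if "z \<in> cball y 1" for j z
      proof (rule poly_bd_abs_le[OF poly_bd_partial[OF P]])
        show "\<bar>(z - y) $ i\<bar> \<le> 1" for i
          using component_le_norm_cart[of "z - y" i] that by (simp add: dist_norm norm_minus_commute)
      qed
    qed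
    also have "\<dots> \<le> (\<Sum>j\<in>(UNIV :: 'p set). real D * A) * \<rho>" using xy(1) A by (intro mult_left_mono) auto
    finally show ?thesis by simp
  qed
  have "\<bar>(lin_field P c x - lin_field P c y) $ i\<bar> \<le> ?n * (norm c * (?n * (real D * A) * \<rho>))" for i
  proof -
    have "(lin_field P c x - lin_field P c y) $ i = (\<Sum>a\<in>UNIV. c $ a * (P a x $ i - P a y $ i))"
      by (simp add: lin_field_nth right_diff_distrib sum_subtractf)
    also have "norm \<dots> \<le> (\<Sum>a\<in>(UNIV :: 'p set). norm c * (?n * (real D * A) * \<rho>))"
      by (rule sum_norm_le) (auto simp: abs_mult intro!: mult_mono component_le_norm_cart Pd)
    finally show ?thesis by simp
  qed
  then have "norm (lin_field P c x - lin_field P c y) \<le> ?n * (?n * (norm c * (?n * (real D * A) * \<rho>)))"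
    by (rule sum_le_norm1_bound)
  also have "\<dots> = (?n ^ 3 * real D * A * \<rho>) * norm c" by (simp add: power3_eq_cube)
  also have "\<dots> \<le> \<kappa> / 2 * norm c" by (rule mult_right_mono[OF \<rho>(2)]) simp
  finally have "norm (lin_field P c x - lin_field P c y) \<le> \<kappa> / 2 * norm c" .
  moreover have "norm (lin_field P c y) \<le> norm (lin_field P c x) + norm (lin_field P c x - lin_field P c y)"
    by (metis norm_minus_commute norm_triangle_sub)
  ultimately show ?thesis using \<kappa>[of c] by (simp add: field_simps)
qed

lemma poly_bd_lie_bracket_le:
  fixes V W :: "'p::finite vfield"
  assumes V: "\<And>j. poly_bd y D A (\<lambda>x. V x $ j)" and W: "\<And>j. poly_bd y D A (\<lambda>x. W x $ j)"
    and x: "norm (x - y) \<le> 1"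
  shows "norm (lie_bracket V W x) \<le> real CARD('p) * (2 * (real CARD('p) * (A * (real D * A))))"
proof (rule sum_le_norm1_bound)
  fix i
  have x': "\<bar>(x - y) $ i\<bar> \<le> 1" for i using component_le_norm_cart[of "x - y" i] x by simp
  have s: "smooth_vf V" "smooth_vf W" using poly_bd_smooth[OF V] poly_bd_smooth[OF W] by (simp_all add: smooth_vf_def)
  have "\<bar>vop V (\<lambda>x. W x $ i) x\<bar> \<le> real CARD('p) * (A * (real D * A))"
    "\<bar>vop W (\<lambda>x. V x $ i) x\<bar> \<le> real CARD('p) * (A * (real D * A))"
    by (rule poly_bd_abs_le[OF poly_bd_vop[OF V W] x'] poly_bd_abs_le[OF poly_bd_vop[OF W V] x'])+
  then show "\<bar>lie_bracket V W x $ i\<bar> \<le> 2 * (real CARD('p) * (A * (real D * A)))"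
    unfolding lie_bracket_vop[OF s] by linarith
qed

subsection \<open>Polynomial bounds for the approximating fields\<close>

lemma poly_bd_wsum:
  fixes c :: "'p::finite list \<Rightarrow> real"
  assumes "\<And>w. length w = k \<Longrightarrow> \<bar>c w\<bar> \<le> N" "k \<le> d"
  shows "poly_bd y d (real CARD('p) ^ k * N) (\<lambda>x. wsum c k (x - y))"
  using assms
proof (induction k arbitrary: c d)
  case 0
  then show ?case by (simp add: poly_bd.const)
next
  case (Suc k)
  obtain e where e: "d = Suc e" "k \<le> e" using Suc.prems(2) by (cases d) auto
  have "poly_bd y e (real CARD('p) ^ k * N) (\<lambda>x. wsum (\<lambda>w. c (a # w)) k (x - y))" for a
    by (rule Suc.IH[OF _ e(2)]) (simp add: Suc.prems(1))
  then have "poly_bd y d (real CARD('p) ^ k * N) (\<lambda>x. (x - y) $ a * wsum (\<lambda>w. c (a # w)) k (x - y))" for a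
    unfolding e(1) by (rule poly_bd.var) simp
  from poly_bd_sum[OF finite this, of UNIV] show ?case
    unfolding wsum_Suc by (simp add: mult.assoc)
qed

lemma smooth_approx_field: "\<forall>i. smooth_vf (approx_field r X y i)"
  by (simp add: smooth_vf_def smooth_def approx_field_def Ck_on_taylor_poly)

text \<open>The centre enters only through the iterated derivatives at y, which are continuous and
  hence bounded on the compact set K.\<close>

lemma poly_bd_taylor_poly:
  fixes f :: "real^'p::finite \<Rightarrow> real"
  assumes S: "open S" and K: "compact K" "convex K" "K \<subseteq> S" and f: "Ck_on m S f" and d: "m \<le> d"
  shows "\<exists>N. \<forall>y\<in>K. poly_bd y d N (taylor_poly m f y)"
proof -
  have "\<exists>M. length w \<le> m \<longrightarrow> (\<forall>y\<in>K. \<bar>partials w f y\<bar> \<le> M)" for w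
  proof (cases "length w \<le> m")
    case True
    then have "continuous_on S (partials w f)" using f by (simp add: Ck_on_def)
    then obtain M where "\<And>y. y \<in> K \<Longrightarrow> \<bar>partials w f y\<bar> \<le> M" using compact_bound[OF S K] by blast
    then show ?thesis by blast
  qed simp
  then have "\<forall>w. \<exists>M. length w \<le> m \<longrightarrow> (\<forall>y\<in>K. \<bar>partials w f y\<bar> \<le> M)" by blast
  from choice[OF this] obtain M where M: "\<forall>w. length w \<le> m \<longrightarrow> (\<forall>y\<in>K. \<bar>partials w f y\<bar> \<le> M w)" ..
  define N where "N = (\<Sum>k\<le>m. \<Sum>w\<in>{w :: 'p list. length w = k}. \<bar>M w\<bar>)"
  define Q where "Q = (\<Sum>k\<le>m. real CARD('p) ^ k)"
  have N: "\<bar>partials w f y\<bar> \<le> N" if "length w \<le> m" "y \<in> K" for w y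
  proof -
    have "\<bar>partials w f y\<bar> \<le> \<bar>M w\<bar>" using M that by fastforce
    also have "\<dots> \<le> (\<Sum>w\<in>{w'. length w' = length w}. \<bar>M w\<bar>)"
      by (rule member_le_sum[of w _ "\<lambda>w. \<bar>M w\<bar>"]) auto
    also have "\<dots> \<le> N" unfolding N_def
      by (rule member_le_sum[of "length w" _ "\<lambda>k. \<Sum>w\<in>{w. length w = k}. \<bar>M w\<bar>"]) (use that in \<open>auto intro: sum_nonneg\<close>)
    finally show ?thesis .
  qed
  have N0: "0 \<le> N" by (simp add: N_def sum_nonneg)
  have "poly_bd y d (real (card {..m}) * (Q * N)) (taylor_poly m f y)" if y: "y \<in> K" for y
  proof -
    have "poly_bd y d (Q * N) (\<lambda>x. inverse (fact k) * wsum (\<lambda>w. partials w f y) k (x - y))" if k: "k \<in> {..m}" for k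
    proof (rule poly_bd_mono[OF poly_bd_cmult[OF poly_bd_wsum] order_refl])
      show "\<bar>partials w f y\<bar> \<le> N" if "length w = k" for w by (rule N) (use that k y in auto)
      show "k \<le> d" using k d by simp
      have "real CARD('p) ^ k \<le> Q" unfolding Q_def by (rule member_le_sum[OF k]) auto
      then have le: "real CARD('p) ^ k * N \<le> Q * N" using N0 by (rule mult_right_mono)
      have "\<bar>inverse (fact k :: real)\<bar> * (real CARD('p) ^ k * N) \<le> 1 * (real CARD('p) ^ k * N)"
        using N0 fact_ge_1[of k] by (intro mult_right_mono) (auto simp: inverse_le_1_iff)
      also have "\<dots> \<le> Q * N" using le by simp
      finally show "\<bar>inverse (fact k :: real)\<bar> * (real CARD('p) ^ k * N) \<le> Q * N" .
    qed
    then have "poly_bd y d (real (card {..m}) * (Q * N)) (\<lambda>x. \<Sum>k\<in>{..m}. inverse (fact k) * wsum (\<lambda>w. partials w f y) k (x - y))"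
      by (intro poly_bd_sum finite_atMost)
    then show ?thesis
      by (rule poly_bd_eq) (simp add: taylor_poly_wsum divide_inverse mult.commute)
  qed
  then show ?thesis by blast
qed

text \<open>Over a finite index set the sums of the degrees and of the absolute bounds dominate the
  individual ones, and \<open>poly_bd\<close> is monotone in both.\<close>

lemma poly_bd_uniform:
  fixes f :: "'i::finite \<Rightarrow> real^'p::finite \<Rightarrow> real^'p \<Rightarrow> real"
  assumes "\<And>i. \<exists>d N. \<forall>y\<in>K. poly_bd y d N (f i y)"
  shows "\<exists>d N. \<forall>i. \<forall>y\<in>K. poly_bd y d N (f i y)"
proof -
  have "\<forall>i. \<exists>z. \<forall>y\<in>K. poly_bd y (fst z) (snd z) (f i y)" using assms by simp
  from choice[OF this] obtain z where z: "\<forall>i. \<forall>y\<in>K. poly_bd y (fst (z i)) (snd (z i)) (f i y)" ..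
  have "poly_bd y (\<Sum>i\<in>UNIV. fst (z i)) (\<Sum>i\<in>UNIV. \<bar>snd (z i)\<bar>) (f i y)" if "y \<in> K" for i y
  proof (rule poly_bd_mono)
    show "poly_bd y (fst (z i)) (snd (z i)) (f i y)" using z that by blast
    show "fst (z i) \<le> (\<Sum>i\<in>UNIV. fst (z i))" by (rule member_le_sum) auto
    have "\<bar>snd (z i)\<bar> \<le> (\<Sum>i\<in>UNIV. \<bar>snd (z i)\<bar>)" by (rule member_le_sum[of i _ "\<lambda>i. \<bar>snd (z i)\<bar>"]) auto
    then show "snd (z i) \<le> (\<Sum>i\<in>UNIV. \<bar>snd (z i)\<bar>)" by linarith
  qed
  then show ?thesis by blast
qed

lemma poly_bd_commutator:
  fixes X :: "nat \<Rightarrow> 'p::finite vfield"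
  assumes S: "open S" and K: "compact K" "convex K" "K \<subseteq> S"
    and X: "\<And>i c. i \<le> n \<Longrightarrow> Ck_on (r - wt i) S (\<lambda>x. X i x $ c)" and I: "set I \<subseteq> {..n}"
  shows "\<exists>d N. \<forall>c. \<forall>y\<in>K. poly_bd y d N (\<lambda>x. commutator (approx_field r X y) I x $ c)"
  using I
proof (induction I rule: induct_list012)
  case 1
  have "poly_bd y 0 0 (\<lambda>x. commutator (approx_field r X y) [] x $ c)" for y c by (simp add: poly_bd.const)
  then show ?case by blast
next
  case (2 i)
  show ?case
  proof (rule poly_bd_uniform)
    fix c
    have "\<exists>N. \<forall>y\<in>K. poly_bd y (r - wt i) N (taylor_poly (r - wt i) (\<lambda>z. X i z $ c) y)"
      by (rule poly_bd_taylor_poly[OF S K X]) (use 2 in auto)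
    then show "\<exists>d N. \<forall>y\<in>K. poly_bd y d N (\<lambda>x. commutator (approx_field r X y) [i] x $ c)"
      by (auto simp: approx_field_def)
  qed
next
  case (3 i j I)
  let ?S = "approx_field r X" and ?J = "j # I"
  have sub: "set [i] \<subseteq> {..n}" "set ?J \<subseteq> {..n}" using "3.prems" by auto
  show ?case
  proof (rule poly_bd_uniform)
    fix c
    have "\<exists>d N. \<forall>c. \<forall>y\<in>K. poly_bd y d N (\<lambda>x. ?S y i x $ c)"
    proof (rule poly_bd_uniform)
      fix c
      have "\<exists>N. \<forall>y\<in>K. poly_bd y (r - wt i) N (taylor_poly (r - wt i) (\<lambda>z. X i z $ c) y)"
        by (rule poly_bd_taylor_poly[OF S K X]) (use sub in auto)
      then show "\<exists>d N. \<forall>y\<in>K. poly_bd y d N (\<lambda>x. ?S y i x $ c)"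
        by (auto simp: approx_field_def)
    qed
    then obtain d N where V: "\<And>c y. y \<in> K \<Longrightarrow> poly_bd y d N (\<lambda>x. ?S y i x $ c)" by blast
    obtain e M where W: "\<And>c y. y \<in> K \<Longrightarrow> poly_bd y e M (\<lambda>x. commutator (?S y) ?J x $ c)"
      using "3.IH"(2)[OF sub(2)] by blast
    let ?n = "real CARD('p)"
    let ?N1 = "?n * (N * (real e * M))" and ?N2 = "?n * (M * (real d * N))"
    have "poly_bd y (d + e) (?N1 + \<bar>- 1\<bar> * ?N2) (\<lambda>x. commutator (?S y) (i # j # I) x $ c)" if y: "y \<in> K" for y
    proof -
      have s: "smooth_vf (?S y i)" "smooth_vf (commutator (?S y) ?J)"
        using smooth_approx_field[of r X y] smooth_commutator[OF smooth_approx_field] by blast+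
      have 1: "poly_bd y (d + e) ?N1 (vop (?S y i) (\<lambda>x. commutator (?S y) ?J x $ c))"
        by (rule poly_bd_vop[OF V[OF y] W[OF y]])
      have 2: "poly_bd y (d + e) ?N2 (vop (commutator (?S y) ?J) (\<lambda>x. ?S y i x $ c))"
        by (rule poly_bd_mono[OF poly_bd_vop[OF W[OF y] V[OF y]]]) auto
      show ?thesis
        by (rule poly_bd_eq[OF poly_bd.add[OF 1 poly_bd_cmult[OF 2] order_refl]])
          (simp add: lie_bracket_vop[OF s])
    qed
    then show "\<exists>d N. \<forall>y\<in>K. poly_bd y d N (\<lambda>x. commutator (?S y) (i # j # I) x $ c)" by blast
  qed
qed

subsection \<open>Comparison of the fields with their approximations\<close>

lemma agree_approx:
  fixes X :: "nat \<Rightarrow> 'p::finite vfield"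
  assumes S: "open S" and K: "compact K" "convex K" "K \<subseteq> S"
    and X: "\<And>i c. i \<le> n \<Longrightarrow> Ck_on (r - wt i) S (\<lambda>x. X i x $ c)" and I: "I \<in> multiindices n r"
  shows "agree S K (r - weight I) (\<lambda>x. commutator X I x $ c) (\<lambda>y x. commutator (approx_field r X y) I x $ c)"
proof (rule agree_commutator[OF S K _ I])
  fix i c assume "i \<le> n"
  then show "agree S K (r - wt i) (\<lambda>x. X i x $ c) (\<lambda>y x. approx_field r X y i x $ c)"
    using agree_taylor_poly[OF S K X, of i c] by (simp add: approx_field_def)
qed

lemma continuous_on_commutator:
  fixes X :: "nat \<Rightarrow> 'p::finite vfield"
  assumes S: "open S" and K: "compact K" "convex K" "K \<subseteq> S"
    and X: "\<And>i c. i \<le> n \<Longrightarrow> Ck_on (r - wt i) S (\<lambda>x. X i x $ c)" and I: "I \<in> multiindices n r"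
  shows "continuous_on K (commutator X I)"
proof -
  have "continuous_on K (\<lambda>x. commutator X I x $ c)" for c
  proof -
    have "Ck_on (r - weight I) S (\<lambda>x. commutator X I x $ c)"
      using agree_imp_agree0[OF S K agree_approx[OF S K X I, of c]] by (simp add: agree0_def[OF S K])
    then show ?thesis by (rule continuous_on_subset[OF Ck_on_imp_continuous K(3)])
  qed
  then have "continuous_on K (\<lambda>x. \<chi> c. commutator X I x $ c)" by (intro continuous_on_vec_lambda)
  then show ?thesis by simp
qed

lemma commutator_approx_center:
  fixes X :: "nat \<Rightarrow> 'p::finite vfield"
  assumes S: "open S" and K: "compact K" "convex K" "K \<subseteq> S"
    and X: "\<And>i c. i \<le> n \<Longrightarrow> Ck_on (r - wt i) S (\<lambda>x. X i x $ c)" and I: "I \<in> multiindices n r" and y: "y \<in> K"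
  shows "commutator (approx_field r X y) I y = commutator X I y"
proof (rule vec_eq_iff[THEN iffD2, rule_format])
  fix c
  show "commutator (approx_field r X y) I y $ c = commutator X I y $ c"
    using agree_imp_agree0[OF S K agree_approx[OF S K X I, of c]] y by (simp add: agree0_def[OF S K])
qed

lemma commutator_approx_error:
  fixes X :: "nat \<Rightarrow> 'p::finite vfield"
  assumes S: "open S" and K: "compact K" "convex K" "K \<subseteq> S"
    and X: "\<And>i c. i \<le> n \<Longrightarrow> Ck_on (r - wt i) S (\<lambda>x. X i x $ c)"
  shows "\<exists>C\<ge>0. \<forall>I\<in>multiindices n r. \<forall>x\<in>K. \<forall>y\<in>K.
    norm (commutator X I x - commutator (approx_field r X y) I x) \<le> C * dist x y ^ (r - weight I)"
proof -
  let ?d = "\<lambda>I x y. commutator X I x - commutator (approx_field r X y) I x"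
  have "\<exists>C. I \<in> multiindices n r \<longrightarrow> C \<ge> 0 \<and> (\<forall>x\<in>K. \<forall>y\<in>K. norm (?d I x y) \<le> C * dist x y ^ (r - weight I))" for I
  proof (cases "I \<in> multiindices n r")
    case True
    have "\<exists>C. C \<ge> 0 \<and> (\<forall>x\<in>K. \<forall>y\<in>K. \<bar>?d I x y $ c\<bar> \<le> C * dist x y ^ (r - weight I))" for c
      using agree0_E[OF S K agree_imp_agree0[OF S K agree_approx[OF S K X True, of c]]]
      unfolding vector_minus_component by metis
    then have "\<forall>c. \<exists>C. C \<ge> 0 \<and> (\<forall>x\<in>K. \<forall>y\<in>K. \<bar>?d I x y $ c\<bar> \<le> C * dist x y ^ (r - weight I))" by blast
    from choice[OF this] obtain C where C: "\<forall>c. C c \<ge> 0 \<and> (\<forall>x\<in>K. \<forall>y\<in>K. \<bar>?d I x y $ c\<bar> \<le> C c * dist x y ^ (r - weight I))" ..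
    have "norm (?d I x y) \<le> (\<Sum>c\<in>UNIV. C c) * dist x y ^ (r - weight I)" if "x \<in> K" "y \<in> K" for x y
    proof -
      have "norm1 (?d I x y) \<le> (\<Sum>c\<in>UNIV. C c * dist x y ^ (r - weight I))"
        unfolding norm1_def by (rule sum_mono) (use C that in blast)
      then show ?thesis using norm_le_norm1[of "?d I x y"] by (simp add: sum_distrib_right)
    qed
    moreover have "0 \<le> (\<Sum>c\<in>UNIV. C c)" using C by (simp add: sum_nonneg)
    ultimately show ?thesis by blast
  qed simp
  then have "\<forall>I. \<exists>C. I \<in> multiindices n r \<longrightarrow> C \<ge> 0 \<and> (\<forall>x\<in>K. \<forall>y\<in>K. norm (?d I x y) \<le> C * dist x y ^ (r - weight I))" by blast
  from choice[OF this] obtain C where C: "\<forall>I. I \<in> multiindices n r \<longrightarrow> C I \<ge> 0 \<and>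
      (\<forall>x\<in>K. \<forall>y\<in>K. norm (?d I x y) \<le> C I * dist x y ^ (r - weight I))" ..
  show ?thesis
  proof (intro exI[of _ "\<Sum>I\<in>multiindices n r. C I"] conjI ballI)
    show "0 \<le> (\<Sum>I\<in>multiindices n r. C I)" using C by (simp add: sum_nonneg)
    fix I x y assume a: "I \<in> multiindices n r" "x \<in> K" "y \<in> K"
    have "C I \<le> (\<Sum>I\<in>multiindices n r. C I)"
      by (rule member_le_sum[OF a(1)]) (use C finite_multiindices in auto)
    then have "C I * dist x y ^ (r - weight I) \<le> (\<Sum>I\<in>multiindices n r. C I) * dist x y ^ (r - weight I)"
      by (rule mult_right_mono) simp
    then show "norm (?d I x y) \<le> (\<Sum>I\<in>multiindices n r. C I) * dist x y ^ (r - weight I)"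
      using C a by (meson order_trans)
  qed
qed

text \<open>The norm of the combination is continuous and positive on the compact product of K with
  the unit sphere. Its minimum there is \<kappa>, and scaling extends the bound to all c.\<close>

lemma frame_lower_bound:
  fixes Y :: "'p::finite \<Rightarrow> 'p vfield"
  assumes K: "compact K" "K \<noteq> {}" and c: "\<And>j. continuous_on K (Y j)"
    and ind: "\<And>x c. x \<in> K \<Longrightarrow> lin_field Y c x = 0 \<Longrightarrow> c = 0"
  shows "\<exists>\<kappa>>0. \<forall>x\<in>K. \<forall>c. \<kappa> * norm c \<le> norm (lin_field Y c x)"
proof -
  let ?S = "K \<times> sphere (0 :: real^'p) 1" and ?f = "\<lambda>z. norm (lin_field Y (snd z) (fst z))"
  have "continuous_on ?S (\<lambda>z. Y j (fst z))" for j
    by (rule continuous_on_compose2[OF c continuous_on_fst]) auto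
  then have cf: "continuous_on ?S ?f"
    unfolding lin_field_def by (intro continuous_intros)
  obtain x where x: "x \<in> K" using K(2) by blast
  obtain j :: 'p where True by simp
  have "axis j 1 \<in> sphere (0 :: real^'p) 1" by simp
  then have "?S \<noteq> {}" using x by blast
  moreover have "compact ?S" by (intro compact_Times K(1) compact_sphere)
  ultimately obtain z where z: "z \<in> ?S" "\<And>z'. z' \<in> ?S \<Longrightarrow> ?f z \<le> ?f z'"
    using continuous_attains_inf[OF _ _ cf] by blast
  have "snd z \<noteq> 0" using z(1) by auto
  then have pos: "0 < ?f z" using ind[of "fst z" "snd z"] z(1) by auto
  have "?f z * norm c \<le> norm (lin_field Y c x)" if x: "x \<in> K" for x c
  proof (cases "c = 0")
    case False
    have "(x, (1 / norm c) *\<^sub>R c) \<in> ?S" using x False by simp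
    moreover have "lin_field Y ((1 / norm c) *\<^sub>R c) x = (1 / norm c) *\<^sub>R lin_field Y c x"
      by (rule linear_scale[OF lin_field_linear])
    ultimately have "?f z \<le> norm (lin_field Y c x) / norm c" using z(2)[of "(x, (1 / norm c) *\<^sub>R c)"] by simp
    then show ?thesis using False by (simp add: pos_le_divide_eq)
  qed simp
  then show ?thesis using pos by blast
qed

subsection \<open>The homogeneous norm\<close>

lemma abs_le_hom_norm_power:
  assumes "1 \<le> weight (B j)"
  shows "\<bar>u $ j\<bar> \<le> hom_norm B u ^ weight (B j)"
proof -
  let ?w = "weight (B j)"
  have "\<bar>u $ j\<bar> powr (1 / real ?w) \<le> hom_norm B u"
    unfolding hom_norm_def by (rule member_le_sum[of j _ "\<lambda>j. \<bar>u $ j\<bar> powr (1 / real (weight (B j)))"]) auto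
  then have "(\<bar>u $ j\<bar> powr (1 / real ?w)) ^ ?w \<le> hom_norm B u ^ ?w" by (rule power_mono) simp
  moreover have "(\<bar>u $ j\<bar> powr (1 / real ?w)) ^ ?w = \<bar>u $ j\<bar>"
    using assms by (cases "u $ j = 0") (auto simp: powr_powr powr_realpow[symmetric])
  ultimately show ?thesis by simp
qed

lemma hom_norm_nonneg: "0 \<le> hom_norm B u"
  by (simp add: hom_norm_def sum_nonneg)

text \<open>The small factor q enters with exponent 1/w, and since q <= 1 and w <= r the exponent
  1/r is the worst case. The gain q^(1/r) is what closes the estimate in
  \<open>hom_norm_Theta_le\<close>.\<close>

lemma hom_norm_le:
  fixes u :: "real^'p::finite"
  assumes w: "\<And>j. 1 \<le> weight (B j)" "\<And>j. weight (B j) \<le> r"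
    and u: "\<And>j. \<bar>u $ j\<bar> \<le> q * \<sigma> ^ weight (B j)" and q: "0 \<le> q" "q \<le> 1" and \<sigma>: "0 < \<sigma>"
  shows "hom_norm B u \<le> real CARD('p) * q powr (1 / real r) * \<sigma>"
proof -
  have "\<bar>u $ j\<bar> powr (1 / real (weight (B j))) \<le> q powr (1 / real r) * \<sigma>" for j
  proof -
    let ?w = "weight (B j)"
    have w': "real ?w > 0" "real ?w \<le> real r" using w[of j] by auto
    have "\<bar>u $ j\<bar> powr (1 / real ?w) \<le> (q * \<sigma> ^ ?w) powr (1 / real ?w)"
      by (rule powr_mono2[OF _ _ u]) (use w' in auto)
    also have "\<dots> = q powr (1 / real ?w) * (\<sigma> ^ ?w) powr (1 / real ?w)"
      by (rule powr_mult)
    also have "(\<sigma> ^ ?w) powr (1 / real ?w) = \<sigma>"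
      using \<sigma> w' by (simp add: powr_realpow[symmetric] powr_powr)
    also have "q powr (1 / real ?w) \<le> q powr (1 / real r)"
      by (rule powr_mono') (use q w' in \<open>auto simp: frac_le\<close>)
    finally show ?thesis using \<sigma> by (simp add: mult_right_mono)
  qed
  then have "hom_norm B u \<le> (\<Sum>j\<in>(UNIV :: 'p set). q powr (1 / real r) * \<sigma>)"
    unfolding hom_norm_def by (rule sum_mono)
  then show ?thesis by (simp add: mult.assoc)
qed

subsection \<open>Uniform constants on a compact set\<close>

text \<open>Collects what must not depend on the centre y in K: the frame bound \<kappa>, the Taylor
  error C, the bound M on the fields, the growth data D and A, the coordinates \<beta> of
  commutators in the basis and \<Lambda> of brackets in the frame. The last condition on \<epsilon>
  keeps the chart inside the ball of radius \<rho> on which the frame is controlled.\<close>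

locale uniform_chart =
  fixes \<Omega> :: "(real^'p::finite) set" and X :: "nat \<Rightarrow> 'p vfield" and B :: "'p \<Rightarrow> nat list" and n r :: nat
    and K :: "(real^'p) set" and \<kappa> C M A \<rho> \<epsilon> H :: real and D :: nat and \<beta> :: "nat list \<Rightarrow> 'p \<Rightarrow> real"
    and \<Lambda> :: "real^'p \<Rightarrow> 'p \<Rightarrow> 'p \<Rightarrow> real^'p \<Rightarrow> real^'p" and g :: real
  assumes K: "K \<subseteq> \<Omega>"
    and B: "inj B" "range B \<subseteq> multiindices n r"
    and frame_X: "0 < \<kappa>" "\<And>x c. x \<in> K \<Longrightarrow> \<kappa> * norm c \<le> norm (lin_field (\<lambda>j. commutator X (B j)) c x)"
    and error: "0 \<le> C" "\<And>I x y. I \<in> multiindices n r \<Longrightarrow> x \<in> K \<Longrightarrow> y \<in> K \<Longrightarrow>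
      norm (commutator X I x - commutator (approx_field r X y) I x) \<le> C * dist x y ^ (r - weight I)"
    and center: "\<And>I y. I \<in> multiindices n r \<Longrightarrow> y \<in> K \<Longrightarrow> commutator (approx_field r X y) I y = commutator X I y"
    and bound_X: "0 \<le> M" "\<And>I x. I \<in> multiindices n r \<Longrightarrow> x \<in> K \<Longrightarrow> norm (commutator X I x) \<le> M"
    and \<beta>: "\<And>I k. I \<in> multiindices n r \<Longrightarrow> \<beta> I k \<noteq> 0 \<Longrightarrow> weight (B k) = weight I"
      "\<And>I x y. I \<in> multiindices n r \<Longrightarrow> commutator (approx_field r X y) I x = (\<Sum>k\<in>UNIV. \<beta> I k *\<^sub>R commutator (approx_field r X y) (B k) x)"
    and poly: "1 \<le> D" "0 < A" "\<And>y j i. y \<in> K \<Longrightarrow> poly_bd y D A (\<lambda>x. commutator (approx_field r X y) (B j) x $ i)"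
    and g: "g = word_growth CARD('p) D A"
    and \<rho>: "0 < \<rho>" "\<rho> \<le> 1" "real CARD('p) ^ 3 * real D * A * \<rho> \<le> \<kappa> / 2"
    and \<Lambda>: "\<And>y a l x. y \<in> K \<Longrightarrow> x \<in> ball y \<rho> \<Longrightarrow>
        lie_bracket (commutator (approx_field r X y) (B a)) (commutator (approx_field r X y) (B l)) x
          = lin_field (\<lambda>j. commutator (approx_field r X y) (B j)) (\<Lambda> y a l x) x"
      "\<And>y a l x k. y \<in> K \<Longrightarrow> x \<in> ball y \<rho> \<Longrightarrow> \<bar>\<Lambda> y a l x $ k\<bar> \<le> H"
      "\<And>y a l x k. y \<in> K \<Longrightarrow> x \<in> ball y \<rho> \<Longrightarrow> \<Lambda> y a l x $ k \<noteq> 0 \<Longrightarrow> weight (B k) \<le> weight (B a) + weight (B l)"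
    and \<epsilon>: "0 < \<epsilon>" "\<epsilon> \<le> 1" "real CARD('p) * \<epsilon> \<le> 1 / (2 * g)" "real CARD('p) ^ 3 * dbound2 g * \<epsilon> \<le> \<kappa> / 2"
      "real CARD('p) ^ 2 * dbound1 g * \<epsilon> < \<rho>"
begin

abbreviation "Sy y \<equiv> (\<lambda>j. commutator (approx_field r X y) (B j))"
abbreviation "Ey y \<equiv> lie_exp (Sy y) y"

lemma B_mult: "B j \<in> multiindices n r"
  using B(2) by blast

lemma weight_B: "1 \<le> weight (B j)" "weight (B j) \<le> r"
  using B_mult[of j] weight_pos[of "B j"] by (auto simp: multiindices_def)

lemma frame_center:
  assumes "y \<in> K"
  shows "\<kappa> * norm c \<le> norm (lin_field (Sy y) c y)"
  using frame_X(2)[OF assms, of c] by (simp add: lin_field_def center[OF B_mult assms])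

lemma dbound1_nonneg:
  assumes "y \<in> K"
  shows "0 \<le> dbound1 g"
  using chart_partial[OF poly(3)[OF assms] poly(1,2) frame_X(1) frame_center[OF assms] g \<epsilon>(1,3,4), of 0] \<epsilon>(1)
  by (meson abs_ge_zero centre_in_cball less_imp_le order_trans)

lemma Ey_upper:
  assumes "y \<in> K" "u \<in> cball 0 \<epsilon>"
  shows "norm (Ey y u - y) \<le> real CARD('p) ^ 2 * dbound1 g * norm u"
  by (rule chart_upper[OF poly(3)[OF assms(1)] poly(1,2) frame_X(1) frame_center[OF assms(1)] g \<epsilon>(1,3,4) assms(2)])

lemma Ey_lower:
  assumes "y \<in> K" "u \<in> cball 0 \<epsilon>" "u' \<in> cball 0 \<epsilon>"
  shows "\<kappa> / 2 * norm (u - u') \<le> norm (Ey y u - Ey y u')"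
  by (rule chart_lower[OF poly(3)[OF assms(1)] poly(1,2) frame_X(1) frame_center[OF assms(1)] g \<epsilon>(1,3,4) assms(2,3)])

lemma Ey_zero: "y \<in> K \<Longrightarrow> Ey y 0 = y"
  by (rule lie_exp_zero[OF poly(3) poly(1,2)])

lemma Ey_ball:
  assumes "y \<in> K" "u \<in> ball 0 \<epsilon>"
  shows "Ey y u \<in> ball y \<rho>"
proof -
  have "norm (Ey y u - y) \<le> real CARD('p) ^ 2 * dbound1 g * norm u" by (rule Ey_upper) (use assms in auto)
  also have "\<dots> \<le> real CARD('p) ^ 2 * dbound1 g * \<epsilon>"
    using assms dbound1_nonneg[OF assms(1)] by (intro mult_left_mono) auto
  finally show ?thesis using \<epsilon>(5) by (simp add: dist_norm norm_minus_commute)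
qed

lemma Ey_dom: "y \<in> K \<Longrightarrow> cball 0 \<epsilon> \<subseteq> {u :: real^'p. norm1 u < 1 / g}"
  by (rule chart_dom[OF poly(3) poly(1,2) frame_X(1) frame_center g \<epsilon>(1,3,4)])

lemma Ey_diffeo: "y \<in> K \<Longrightarrow> smooth_diffeo_on (ball 0 \<epsilon>) (Ey y)"
  by (rule chart_diffeo[OF poly(3) poly(1,2) frame_X(1) frame_center g \<epsilon>(1,3,4)])

lemma Ey_integral_curve:
  assumes "y \<in> K" "norm1 u < 1 / g"
  shows "integral_curve (lin_field (Sy y) u) y (\<lambda>t. Ey y (t *\<^sub>R u))"
  by (rule chart_integral_curve[OF poly(3)[OF assms(1)] poly(1,2) frame_X(1) frame_center[OF assms(1)] g \<epsilon>(1,3,4) assms(2)])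

lemma exp_map_Ey:
  assumes "y \<in> K" "u \<in> ball 0 \<epsilon>"
  shows "exp_map r X B y u = Ey y u"
proof -
  have "norm1 u < 1 / g" using subsetD[OF Ey_dom[OF assms(1)] subsetD[OF ball_subset_cball assms(2)]] by simp
  then show ?thesis unfolding exp_map_def coord_field_lin_field
    by (rule chart_vf_exp[OF poly(3)[OF assms(1)] poly(1,2) frame_X(1) frame_center[OF assms(1)] g \<epsilon>(1,3,4)])
qed

lemma Theta_Ey:
  assumes "y \<in> K" "u \<in> ball 0 \<epsilon>"
  shows "Ey y u \<in> Theta_dom r X B y" "Theta r X B y (Ey y u) = u"
proof -
  have "\<exists>\<phi>. integral_curve (coord_field r X B y u) y \<phi>" if u: "u \<in> ball 0 \<epsilon>" for u
  proof -
    have "norm1 u < 1 / g" using subsetD[OF Ey_dom[OF assms(1)] subsetD[OF ball_subset_cball u]] by simp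
    from Ey_integral_curve[OF assms(1) this] show ?thesis unfolding coord_field_lin_field by blast
  qed
  from Theta_exp_map[OF \<epsilon>(1) this Ey_diffeo[OF assms(1)] exp_map_Ey[OF assms(1)] assms(2)]
  show "Ey y u \<in> Theta_dom r X B y" "Theta r X B y (Ey y u) = u" by blast+
qed

lemma Theta_near:
  assumes "y \<in> K" "x \<in> ball y (\<kappa> / 2 * \<epsilon>)"
  shows "x \<in> Theta_dom r X B y" "Theta r X B y x \<in> ball 0 \<epsilon>" "Ey y (Theta r X B y x) = x"
    "norm (Theta r X B y x) \<le> 2 / \<kappa> * dist x y"
proof -
  have "ball y (\<kappa> / 2 * \<epsilon>) \<subseteq> Ey y ` ball 0 \<epsilon>"
    by (rule chart_image[OF poly(3)[OF assms(1)] poly(1,2) frame_X(1) frame_center[OF assms(1)] g \<epsilon>(1,3,4)])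
  then obtain u where u: "u \<in> ball 0 \<epsilon>" "x = Ey y u" using assms(2) by blast
  note T = Theta_Ey[OF assms(1) u(1)]
  show "x \<in> Theta_dom r X B y" "Theta r X B y x \<in> ball 0 \<epsilon>" "Ey y (Theta r X B y x) = x"
    using T u by simp_all
  have "\<kappa> / 2 * norm (u - 0) \<le> norm (Ey y u - Ey y 0)" by (rule Ey_lower[OF assms(1)]) (use u \<epsilon>(1) in auto)
  then show "norm (Theta r X B y x) \<le> 2 / \<kappa> * dist x y"
    using T u frame_X(1) Ey_zero[OF assms(1)] by (simp add: dist_norm field_simps)
qed

text \<open>Such a sum is the price of replacing the original fields by the approximating ones along a curve
  at distance \<open>O(\<delta>)\<close> from the center: each coefficient in the basis changes by \<open>O(\<delta>^r)\<close>,
  which is at most \<open>\<delta>^|I|\<close> for every admissible weight.\<close>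

lemma error_sum:
  assumes y: "y \<in> K" and z: "z \<in> K" and zy: "dist z y \<le> m * \<delta>" and m: "1 \<le> m" and \<delta>: "0 < \<delta>"
    and J: "finite J" "\<And>j. j \<in> J \<Longrightarrow> I j \<in> multiindices n r" "\<And>j. j \<in> J \<Longrightarrow> \<bar>a j\<bar> \<le> \<delta> ^ weight (I j)"
  shows "norm (\<Sum>j\<in>J. a j *\<^sub>R (commutator X (I j) z - commutator (approx_field r X y) (I j) z))
     \<le> real (card J) * (C * m ^ r * \<delta> ^ r)"
proof -
  have "norm (a j *\<^sub>R (commutator X (I j) z - commutator (approx_field r X y) (I j) z)) \<le> C * m ^ r * \<delta> ^ r"
    if j: "j \<in> J" for j
  proof -
    let ?w = "weight (I j)"
    have w: "?w \<le> r" using J(2)[OF j] by (simp add: multiindices_def)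
    have "dist z y ^ (r - ?w) \<le> (m * \<delta>) ^ (r - ?w)" by (rule power_mono[OF zy]) simp
    also have "\<dots> \<le> m ^ r * \<delta> ^ (r - ?w)"
      unfolding power_mult_distrib using m \<delta> by (intro mult_right_mono power_increasing) auto
    finally have d: "C * dist z y ^ (r - ?w) \<le> C * (m ^ r * \<delta> ^ (r - ?w))" by (rule mult_left_mono[OF _ error(1)])
    have "norm (a j *\<^sub>R (commutator X (I j) z - commutator (approx_field r X y) (I j) z))
        \<le> \<delta> ^ ?w * (C * (m ^ r * \<delta> ^ (r - ?w)))"
      unfolding norm_scaleR using J(3)[OF j] \<delta> order_trans[OF error(2)[OF J(2)[OF j] z y] d]
      by (intro mult_mono) auto
    also have "\<dots> = C * m ^ r * (\<delta> ^ ?w * \<delta> ^ (r - ?w))" by simp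
    also have "\<delta> ^ ?w * \<delta> ^ (r - ?w) = \<delta> ^ r" using w by (simp add: power_add[symmetric])
    finally show ?thesis .
  qed
  then show ?thesis by (rule sum_norm_bound)
qed


section \<open>The distance is bounded by rho\<close>

text \<open>The summand 1 accounts for the coordinates u themselves, the other for the Taylor error
  expressed in the original frame. The maximum is the constant in the Euclidean distance O(\<delta>)
  between y and points of the ray.\<close>

definition Q1 :: real where
  "Q1 = 1 + real CARD('p) * C * max 1 (real CARD('p) ^ 3 * dbound1 g) ^ r / \<kappa>"

lemma Q1_ge: "1 \<le> Q1"
  using error(1) frame_X(1) by (simp add: Q1_def)

lemma norm_le_hom:
  assumes "0 < \<delta>" "\<delta> \<le> 1" "\<And>j. \<bar>u $ j\<bar> \<le> \<delta> ^ weight (B j)"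
  shows "norm u \<le> real CARD('p) * \<delta>"
proof (rule sum_le_norm1_bound)
  fix j
  have "\<delta> ^ weight (B j) \<le> \<delta> ^ 1" using assms(1,2) weight_B(1)[of j] by (intro power_decreasing) auto
  then show "\<bar>u $ j\<bar> \<le> \<delta>" using assms(3)[of j] by simp
qed

text \<open>The Taylor error has size \<delta>^r and is expanded in the original frame, where it
  only enlarges the coefficients u by a constant factor. The sign is reversed because the ray will
  be run back to its centre.\<close>

lemma lin_field_in_X_frame:
  assumes y: "y \<in> K" and z: "z \<in> K" "dist z y \<le> max 1 (real CARD('p) ^ 3 * dbound1 g) * \<delta>"
    and \<delta>: "0 < \<delta>" "\<delta> \<le> 1" and u: "\<And>j. \<bar>u $ j\<bar> \<le> \<delta> ^ weight (B j)"
  shows "\<exists>c. lin_field (Sy y) u z = - lin_field (\<lambda>j. commutator X (B j)) c z \<and> (\<forall>j. \<bar>c $ j\<bar> \<le> Q1 * \<delta> ^ weight (B j))"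
proof -
  let ?m = "max 1 (real CARD('p) ^ 3 * dbound1 g)" and ?XB = "\<lambda>j. commutator X (B j)"
  define e where "e = (\<Sum>j\<in>UNIV. (u $ j) *\<^sub>R (commutator X (B j) z - commutator (approx_field r X y) (B j) z))"
  have e: "norm e \<le> real CARD('p) * (C * ?m ^ r * \<delta> ^ r)"
    unfolding e_def by (rule error_sum[OF y z _ \<delta>(1) finite B_mult u]) simp
  obtain c where c: "lin_field ?XB c z = e" "norm c \<le> norm e / \<kappa>"
    using frame_coordinates[OF frame_X(1) frame_X(2)[OF z(1)]] by blast
  have "lin_field (Sy y) u z = lin_field ?XB u z - e"
    by (simp add: lin_field_def e_def scaleR_diff_right sum_subtractf)
  also have "\<dots> = - lin_field ?XB (c - u) z"
    unfolding c(1)[symmetric] linear_diff[OF lin_field_linear] by simp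
  finally have 1: "lin_field (Sy y) u z = - lin_field ?XB (c - u) z" .
  have "\<bar>(c - u) $ j\<bar> \<le> Q1 * \<delta> ^ weight (B j)" for j
  proof -
    let ?q = "real CARD('p) * C * ?m ^ r / \<kappa>"
    have q: "0 \<le> ?q" using error(1) frame_X(1) by simp
    have "\<bar>c $ j\<bar> \<le> norm e / \<kappa>" using component_le_norm_cart[of c j] c(2) by linarith
    also have "\<dots> \<le> ?q * \<delta> ^ r" using e frame_X(1) by (simp add: divide_right_mono mult_ac)
    also have "\<dots> \<le> ?q * \<delta> ^ weight (B j)"
      using q \<delta> weight_B(2)[of j] by (intro mult_left_mono power_decreasing) auto
    finally have "\<bar>c $ j\<bar> \<le> ?q * \<delta> ^ weight (B j)" .
    then have "\<bar>c $ j - u $ j\<bar> \<le> ?q * \<delta> ^ weight (B j) + \<delta> ^ weight (B j)" using u[of j] by linarith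
    also have "\<dots> = Q1 * \<delta> ^ weight (B j)" by (simp add: Q1_def algebra_simps)
    finally show ?thesis by simp
  qed
  then show ?thesis using 1 by blast
qed

lemma sum_multiindices_B:
  fixes V :: "nat list \<Rightarrow> real^'p"
  shows "(\<Sum>I\<in>multiindices n r. (\<Sum>j\<in>UNIV. if B j = I then c j else 0) *\<^sub>R V I) = (\<Sum>j\<in>UNIV. c j *\<^sub>R V (B j))"
proof -
  have "(\<Sum>I\<in>multiindices n r. (\<Sum>j\<in>UNIV. if B j = I then c j else 0) *\<^sub>R V I)
      = (\<Sum>I\<in>multiindices n r. \<Sum>j\<in>UNIV. if B j = I then c j *\<^sub>R V I else 0)"
    unfolding scaleR_sum_left by (intro sum.cong refl) auto
  also have "\<dots> = (\<Sum>j\<in>UNIV. \<Sum>I\<in>multiindices n r. if B j = I then c j *\<^sub>R V I else 0)" by (rule sum.swap)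
  also have "\<dots> = (\<Sum>j\<in>UNIV. c j *\<^sub>R V (B j))"
    by (rule sum.cong[OF refl], subst sum.delta'[OF finite_multiindices]) (use B_mult in auto)
  finally show ?thesis .
qed

lemma abs_sum_B_le:
  fixes q :: real
  assumes "\<And>j. \<bar>c j\<bar> \<le> q ^ weight (B j)" "0 \<le> q"
  shows "\<bar>\<Sum>j\<in>UNIV. if B j = I then c j else 0\<bar> \<le> q ^ weight I"
proof (cases "I \<in> range B")
  case True
  then obtain k where k: "I = B k" by blast
  have "(\<Sum>j\<in>UNIV. if B j = I then c j else 0) = (\<Sum>j\<in>UNIV. if j = k then c j else 0)"
    by (rule sum.cong) (use B(1) in \<open>auto simp: k dest: injD\<close>)
  then show ?thesis using assms(1)[of k] by (simp add: k)
next
  case False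
  then have "(\<Sum>j\<in>UNIV. if B j = I then c j else 0) = 0" by (intro sum.neutral) auto
  then show ?thesis using assms(2) by simp
qed

text \<open>The reversed ray is an admissible curve: its velocity has coefficients at most Q1
  \<delta>^w in the original basis fields, which Q1 >= 1 and w >= 1 turn into (Q1 \<delta>)^w.
  Commutators outside the basis receive the coefficient 0.\<close>

lemma cc_dist_le:
  assumes y: "y \<in> K" "ball y \<rho> \<subseteq> K" and u: "u \<in> ball 0 \<epsilon>"
    and \<delta>: "0 < \<delta>" "\<delta> \<le> 1" and u\<delta>: "\<And>j. \<bar>u $ j\<bar> \<le> \<delta> ^ weight (B j)"
  shows "\<exists>\<phi>\<in>curve_class n r \<Omega> X (Q1 * \<delta>). \<phi> 0 = Ey y u \<and> \<phi> 1 = y" "cc_dist n r \<Omega> X (Ey y u) y \<le> Q1 * \<delta>"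
proof -
  let ?XB = "\<lambda>j. commutator X (B j)"
  define \<psi> where "\<psi> t = Ey y ((1 - t) *\<^sub>R u)" for t
  have su: "s *\<^sub>R u \<in> ball 0 \<epsilon>" "norm (s *\<^sub>R u) \<le> norm u" if "s \<in> {0..1}" for s :: real
  proof -
    show "norm (s *\<^sub>R u) \<le> norm u" using that by (simp add: mult_left_le_one_le)
    then show "s *\<^sub>R u \<in> ball 0 \<epsilon>" using u by simp
  qed
  have \<psi>K: "\<psi> t \<in> K" and \<psi>d: "dist (\<psi> t) y \<le> max 1 (real CARD('p) ^ 3 * dbound1 g) * \<delta>" if t: "t \<in> {0..1}" for t
  proof -
    have t': "1 - t \<in> {0..1}" using t by auto
    show "\<psi> t \<in> K" unfolding \<psi>_def using Ey_ball[OF y(1) su(1)[OF t']] y(2) by blast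
    have "norm (Ey y ((1 - t) *\<^sub>R u) - y) \<le> real CARD('p) ^ 2 * dbound1 g * norm ((1 - t) *\<^sub>R u)"
      by (rule Ey_upper[OF y(1)]) (use su(1)[OF t'] in auto)
    also have "\<dots> \<le> real CARD('p) ^ 2 * dbound1 g * (real CARD('p) * \<delta>)"
      using dbound1_nonneg[OF y(1)] order_trans[OF su(2)[OF t'] norm_le_hom[OF \<delta> u\<delta>]] by (intro mult_left_mono) auto
    also have "\<dots> = real CARD('p) ^ 3 * dbound1 g * \<delta>" by (simp add: power2_eq_square power3_eq_cube)
    also have "\<dots> \<le> max 1 (real CARD('p) ^ 3 * dbound1 g) * \<delta>" using \<delta> by (intro mult_right_mono) auto
    finally show "dist (\<psi> t) y \<le> max 1 (real CARD('p) ^ 3 * dbound1 g) * \<delta>" by (simp add: \<psi>_def dist_norm)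
  qed
  have "\<forall>t. \<exists>c. t \<in> {0..1} \<longrightarrow> lin_field (Sy y) u (\<psi> t) = - lin_field ?XB c (\<psi> t) \<and> (\<forall>j. \<bar>c $ j\<bar> \<le> Q1 * \<delta> ^ weight (B j))"
    using lin_field_in_X_frame[OF y(1) \<psi>K \<psi>d \<delta> u\<delta>] by blast
  from choice[OF this] obtain c where c: "\<forall>t. t \<in> {0..1} \<longrightarrow> lin_field (Sy y) u (\<psi> t) = - lin_field ?XB (c t) (\<psi> t) \<and>
      (\<forall>j. \<bar>c t $ j\<bar> \<le> Q1 * \<delta> ^ weight (B j))" ..
  have d\<psi>: "(\<psi> has_vector_derivative lin_field ?XB (c t) (\<psi> t)) (at t within {0..1})" if t: "t \<in> {0..1}" for t
  proof -
    have t': "1 - t \<in> {0..1}" using t by auto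
    have dm: "norm1 ((1 - t) *\<^sub>R u) < 1 / word_growth CARD('p) D A"
      using subsetD[OF Ey_dom[OF y(1)] subsetD[OF ball_subset_cball su(1)[OF t']]] by (simp add: g)
    have 1: "((\<lambda>t. Ey y (t *\<^sub>R u)) has_vector_derivative lin_field (Sy y) u (Ey y ((1 - t) *\<^sub>R u))) (at (1 - t))"
      by (rule has_vector_derivative_lie_exp[where A = A and D = D]) (use poly(1,2) poly(3)[OF y(1)] dm in auto)
    have 2: "((\<lambda>t. 1 - t) has_vector_derivative - 1) (at t)" by (auto intro!: derivative_eq_intros)
    from vector_diff_chain_at[OF 2 1]
    have "(\<psi> has_vector_derivative - lin_field (Sy y) u (\<psi> t)) (at t)" by (simp add: comp_def \<psi>_def[abs_def])
    then show ?thesis using c t by (auto intro: has_vector_derivative_at_within)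
  qed
  \<comment> \<open>A Lipschitz bound yields absolute continuity; the summand 1 keeps the constant
    positive when M is 0.\<close>
  have lip: "norm (\<psi> s - \<psi> t) \<le> (real CARD('p) * (Q1 * M) + 1) * norm (s - t)" if "s \<in> {0..1}" "t \<in> {0..1}" for s t
  proof (rule differentiable_bound[OF convex_real_interval(5) _ _ that])
    fix t :: real assume t: "t \<in> {0..1}"
    show "(\<psi> has_derivative (\<lambda>h. h *\<^sub>R lin_field ?XB (c t) (\<psi> t))) (at t within {0..1})"
      using d\<psi>[OF t] by (simp add: has_vector_derivative_def)
    have "norm (lin_field ?XB (c t) (\<psi> t)) \<le> real (card (UNIV :: 'p set)) * (Q1 * M)"
      unfolding lin_field_def
    proof (rule sum_norm_bound)
      fix j
      have "\<bar>c t $ j\<bar> \<le> Q1 * \<delta> ^ weight (B j)" using c t by blast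
      also have "\<dots> \<le> Q1 * 1" using \<delta> Q1_ge by (intro mult_left_mono power_le_one) auto
      finally show "norm ((c t $ j) *\<^sub>R ?XB j (\<psi> t)) \<le> Q1 * M"
        unfolding norm_scaleR using bound_X(2)[OF B_mult \<psi>K[OF t]] Q1_ge by (intro mult_mono) auto
    qed
    then show "onorm (\<lambda>h. h *\<^sub>R lin_field ?XB (c t) (\<psi> t)) \<le> real CARD('p) * (Q1 * M) + 1"
      by (intro onorm_le) (simp add: mult.commute[of "\<bar>_\<bar>"] mult_right_mono)
  qed
  have ac: "abs_continuous_on {0..1} \<psi>"
    by (rule abs_continuous_on_lipschitz[OF abs_continuous_on_id _ lip]) (use Q1_ge bound_X(1) in \<open>simp add: add_nonneg_pos\<close>)
  define a where "a I t = (\<Sum>j\<in>UNIV. if B j = I then c t $ j else 0)" for I t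
  have a: "\<bar>a I t\<bar> \<le> (Q1 * \<delta>) ^ weight I" if "t \<in> {0..1}" for I t
    unfolding a_def
  proof (rule abs_sum_B_le)
    fix j
    have "\<bar>c t $ j\<bar> \<le> Q1 ^ 1 * \<delta> ^ weight (B j)" using c that by simp
    also have "\<dots> \<le> Q1 ^ weight (B j) * \<delta> ^ weight (B j)"
      using Q1_ge weight_B(1)[of j] \<delta> by (intro mult_right_mono power_increasing) auto
    finally show "\<bar>c t $ j\<bar> \<le> (Q1 * \<delta>) ^ weight (B j)" by (simp add: power_mult_distrib)
  qed (use Q1_ge \<delta> in simp)
  have "(\<Sum>I\<in>multiindices n r. a I t *\<^sub>R commutator X I (\<psi> t)) = lin_field ?XB (c t) (\<psi> t)" for t
    unfolding a_def lin_field_def by (rule sum_multiindices_B)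
  then have "\<forall>t\<in>{0..1}. (\<psi> has_vector_derivative (\<Sum>I\<in>multiindices n r. a I t *\<^sub>R commutator X I (\<psi> t))) (at t within {0..1})"
    using d\<psi> by simp
  then have "AE t in lebesgue_on {0..1}. (\<psi> has_vector_derivative (\<Sum>I\<in>multiindices n r. a I t *\<^sub>R commutator X I (\<psi> t))) (at t within {0..1})"
    by (intro AE_I2) (simp add: space_restrict_space)
  then have \<psi>: "\<psi> \<in> curve_class n r \<Omega> X (Q1 * \<delta>)"
    unfolding curve_class_def using \<psi>K K ac a by blast
  have ends: "\<psi> 0 = Ey y u" "\<psi> 1 = y" using Ey_zero[OF y(1)] by (simp_all add: \<psi>_def)
  show "\<exists>\<phi>\<in>curve_class n r \<Omega> X (Q1 * \<delta>). \<phi> 0 = Ey y u \<and> \<phi> 1 = y" using \<psi> ends by blast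
  then show "cc_dist n r \<Omega> X (Ey y u) y \<le> Q1 * \<delta>"
    unfolding cc_dist_def using \<delta> Q1_ge by (intro cInf_lower) (auto intro!: bdd_belowI[of _ 0])
qed


section \<open>rho is bounded by the distance\<close>

text \<open>The speed constant of an admissible curve, whose coefficients are at most \<delta> on
  each commutator. The maximum with 1 makes it usable as the distance constant in
  \<open>error_sum\<close>.\<close>

definition m2 :: real where "m2 = max 1 (real (card (multiindices n r)) * M)"

text \<open>The double sum comes from rewriting commutators in the basis without change of weight;
  the rest is the Taylor error solved in the frame of the approximating fields, whose lower bound
  away from y is only \<kappa> / 2.\<close>

definition Q3 :: real where
  "Q3 = (\<Sum>I\<in>multiindices n r. \<Sum>k\<in>UNIV. \<bar>\<beta> I k\<bar>) + 2 / \<kappa> * (real (card (multiindices n r)) * (C * m2 ^ r))"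

text \<open>The ratio between the scale \<sigma> and the homogeneous norm that
  \<open>weighted_differential_bound\<close> demands.\<close>

definition Kc :: real where "Kc = max 1 (4 * real CARD('p) ^ 2 * H)"

text \<open>One summand for each outcome of the final case distinction: \<sigma> at most \<delta>,
  \<sigma> at most 2 Q3 \<delta>, or the bound obtained from self-consistency.\<close>

definition Q2 :: real where "Q2 = 1 + 2 * Q3 + 2 * Q3 * (real CARD('p) * Kc) ^ r"

lemma Q3_nonneg: "0 \<le> Q3"
  using frame_X(1) error(1) by (auto simp: Q3_def m2_def intro!: add_nonneg_nonneg sum_nonneg)

lemma Kc_ge: "1 \<le> Kc" "4 * real CARD('p) ^ 2 * H \<le> Kc"
  by (simp_all add: Kc_def)

lemma frame_ball:
  assumes "y \<in> K" "x \<in> ball y \<rho>"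
  shows "\<kappa> / 2 * norm c \<le> norm (lin_field (Sy y) c x)"
  by (rule frame_near[OF poly(3)[OF assms(1)] poly(2) frame_center[OF assms(1)] \<rho>(2,3) assms(2)])

text \<open>Rewriting in the basis preserves weights and so keeps the powers of \<delta> exactly.
  The Taylor error is of order \<delta>^r, below \<delta>^w for every basis weight w.\<close>

lemma velocity_in_frame:
  assumes y: "y \<in> K" and z: "z \<in> K" "z \<in> ball y \<rho>" "dist z y \<le> m2 * \<delta>"
    and \<delta>: "0 < \<delta>" "\<delta> \<le> 1" and a: "\<And>I. I \<in> multiindices n r \<Longrightarrow> \<bar>a I\<bar> \<le> \<delta> ^ weight I"
  shows "\<exists>b. (\<Sum>I\<in>multiindices n r. a I *\<^sub>R commutator X I z) = lin_field (Sy y) b z \<and> (\<forall>k. \<bar>b $ k\<bar> \<le> Q3 * \<delta> ^ weight (B k))"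
proof -
  let ?MI = "multiindices n r"
  define e where "e = (\<Sum>I\<in>?MI. a I *\<^sub>R (commutator X I z - commutator (approx_field r X y) I z))"
  define b0 where "b0 = (\<chi> k. \<Sum>I\<in>?MI. a I * \<beta> I k)"
  have e: "norm e \<le> real (card ?MI) * (C * m2 ^ r * \<delta> ^ r)"
    unfolding e_def by (rule error_sum[OF y z(1,3) _ \<delta>(1) finite_multiindices _ a]) (simp_all add: m2_def)
  have k2: "0 < \<kappa> / 2" using frame_X(1) by simp
  obtain c where c: "lin_field (Sy y) c z = e" "norm c \<le> norm e / (\<kappa> / 2)"
    using frame_coordinates[OF k2 frame_ball[OF y z(2)]] by blast
  have "(\<Sum>I\<in>?MI. a I *\<^sub>R commutator (approx_field r X y) I z) = lin_field (Sy y) b0 z"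
  proof -
    have "(\<Sum>I\<in>?MI. a I *\<^sub>R commutator (approx_field r X y) I z)
        = (\<Sum>I\<in>?MI. \<Sum>k\<in>UNIV. (a I * \<beta> I k) *\<^sub>R commutator (approx_field r X y) (B k) z)"
    proof (rule sum.cong[OF refl])
      fix I assume I: "I \<in> ?MI"
      show "a I *\<^sub>R commutator (approx_field r X y) I z = (\<Sum>k\<in>UNIV. (a I * \<beta> I k) *\<^sub>R commutator (approx_field r X y) (B k) z)"
        unfolding \<beta>(2)[OF I, of y z] by (simp add: scaleR_sum_right)
    qed
    also have "\<dots> = (\<Sum>k\<in>UNIV. \<Sum>I\<in>?MI. (a I * \<beta> I k) *\<^sub>R commutator (approx_field r X y) (B k) z)" by (rule sum.swap)
    finally show ?thesis by (simp add: lin_field_def b0_def scaleR_sum_left)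
  qed
  then have 1: "(\<Sum>I\<in>?MI. a I *\<^sub>R commutator X I z) = lin_field (Sy y) (b0 + c) z"
    unfolding linear_add[OF lin_field_linear] c(1) e_def by (simp add: scaleR_diff_right sum_subtractf)
  have "\<bar>(b0 + c) $ k\<bar> \<le> Q3 * \<delta> ^ weight (B k)" for k
  proof -
    let ?w = "weight (B k)"
    have "\<bar>a I * \<beta> I k\<bar> \<le> \<bar>\<beta> I k\<bar> * \<delta> ^ ?w" if I: "I \<in> ?MI" for I
    proof (cases "\<beta> I k = 0")
      case False
      then have "?w = weight I" by (rule \<beta>(1)[OF I])
      then show ?thesis using mult_left_mono[OF a[OF I], of "\<bar>\<beta> I k\<bar>"] by (simp add: abs_mult mult.commute)
    qed simp
    then have "\<bar>b0 $ k\<bar> \<le> (\<Sum>I\<in>?MI. \<bar>\<beta> I k\<bar> * \<delta> ^ ?w)"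
      unfolding b0_def vec_lambda_beta by (intro order_trans[OF sum_abs] sum_mono)
    also have "\<dots> \<le> (\<Sum>I\<in>?MI. \<Sum>k\<in>UNIV. \<bar>\<beta> I k\<bar>) * \<delta> ^ ?w"
      unfolding sum_distrib_right[symmetric] using \<delta>
      by (intro mult_right_mono sum_mono member_le_sum[of k UNIV "\<lambda>k. \<bar>\<beta> _ k\<bar>"]) auto
    finally have b0: "\<bar>b0 $ k\<bar> \<le> (\<Sum>I\<in>?MI. \<Sum>k\<in>UNIV. \<bar>\<beta> I k\<bar>) * \<delta> ^ ?w" .
    let ?q = "2 / \<kappa> * (real (card ?MI) * (C * m2 ^ r))"
    have q: "0 \<le> ?q" using error(1) frame_X(1) by (simp add: m2_def)
    have "\<bar>c $ k\<bar> \<le> norm e / (\<kappa> / 2)" using component_le_norm_cart[of c k] c(2) by linarith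
    also have "\<dots> \<le> (real (card ?MI) * (C * m2 ^ r * \<delta> ^ r)) / (\<kappa> / 2)" by (rule divide_right_mono[OF e]) (use k2 in simp)
    also have "\<dots> = ?q * \<delta> ^ r" by simp
    also have "\<dots> \<le> ?q * \<delta> ^ ?w"
      using q \<delta> weight_B(2)[of k] by (intro mult_left_mono power_decreasing) auto
    finally have "\<bar>c $ k\<bar> \<le> ?q * \<delta> ^ ?w" .
    then have "\<bar>b0 $ k + c $ k\<bar> \<le> (\<Sum>I\<in>?MI. \<Sum>k\<in>UNIV. \<bar>\<beta> I k\<bar>) * \<delta> ^ ?w + ?q * \<delta> ^ ?w" using b0 by linarith
    then show ?thesis by (simp only: Q3_def distrib_right vector_add_component)
  qed
  then show ?thesis using 1 by blast
qed

text \<open>The speed is controlled only inside K. The curve is followed back from its end y to the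
  last time at which it is at least \<open>\<rho>1\<close> away; from then on it stays in K, and its
  increment is at most m2 \<delta> < \<open>\<rho>1\<close>, a contradiction.\<close>

lemma curve_near:
  assumes y: "y \<in> K" "ball y \<rho> \<subseteq> K" and ac: "abs_continuous_on {0..1} \<phi>" and at1: "\<phi> 1 = y"
    and N: "negligible N" and \<delta>: "0 < \<delta>" "\<delta> \<le> 1" and \<rho>1: "\<rho>1 \<le> \<rho>" "m2 * \<delta> < \<rho>1"
    and d: "\<And>t. t \<in> {0..1} - N \<Longrightarrow> (\<phi> has_vector_derivative (\<Sum>I\<in>multiindices n r. a I t *\<^sub>R commutator X I (\<phi> t))) (at t within {0..1})"
    and a: "\<And>I t. I \<in> multiindices n r \<Longrightarrow> t \<in> {0..1} \<Longrightarrow> \<bar>a I t\<bar> \<le> \<delta> ^ weight I"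
    and t: "t \<in> {0..1}"
  shows "dist (\<phi> t) y < \<rho>1" "dist (\<phi> t) y \<le> m2 * \<delta>"
proof -
  let ?MI = "multiindices n r"
  have speed: "norm (\<Sum>I\<in>?MI. a I t *\<^sub>R commutator X I (\<phi> t)) \<le> m2 * \<delta>" if t: "t \<in> {0..1}" "\<phi> t \<in> K" for t
  proof -
    have "norm (\<Sum>I\<in>?MI. a I t *\<^sub>R commutator X I (\<phi> t)) \<le> real (card ?MI) * (\<delta> * M)"
    proof (rule sum_norm_bound)
      fix I assume I: "I \<in> ?MI"
      have "1 \<le> weight I" using I weight_pos by (auto simp: multiindices_def)
      then have "\<delta> ^ weight I \<le> \<delta> ^ 1" using \<delta> by (intro power_decreasing) auto
      then have "\<bar>a I t\<bar> \<le> \<delta>" using a[OF I t(1)] by simp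
      then show "norm (a I t *\<^sub>R commutator X I (\<phi> t)) \<le> \<delta> * M"
        unfolding norm_scaleR using bound_X(2)[OF I t(2)] \<delta> by (intro mult_mono) auto
    qed
    also have "\<dots> = real (card ?MI) * M * \<delta>" by simp
    also have "\<dots> \<le> m2 * \<delta>" using \<delta> by (intro mult_right_mono) (auto simp: m2_def)
    finally show ?thesis .
  qed
  have m2\<delta>: "0 \<le> m2 * \<delta>" using \<delta> by (simp add: m2_def)
  \<comment> \<open>The time s is added to the null set, since at an exit time
    \<open>\<phi> s\<close> need not be known to lie in K.\<close>
  have incr: "norm (\<phi> 1 - \<phi> s) \<le> m2 * \<delta> * (1 - s)" if s: "s \<in> {0..1}" "\<And>t. s < t \<Longrightarrow> t \<le> 1 \<Longrightarrow> \<phi> t \<in> K" for s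
  proof (rule abs_continuous_increment_bound[OF ac, of s 1 "insert s N" "m2 * \<delta>"])
    show "\<exists>f'. (\<phi> has_vector_derivative f') (at t within {0..1}) \<and> norm f' \<le> m2 * \<delta>" if "t \<in> {s..1} - insert s N" for t
    proof -
      have "t \<in> {0..1} - N" "\<phi> t \<in> K" using that s by auto
      then show ?thesis using d speed by blast
    qed
  qed (use s N m2\<delta> in auto)
  have cont: "continuous_on {0..1} \<phi>" by (rule abs_continuous_on_imp_continuous[OF ac])
  have near: "dist (\<phi> t) y < \<rho>1" if t: "t \<in> {0..1}" for t
  proof (rule ccontr)
    assume far: "\<not> dist (\<phi> t) y < \<rho>1"
    define T where "T = {0..1} \<inter> (\<lambda>t. dist (\<phi> t) y) -` {\<rho>1..}"
    have "continuous_on {0..1} (\<lambda>t. dist (\<phi> t) y)" by (intro continuous_intros cont)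
    then have "closed T" unfolding T_def by (rule continuous_closed_preimage) auto
    then have "compact T" using compact_Int_closed[of "{0..1}" T] by (simp add: T_def Int_absorb1 Int_commute)
    moreover have "T \<noteq> {}" using far t by (auto simp: T_def)
    ultimately obtain s where s: "s \<in> T" "\<And>t. t \<in> T \<Longrightarrow> t \<le> s" using compact_attains_sup[of T] by blast
    have "\<phi> t \<in> K" if "s < t" "t \<le> 1" for t
    proof -
      have "t \<notin> T" using s(2) that by force
      then have "dist (\<phi> t) y < \<rho>1" using that s(1) by (auto simp: T_def)
      then show ?thesis using y(2) \<rho>1(1) by (auto simp: dist_commute)
    qed
    then have "norm (\<phi> 1 - \<phi> s) \<le> m2 * \<delta> * (1 - s)" using s(1) by (intro incr) (auto simp: T_def)
    also have "\<dots> \<le> m2 * \<delta> * 1" using m2\<delta> s(1) by (intro mult_left_mono) (auto simp: T_def)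
    finally have "dist (\<phi> s) y < \<rho>1" using \<rho>1(2) at1 by (simp add: dist_norm norm_minus_commute)
    then show False using s(1) by (simp add: T_def)
  qed
  then show "dist (\<phi> t) y < \<rho>1" using t by blast
  have inK: "\<phi> t \<in> K" if "t \<in> {0..1}" for t
    using near[OF that] y(2) \<rho>1(1) by (auto simp: dist_commute)
  have "norm (\<phi> 1 - \<phi> t) \<le> m2 * \<delta> * (1 - t)" by (rule incr[OF t]) (use inK t in auto)
  also have "\<dots> \<le> m2 * \<delta> * 1" using m2\<delta> t by (intro mult_left_mono) auto
  finally show "dist (\<phi> t) y \<le> m2 * \<delta>" using at1 by (simp add: dist_norm norm_minus_commute)
qed

text \<open>Near z the map coincides with the inverse of the chart, which is smooth on the open
  image of the chart domain.\<close>

lemma Theta_derivative: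
  assumes y: "y \<in> K" and z: "z \<in> ball y (\<kappa> / 2 * \<epsilon>)"
  shows "\<exists>T'. (Theta r X B y has_derivative T') (at z)"
proof -
  let ?V = "Ey y ` ball 0 \<epsilon>"
  have dif: "open ?V" "\<And>j. Ck_on 1 ?V (\<lambda>x. inv_into (ball 0 \<epsilon>) (Ey y) x $ j)" "inj_on (Ey y) (ball 0 \<epsilon>)"
    using Ey_diffeo[OF y] by (auto simp: smooth_diffeo_on_def smooth_map_on_def)
  have zV: "z \<in> ?V" using Theta_near[OF y z] by (metis imageI)
  have eq: "Theta r X B y x $ j = inv_into (ball 0 \<epsilon>) (Ey y) x $ j" if "x \<in> ?V" for x j
    using that Theta_Ey(2)[OF y] inv_into_f_f[OF dif(3)] by auto
  have "Ck_on 1 ?V (\<lambda>x. Theta r X B y x $ j)" for j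
    by (rule Ck_on_eq[OF dif(1) dif(2) eq])
  then have "(\<lambda>x. Theta r X B y x $ j) differentiable (at z)" for j
    using Ck_on_differentiable[OF _ zero_less_one dif(1) zV] by blast
  from has_derivative_vec_partials[OF this] show ?thesis by blast
qed

lemma differential_bound:
  assumes y: "y \<in> K" and u: "u \<in> ball 0 \<epsilon>" "\<And>a. \<bar>u $ a\<bar> \<le> (\<sigma> / Kc) ^ weight (B a)"
    and \<sigma>: "0 < \<sigma>" "\<sigma> \<le> 1" and v: "jac (Ey y) u *v v = lin_field (Sy y) b (Ey y u)"
    and b: "\<And>l. \<bar>b $ l\<bar> \<le> Q * \<sigma> ^ weight (B l)"
  shows "\<bar>v $ k\<bar> \<le> 2 * Q * \<sigma> ^ weight (B k)"
proof (rule weighted_differential_bound[where P = "Sy y" and y = y and D = D and A = A and \<epsilon> = \<epsilon> and \<rho> = \<rho>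
      and \<kappa> = "\<kappa> / 2" and H = H and \<Lambda> = "\<Lambda> y" and w = "\<lambda>k. weight (B k)" and K = Kc and u = u and b = b and v = v])
  show "poly_bd y D A (\<lambda>x. Sy y a x $ j)" for a j by (rule poly(3)[OF y])
  show "ball 0 \<epsilon> \<subseteq> {u :: real^'p. norm1 u < 1 / word_growth CARD('p) D A}"
    using order_trans[OF ball_subset_cball Ey_dom[OF y]] by (simp only: g)
  show "Ey y u \<in> ball y \<rho>" if "u \<in> ball 0 \<epsilon>" for u by (rule Ey_ball[OF y that])
  show "\<kappa> / 2 * norm c \<le> norm (lin_field (Sy y) c x)" if "x \<in> ball y \<rho>" for x c by (rule frame_ball[OF y that])
  show "lie_bracket (Sy y a) (Sy y l) x = lin_field (Sy y) (\<Lambda> y a l x) x" if "x \<in> ball y \<rho>" for a l x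
    by (rule \<Lambda>(1)[OF y that])
  show "\<bar>\<Lambda> y a l x $ k\<bar> \<le> H" if "x \<in> ball y \<rho>" for a l x k by (rule \<Lambda>(2)[OF y that])
  show "weight (B k) \<le> weight (B a) + weight (B l)" if "x \<in> ball y \<rho>" "\<Lambda> y a l x $ k \<noteq> 0" for a l x k
    by (rule \<Lambda>(3)[OF y that])
qed (use poly(1,2) frame_X(1) weight_B(1) u \<sigma> v b Kc_ge in simp_all)

text \<open>The curve is lifted to the chart, where the differential estimate controls its velocity.
  The conditions on \<open>\<rho>1\<close> keep the lift inside the chart and so small that \<sigma>
  is at most 1, as \<open>differential_bound\<close> requires.\<close>

lemma hom_norm_Theta_le:
  assumes y: "y \<in> K" "ball y \<rho> \<subseteq> K" and \<phi>: "\<phi> \<in> curve_class n r \<Omega> X \<delta>" "\<phi> 0 = x" "\<phi> 1 = y"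
    and \<delta>: "0 < \<delta>" "\<delta> \<le> 1" and \<rho>1: "\<rho>1 \<le> \<rho>" "\<rho>1 \<le> \<kappa> / 2 * \<epsilon>" "m2 * \<delta> < \<rho>1" "2 / \<kappa> * \<rho>1 \<le> 1" "0 < \<rho>1"
      "Kc * (real CARD('p) * (2 / \<kappa> * \<rho>1) powr (1 / real r)) \<le> 1"
  shows "hom_norm B (Theta r X B y x) \<le> Q2 * \<delta>"
proof -
  let ?MI = "multiindices n r"
  obtain a where ac: "abs_continuous_on {0..1} \<phi>"
    and a: "\<And>I t. I \<in> ?MI \<Longrightarrow> t \<in> {0..1} \<Longrightarrow> \<bar>a I t\<bar> \<le> \<delta> ^ weight I"
    and ae: "AE t in lebesgue_on {0..1}. (\<phi> has_vector_derivative (\<Sum>I\<in>?MI. a I t *\<^sub>R commutator X I (\<phi> t))) (at t within {0..1})"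
    using \<phi>(1) unfolding curve_class_def by blast
  have "AE t in lebesgue. t \<in> {0..1} \<longrightarrow> (\<phi> has_vector_derivative (\<Sum>I\<in>?MI. a I t *\<^sub>R commutator X I (\<phi> t))) (at t within {0..1})"
    using ae by (subst (asm) AE_restrict_space_iff) auto
  then obtain N where N: "N \<in> null_sets lebesgue" "{t \<in> space lebesgue. \<not> (t \<in> {0..1} \<longrightarrow>
      (\<phi> has_vector_derivative (\<Sum>I\<in>?MI. a I t *\<^sub>R commutator X I (\<phi> t))) (at t within {0..1}))} \<subseteq> N"
    unfolding eventually_ae_filter by blast
  have Nn: "negligible N" using N(1) by (simp add: negligible_iff_null_sets)
  have d: "(\<phi> has_vector_derivative (\<Sum>I\<in>?MI. a I t *\<^sub>R commutator X I (\<phi> t))) (at t within {0..1})" if "t \<in> {0..1} - N" for t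
    using N(2) that by auto
  have near: "dist (\<phi> t) y < \<rho>1" "dist (\<phi> t) y \<le> m2 * \<delta>" if "t \<in> {0..1}" for t
    using curve_near[OF y ac \<phi>(3) Nn \<delta> \<rho>1(1,3), of a t] d a that by blast+
  define u where "u t = Theta r X B y (\<phi> t)" for t
  have \<phi>b: "\<phi> t \<in> ball y (\<kappa> / 2 * \<epsilon>)" "\<phi> t \<in> ball y \<rho>" if "t \<in> {0..1}" for t
    using near(1)[OF that] \<rho>1(1,2) by (auto simp: dist_commute)
  have ub: "u t \<in> ball 0 \<epsilon>" and Eu: "Ey y (u t) = \<phi> t" and un: "norm (u t) \<le> 2 / \<kappa> * \<rho>1" if t: "t \<in> {0..1}" for t
  proof -
    note T = Theta_near[OF y(1) \<phi>b(1)[OF t]]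
    show "u t \<in> ball 0 \<epsilon>" "Ey y (u t) = \<phi> t" using T by (simp_all add: u_def)
    have "norm (u t) \<le> 2 / \<kappa> * dist (\<phi> t) y" using T(4) by (simp add: u_def)
    also have "\<dots> \<le> 2 / \<kappa> * \<rho>1" using near(1)[OF t] frame_X(1) by (intro mult_left_mono) auto
    finally show "norm (u t) \<le> 2 / \<kappa> * \<rho>1" .
  qed
  \<comment> \<open>The lift is differentiable by the chain rule for \<open>Theta\<close>.
    Differentiating \<open>Ey y (u t) = \<phi> t\<close> and uniqueness of derivatives on the
    interval show that the Jacobian maps v to the velocity of the curve.\<close>
  have "\<exists>v b. (u has_vector_derivative v) (at t within {0..1}) \<and> jac (Ey y) (u t) *v v = lin_field (Sy y) b (Ey y (u t)) \<and>
      (\<forall>k. \<bar>b $ k\<bar> \<le> Q3 * \<delta> ^ weight (B k))" if t: "t \<in> {0..1} - N" for t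
  proof -
    have t01: "t \<in> {0..1}" using t by blast
    obtain T' where T': "(Theta r X B y has_derivative T') (at (\<phi> t))" using Theta_derivative[OF y(1) \<phi>b(1)[OF t01]] by blast
    let ?\<phi>' = "\<Sum>I\<in>?MI. a I t *\<^sub>R commutator X I (\<phi> t)"
    have "((Theta r X B y \<circ> \<phi>) has_vector_derivative T' ?\<phi>') (at t within {0..1})"
      by (rule vector_derivative_diff_chain_within[OF d[OF t] has_derivative_at_withinI[OF T']])
    then have du: "(u has_vector_derivative T' ?\<phi>') (at t within {0..1})" by (simp add: comp_def u_def[abs_def])
    have "norm1 (u t) < 1 / g" using subsetD[OF Ey_dom[OF y(1)] subsetD[OF ball_subset_cball ub[OF t01]]] by simp
    then have "(\<lambda>w. Ey y w $ i) differentiable (at (u t))" for i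
      using Ck_on_differentiable[OF chart_Ck[OF poly(3)[OF y(1)] poly(1,2) frame_X(1) frame_center[OF y(1)] g \<epsilon>(1,3,4), of 1 i] _ open_norm1]
      by simp
    from vector_derivative_diff_chain_within[OF du has_derivative_at_withinI[OF has_derivative_jac[OF this]]]
    have dE: "((Ey y \<circ> u) has_vector_derivative jac (Ey y) (u t) *v T' ?\<phi>') (at t within {0..1})" .
    have "(\<phi> has_vector_derivative jac (Ey y) (u t) *v T' ?\<phi>') (at t within {0..1})"
      by (rule has_vector_derivative_transform[OF t01 _ dE]) (simp add: Eu)
    then have eq: "jac (Ey y) (u t) *v T' ?\<phi>' = ?\<phi>'"
      using vector_derivative_unique_within_closed_interval[of 0 1 t \<phi>] d[OF t] t01 by (auto simp: cbox_interval)
    have "\<phi> t \<in> K" using \<phi>b(2)[OF t01] y(2) by blast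
    then obtain b where "?\<phi>' = lin_field (Sy y) b (\<phi> t)" "\<And>k. \<bar>b $ k\<bar> \<le> Q3 * \<delta> ^ weight (B k)"
      using velocity_in_frame[OF y(1) _ \<phi>b(2)[OF t01] near(2)[OF t01] \<delta>, of "\<lambda>I. a I t"] a t01 by blast
    then show ?thesis using du eq Eu[OF t01] by auto
  qed
  note vel = this
  have u1: "u 1 = 0"
  proof -
    have "Theta r X B y (Ey y 0) = 0" by (rule Theta_Ey(2)[OF y(1)]) (use \<epsilon>(1) in simp)
    then show ?thesis by (simp add: u_def \<phi>(3) Ey_zero[OF y(1)])
  qed
  have acu: "abs_continuous_on {0..1} (\<lambda>t. u t $ k)" for k
  proof (rule abs_continuous_on_lipschitz[OF ac, of "2 / \<kappa>"])
    fix s t :: real assume st: "s \<in> {0..1}" "t \<in> {0..1}"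
    have "\<kappa> / 2 * norm (u s - u t) \<le> norm (\<phi> s - \<phi> t)"
      using Ey_lower[OF y(1), of "u s" "u t"] ub[OF st(1)] ub[OF st(2)] Eu[OF st(1)] Eu[OF st(2)] by auto
    then have "norm (u s - u t) \<le> 2 / \<kappa> * norm (\<phi> s - \<phi> t)" using frame_X(1) by (simp add: field_simps)
    moreover have "\<bar>(u s - u t) $ k\<bar> \<le> norm (u s - u t)" by (rule component_le_norm_cart)
    ultimately show "norm (u s $ k - u t $ k) \<le> 2 / \<kappa> * norm (\<phi> s - \<phi> t)" by simp
  qed (use frame_X(1) in simp)
  have hom_le: "hom_norm B (u t) \<le> real CARD('p) * (2 / \<kappa> * \<rho>1) powr (1 / real r)" if t: "t \<in> {0..1}" for t
  proof -
    have "hom_norm B (u t) \<le> real CARD('p) * (2 / \<kappa> * \<rho>1) powr (1 / real r) * 1"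
    proof (rule hom_norm_le[OF weight_B])
      show "\<bar>u t $ j\<bar> \<le> 2 / \<kappa> * \<rho>1 * 1 ^ weight (B j)" for j
        using component_le_norm_cart[of "u t" j] un[OF t] by simp
    qed (use \<rho>1 frame_X(1) in auto)
    then show ?thesis by simp
  qed
  \<comment> \<open>The a priori bound \<open>hom_le\<close> makes this supremum over all times
    finite.\<close>
  define s0 where "s0 = (SUP t\<in>{0..1}. hom_norm B (u t))"
  have bdd: "bdd_above ((\<lambda>t. hom_norm B (u t)) ` {0..1})" by (rule bdd_aboveI2[OF hom_le])
  have s0: "hom_norm B (u t) \<le> s0" if "t \<in> {0..1}" for t unfolding s0_def by (rule cSUP_upper[OF that bdd])
  have s0_le: "s0 \<le> s" if "\<And>t. t \<in> {0..1} \<Longrightarrow> hom_norm B (u t) \<le> s" for s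
    unfolding s0_def by (rule cSUP_least) (use that in auto)
  have s0_nonneg: "0 \<le> s0" by (rule order_trans[OF hom_norm_nonneg s0[of 0]]) simp
  \<comment> \<open>The factor Kc provides the entry bound (\<sigma> / Kc)^w at all times at once,
    as the differential estimate demands.\<close>
  define \<sigma> where "\<sigma> = Kc * s0"
  have s0\<sigma>: "s0 \<le> \<sigma>" using Kc_ge(1) s0_nonneg by (simp add: \<sigma>_def mult_right_mono[of 1 Kc s0, simplified])
  have \<sigma>1: "\<sigma> \<le> 1"
  proof -
    have "\<sigma> \<le> Kc * (real CARD('p) * (2 / \<kappa> * \<rho>1) powr (1 / real r))"
      unfolding \<sigma>_def using Kc_ge(1) by (intro mult_left_mono s0_le hom_le) auto
    then show ?thesis using \<rho>1(6) by linarith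
  qed
  have pw: "0 \<le> (real CARD('p) * Kc) ^ r" using Kc_ge(1) by simp
  \<comment> \<open>If \<sigma> is comparable to \<delta>, the claim is immediate. Otherwise
    \<delta> < \<sigma> allows powers of \<delta> to be weakened to powers of \<sigma>, and 2 Q3
    \<delta> < \<sigma> gives q <= 1.\<close>
  have "s0 \<le> Q2 * \<delta>"
  proof (cases "\<sigma> \<le> \<delta> \<or> \<sigma> \<le> 2 * Q3 * \<delta>")
    case True
    have "0 \<le> 2 * Q3 * (real CARD('p) * Kc) ^ r * \<delta>" using pw Q3_nonneg \<delta> by simp
    moreover have "0 \<le> 2 * Q3 * \<delta>" using Q3_nonneg \<delta> by simp
    moreover have "Q2 * \<delta> = \<delta> + 2 * Q3 * \<delta> + 2 * Q3 * (real CARD('p) * Kc) ^ r * \<delta>" by (simp add: Q2_def algebra_simps)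
    ultimately show ?thesis using True s0\<sigma> \<delta> by linarith
  next
    case False
    then have \<sigma>: "\<delta> < \<sigma>" "2 * Q3 * \<delta> < \<sigma>" "0 < \<sigma>" using \<delta> by auto
    then have s0_pos: "0 < s0" using s0_nonneg by (cases "s0 = 0") (auto simp: \<sigma>_def)
    define q where "q = 2 * Q3 * \<delta> / \<sigma>"
    have q: "0 \<le> q" "q \<le> 1" using \<sigma> Q3_nonneg \<delta> by (auto simp: q_def)
    have "\<bar>u t $ k\<bar> \<le> q * \<sigma> ^ weight (B k)" if t: "t \<in> {0..1}" for t k
    proof -
      have "norm (u 1 $ k - u t $ k) \<le> q * \<sigma> ^ weight (B k) * (1 - t)"
      proof (rule abs_continuous_increment_bound[OF acu, of t 1 N])
        fix s assume s: "s \<in> {t..1} - N"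
        then have s': "s \<in> {0..1} - N" "s \<in> {0..1}" using t by auto
        obtain v b where v: "(u has_vector_derivative v) (at s within {0..1})"
          "jac (Ey y) (u s) *v v = lin_field (Sy y) b (Ey y (u s))" "\<And>k. \<bar>b $ k\<bar> \<le> Q3 * \<delta> ^ weight (B k)"
          using vel[OF s'(1)] by blast
        have "\<bar>v $ k\<bar> \<le> 2 * (Q3 * \<delta> / \<sigma>) * \<sigma> ^ weight (B k)"
        proof (rule differential_bound[OF y(1) ub[OF s'(2)] _ \<sigma>(3) \<sigma>1 v(2)])
          fix l
          have "\<bar>u s $ l\<bar> \<le> hom_norm B (u s) ^ weight (B l)" by (rule abs_le_hom_norm_power[OF weight_B(1)])
          also have "\<dots> \<le> s0 ^ weight (B l)" by (rule power_mono[OF s0[OF s'(2)] hom_norm_nonneg])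
          also have "s0 = \<sigma> / Kc" using Kc_ge(1) by (simp add: \<sigma>_def)
          finally show "\<bar>u s $ l\<bar> \<le> (\<sigma> / Kc) ^ weight (B l)" .
          \<comment> \<open>Exactly one factor \<delta> is kept and the others are weakened to
            \<sigma>. This leaves the gain \<delta> / \<sigma>, the same for all weights.\<close>
          obtain w where w: "weight (B l) = Suc w" using weight_B(1)[of l] by (cases "weight (B l)") auto
          have "\<delta> ^ w \<le> \<sigma> ^ w" using \<sigma>(1) \<delta>(1) by (intro power_mono) auto
          then have "\<bar>b $ l\<bar> \<le> Q3 * (\<delta> * \<sigma> ^ w)"
            using order_trans[OF v(3)[of l]] Q3_nonneg \<delta>(1) by (simp add: w mult_left_mono)
          also have "\<dots> = Q3 * \<delta> / \<sigma> * \<sigma> ^ weight (B l)" using \<sigma>(3) by (simp add: w)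
          finally show "\<bar>b $ l\<bar> \<le> Q3 * \<delta> / \<sigma> * \<sigma> ^ weight (B l)" .
        qed
        moreover have "((\<lambda>t. u t $ k) has_vector_derivative v $ k) (at s within {0..1})"
          using v(1) unfolding has_vector_derivative_def has_derivative_vec_nth_iff by simp
        ultimately show "\<exists>f'. ((\<lambda>t. u t $ k) has_vector_derivative f') (at s within {0..1}) \<and> norm f' \<le> q * \<sigma> ^ weight (B k)"
          by (intro exI[of _ "v $ k"]) (simp add: q_def)
      qed (use t Nn q \<sigma> in auto)
      also have "\<dots> \<le> q * \<sigma> ^ weight (B k) * 1" using t q \<sigma> by (intro mult_left_mono) auto
      finally show ?thesis by (simp add: u1)
    qed
    note uq = this
    have "hom_norm B (u t) \<le> real CARD('p) * q powr (1 / real r) * \<sigma>" if "t \<in> {0..1}" for t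
      by (rule hom_norm_le[OF weight_B _ q \<sigma>(3)]) (rule uq[OF that])
    then have "s0 \<le> real CARD('p) * q powr (1 / real r) * \<sigma>" by (rule s0_le)
    also have "\<dots> = (real CARD('p) * Kc * q powr (1 / real r)) * s0" by (simp add: \<sigma>_def)
    \<comment> \<open>Cancelling s0 leaves a lower bound for q, which is an upper bound for \<sigma>
      in terms of \<delta>.\<close>
    finally have "1 \<le> real CARD('p) * Kc * q powr (1 / real r)" using s0_pos by simp
    then have "1 \<le> (real CARD('p) * Kc * q powr (1 / real r)) ^ r" by (rule one_le_power)
    also have "\<dots> = (real CARD('p) * Kc) ^ r * (q powr (1 / real r)) ^ r" by (simp only: power_mult_distrib)
    also have "(q powr (1 / real r)) ^ r = q"
    proof -
      have "r \<noteq> 0" using weight_B[of undefined] by auto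
      then show ?thesis using q(1) by (cases "q = 0") (auto simp: powr_realpow[symmetric] powr_powr)
    qed
    finally have "\<sigma> \<le> (real CARD('p) * Kc) ^ r * (2 * Q3 * \<delta>)" using \<sigma>(3) by (simp add: q_def pos_le_divide_eq)
    moreover have "Q2 * \<delta> = \<delta> + 2 * Q3 * \<delta> + (real CARD('p) * Kc) ^ r * (2 * Q3 * \<delta>)" by (simp add: Q2_def algebra_simps)
    moreover have "0 \<le> 2 * Q3 * \<delta>" using Q3_nonneg \<delta> by simp
    ultimately show ?thesis using s0\<sigma> \<delta> by linarith
  qed
  then show ?thesis using s0[of 0] by (simp add: u_def \<phi>(2))
qed

end

section \<open>Existence of the uniform constants\<close>

lemma basis_independent:
  assumes "basis_multiindices n r \<Omega> X B" "x \<in> \<Omega>" "lin_field (\<lambda>j. commutator X (B j)) c x = 0"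
  shows "c = 0"
proof (rule vec_eq_iff[THEN iffD2, rule_format])
  fix k
  let ?e = "\<lambda>j. commutator X (B j) x"
  have e: "inj ?e" "independent (range ?e)" using assms(1,2) by (auto simp: basis_multiindices_def)
  have "(\<Sum>v\<in>range ?e. c $ (inv ?e v) *\<^sub>R v) = (\<Sum>j\<in>UNIV. c $ j *\<^sub>R ?e j)"
    by (subst sum.reindex[OF e(1)]) (simp add: inv_f_f[OF e(1)])
  then have "(\<Sum>v\<in>range ?e. c $ (inv ?e v) *\<^sub>R v) = 0" using assms(3) by (simp add: lin_field_def)
  from independentD[OF e(2) _ order_refl this, of "?e k"] show "c $ k = 0 $ k"
    by (simp add: inv_f_f[OF e(1)])
qed

lemma commutator_bounded:
  fixes X :: "nat \<Rightarrow> 'p::finite vfield"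
  assumes "compact K" "\<And>I. I \<in> multiindices n r \<Longrightarrow> continuous_on K (commutator X I)"
  shows "\<exists>M\<ge>0. \<forall>I\<in>multiindices n r. \<forall>x\<in>K. norm (commutator X I x) \<le> M"
proof -
  have "bounded (\<Union>I\<in>multiindices n r. commutator X I ` K)"
    by (intro bounded_UN finite_multiindices ballI compact_imp_bounded compact_continuous_image assms)
  then obtain M where M: "\<forall>z\<in>(\<Union>I\<in>multiindices n r. commutator X I ` K). norm z \<le> M" by (auto simp: bounded_iff)
  have "norm (commutator X I x) \<le> max M 0" if "I \<in> multiindices n r" "x \<in> K" for I x
    using M that by (simp add: max.coboundedI1)
  then show ?thesis by (intro exI[of _ "max M 0"]) simp
qed

text \<open>Existence and size of the coordinates follow from nondegeneracy of the frame at x. The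
  weight restriction comes from uniqueness of coordinates against the structure constants if the
  weights add up to at most r; beyond r it is automatic, as basis weights are at most r.\<close>

lemma bracket_coordinates:
  fixes X :: "nat \<Rightarrow> 'p::finite vfield"
  assumes free: "free_up_to_weight n r \<Omega> X" and basis: "basis_multiindices n r \<Omega> X B" and x0: "x0 \<in> \<Omega>"
    and P: "\<And>j i. poly_bd y D A (\<lambda>x. commutator (approx_field r X y) (B j) x $ i)"
    and \<kappa>: "0 < \<kappa>" "\<And>c. \<kappa> * norm c \<le> norm (lin_field (\<lambda>j. commutator (approx_field r X y) (B j)) c x)"
    and x: "norm (x - y) \<le> 1"
  shows "\<exists>c. lie_bracket (commutator (approx_field r X y) (B a)) (commutator (approx_field r X y) (B l)) x
      = lin_field (\<lambda>j. commutator (approx_field r X y) (B j)) c x \<and>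
    (\<forall>k. \<bar>c $ k\<bar> \<le> real CARD('p) * (2 * (real CARD('p) * (A * (real D * A)))) / \<kappa>) \<and>
    (\<forall>k. c $ k \<noteq> 0 \<longrightarrow> weight (B k) \<le> weight (B a) + weight (B l))"
proof -
  let ?S = "\<lambda>j. commutator (approx_field r X y) (B j)"
  let ?b = "lie_bracket (?S a) (?S l) x"
  obtain c where c: "lin_field ?S c x = ?b" "norm c \<le> norm ?b / \<kappa>" using frame_coordinates[OF \<kappa>] by blast
  have "\<bar>c $ k\<bar> \<le> real CARD('p) * (2 * (real CARD('p) * (A * (real D * A)))) / \<kappa>" for k
  proof -
    have "\<bar>c $ k\<bar> \<le> norm ?b / \<kappa>" using component_le_norm_cart[of c k] c(2) by linarith
    also have "\<dots> \<le> real CARD('p) * (2 * (real CARD('p) * (A * (real D * A)))) / \<kappa>"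
      by (rule divide_right_mono[OF poly_bd_lie_bracket_le[OF P P x]]) (use \<kappa>(1) in simp)
    finally show ?thesis .
  qed
  moreover have "weight (B k) \<le> weight (B a) + weight (B l)" if "c $ k \<noteq> 0" for k
  proof (cases "weight (B a) + weight (B l) \<le> r")
    case True
    obtain d where d: "\<And>k. d k \<noteq> 0 \<Longrightarrow> weight (B k) = weight (B a) + weight (B l)"
      "\<And>S x. \<forall>i. smooth_vf (S i) \<Longrightarrow>
        lie_bracket (commutator S (B a)) (commutator S (B l)) (x :: real^'p) = (\<Sum>k\<in>UNIV. d k *\<^sub>R commutator S (B k) x)"
      using structure_constants[OF free basis x0 True] by blast
    have "lin_field ?S (c - (\<chi> k. d k)) x = 0"
      unfolding linear_diff[OF lin_field_linear] c(1) d(2)[OF smooth_approx_field] by (simp add: lin_field_def)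
    then have "c - (\<chi> k. d k) = 0" using \<kappa>(2)[of "c - (\<chi> k. d k)"] \<kappa>(1) by (simp add: mult_le_0_iff)
    then have "c $ k = d k" by (simp add: vec_eq_iff)
    then show ?thesis using d(1) that by simp
  next
    case False
    have "B k \<in> multiindices n r" using basis by (auto simp: basis_multiindices_def)
    then have "weight (B k) \<le> r" by (simp add: multiindices_def)
    then show ?thesis using False by simp
  qed
  ultimately show ?thesis using c(1) by metis
qed

theorem proposition34:
  fixes \<Omega> :: "(real^'p::finite) set"
    and X :: "nat \<Rightarrow> real^'p \<Rightarrow> real^'p"
    and B :: "'p \<Rightarrow> nat list"
    and n r :: nat
    and \<alpha> :: real
  assumes "open \<Omega>" and "connected \<Omega>" and "bounded \<Omega>"
    and "r \<ge> 2" and "0 < \<alpha>" and "\<alpha> \<le> 1"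
    and "\<forall>i\<in>{1..n}. \<forall>j. Ck_Hoelder_on (r - 1) \<alpha> \<Omega> (\<lambda>x. X i x $ j)"
    and "\<forall>j. Ck_Hoelder_on (r - 2) \<alpha> \<Omega> (\<lambda>x. X 0 x $ j)"
    and "hoermander_condition n r \<Omega> X"
    and "free_up_to_weight n r \<Omega> X"
    and "basis_multiindices n r \<Omega> X B"
  shows "\<forall>x0\<in>\<Omega>. \<exists>W C1 C2. open W \<and> x0 \<in> W \<and> W \<subseteq> \<Omega> \<and> C1 > 0 \<and> C2 > 0 \<and>
    (\<forall>x\<in>W. \<forall>y\<in>W. x \<in> Theta_dom r X B y \<and>
       C1 * cc_dist n r \<Omega> X x y \<le> rho r X B x y \<and>
       rho r X B x y \<le> C2 * cc_dist n r \<Omega> X x y)"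
proof (rule ballI)
  fix x0 assume x0: "x0 \<in> \<Omega>"
  let ?p = "real CARD('p)"
  obtain R where R: "0 < R" "cball x0 R \<subseteq> \<Omega>" using assms(1) x0 open_contains_cball by blast
  define K where "K = cball x0 R"
  have K: "compact K" "convex K" "K \<subseteq> \<Omega>" "K \<noteq> {}" using R by (auto simp: K_def)
  \<comment> \<open>The two regularity assumptions become one: the order is r minus the weight of
    the field.\<close>
  have X: "Ck_on (r - wt i) \<Omega> (\<lambda>x. X i x $ c)" if "i \<le> n" for i c
    using assms(7,8) that by (cases "i = 0") (auto simp: wt_def Ck_Hoelder_on_def)
  have B: "inj B" "range B \<subseteq> multiindices n r" using assms(11) by (simp_all add: basis_multiindices_def)
  have B_mult: "B j \<in> multiindices n r" for j using B(2) by blast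
  have cont: "continuous_on K (commutator X I)" if "I \<in> multiindices n r" for I
    by (rule continuous_on_commutator[OF assms(1) K(1-3) X that])
  have "\<exists>\<kappa>>0. \<forall>x\<in>K. \<forall>c. \<kappa> * norm c \<le> norm (lin_field (\<lambda>j. commutator X (B j)) c x)"
    by (rule frame_lower_bound[OF K(1,4) cont[OF B_mult]]) (use basis_independent[OF assms(11)] K(3) in blast)
  then obtain \<kappa> where \<kappa>: "0 < \<kappa>" "\<And>x c. x \<in> K \<Longrightarrow> \<kappa> * norm c \<le> norm (lin_field (\<lambda>j. commutator X (B j)) c x)" by blast
  have "\<exists>C\<ge>0. \<forall>I\<in>multiindices n r. \<forall>x\<in>K. \<forall>y\<in>K.
      norm (commutator X I x - commutator (approx_field r X y) I x) \<le> C * dist x y ^ (r - weight I)"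
    by (rule commutator_approx_error[OF assms(1) K(1-3) X])
  then obtain C where C: "0 \<le> C" "\<And>I x y. I \<in> multiindices n r \<Longrightarrow> x \<in> K \<Longrightarrow> y \<in> K \<Longrightarrow>
      norm (commutator X I x - commutator (approx_field r X y) I x) \<le> C * dist x y ^ (r - weight I)"
    by blast
  have center: "commutator (approx_field r X y) I y = commutator X I y" if "I \<in> multiindices n r" "y \<in> K" for I y
    by (rule commutator_approx_center[OF assms(1) K(1-3) X that])
  obtain M where M: "0 \<le> M" "\<And>I x. I \<in> multiindices n r \<Longrightarrow> x \<in> K \<Longrightarrow> norm (commutator X I x) \<le> M"
    using commutator_bounded[OF K(1) cont] by blast
  have "\<exists>b. I \<in> multiindices n r \<longrightarrow> (\<forall>k. b k \<noteq> 0 \<longrightarrow> weight (B k) = weight I) \<and>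
      (\<forall>x y. commutator (approx_field r X y) I x = (\<Sum>k\<in>UNIV. b k *\<^sub>R commutator (approx_field r X y) (B k) x))" for I
  proof (cases "I \<in> multiindices n r")
    case True
    obtain b where "\<And>k. b k \<noteq> 0 \<Longrightarrow> weight (B k) = weight I"
      "\<And>S x. \<forall>i. smooth_vf (S i) \<Longrightarrow> commutator S I x = (\<Sum>k\<in>UNIV. b k *\<^sub>R commutator S (B k) (x :: real^'p))"
      using commutator_basis_expansion[OF assms(10,11) x0 True] by blast
    then show ?thesis using smooth_approx_field by blast
  qed simp
  then have "\<forall>I. \<exists>b. I \<in> multiindices n r \<longrightarrow> (\<forall>k. b k \<noteq> 0 \<longrightarrow> weight (B k) = weight I) \<and>
      (\<forall>x y. commutator (approx_field r X y) I x = (\<Sum>k\<in>UNIV. b k *\<^sub>R commutator (approx_field r X y) (B k) x))" by blast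
  from choice[OF this] obtain \<beta> where \<beta>': "\<forall>I. I \<in> multiindices n r \<longrightarrow> (\<forall>k. \<beta> I k \<noteq> 0 \<longrightarrow> weight (B k) = weight I) \<and>
      (\<forall>x y. commutator (approx_field r X y) I x = (\<Sum>k\<in>UNIV. \<beta> I k *\<^sub>R commutator (approx_field r X y) (B k) x))" ..
  have \<beta>: "\<beta> I k \<noteq> 0 \<Longrightarrow> weight (B k) = weight I"
    "commutator (approx_field r X y) I x = (\<Sum>k\<in>UNIV. \<beta> I k *\<^sub>R commutator (approx_field r X y) (B k) x)"
    if "I \<in> multiindices n r" for I k x y using \<beta>'[THEN spec, THEN mp, OF that] by blast+
  have "\<exists>d N. \<forall>z :: 'p \<times> 'p. \<forall>y\<in>K. poly_bd y d N (\<lambda>x. commutator (approx_field r X y) (B (fst z)) x $ snd z)"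
  proof (rule poly_bd_uniform)
    fix z :: "'p \<times> 'p"
    have "set (B (fst z)) \<subseteq> {..n}" using B_mult[of "fst z"] by (simp add: multiindices_def)
    from poly_bd_commutator[OF assms(1) K(1-3) X this]
    show "\<exists>d N. \<forall>y\<in>K. poly_bd y d N (\<lambda>x. commutator (approx_field r X y) (B (fst z)) x $ snd z)" by blast
  qed
  then obtain D0 A0 where DA: "\<forall>z :: 'p \<times> 'p. \<forall>y\<in>K. poly_bd y D0 A0 (\<lambda>x. commutator (approx_field r X y) (B (fst z)) x $ snd z)" by blast
  define D where "D = max 1 D0"
  define A where "A = max 1 A0"
  have DA': "1 \<le> D" "0 < A" by (auto simp: D_def A_def)
  have poly: "poly_bd y D A (\<lambda>x. commutator (approx_field r X y) (B j) x $ i)" if "y \<in> K" for y j i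
  proof (rule poly_bd_mono)
    show "poly_bd y D0 A0 (\<lambda>x. commutator (approx_field r X y) (B j) x $ i)" using DA[THEN spec, of "(j, i)"] that by simp
  qed (auto simp: D_def A_def)
  define g where "g = word_growth CARD('p) D A"
  have g_pos: "0 < g" using DA' by (simp add: g_def word_growth_def)
  \<comment> \<open>R / 2 keeps balls of radius \<rho> around points of W inside K, 1 gives access
    to the coefficient bounds of polynomials, and the quotient is the demand of
    \<open>frame_near\<close>.\<close>
  define \<rho> where "\<rho> = min (R / 2) (min 1 (\<kappa> / (2 * (?p ^ 3 * real D * A))))"
  have pDA: "0 < ?p ^ 3 * real D * A" using DA' by simp
  have half: "z * (w / (2 * z)) = w / 2" if "0 < z" for z w :: real using that by simp
  have \<rho>: "0 < \<rho>" "\<rho> \<le> 1" "\<rho> \<le> R / 2" using R(1) \<kappa>(1) pDA by (auto simp: \<rho>_def)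
  have \<rho>3: "?p ^ 3 * real D * A * \<rho> \<le> \<kappa> / 2"
  proof -
    have "?p ^ 3 * real D * A * \<rho> \<le> ?p ^ 3 * real D * A * (\<kappa> / (2 * (?p ^ 3 * real D * A)))"
      by (rule mult_left_mono) (use pDA in \<open>auto simp: \<rho>_def\<close>)
    also have "\<dots> = \<kappa> / 2" by (rule half[OF pDA])
    finally show ?thesis .
  qed
  define H where "H = ?p * (2 * (?p * (A * (real D * A)))) / (\<kappa> / 2)"
  \<comment> \<open>A pointwise choice suffices: the coefficient matrix in
    \<open>weighted_linear_ode\<close> only has to be bounded.\<close>
  define \<Lambda> where "\<Lambda> y a l x = (SOME c. lie_bracket (commutator (approx_field r X y) (B a)) (commutator (approx_field r X y) (B l)) x
      = lin_field (\<lambda>j. commutator (approx_field r X y) (B j)) c x \<and> (\<forall>k. \<bar>c $ k\<bar> \<le> H) \<and>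
    (\<forall>k. c $ k \<noteq> 0 \<longrightarrow> weight (B k) \<le> weight (B a) + weight (B l)))" for y a l x
  have \<Lambda>': "lie_bracket (commutator (approx_field r X y) (B a)) (commutator (approx_field r X y) (B l)) x
      = lin_field (\<lambda>j. commutator (approx_field r X y) (B j)) (\<Lambda> y a l x) x \<and> (\<forall>k. \<bar>\<Lambda> y a l x $ k\<bar> \<le> H) \<and>
    (\<forall>k. \<Lambda> y a l x $ k \<noteq> 0 \<longrightarrow> weight (B k) \<le> weight (B a) + weight (B l))"
    if y: "y \<in> K" and x: "x \<in> ball y \<rho>" for y a l x
    unfolding \<Lambda>_def
  proof (rule someI_ex, unfold H_def, rule bracket_coordinates[OF assms(10,11) x0 poly[OF y]])
    have "\<kappa> * norm c \<le> norm (lin_field (\<lambda>j. commutator (approx_field r X y) (B j)) c y)" for c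
      using \<kappa>(2)[OF y, of c] by (simp add: lin_field_def center[OF B_mult y])
    then show "\<kappa> / 2 * norm c \<le> norm (lin_field (\<lambda>j. commutator (approx_field r X y) (B j)) c x)" for c
      by (rule frame_near[OF poly[OF y] DA'(2) _ \<rho>(2) \<rho>3 x])
    show "norm (x - y) \<le> 1" using x \<rho>(2) by (simp add: dist_norm norm_minus_commute)
  qed (use \<kappa>(1) in simp)
  have \<Lambda>: "lie_bracket (commutator (approx_field r X y) (B a)) (commutator (approx_field r X y) (B l)) x
      = lin_field (\<lambda>j. commutator (approx_field r X y) (B j)) (\<Lambda> y a l x) x"
    "\<bar>\<Lambda> y a l x $ k\<bar> \<le> H" "\<Lambda> y a l x $ k \<noteq> 0 \<Longrightarrow> weight (B k) \<le> weight (B a) + weight (B l)"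
    if "y \<in> K" "x \<in> ball y \<rho>" for y a l x k
    using \<Lambda>'[OF that, of a l] by blast+
  \<comment> \<open>One entry for each demand: half the radius of convergence, the inverse function
    theorem, and an image inside the ball of radius \<rho>. The summands + 1 keep the denominators
    positive.\<close>
  define \<epsilon> where "\<epsilon> = min 1 (min (1 / (2 * g * ?p)) (min (\<kappa> / (2 * (?p ^ 3 * \<bar>dbound2 g\<bar> + 1))) (\<rho> / (2 * (?p ^ 2 * \<bar>dbound1 g\<bar> + 1)))))"
  have q2: "0 < ?p ^ 3 * \<bar>dbound2 g\<bar> + 1" and q1: "0 < ?p ^ 2 * \<bar>dbound1 g\<bar> + 1" by (auto intro: add_nonneg_pos)
  have \<epsilon>: "0 < \<epsilon>" "\<epsilon> \<le> 1" using g_pos \<kappa>(1) \<rho>(1) q1 q2 by (auto simp: \<epsilon>_def)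
  have \<epsilon>_le: "\<epsilon> \<le> 1 / (2 * g * ?p)" "\<epsilon> \<le> \<kappa> / (2 * (?p ^ 3 * \<bar>dbound2 g\<bar> + 1))" "\<epsilon> \<le> \<rho> / (2 * (?p ^ 2 * \<bar>dbound1 g\<bar> + 1))"
    unfolding \<epsilon>_def by (intro min.coboundedI2[OF min.cobounded1] min.coboundedI2[OF min.coboundedI2[OF min.cobounded1]] min.coboundedI2[OF min.coboundedI2[OF min.cobounded2]])+
  have \<epsilon>3: "?p * \<epsilon> \<le> 1 / (2 * g)"
  proof -
    have "?p * \<epsilon> \<le> ?p * (1 / (2 * g * ?p))" by (rule mult_left_mono[OF \<epsilon>_le(1)]) simp
    then show ?thesis by simp
  qed
  have \<epsilon>4: "?p ^ 3 * dbound2 g * \<epsilon> \<le> \<kappa> / 2"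
  proof -
    have "?p ^ 3 * dbound2 g * \<epsilon> \<le> (?p ^ 3 * \<bar>dbound2 g\<bar> + 1) * \<epsilon>"
      using \<epsilon>(1) by (intro mult_right_mono) (auto intro: order_trans[OF mult_left_mono[OF abs_ge_self]])
    also have "\<dots> \<le> (?p ^ 3 * \<bar>dbound2 g\<bar> + 1) * (\<kappa> / (2 * (?p ^ 3 * \<bar>dbound2 g\<bar> + 1)))"
      by (rule mult_left_mono[OF \<epsilon>_le(2) less_imp_le[OF q2]])
    also have "\<dots> = \<kappa> / 2" by (rule half[OF q2])
    finally show ?thesis .
  qed
  have \<epsilon>5: "?p ^ 2 * dbound1 g * \<epsilon> < \<rho>"
  proof -
    have "?p ^ 2 * dbound1 g * \<epsilon> \<le> (?p ^ 2 * \<bar>dbound1 g\<bar> + 1) * \<epsilon>"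
      using \<epsilon>(1) by (intro mult_right_mono) (auto intro: order_trans[OF mult_left_mono[OF abs_ge_self]])
    also have "\<dots> \<le> (?p ^ 2 * \<bar>dbound1 g\<bar> + 1) * (\<rho> / (2 * (?p ^ 2 * \<bar>dbound1 g\<bar> + 1)))"
      by (rule mult_left_mono[OF \<epsilon>_le(3) less_imp_le[OF q1]])
    also have "\<dots> = \<rho> / 2" by (rule half[OF q1])
    finally show ?thesis using \<rho>(1) by simp
  qed
  interpret uniform_chart \<Omega> X B n r K \<kappa> C M A \<rho> \<epsilon> H D \<beta> \<Lambda> g
    using K(3) B \<kappa> C center M \<beta> DA' poly g_def \<rho>(1,2) \<rho>3 \<Lambda> \<epsilon> \<epsilon>3 \<epsilon>4 \<epsilon>5
    by unfold_locales
  have r: "0 < r" using assms(4) by simp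
  \<comment> \<open>Chosen so that Kc CARD('p) \<theta> is 1/2. Its r-th power in
    \<open>\<rho>1\<close> compensates for the exponent 1/r in the homogeneous norm.\<close>
  define \<theta> where "\<theta> = 1 / (2 * Kc * ?p)"
  have \<theta>: "0 < \<theta>" using Kc_ge(1) by (simp add: \<theta>_def)
  define \<rho>1 where "\<rho>1 = min \<rho> (min (\<kappa> / 2 * \<epsilon>) (min (\<kappa> / 2) (\<kappa> / 2 * \<theta> ^ r)))"
  have \<rho>1: "0 < \<rho>1" "\<rho>1 \<le> \<rho>" "\<rho>1 \<le> \<kappa> / 2 * \<epsilon>" using \<rho>(1) \<kappa>(1) \<epsilon>(1) \<theta> by (auto simp: \<rho>1_def)
  have \<rho>1': "2 / \<kappa> * \<rho>1 \<le> 1" "2 / \<kappa> * \<rho>1 \<le> \<theta> ^ r"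
  proof -
    have le: "2 / \<kappa> * \<rho>1 \<le> z" if "\<rho>1 \<le> \<kappa> / 2 * z" for z
      using that \<kappa>(1) by (simp add: pos_divide_le_eq mult.commute)
    show "2 / \<kappa> * \<rho>1 \<le> 1" "2 / \<kappa> * \<rho>1 \<le> \<theta> ^ r" by (rule le, simp add: \<rho>1_def)+
  qed
  have hom_small: "Kc * (?p * (2 / \<kappa> * \<rho>1) powr (1 / real r)) \<le> 1 / 2"
  proof -
    have "(2 / \<kappa> * \<rho>1) powr (1 / real r) \<le> (\<theta> ^ r) powr (1 / real r)"
      by (rule powr_mono2) (use \<rho>1' \<rho>1 \<kappa>(1) in auto)
    also have "\<dots> = \<theta>" using \<theta> r by (simp add: powr_realpow[symmetric] powr_powr)
    finally have "Kc * (?p * (2 / \<kappa> * \<rho>1) powr (1 / real r)) \<le> Kc * (?p * \<theta>)"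
      using Kc_ge(1) by (intro mult_left_mono) auto
    also have "\<dots> = 1 / 2" using Kc_ge(1) by (simp add: \<theta>_def)
    finally show ?thesis .
  qed
  have m2: "1 \<le> m2" by (simp add: m2_def)
  \<comment> \<open>Below this threshold a curve stays within \<open>\<rho>1\<close> of its end, as
    \<open>hom_norm_Theta_le\<close> requires.\<close>
  define \<delta>0 where "\<delta>0 = min 1 (\<rho>1 / (2 * m2))"
  have \<delta>0: "0 < \<delta>0" "\<delta>0 \<le> 1" using \<rho>1(1) m2 by (auto simp: \<delta>0_def)
  have \<delta>0_m2: "m2 * \<delta> < \<rho>1" if "\<delta> \<le> \<delta>0" for \<delta>
  proof -
    have "m2 * \<delta> \<le> m2 * (\<rho>1 / (2 * m2))" using that m2 by (intro mult_left_mono) (auto simp: \<delta>0_def)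
    also have "\<dots> < \<rho>1" using m2 \<rho>1(1) by simp
    finally show ?thesis .
  qed
  \<comment> \<open>Half radii: two points of W are less than \<open>\<rho>1\<close> apart, and
    balls of radius \<rho> around them stay in K.\<close>
  define W where "W = ball x0 (min (R / 2) (\<rho>1 / 2))"
  have Q2_nonneg: "0 \<le> Q2" using Q3_nonneg Kc_ge(1) by (simp add: Q2_def)
  \<comment> \<open>The second summand serves the curves with \<delta> above the threshold, where
    rho <= 1/2 on W already gives the bound.\<close>
  define C2 where "C2 = Q2 + 1 / \<delta>0"
  have C2: "0 < C2" using Q2_nonneg \<delta>0 by (simp add: C2_def add_nonneg_pos)
  have main: "x \<in> Theta_dom r X B y \<and> 1 / Q1 * cc_dist n r \<Omega> X x y \<le> rho r X B x y \<and>
      rho r X B x y \<le> C2 * cc_dist n r \<Omega> X x y" if x: "x \<in> W" and y: "y \<in> W" for x y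
  proof -
    have xd: "dist x0 x < R / 2" "dist x0 x < \<rho>1 / 2" and yd: "dist x0 y < R / 2" "dist x0 y < \<rho>1 / 2"
      using x y by (auto simp: W_def)
    have yK: "y \<in> K" using yd(1) R(1) by (simp add: K_def)
    have bK: "ball y \<rho> \<subseteq> K"
    proof
      fix z assume "z \<in> ball y \<rho>"
      then show "z \<in> K" using yd(1) \<open>\<rho> \<le> R / 2\<close> dist_triangle[of x0 z y] by (simp add: K_def)
    qed
    have xy: "dist x y < \<rho>1" using dist_triangle3[of x y x0] xd(2) yd(2) by simp
    then have xb: "x \<in> ball y (\<kappa> / 2 * \<epsilon>)" using \<rho>1(3) by (simp add: dist_commute)
    define u where "u = Theta r X B y x"
    note T = Theta_near[OF yK xb, folded u_def]
    have rho: "rho r X B x y = hom_norm B u" by (simp add: rho_def u_def)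
    have s_le: "hom_norm B u \<le> 1 / 2"
    proof -
      have "norm u \<le> 2 / \<kappa> * \<rho>1"
        using T(4) xy \<kappa>(1) by (intro order_trans[OF T(4)] mult_left_mono) auto
      then have "\<bar>u $ j\<bar> \<le> 2 / \<kappa> * \<rho>1 * 1 ^ weight (B j)" for j using component_le_norm_cart[of u j] by simp
      then have le: "hom_norm B u \<le> ?p * (2 / \<kappa> * \<rho>1) powr (1 / real r) * 1"
        by (rule hom_norm_le[OF weight_B]) (use \<rho>1(1) \<rho>1'(1) \<kappa>(1) in auto)
      have "1 * (?p * (2 / \<kappa> * \<rho>1) powr (1 / real r)) \<le> Kc * (?p * (2 / \<kappa> * \<rho>1) powr (1 / real r))"
        using Kc_ge(1) by (intro mult_right_mono) auto
      then show ?thesis using le hom_small by linarith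
    qed
    have u\<delta>: "\<bar>u $ j\<bar> \<le> \<delta> ^ weight (B j)" if "hom_norm B u < \<delta>" for \<delta> j
      using order_trans[OF abs_le_hom_norm_power[OF weight_B(1)] power_mono[OF less_imp_le[OF that] hom_norm_nonneg]] .
    have curve: "\<exists>\<phi>\<in>curve_class n r \<Omega> X (Q1 * \<delta>). \<phi> 0 = x \<and> \<phi> 1 = y" "cc_dist n r \<Omega> X x y \<le> Q1 * \<delta>"
      if "hom_norm B u < \<delta>" "\<delta> < 1" for \<delta>
      using cc_dist_le[OF yK bK T(2) _ _ u\<delta>[OF that(1)]] that hom_norm_nonneg[of B u] unfolding T(3) by auto
    have Q1_pos: "0 < Q1" using Q1_ge by simp
    \<comment> \<open>Admissible \<delta> are positive while the homogeneous norm may be 0, so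
      \<delta> runs through values above the norm and then decreases to it.\<close>
    have "1 / Q1 * cc_dist n r \<Omega> X x y \<le> hom_norm B u"
    proof (rule dense_ge_bounded[of _ 1])
      fix \<delta> assume "hom_norm B u < \<delta>" "\<delta> < 1"
      then show "1 / Q1 * cc_dist n r \<Omega> X x y \<le> \<delta>" using curve(2)[of \<delta>] Q1_pos by (simp add: pos_divide_le_eq mult.commute)
    qed (use s_le in simp)
    \<comment> \<open>A lower bound for a real infimum also needs a nonempty set; the reversed ray
      provides an admissible curve.\<close>
    moreover have "hom_norm B u / C2 \<le> cc_dist n r \<Omega> X x y"
      unfolding cc_dist_def
    proof (rule cInf_greatest)
      obtain \<delta> where "hom_norm B u < \<delta>" "\<delta> < 1" using dense[of "hom_norm B u" 1] s_le by auto
      moreover from this have "0 < Q1 * \<delta>" using Q1_pos hom_norm_nonneg[of B u] by (intro mult_pos_pos) auto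
      ultimately show "{\<delta>. 0 < \<delta> \<and> (\<exists>\<phi>\<in>curve_class n r \<Omega> X \<delta>. \<phi> 0 = x \<and> \<phi> 1 = y)} \<noteq> {}"
        using curve(1)[of \<delta>] by blast
      fix \<delta> assume "\<delta> \<in> {\<delta>. 0 < \<delta> \<and> (\<exists>\<phi>\<in>curve_class n r \<Omega> X \<delta>. \<phi> 0 = x \<and> \<phi> 1 = y)}"
      then obtain \<phi> where \<phi>: "0 < \<delta>" "\<phi> \<in> curve_class n r \<Omega> X \<delta>" "\<phi> 0 = x" "\<phi> 1 = y" by blast
      have "hom_norm B u \<le> C2 * \<delta>"
      proof (cases "\<delta> \<le> \<delta>0")
        case True
        have "hom_norm B u \<le> Q2 * \<delta>"
          unfolding u_def
          by (rule hom_norm_Theta_le[OF yK bK \<phi>(2-4,1) _ \<rho>1(2,3) \<delta>0_m2[OF True] \<rho>1'(1) \<rho>1(1)])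
            (use True \<delta>0(2) hom_small in auto)
        also have "\<dots> \<le> C2 * \<delta>" using \<phi>(1) \<delta>0(1) by (simp add: C2_def mult_right_mono)
        finally show ?thesis .
      next
        case False
        have "1 \<le> 1 / \<delta>0 * \<delta>" using False \<delta>0(1) by (simp add: pos_le_divide_eq)
        also have "\<dots> \<le> C2 * \<delta>" using \<phi>(1) Q2_nonneg by (intro mult_right_mono) (auto simp: C2_def)
        finally show ?thesis using s_le by linarith
      qed
      then show "hom_norm B u / C2 \<le> \<delta>" using C2 by (simp add: pos_divide_le_eq mult.commute)
    qed
    ultimately show ?thesis using T(1) C2 by (simp add: rho pos_divide_le_eq mult.commute)
  qed
  show "\<exists>W C1 C2. open W \<and> x0 \<in> W \<and> W \<subseteq> \<Omega> \<and> C1 > 0 \<and> C2 > 0 \<and>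
    (\<forall>x\<in>W. \<forall>y\<in>W. x \<in> Theta_dom r X B y \<and>
       C1 * cc_dist n r \<Omega> X x y \<le> rho r X B x y \<and>
       rho r X B x y \<le> C2 * cc_dist n r \<Omega> X x y)"
  proof (rule exI[of _ W], rule exI[of _ "1 / Q1"], rule exI[of _ C2], intro conjI)
    show "open W" by (simp add: W_def)
    show "x0 \<in> W" using R(1) \<rho>1(1) by (simp add: W_def)
    show "W \<subseteq> \<Omega>" using R by (auto simp: W_def)
    show "0 < 1 / Q1" using Q1_ge by simp
    show "0 < C2" by (rule C2)
    show "\<forall>x\<in>W. \<forall>y\<in>W. x \<in> Theta_dom r X B y \<and> 1 / Q1 * cc_dist n r \<Omega> X x y \<le> rho r X B x y \<and>
       rho r X B x y \<le> C2 * cc_dist n r \<Omega> X x y" using main by blast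
  qed
qed

end
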